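(* Work over $k=\mathbb{Q}$, and let $R$, $V=R^{(1)}$, $I$, $M_8=\operatorname{Proj}(R)\subset\mathbb{P}V=\operatorname{Proj}(\operatorname{Sym}(V))$ be the objects attached to eight points on the projective line, as defined in the context. Then there is, up to scaling, a unique non-zero skew-invariant cubic polynomial $s\in\operatorname{Sym}^3(V)$. It vanishes on $M_8$, and $M_8$ is the singular locus of the hypersurface $s=0$ in $\mathbb{P}V$. Moreover, the $14$ partial derivatives of $s$ (with respect to a basis of $V$) generate the ideal $I$; that is, the singular scheme of the affine cone $\{s=0\}\subset\operatorname{Spec}(\operatorname{Sym}(V))$ is precisely the affine cone $\operatorname{Spec}(R)$ over $M_8$. These $14$ partial derivatives have no syzygies of degree zero or one. Finally, $s$ may be taken to be the skew-average of $X_\Gamma^3\in\operatorname{Sym}^3(V)$ for any matching $\Gamma$.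
   Context: Let $k$ be a commutative ring and $L=\{1,\dots,8\}$. Consider the polynomial ring $k[x_1,y_1,\dots,x_8,y_8]$, on which the algebraic group $\mathrm{SL}_2$ acts by acting simultaneously on all pairs $(x_i,y_i)$. For $d\ge 0$ let $R^{(d)}$ be the $k$-module of $\mathrm{SL}_2$-invariant polynomials that are homogeneous of degree $d$ in each pair $(x_i,y_i)$ separately, i.e. $R^{(d)}=((\operatorname{Sym}^d U^* )^{\otimes 8})^{\mathrm{SL}(U)}$ with $U$ free of rank two. Put $R=\bigoplus_{d\ge0}R^{(d)}$, a graded ring. The symmetric group $S_8$ acts on $R$ by permuting the indices (the tensor factors). The GIT quotient $(\mathbb{P}^1)^8/\!/\mathrm{GL}(2)$ is $M_8=\operatorname{Proj}(R)$. A matching $\Gamma$ is a directed graph on the vertex set $L$ in which every vertex lies on exactly one edge; set $X_\Gamma=\prod_{(i,j)}(x_iy_j-x_jy_i)\in R^{(1)}$, the product over the directed edges $(i,j)$ of $\Gamma$. Put $V=R^{(1)}$. It is known that $V$ is free of rank $14$, spanned by the $X_\Gamma$, and that $R$ is generated by $V$ as a $k$-algebra. Let $I=\ker(\operatorname{Sym}(V)\to R)$, so $M_8\subset\mathbb{P}V$ is cut out by $I$. An element $f\in\operatorname{Sym}^3(V)$ is skew-invariant if $\sigma f=\operatorname{sgn}(\sigma)f$ for all $\sigma\in S_8$. The skew-average of $f$ is $\sum_{\sigma\in S_8}\operatorname{sgn}(\sigma)\,\sigma f$ (up to scaling). A syzygy of degree $d$ among the partial derivatives $\partial_1 s,\dots,\partial_{14}s$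 is a relation $\sum_i f_i\,\partial_i s=0$ with $f_i\in\operatorname{Sym}^d(V)$ not all zero. The singular scheme of the affine cone $s=0$ is the closed subscheme of $\operatorname{Spec}(\operatorname{Sym}(V))$ defined by $s$ and all its partial derivatives. *)

theory Defs
  imports
    "HOL-Library.Poly_Mapping"
    "HOL-Library.Numeral_Type"
    "HOL-Combinatorics.Permutations"
    "HOL-Algebra.Ideal"
    "HOL-Algebra.RingHom"
    "HOL-Algebra.Algebraic_Closure_Type"
begin

section \<open>Polynomials over the rationals with variables indexed by a type\<close>

type_synonym 'v monom = "'v \<Rightarrow>\<^sub>0 nat"
type_synonym 'v qpoly = "'v monom \<Rightarrow>\<^sub>0 rat"

definition Const :: "rat \<Rightarrow> 'v qpoly"
  where "Const c = Poly_Mapping.single 0 c"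

definition Var :: "'v \<Rightarrow> 'v qpoly"
  where "Var v = Poly_Mapping.single (Poly_Mapping.single v 1) 1"

definition scale :: "rat \<Rightarrow> 'v qpoly \<Rightarrow> 'v qpoly"
  where "scale c p = Const c * p"

interpretation qpoly: vector_space "scale :: rat \<Rightarrow> 'v qpoly \<Rightarrow> 'v qpoly"
  by unfold_locales
    (simp_all add: scale_def Const_def algebra_simps single_add mult_single flip: mult.assoc)

text \<open>The \<open>\<rat>\<close>-algebra homomorphism sending the variable \<open>v\<close> to \<open>g v\<close>.\<close>

definition subst :: "('v \<Rightarrow> 'w qpoly) \<Rightarrow> 'v qpoly \<Rightarrow> 'w qpoly"
  where "subst g p =
    (\<Sum>m\<in>Poly_Mapping.keys p. Const (Poly_Mapping.lookup p m) *
      (\<Prod>v\<in>Poly_Mapping.keys m. g v ^ Poly_Mapping.lookup m v))"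

definition mdeg :: "'v monom \<Rightarrow> nat"
  where "mdeg m = (\<Sum>v\<in>Poly_Mapping.keys m. Poly_Mapping.lookup m v)"

definition homog :: "nat \<Rightarrow> 'v qpoly set"
  where "homog d = {p. \<forall>m\<in>Poly_Mapping.keys p. mdeg m = d}"

text \<open>In the partial derivative, the monomials not containing \<open>v\<close> contribute zero, so the
  truncated subtraction of exponents is harmless.\<close>

definition pd :: "'v \<Rightarrow> 'v qpoly \<Rightarrow> 'v qpoly"
  where "pd v p =
    (\<Sum>m\<in>Poly_Mapping.keys p. Poly_Mapping.single (m - Poly_Mapping.single v 1)
      (Poly_Mapping.lookup p m * of_nat (Poly_Mapping.lookup m v)))"


section \<open>The ring of invariants of eight points on the projective line\<close>

text \<open>The label set \<open>L\<close> is the eight-element type \<open>8\<close>, that is, the labels are read modulo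
  eight. \<open>XX i\<close> and \<open>YY i\<close> are the coordinates of the \<open>i\<close>-th point.\<close>

datatype coord = XX "8" | YY "8"

text \<open>Invariance is invariance under the algebraic group \<open>SL\<^sub>2\<close>, in terms of the coaction of
  its coordinate ring \<open>\<rat>[a,b,c,d]/(ad - bc - 1)\<close>: the substitution
  \<open>x\<^sub>i \<mapsto> a x\<^sub>i + b y\<^sub>i\<close>, \<open>y\<^sub>i \<mapsto> c x\<^sub>i + d y\<^sub>i\<close> by the generic matrix
  fixes \<open>f\<close> modulo \<open>ad - bc - 1\<close>.\<close>

datatype gl2_coord = GA | GB | GC | GD

abbreviation gvar :: "gl2_coord \<Rightarrow> (gl2_coord + coord) qpoly"
  where "gvar g \<equiv> Var (Inl g)"

abbreviation pvar :: "coord \<Rightarrow> (gl2_coord + coord) qpoly"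
  where "pvar u \<equiv> Var (Inr u)"

fun generic_action :: "coord \<Rightarrow> (gl2_coord + coord) qpoly" where
  "generic_action (XX i) = gvar GA * pvar (XX i) + gvar GB * pvar (YY i)"
| "generic_action (YY i) = gvar GC * pvar (XX i) + gvar GD * pvar (YY i)"

definition SL2_invariant :: "coord qpoly \<Rightarrow> bool"
  where "SL2_invariant f \<longleftrightarrow>
    (gvar GA * gvar GD - gvar GB * gvar GC - 1) dvd (subst generic_action f - subst pvar f)"

definition Rpiece :: "nat \<Rightarrow> coord qpoly set"
  where "Rpiece d = {f. SL2_invariant f \<and>
    (\<forall>m\<in>Poly_Mapping.keys f. \<forall>i.
      Poly_Mapping.lookup m (XX i) + Poly_Mapping.lookup m (YY i) = d)}"

text \<open>The internal direct sum of the \<open>Rpiece d\<close>, as a subring of the polynomial ring.\<close>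

definition Rcarrier :: "coord qpoly set"
  where "Rcarrier = {\<Sum>d<N. h d | h N. \<forall>d. h d \<in> Rpiece d}"

definition Rring :: "coord qpoly ring"
  where "Rring = ring_of_type_algebra\<lparr>carrier := Rcarrier\<rparr>"

abbreviation V :: "coord qpoly set"
  where "V \<equiv> Rpiece 1"

fun perm_coord :: "(8 \<Rightarrow> 8) \<Rightarrow> coord \<Rightarrow> coord" where
  "perm_coord \<sigma> (XX i) = XX (\<sigma> i)"
| "perm_coord \<sigma> (YY i) = YY (\<sigma> i)"

definition perm_act :: "(8 \<Rightarrow> 8) \<Rightarrow> coord qpoly \<Rightarrow> coord qpoly"
  where "perm_act \<sigma> = subst (\<lambda>u. Var (perm_coord \<sigma> u))"

definition matching :: "(8 \<times> 8) set \<Rightarrow> bool"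
  where "matching \<Gamma> \<longleftrightarrow> (\<forall>(i, j)\<in>\<Gamma>. i \<noteq> j) \<and> (\<forall>v. \<exists>!e\<in>\<Gamma>. v = fst e \<or> v = snd e)"

definition XG :: "(8 \<times> 8) set \<Rightarrow> coord qpoly"
  where "XG \<Gamma> = (\<Prod>(i, j)\<in>\<Gamma>. Var (XX i) * Var (YY j) - Var (XX j) * Var (YY i))"


section \<open>The symmetric algebra of \<open>V\<close> in terms of a basis\<close>

definition is_basis :: "('n \<Rightarrow> coord qpoly) \<Rightarrow> bool"
  where "is_basis b \<longleftrightarrow>
    inj b \<and> qpoly.independent (range b) \<and> qpoly.span (range b) = V"

text \<open>Given a basis \<open>b\<close> of \<open>V\<close>, the symmetric algebra is the polynomial ring \<open>'n qpoly\<close>, whose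
  variable \<open>Var j\<close> stands for the element \<open>b j\<close> of \<open>V\<close>; its piece of degree \<open>d\<close> is
  \<open>homog d\<close>. The inclusion of \<open>V\<close> is \<open>incl b\<close>.\<close>

definition Sym :: "'n qpoly ring"
  where "Sym = ring_of_type_algebra"

definition incl :: "('n::finite \<Rightarrow> coord qpoly) \<Rightarrow> coord qpoly \<Rightarrow> 'n qpoly"
  where "incl b v = (\<Sum>j\<in>UNIV. scale (qpoly.representation (range b) v (b j)) (Var j))"

definition Sym_to_R :: "('n \<Rightarrow> coord qpoly) \<Rightarrow> 'n qpoly \<Rightarrow> coord qpoly"
  where "Sym_to_R b = subst b"

definition I :: "('n \<Rightarrow> coord qpoly) \<Rightarrow> 'n qpoly set"
  where "I b = a_kernel Sym Rring (Sym_to_R b)"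

definition sym_act :: "('n::finite \<Rightarrow> coord qpoly) \<Rightarrow> (8 \<Rightarrow> 8) \<Rightarrow> 'n qpoly \<Rightarrow> 'n qpoly"
  where "sym_act b \<sigma> = subst (\<lambda>j. incl b (perm_act \<sigma> (b j)))"

definition skew_invariant :: "('n::finite \<Rightarrow> coord qpoly) \<Rightarrow> 'n qpoly \<Rightarrow> bool"
  where "skew_invariant b f \<longleftrightarrow>
    (\<forall>\<sigma>. \<sigma> permutes UNIV \<longrightarrow> sym_act b \<sigma> f = scale (of_int (sign \<sigma>)) f)"

definition skew_average :: "('n::finite \<Rightarrow> coord qpoly) \<Rightarrow> 'n qpoly \<Rightarrow> 'n qpoly"
  where "skew_average b f =
    (\<Sum>\<sigma> | \<sigma> permutes UNIV. scale (of_int (sign \<sigma>)) (sym_act b \<sigma> f))"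


section \<open>Proj and the singular locus\<close>

text \<open>The points of \<open>Proj A\<close>, where \<open>gr d\<close> is the piece of degree \<open>d\<close> of the graded ring \<open>A\<close>:
  the prime ideals that are generated by homogeneous elements and do not contain all
  homogeneous elements of positive degree.\<close>

definition Proj :: "('a, 'b) ring_scheme \<Rightarrow> (nat \<Rightarrow> 'a set) \<Rightarrow> 'a set set"
  where "Proj A gr = {P. primeideal P A \<and> P = Idl\<^bsub>A\<^esub> (P \<inter> (\<Union>d. gr d)) \<and>
    \<not> (\<Union>d\<in>{0<..}. gr d) \<subseteq> P}"

definition PV :: "'n qpoly set set"
  where "PV = Proj Sym homog"

text \<open>\<open>Proj R\<close>, embedded in \<open>PV\<close> by pulling back prime ideals along \<open>Sym_to_R b\<close>.\<close>

definition M8 :: "('n \<Rightarrow> coord qpoly) \<Rightarrow> 'n qpoly set set"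
  where "M8 b = (\<lambda>Q. Sym_to_R b -` Q) ` Proj Rring Rpiece"

text \<open>The ideal of the singular scheme of the affine cone \<open>s = 0\<close>, and the points of \<open>PV\<close>
  at which \<open>s\<close> and all its partial derivatives vanish.\<close>

definition sing_ideal :: "'n qpoly \<Rightarrow> 'n qpoly set"
  where "sing_ideal s = Idl\<^bsub>Sym\<^esub> (insert s (range (\<lambda>i. pd i s)))"

definition sing_locus :: "'n qpoly \<Rightarrow> 'n qpoly set set"
  where "sing_locus s = {P \<in> PV. s \<in> P \<and> (\<forall>i. pd i s \<in> P)}"

text \<open>A closed subscheme of \<open>Spec Sym\<close> is given by its ideal. \<open>Spec R\<close> is the closed subscheme
  with ideal \<open>J\<close> if \<open>Sym_to_R b\<close> maps onto \<open>R\<close> with kernel \<open>J\<close>.\<close>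

definition SpecR_is_subscheme :: "('n \<Rightarrow> coord qpoly) \<Rightarrow> 'n qpoly set \<Rightarrow> bool"
  where "SpecR_is_subscheme b J \<longleftrightarrow>
    Sym_to_R b ` carrier Sym = carrier Rring \<and> a_kernel Sym Rring (Sym_to_R b) = J"

definition has_syzygy :: "'n::finite qpoly \<Rightarrow> nat \<Rightarrow> bool"
  where "has_syzygy s d \<longleftrightarrow>
    (\<exists>f. (\<forall>i. f i \<in> homog d) \<and> (\<exists>i. f i \<noteq> 0) \<and> (\<Sum>i\<in>UNIV. f i * pd i s) = 0)"

end

theory Submission
  imports Defs "HOL-Library.Multiset"
begin

text \<open>Split the eight labels into the pairs 01, 23, 45, 67. A pair of points is the zero set
  of a binary quadratic form, hence a vector of a three-dimensional quadratic space, and the bracket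
  of the pair is a square root of the norm of that vector. Fourteen products of brackets, scalar
  products and volumes of these four vectors (\<open>sb\<close>) form a basis of \<open>V\<close>;
  in these coordinates the whole theorem becomes explicit.

  Generators: by \<open>first_fundamental_theorem\<close> the invariants are spanned by bracket
  monomials, that is, by multigraphs on the labels. The Pluecker relation makes the graphs bipartite
  between even and odd labels (\<open>bm_in_bipspan\<close>), Hall's theorem peels off perfect
  matchings (\<open>bip_split_matching\<close>), and trace identities for 2 by 2 matrices expand a
  bipartite matching in \<open>sb\<close> (\<open>bipartite_matching_in_span\<close>). So the ring
  is generated by \<open>sb\<close> (\<open>kempe\<close>).

  Relations: fourteen quadrics \<open>rel\<close> vanish on the ring, namely Cramer's rule, products
  of two volumes written as Gram minors, the vanishing of the 4 by 4 Gram determinant, and three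
  identities that only regroup factors. Modulo the ideal \<open>J\<close> of these quadrics every
  polynomial reduces to monomials divisible by no entry of the list \<open>GB\<close>
  (\<open>normal_form\<close>). For a suitable configuration of points each invariant
  \<open>sb v\<close> has a single monomial as leading form, and the leading monomials of the
  standard monomials are pairwise distinct (\<open>Std_ex_inj\<close>), so standard monomials stay
  independent in the ring (\<open>Std_independent\<close>). Together this says that the kernel is
  exactly \<open>J\<close> (\<open>kernel_subst_sb\<close>).

  The cubic: the partial derivatives of the explicit polynomial \<open>cubic\<close> span the same
  space as the quadrics, so they generate the kernel, and Euler's formula puts \<open>cubic\<close>
  itself into the kernel. A linear syzygy polarises to a system of linear equations for its
  coefficients, whose only solution is zero (\<open>no_linear_relation\<close>).

  Symmetry: \<open>cubic\<close> changes by the sign under generators of the symmetric group, hence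
  under all of it (\<open>skew_s\<close>). Conversely the skew-average of any cubic form is a
  multiple of the average of the cube of \<open>P0\<close> (\<open>avg_span\<close>). Since the
  average of the skew cubic is 8! times itself, that average is not zero and is proportional to the
  cubic. This gives uniqueness, and, because every \<open>XG\<close> of a matching is a permutation
  of \<open>sb P0\<close>, also the statement on skew-averages.

  A linear change of variables (\<open>Y\<close>, with inverse \<open>Th\<close>) carries everything
  to an arbitrary basis, and \<open>Proj_quotient\<close> turns the equality of ideals into the
  equality of \<open>M8\<close> with the singular locus.\<close>

section \<open>Polynomials as sums of monomials; substitution homomorphisms\<close>

lemma Const_simps [simp]:
  "Const 0 = 0" "Const 1 = 1"
  "Const (- a) = - Const a" "Const (numeral n) = numeral n"
  by (simp_all add: Const_def single_uminus)

lemma Const_add: "Const (a + b) = Const a + Const b"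
  and Const_diff: "Const (a - b) = Const a - Const b"
  and Const_mult: "Const (a * b) = Const a * Const b"
  by (simp_all add: Const_def single_add single_diff mult_single)

lemma Const_power: "Const (a ^ n) = Const a ^ n"
  by (induction n) (simp_all add: Const_mult)

lemma Const_sum: "Const (sum f A) = (\<Sum>x\<in>A. Const (f x))"
  by (induction A rule: infinite_finite_induct) (simp_all add: Const_add)

lemma Const_eq_iff [simp]: "Const a = Const b \<longleftrightarrow> a = b"
  by (auto simp: Const_def dest: arg_cong[where f = "\<lambda>p. Poly_Mapping.lookup p 0"])

lemma Const_eq_0_iff [simp]: "Const a = 0 \<longleftrightarrow> a = 0"
  using Const_eq_iff[of a 0] by (simp del: Const_eq_iff)

lemma lookup_Const_mult: "Poly_Mapping.lookup (Const c * p) m = c * Poly_Mapping.lookup p m"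
  by (simp add: Const_def mult_map_scale_conv_mult[symmetric] Poly_Mapping.map.rep_eq when_def)

definition mon :: "'v monom \<Rightarrow> 'v qpoly"
  where "mon m = Poly_Mapping.single m 1"

lemma mon_0 [simp]: "mon 0 = 1"
  by (simp add: mon_def)

lemma mon_add: "mon (m + n) = mon m * mon n"
  by (simp add: mon_def mult_single)

lemma single_conv_mon: "Poly_Mapping.single m c = Const c * mon m"
  by (simp add: Const_def mon_def mult_single)

lemma Var_conv_mon: "Var v = mon (Poly_Mapping.single v 1)"
  by (simp add: Var_def mon_def)

lemma keys_mon [simp]: "Poly_Mapping.keys (mon m) = {m}"
  by (simp add: mon_def)

lemma lookup_mon: "Poly_Mapping.lookup (mon m) n = (if m = n then 1 else 0)"
  by (simp add: mon_def lookup_single when_def)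

lemma sum_keys_superset:
  assumes "finite A" "Poly_Mapping.keys p \<subseteq> A" "\<And>m. h m 0 = 0"
  shows "(\<Sum>m\<in>Poly_Mapping.keys p. h m (Poly_Mapping.lookup p m)) =
    (\<Sum>m\<in>A. h m (Poly_Mapping.lookup p m))"
  using assms by (intro sum.mono_neutral_left) (auto simp: in_keys_iff)

lemma prod_keys_superset:
  assumes "finite A" "Poly_Mapping.keys p \<subseteq> A" "\<And>m. h m 0 = 1"
  shows "(\<Prod>m\<in>Poly_Mapping.keys p. h m (Poly_Mapping.lookup p m)) =
    (\<Prod>m\<in>A. h m (Poly_Mapping.lookup p m))"
  using assms by (intro prod.mono_neutral_left) (auto simp: in_keys_iff)

lemma poly_eq_sum_monos:
  "p = (\<Sum>m\<in>Poly_Mapping.keys p. Const (Poly_Mapping.lookup p m) * mon m)"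
proof (rule poly_mapping_eqI)
  fix k
  show "Poly_Mapping.lookup p k =
    Poly_Mapping.lookup (\<Sum>m\<in>Poly_Mapping.keys p. Const (Poly_Mapping.lookup p m) * mon m) k"
    by (simp add: lookup_sum lookup_Const_mult lookup_mon if_distrib sum.delta in_keys_iff cong: if_cong)
qed

lemma mon_induct [case_names single add]:
  fixes m :: "'v monom"
  assumes zero: "Q 0" and single_add: "\<And>v m. Q m \<Longrightarrow> Q (Poly_Mapping.single v 1 + m)"
  shows "Q m"
proof (induction "\<Sum>v\<in>Poly_Mapping.keys m. Poly_Mapping.lookup m v" arbitrary: m)
  case 0
  then have "Poly_Mapping.lookup m v = 0" if "v \<in> Poly_Mapping.keys m" for v
    using that by simp
  then have "m = 0" by (intro poly_mapping_eqI) (auto simp: in_keys_iff)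
  then show ?case using zero by simp
next
  case (Suc n)
  then have "Poly_Mapping.keys m \<noteq> {}" by auto
  then obtain v where v: "v \<in> Poly_Mapping.keys m" by blast
  define m' where "m' = m - Poly_Mapping.single v 1"
  have m: "m = Poly_Mapping.single v 1 + m'"
    using v by (intro poly_mapping_eqI)
      (auto simp: m'_def lookup_add lookup_minus lookup_single when_def in_keys_iff)
  have "(\<Sum>u\<in>Poly_Mapping.keys m'. Poly_Mapping.lookup m' u)
      = (\<Sum>u\<in>Poly_Mapping.keys m. Poly_Mapping.lookup m' u)"
    by (rule sum_keys_superset) (auto simp: m'_def in_keys_iff lookup_minus)
  moreover have "(\<Sum>u\<in>Poly_Mapping.keys m. Poly_Mapping.lookup m u) =
      (\<Sum>u\<in>Poly_Mapping.keys m. Poly_Mapping.lookup m' u + (if u = v then 1 else 0))"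
    by (intro sum.cong) (auto simp: m lookup_add lookup_single)
  ultimately have "(\<Sum>u\<in>Poly_Mapping.keys m'. Poly_Mapping.lookup m' u) = n"
    using v Suc(2) by (simp add: sum.distrib)
  then show ?case using Suc(1)[of m'] single_add m by auto
qed

lemma qpoly_induct [case_names Const Var add mult]:
  fixes p :: "'v qpoly"
  assumes C: "\<And>c. Q (Const c)" and V: "\<And>v. Q (Var v)"
    and add: "\<And>p q. Q p \<Longrightarrow> Q q \<Longrightarrow> Q (p + q)"
    and mult: "\<And>p q. Q p \<Longrightarrow> Q q \<Longrightarrow> Q (p * q)"
  shows "Q p"
proof -
  have mon: "Q (mon m)" for m :: "'v monom"
    by (induction m rule: mon_induct)
      (use C[of 1] V mult in \<open>auto simp: mon_add simp flip: Var_conv_mon simp del: One_nat_def\<close>)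
  have "Q (\<Sum>m\<in>A. Const (h m) * mon m)" if "finite A" for A and h :: "'v monom \<Rightarrow> rat"
    using that by (induction A) (use C[of 0] C mon mult add in auto)
  from this[of "Poly_Mapping.keys p"] show ?thesis
    by (subst poly_eq_sum_monos) auto
qed

definition msubst :: "('v \<Rightarrow> 'w qpoly) \<Rightarrow> 'v monom \<Rightarrow> 'w qpoly"
  where "msubst g m = (\<Prod>v\<in>Poly_Mapping.keys m. g v ^ Poly_Mapping.lookup m v)"

lemma subst_msubst:
  "subst g p = (\<Sum>m\<in>Poly_Mapping.keys p. Const (Poly_Mapping.lookup p m) * msubst g m)"
  by (simp add: subst_def msubst_def)

lemma subst_superset:
  assumes "finite A" "Poly_Mapping.keys p \<subseteq> A"
  shows "subst g p = (\<Sum>m\<in>A. Const (Poly_Mapping.lookup p m) * msubst g m)"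
  unfolding subst_msubst using assms
  by (rule sum_keys_superset[where h = "\<lambda>m c. Const c * msubst g m"]) auto

lemma msubst_add: "msubst g (m + n) = msubst g m * msubst g n"
proof -
  define A where "A = Poly_Mapping.keys m \<union> Poly_Mapping.keys n"
  have A: "finite A" "Poly_Mapping.keys m \<subseteq> A" "Poly_Mapping.keys n \<subseteq> A"
    "Poly_Mapping.keys (m + n) \<subseteq> A"
    using keys_add[of m n] by (auto simp: A_def)
  have *: "msubst g k = (\<Prod>v\<in>A. g v ^ Poly_Mapping.lookup k v)" if "Poly_Mapping.keys k \<subseteq> A" for k
    unfolding msubst_def
    using A(1) that by (intro prod_keys_superset[where h = "\<lambda>v k. g v ^ k"]) auto
  show ?thesis
    by (simp add: * A lookup_add power_add prod.distrib)
qed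

lemma subst_add [simp]: "subst g (p + q) = subst g p + subst g q"
proof -
  define A where "A = Poly_Mapping.keys p \<union> Poly_Mapping.keys q"
  have A: "finite A" "Poly_Mapping.keys p \<subseteq> A" "Poly_Mapping.keys q \<subseteq> A"
    "Poly_Mapping.keys (p + q) \<subseteq> A"
    using keys_add[of p q] by (auto simp: A_def)
  show ?thesis
    by (simp add: subst_superset[OF A(1)] A lookup_add Const_add algebra_simps sum.distrib)
qed

lemma subst_Const_mon: "subst g (Const c * mon m) = Const c * msubst g m"
  by (cases "c = 0") (simp_all add: subst_msubst flip: single_conv_mon)

lemma subst_0 [simp]: "subst g 0 = 0"
  by (simp add: subst_def)

lemma subst_sum [simp]: "subst g (sum f A) = (\<Sum>x\<in>A. subst g (f x))"
  by (induction A rule: infinite_finite_induct) simp_all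

lemma subst_mult [simp]: "subst g (p * q) = subst g p * subst g q"
proof -
  have 1: "subst g ((Const c * mon m) * (Const d * mon n)) =
      subst g (Const c * mon m) * subst g (Const d * mon n)" for c m d n
  proof -
    have *: "(Const c * mon m) * (Const d * mon n) = Const (c * d) * mon (m + n)"
      by (simp add: Const_mult mon_add mult_ac)
    show ?thesis unfolding * subst_Const_mon msubst_add by (simp only: Const_mult mult_ac)
  qed
  have 2: "subst g (p * q) = subst g p * subst g q"
    if "p = (\<Sum>m\<in>A. Const (h m) * mon m)" "q = (\<Sum>m\<in>B. Const (k m) * mon m)"
    for A h B k
    unfolding that sum_product subst_sum 1 ..
  show ?thesis by (rule 2[OF poly_eq_sum_monos poly_eq_sum_monos])
qed

lemma subst_Const [simp]: "subst g (Const c) = Const c"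
  using subst_Const_mon[of g c 0] by (simp add: msubst_def)

lemma subst_1 [simp]: "subst g 1 = 1"
  using subst_Const[of g 1] by (simp del: subst_Const)

lemma subst_numeral [simp]: "subst g (numeral n) = numeral n"
  using subst_Const[of g "numeral n"] by (simp del: subst_Const)

lemma subst_Var [simp]: "subst g (Var v) = g v"
  using subst_Const_mon[of g 1 "Poly_Mapping.single v 1"]
  by (simp add: msubst_def Var_conv_mon)

lemma subst_uminus [simp]: "subst g (- p) = - subst g p"
  using subst_add[of g p "- p"] by (simp del: subst_add add: eq_neg_iff_add_eq_0 add.commute)

lemma subst_diff [simp]: "subst g (p - q) = subst g p - subst g q"
  using subst_add[of g p "- q"] by (simp del: subst_add)

lemma subst_power [simp]: "subst g (p ^ n) = subst g p ^ n"
  by (induction n) simp_all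

lemma subst_prod [simp]: "subst g (prod f A) = (\<Prod>x\<in>A. subst g (f x))"
  by (induction A rule: infinite_finite_induct) simp_all

lemma subst_scale [simp]: "subst g (scale c p) = scale c (subst g p)"
  by (simp add: scale_def)

lemma subst_subst: "subst g (subst h p) = subst (\<lambda>v. subst g (h v)) p"
  by (induction p rule: qpoly_induct) simp_all

lemma subst_Var_id [simp]: "subst Var p = p"
  by (induction p rule: qpoly_induct) simp_all

lemma subst_mon: "subst g (mon m) = msubst g m"
  using subst_Const_mon[of g 1 m] by simp

lemma mon_conv_msubst: "mon m = msubst Var m"
  using subst_mon[of Var m] by simp


section \<open>Weighted degrees and homogeneous components\<close>

text \<open>One notion of weighted degree serves four purposes: the total degree, the degree in a
  single point (\<open>pw\<close>), the termination of the reduction modulo the quadrics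
  (\<open>wgt\<close>), and leading forms of invariants (\<open>om\<close>).\<close>

definition wt :: "('v \<Rightarrow> nat) \<Rightarrow> 'v monom \<Rightarrow> nat"
  where "wt w m = (\<Sum>v\<in>Poly_Mapping.keys m. Poly_Mapping.lookup m v * w v)"

lemma wt_superset:
  assumes "finite A" "Poly_Mapping.keys m \<subseteq> A"
  shows "wt w m = (\<Sum>v\<in>A. Poly_Mapping.lookup m v * w v)"
  unfolding wt_def using assms
  by (rule sum_keys_superset[where h = "\<lambda>v k. k * w v"]) auto

lemma wt_UNIV: "wt w m = (\<Sum>v\<in>UNIV. Poly_Mapping.lookup m v * w v)" for m :: "'v::finite monom"
  by (rule wt_superset) auto

lemma wt_add: "wt w (m + n) = wt w m + wt w n"
proof -
  define A where "A = Poly_Mapping.keys m \<union> Poly_Mapping.keys n"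
  have A: "finite A" "Poly_Mapping.keys m \<subseteq> A" "Poly_Mapping.keys n \<subseteq> A"
    "Poly_Mapping.keys (m + n) \<subseteq> A"
    using keys_add[of m n] by (auto simp: A_def)
  show ?thesis
    by (simp add: wt_superset[OF A(1)] A lookup_add sum.distrib algebra_simps)
qed

lemma msubst_0 [simp]: "msubst g 0 = 1"
  by (simp add: msubst_def)

lemma msubst_single [simp]: "msubst g (Poly_Mapping.single v k) = g v ^ k"
  by (simp add: msubst_def)

lemma wt_0 [simp]: "wt w 0 = 0"
  by (simp add: wt_def)

lemma wt_single [simp]: "wt w (Poly_Mapping.single v k) = k * w v"
  by (simp add: wt_def)

lemma mdeg_wt: "mdeg m = wt (\<lambda>_. 1) m"
  by (simp add: mdeg_def wt_def)

definition whomog :: "('v \<Rightarrow> nat) \<Rightarrow> nat \<Rightarrow> 'v qpoly set"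
  where "whomog w n = {p. \<forall>m\<in>Poly_Mapping.keys p. wt w m = n}"

lemma homog_whomog: "homog n = whomog (\<lambda>_. 1) n"
  by (simp add: homog_def whomog_def mdeg_wt)

lemma whomog_0 [simp]: "0 \<in> whomog w n"
  by (simp add: whomog_def)

lemma whomog_mon: "mon m \<in> whomog w n \<longleftrightarrow> wt w m = n"
  by (simp add: whomog_def)

lemma whomog_add: "p \<in> whomog w n \<Longrightarrow> q \<in> whomog w n \<Longrightarrow> p + q \<in> whomog w n"
  using keys_add[of p q] by (auto simp: whomog_def)

lemma whomog_Const_mult: "p \<in> whomog w n \<Longrightarrow> Const c * p \<in> whomog w n"
  by (auto simp: whomog_def in_keys_iff lookup_Const_mult)

lemma whomog_scale: "p \<in> whomog w n \<Longrightarrow> scale c p \<in> whomog w n"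
  by (simp add: scale_def whomog_Const_mult)

lemma whomog_uminus: "p \<in> whomog w n \<Longrightarrow> - p \<in> whomog w n"
  by (simp add: whomog_def)

lemma whomog_diff: "p \<in> whomog w n \<Longrightarrow> q \<in> whomog w n \<Longrightarrow> p - q \<in> whomog w n"
  using whomog_add[of p w n "- q"] whomog_uminus[of q] by simp

lemma whomog_sum: "(\<And>x. x \<in> A \<Longrightarrow> f x \<in> whomog w n) \<Longrightarrow> sum f A \<in> whomog w n"
  by (induction A rule: infinite_finite_induct) (auto intro: whomog_add)

lemma whomog_mult:
  assumes "p \<in> whomog w n" "q \<in> whomog w k"
  shows "p * q \<in> whomog w (n + k)"
  using assms keys_mult[of p q] by (fastforce simp: whomog_def wt_add)

lemma whomog_1 [simp]: "1 \<in> whomog w 0"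
  by (simp add: whomog_def)

lemma whomog_Const [simp]: "Const c \<in> whomog w 0"
  using whomog_Const_mult[OF whomog_1, of c w] by simp

lemma whomog_Var: "Var v \<in> whomog w (w v)"
  by (simp add: Var_conv_mon whomog_mon)

lemma whomog_power: "p \<in> whomog w n \<Longrightarrow> p ^ k \<in> whomog w (k * n)"
  by (induction k) (auto simp: intro!: whomog_mult)

lemma whomog_prod:
  "(\<And>x. x \<in> A \<Longrightarrow> f x \<in> whomog w (d x)) \<Longrightarrow> prod f A \<in> whomog w (sum d A)"
  by (induction A rule: infinite_finite_induct) (auto intro: whomog_mult)

lemma whomog_subst:
  assumes "\<And>v. g v \<in> whomog w' (w v)" "p \<in> whomog w n"
  shows "subst g p \<in> whomog w' n"
  unfolding subst_msubst
proof (intro whomog_sum whomog_Const_mult)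
  fix m assume "m \<in> Poly_Mapping.keys p"
  then have "n = (\<Sum>v\<in>Poly_Mapping.keys m. Poly_Mapping.lookup m v * w v)"
    using assms(2) by (auto simp: whomog_def wt_def)
  then show "msubst g m \<in> whomog w' n"
    unfolding msubst_def by (auto intro!: whomog_prod whomog_power assms(1))
qed

text \<open>The factor \<open>c\<close> may itself be a polynomial. This clears denominators in
  \<open>br_dvd_if_merge_vanish\<close>; with a rational constant it pulls the halves out of the
  action of a transposition.\<close>

lemma subst_scaled:
  assumes "p \<in> whomog w n"
  shows "subst (\<lambda>v. c ^ w v * g v) p = c ^ n * subst g p"
proof -
  have "msubst (\<lambda>v. c ^ w v * g v) m = c ^ wt w m * msubst g m" for m
    by (induction m rule: mon_induct) (simp_all add: msubst_add wt_add power_add mult_ac)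
  then show ?thesis
    using assms unfolding subst_msubst sum_distrib_left
    by (intro sum.cong) (auto simp: whomog_def mult_ac)
qed

definition wcomp :: "('v \<Rightarrow> nat) \<Rightarrow> nat \<Rightarrow> 'v qpoly \<Rightarrow> 'v qpoly"
  where "wcomp w n p = (\<Sum>m\<in>{m\<in>Poly_Mapping.keys p. wt w m = n}. Const (Poly_Mapping.lookup p m) * mon m)"

lemma lookup_wcomp:
  "Poly_Mapping.lookup (wcomp w n p) m = (if wt w m = n then Poly_Mapping.lookup p m else 0)"
  by (auto simp: wcomp_def lookup_sum lookup_Const_mult lookup_mon if_distrib sum.delta in_keys_iff
      cong: if_cong)

lemma wcomp_add: "wcomp w n (p + q) = wcomp w n p + wcomp w n q"
  by (rule poly_mapping_eqI) (simp add: lookup_wcomp lookup_add)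

lemma wcomp_0 [simp]: "wcomp w n 0 = 0"
  by (rule poly_mapping_eqI) (simp add: lookup_wcomp)

lemma wcomp_sum: "wcomp w n (sum f A) = (\<Sum>x\<in>A. wcomp w n (f x))"
  by (induction A rule: infinite_finite_induct) (simp_all add: wcomp_add)

lemma wcomp_in_whomog: "wcomp w n p \<in> whomog w n"
  by (auto simp: whomog_def in_keys_iff lookup_wcomp split: if_splits)

lemma wcomp_whomog: "p \<in> whomog w k \<Longrightarrow> wcomp w n p = (if n = k then p else 0)"
  by (rule poly_mapping_eqI) (auto simp: lookup_wcomp whomog_def in_keys_iff)

lemma wcomp_mult_whomog:
  assumes "p \<in> whomog w k"
  shows "wcomp w n (p * q) = (if k \<le> n then p * wcomp w (n - k) q else 0)"
proof -
  have 1: "wcomp w n (p * (Const c * mon m)) =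
      (if k \<le> n then p * wcomp w (n - k) (Const c * mon m) else 0)" for c m
  proof -
    have a: "p * (Const c * mon m) \<in> whomog w (k + wt w m)"
      by (intro whomog_mult assms whomog_Const_mult) (simp add: whomog_mon)
    have b: "Const c * mon m \<in> whomog w (wt w m)"
      by (intro whomog_Const_mult) (simp add: whomog_mon)
    show ?thesis by (auto simp: wcomp_whomog[OF a] wcomp_whomog[OF b])
  qed
  have 2: "wcomp w n (p * q) = (if k \<le> n then p * wcomp w (n - k) q else 0)"
    if "q = (\<Sum>m\<in>A. Const (h m) * mon m)" for A h
    unfolding that sum_distrib_left wcomp_sum 1 by (auto simp: sum_distrib_left)
  show ?thesis by (rule 2[OF poly_eq_sum_monos])
qed

lemma sum_wcomp: "(\<Sum>n<N. wcomp w n p) = p" if "\<forall>m\<in>Poly_Mapping.keys p. wt w m < N"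
proof (rule poly_mapping_eqI)
  fix m
  show "Poly_Mapping.lookup (\<Sum>n<N. wcomp w n p) m = Poly_Mapping.lookup p m"
    using that by (auto simp: lookup_sum lookup_wcomp sum.delta' in_keys_iff)
qed

lemma ex_sum_wcomp: "\<exists>N. (\<Sum>n<N. wcomp w n p) = p"
proof -
  have "\<forall>m\<in>Poly_Mapping.keys p. wt w m < Suc (Max (insert 0 (wt w ` Poly_Mapping.keys p)))"
    by (auto simp: less_Suc_eq_le)
  then show ?thesis by (metis sum_wcomp)
qed


section \<open>Partial derivatives\<close>

lemma lookup_pd_superset:
  assumes "finite A" "Poly_Mapping.keys p \<subseteq> A"
  shows "pd v p = (\<Sum>m\<in>A. Poly_Mapping.single (m - Poly_Mapping.single v 1)
      (Poly_Mapping.lookup p m * of_nat (Poly_Mapping.lookup m v)))"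
  unfolding pd_def using assms
  by (intro sum_keys_superset[where h = "\<lambda>m c. Poly_Mapping.single (m - Poly_Mapping.single v 1)
    (c * of_nat (Poly_Mapping.lookup m v))"]) auto

lemma pd_add [simp]: "pd v (p + q) = pd v p + pd v q"
proof -
  define A where "A = Poly_Mapping.keys p \<union> Poly_Mapping.keys q"
  have A: "finite A" "Poly_Mapping.keys p \<subseteq> A" "Poly_Mapping.keys q \<subseteq> A"
    "Poly_Mapping.keys (p + q) \<subseteq> A"
    using keys_add[of p q] by (auto simp: A_def)
  show ?thesis
    by (simp add: lookup_pd_superset[OF A(1)] A lookup_add single_add[symmetric] algebra_simps
        flip: sum.distrib)
qed

lemma pd_0 [simp]: "pd v 0 = 0"
  by (simp add: pd_def)

lemma pd_sum [simp]: "pd v (sum f A) = (\<Sum>x\<in>A. pd v (f x))"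
  by (induction A rule: infinite_finite_induct) simp_all

lemma pd_Const_mon:
  "pd v (Const c * mon m) = Const (c * of_nat (Poly_Mapping.lookup m v)) * mon (m - Poly_Mapping.single v 1)"
  by (cases "c = 0") (simp_all add: pd_def flip: single_conv_mon)

lemma pd_mult: "pd v (p * q) = pd v p * q + p * pd v q"
proof -
  have sh: "Const (of_nat (Poly_Mapping.lookup m v)) * mon (m + n - Poly_Mapping.single v 1) =
      Const (of_nat (Poly_Mapping.lookup m v)) * mon (m - Poly_Mapping.single v 1) * mon n"
    for m n :: "'a monom"
  proof (cases "Poly_Mapping.lookup m v = 0")
    case False
    then have "m + n - Poly_Mapping.single v 1 = (m - Poly_Mapping.single v 1) + n"
      by (intro poly_mapping_eqI) (auto simp: lookup_add lookup_minus lookup_single when_def)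
    then show ?thesis by (simp add: mon_add mult.assoc)
  qed simp
  have 1: "pd v ((Const c * mon m) * (Const d * mon n)) =
      pd v (Const c * mon m) * (Const d * mon n) + (Const c * mon m) * pd v (Const d * mon n)"
    for c m d n
  proof -
    have *: "(Const c * mon m) * (Const d * mon n) = Const (c * d) * mon (m + n)"
      by (simp add: Const_mult mon_add mult_ac)
    have "pd v ((Const c * mon m) * (Const d * mon n)) =
      Const (c * d) * (Const (of_nat (Poly_Mapping.lookup m v)) * mon (m + n - Poly_Mapping.single v 1)
        + Const (of_nat (Poly_Mapping.lookup n v)) * mon (n + m - Poly_Mapping.single v 1))"
      unfolding * pd_Const_mon lookup_add of_nat_add
      by (simp only: Const_mult Const_add distrib_left distrib_right add.commute[of n m] mult.assoc)
    also have "\<dots> = pd v (Const c * mon m) * (Const d * mon n) + (Const c * mon m) * pd v (Const d * mon n)"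
      unfolding sh pd_Const_mon by (simp add: Const_mult algebra_simps)
    finally show ?thesis .
  qed
  have 2: "pd v (p * q) = pd v p * q + p * pd v q"
    if "p = (\<Sum>m\<in>A. Const (h m) * mon m)" "q = (\<Sum>m\<in>B. Const (k m) * mon m)"
    for A h B k
    unfolding that sum_product pd_sum 1 by (simp add: sum.distrib)
  show ?thesis by (rule 2[OF poly_eq_sum_monos poly_eq_sum_monos])
qed

lemma pd_Const [simp]: "pd v (Const c) = 0"
  using pd_Const_mon[of v c 0] by simp

lemma pd_1 [simp]: "pd v 1 = 0"
  using pd_Const[of v 1] by (simp del: pd_Const)

lemma pd_numeral [simp]: "pd v (numeral n) = 0"
  using pd_Const[of v "numeral n"] by (simp del: pd_Const)

lemma pd_Var: "pd v (Var u) = (if u = v then 1 else 0)"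
  using pd_Const_mon[of v 1 "Poly_Mapping.single u 1"]
  by (simp add: Var_conv_mon lookup_single when_def)

lemma pd_uminus [simp]: "pd v (- p) = - pd v p"
  using pd_add[of v p "- p"] by (simp del: pd_add add: eq_neg_iff_add_eq_0 add.commute)

lemma pd_diff [simp]: "pd v (p - q) = pd v p - pd v q"
  using pd_add[of v p "- q"] by (simp del: pd_add)

lemma pd_scale [simp]: "pd v (scale c p) = scale c (pd v p)"
  by (simp add: scale_def pd_mult)

lemma pd_subst: "pd v (subst g p) = (\<Sum>u\<in>UNIV. subst g (pd u p) * pd v (g u))"
  for p :: "'v::finite qpoly"
proof (induction p rule: qpoly_induct)
  case (Var u)
  then show ?case by (simp add: pd_Var if_distrib if_distribR cong: if_cong)
qed (simp_all add: pd_mult sum.distrib algebra_simps sum_distrib_left)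

section \<open>Cancellation and divisibility\<close>

text \<open>A linear order on the variables induces one on the monomials, so leading terms multiply
  and the ring of polynomials in the coordinates has no zero divisors. Brackets can then be
  cancelled.\<close>

instantiation coord :: linorder
begin

fun less_eq_coord :: "coord \<Rightarrow> coord \<Rightarrow> bool" where
  "XX i \<le> XX j \<longleftrightarrow> i \<le> j"
| "XX i \<le> YY j \<longleftrightarrow> True"
| "YY i \<le> XX j \<longleftrightarrow> False"
| "YY i \<le> YY j \<longleftrightarrow> i \<le> j"

definition less_coord :: "coord \<Rightarrow> coord \<Rightarrow> bool"
  where "u < v \<longleftrightarrow> u \<le> v \<and> \<not> v \<le> (u :: coord)"

instance
proof
  fix x y z :: coord
  show "x < y \<longleftrightarrow> x \<le> y \<and> \<not> y \<le> x" by (simp add: less_coord_def)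
  show "x \<le> x" by (cases x) auto
  show "x \<le> y \<Longrightarrow> y \<le> z \<Longrightarrow> x \<le> z" by (cases x; cases y; cases z) auto
  show "x \<le> y \<Longrightarrow> y \<le> x \<Longrightarrow> x = y" by (cases x; cases y) auto
  show "x \<le> y \<or> y \<le> x" by (cases x; cases y) auto
qed

end

lemma UNIV_8: "(UNIV :: 8 set) = {0, 1, 2, 3, 4, 5, 6, 7}"
proof -
  have "card {0, 1, 2, 3, 4, 5, 6, 7 :: 8} = 8" by simp
  then show ?thesis
    by (intro sym[OF card_subset_eq]) auto
qed

lemma forall_8: "(\<forall>i :: 8. Q i) \<longleftrightarrow> Q 0 \<and> Q 1 \<and> Q 2 \<and> Q 3 \<and> Q 4 \<and> Q 5 \<and> Q 6 \<and> Q 7"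
proof -
  have "(\<forall>i :: 8. Q i) \<longleftrightarrow> (\<forall>i\<in>UNIV. Q i)" by simp
  then show ?thesis unfolding UNIV_8 by simp
qed

text \<open>Substitution is a ring homomorphism, so a congruence modulo \<open>b\<close> need only
  be checked on variables. Divisibility by variables and by brackets is derived from this.\<close>

lemma subst_dvd_cong:
  assumes "\<And>v. b dvd g v - h v"
  shows "b dvd subst g p - subst h p"
proof (induction p rule: qpoly_induct)
  case (add p q)
  have "subst g (p + q) - subst h (p + q) = (subst g p - subst h p) + (subst g q - subst h q)"
    by simp
  then show ?case using add by (metis dvd_add)
next
  case (mult p q)
  have "subst g (p * q) - subst h (p * q) =
      (subst g p - subst h p) * subst g q + (subst g q - subst h q) * subst h p"
    by (simp add: algebra_simps)
  then show ?case using mult by (metis dvd_add dvd_mult2)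
qed (use assms in simp_all)

lemma Var_dvd_if_vanish:
  assumes "subst (Var(v := 0)) p = 0"
  shows "Var v dvd p"
proof -
  have "Var v dvd subst Var p - subst (Var(v := 0)) p"
    by (intro subst_dvd_cong) auto
  then show ?thesis using assms by simp
qed

lemma Var_nonzero [simp]: "Var v \<noteq> 0"
proof
  assume "Var v = 0"
  then have "subst (\<lambda>_. 1 :: 'a qpoly) (Var v) = 0" by (simp del: subst_Var)
  then show False by simp
qed

text \<open>Multiplication by \<open>p\<close> shifts homogeneous components by \<open>e\<close>, so
  \<open>p\<close> annihilates every component of \<open>q\<close> outside degree
  \<open>n - e\<close>, and \<open>p\<close> is not a zero divisor. If \<open>n < e\<close>, all
  components vanish and \<open>q = 0\<close>, so the truncated subtraction does no harm.\<close>

lemma whomog_divisor: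
  fixes p q :: "'v::linorder qpoly"
  assumes "p \<noteq> 0" "p \<in> whomog w e" "p * q \<in> whomog w n"
  shows "q \<in> whomog w (n - e)"
proof -
  have 0: "wcomp w l q = 0" if "l + e \<noteq> n" for l
  proof -
    have "p * wcomp w l q = wcomp w (l + e) (p * q)"
      by (simp add: wcomp_mult_whomog[OF assms(2)])
    also have "\<dots> = 0" using wcomp_whomog[OF assms(3)] that by simp
    finally show ?thesis using assms(1) by simp
  qed
  show ?thesis
  proof (unfold whomog_def, safe)
    fix m assume m: "m \<in> Poly_Mapping.keys q"
    have "Poly_Mapping.lookup (wcomp w (wt w m) q) m \<noteq> 0"
      using m by (simp add: lookup_wcomp in_keys_iff)
    then have "wcomp w (wt w m) q \<noteq> 0" by auto
    with 0 show "wt w m = n - e" by force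
  qed
qed


section \<open>Brackets and the first fundamental theorem for SL2\<close>

definition br :: "8 \<Rightarrow> 8 \<Rightarrow> coord qpoly"
  where "br i j = Var (XX i) * Var (YY j) - Var (XX j) * Var (YY i)"

definition pw :: "8 \<Rightarrow> coord \<Rightarrow> nat"
  where "pw i u = (if u = XX i \<or> u = YY i then 1 else 0)"

definition mhom :: "(8 \<Rightarrow> nat) \<Rightarrow> coord qpoly set"
  where "mhom D = {f. \<forall>i. f \<in> whomog (pw i) (D i)}"

lemma wt_pw: "wt (pw i) m = Poly_Mapping.lookup m (XX i) + Poly_Mapping.lookup m (YY i)"
proof -
  have "wt (pw i) m = (\<Sum>v\<in>Poly_Mapping.keys m \<union> {XX i, YY i}. Poly_Mapping.lookup m v * pw i v)"
    by (rule wt_superset) auto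
  also have "\<dots> = (\<Sum>v\<in>{XX i, YY i}. Poly_Mapping.lookup m v * pw i v)"
    by (rule sum.mono_neutral_right) (auto simp: pw_def)
  finally show ?thesis by (simp add: pw_def)
qed

lemma Rpiece_mhom: "Rpiece d = {f. SL2_invariant f \<and> f \<in> mhom (\<lambda>_. d)}"
  by (auto simp: Rpiece_def mhom_def whomog_def wt_pw)

lemma whomog_add_weights:
  assumes "p \<in> whomog w n" "p \<in> whomog w' n'"
  shows "p \<in> whomog (\<lambda>v. w v + w' v) (n + n')"
  using assms by (auto simp: whomog_def wt_def algebra_simps sum.distrib)

lemma whomog_zero_weight: "p \<in> whomog (\<lambda>_. 0) 0"
  by (auto simp: whomog_def wt_def)

lemma mhom_add: "p \<in> mhom D \<Longrightarrow> q \<in> mhom D \<Longrightarrow> p + q \<in> mhom D"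
  and mhom_diff: "p \<in> mhom D \<Longrightarrow> q \<in> mhom D \<Longrightarrow> p - q \<in> mhom D"
  and mhom_scale: "p \<in> mhom D \<Longrightarrow> scale c p \<in> mhom D"
  by (auto simp: mhom_def whomog_add whomog_diff whomog_scale)

lemma mhom_0 [simp]: "0 \<in> mhom D"
  by (auto simp: mhom_def)

lemma mhom_mult: "p \<in> mhom D \<Longrightarrow> q \<in> mhom D' \<Longrightarrow> p * q \<in> mhom (\<lambda>i. D i + D' i)"
  by (auto simp: mhom_def intro: whomog_mult)

lemma br_mhom: "br i j \<in> mhom (\<lambda>k. (if k = i then 1 else 0) + (if k = j then 1 else 0))"
proof -
  have "Var (XX i) * Var (YY j) \<in> whomog (pw k) (pw k (XX i) + pw k (YY j))"
    "Var (XX j) * Var (YY i) \<in> whomog (pw k) (pw k (XX j) + pw k (YY i))" for k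
    by (intro whomog_mult whomog_Var)+
  moreover have "pw k (XX i) + pw k (YY j) = (if k = i then 1 else 0) + (if k = j then 1 else 0)"
    "pw k (XX j) + pw k (YY i) = (if k = i then 1 else 0) + (if k = j then 1 else 0)" for k
    by (auto simp: pw_def)
  ultimately show ?thesis
    unfolding mhom_def br_def mem_Collect_eq by (metis whomog_diff)
qed

lemma br_nonzero: "i \<noteq> j \<Longrightarrow> br i j \<noteq> 0"
proof
  assume ij: "i \<noteq> j" and "br i j = 0"
  then have "subst (\<lambda>u. if u = XX i \<or> u = YY j then 1 else 0) (br i j) = (0 :: coord qpoly)"
    by simp
  with ij show False by (simp add: br_def)
qed

lemma br_swap: "br j i = - br i j"
  by (simp add: br_def)

lemma br_refl [simp]: "br i i = 0"
  by (simp add: br_def)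

lemma pluecker: "br a b * br c d = br a c * br b d - br a d * br b c"
  by (simp add: br_def algebra_simps)

text \<open>Specialisation to configurations in which point \<open>j\<close> coincides with point
  \<open>i\<close>.\<close>

definition merge :: "8 \<Rightarrow> 8 \<Rightarrow> coord \<Rightarrow> coord qpoly"
  where "merge i j = (Var (XX j := Var (XX i), YY j := Var (YY i)))"

text \<open>Modulo the bracket the two points are proportional: y_i times the coordinates of point
  \<open>j\<close> equals y_j times those of point \<open>i\<close>. By homogeneity in point
  \<open>j\<close>, y_i^n f is congruent to y_j^n times the merged polynomial, which is zero; and
  y_i is coprime to the bracket.\<close>

lemma br_dvd_if_merge_vanish:
  assumes "i \<noteq> j" "f \<in> whomog (pw j) n" "subst (merge i j) f = 0"
  shows "br i j dvd f"
proof -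
  have "br i j dvd subst (\<lambda>u. Var (YY i) ^ pw j u * Var u) f
      - subst (\<lambda>u. Var (YY j) ^ pw j u * merge i j u) f"
  proof (rule subst_dvd_cong)
    fix u
    show "br i j dvd Var (YY i) ^ pw j u * Var u - Var (YY j) ^ pw j u * merge i j u"
      by (cases u) (auto simp: merge_def pw_def br_def algebra_simps dvd_def intro!: exI[of _ "-1"])
  qed
  then have "br i j dvd Var (YY i) ^ n * f"
    using assms(3) by (simp add: subst_scaled[OF assms(2)])
  \<comment> \<open>The powers of y_i are removed one at a time: at y_i = 0 the bracket becomes x_i
    y_j, which is not zero, so the cofactor \<open>h\<close> must vanish there and is divisible by
    y_i.\<close>
  then show ?thesis
  proof (induction n)
    case (Suc n)
    then obtain h where h: "Var (YY i) * (Var (YY i) ^ n * f) = br i j * h"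
      by (auto simp: dvd_def mult.assoc)
    have "subst (Var(YY i := 0)) (br i j * h) = 0"
      unfolding h[symmetric] by simp
    then have "subst (Var(YY i := 0)) h = 0"
      using assms(1) by (simp add: br_def)
    then obtain h' where "h = Var (YY i) * h'"
      by (metis Var_dvd_if_vanish dvdE)
    with h have "Var (YY i) ^ n * f = br i j * h'"
      by (simp add: mult.left_commute[of _ "Var (YY i)"])
    then show ?case using Suc.IH by simp
  qed simp
qed


section \<open>Invariance under rational matrices, bracket monomials, and the first fundamental
  theorem\<close>

definition mat_act :: "rat \<Rightarrow> rat \<Rightarrow> rat \<Rightarrow> rat \<Rightarrow> coord \<Rightarrow> coord qpoly"
  where "mat_act a b c d u = (case u of
    XX i \<Rightarrow> Const a * Var (XX i) + Const b * Var (YY i)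
  | YY i \<Rightarrow> Const c * Var (XX i) + Const d * Var (YY i))"

text \<open>Invariance under the rational points of the group only, which follows from the coaction
  condition by specialising the generic matrix. It is easier to transport through merging and
  division by brackets, and it is enough for the first fundamental theorem.\<close>

definition invar :: "coord qpoly \<Rightarrow> bool"
  where "invar f \<longleftrightarrow> (\<forall>a b c d. a * d - b * c = 1 \<longrightarrow> subst (mat_act a b c d) f = f)"

lemma invar_if_SL2_invariant:
  assumes "SL2_invariant f"
  shows "invar f"
  unfolding invar_def
proof (intro allI impI)
  fix a b c d :: rat
  assume det: "a * d - b * c = 1"
  define h :: "gl2_coord + coord \<Rightarrow> coord qpoly"
    where "h = case_sum (case_gl2_coord (Const a) (Const b) (Const c) (Const d)) Var"
  obtain k where k: "subst generic_action f - subst pvar f = (gvar GA * gvar GD - gvar GB * gvar GC - 1) * k"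
    using assms by (auto simp: SL2_invariant_def dvd_def)
  have "subst h (subst generic_action f - subst pvar f) = 0"
    unfolding k by (simp add: h_def det flip: Const_mult Const_diff)
  moreover have "subst h (generic_action u) = mat_act a b c d u" for u
    by (cases u) (simp_all add: h_def mat_act_def)
  moreover have "subst h (pvar u) = Var u" for u
    by (simp add: h_def)
  ultimately show "subst (mat_act a b c d) f = f"
    by (simp add: subst_subst)
qed

lemma SL2_invariant_add: "SL2_invariant f \<Longrightarrow> SL2_invariant g \<Longrightarrow> SL2_invariant (f + g)"
  unfolding SL2_invariant_def by (drule (1) dvd_add) (simp add: algebra_simps)

lemma SL2_invariant_mult:
  assumes "SL2_invariant f" "SL2_invariant g"
  shows "SL2_invariant (f * g)"
proof -
  have "subst generic_action (f * g) - subst pvar (f * g) =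
      (subst generic_action f - subst pvar f) * subst generic_action g
      + (subst generic_action g - subst pvar g) * subst pvar f"
    by (simp add: algebra_simps)
  then show ?thesis
    using assms unfolding SL2_invariant_def by (metis dvd_add dvd_mult2)
qed

lemma SL2_invariant_Const [simp]: "SL2_invariant (Const c)"
  by (simp add: SL2_invariant_def)

lemma SL2_invariant_br: "SL2_invariant (br i j)"
proof -
  have "subst generic_action (br i j) - subst pvar (br i j) =
      (gvar GA * gvar GD - gvar GB * gvar GC - 1) * subst pvar (br i j)"
    by (simp add: br_def algebra_simps)
  then show ?thesis by (simp add: SL2_invariant_def)
qed

text \<open>A bracket monomial is encoded by a directed multigraph on the labels. Reversing an edge
  changes the sign and a loop gives zero; as a loop counts twice in \<open>gdeg\<close>, vertex
  degrees are the multidegree in all cases.\<close>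

definition bm :: "(8 \<times> 8) multiset \<Rightarrow> coord qpoly"
  where "bm G = (\<Prod>(i, j)\<in>#G. br i j)"

definition gdeg :: "(8 \<times> 8) multiset \<Rightarrow> 8 \<Rightarrow> nat"
  where "gdeg G k = (\<Sum>(i, j)\<in>#G. (if k = i then 1 else 0) + (if k = j then 1 else 0))"

lemma bm_simps [simp]: "bm {#} = 1" "bm (add_mset (i, j) G) = br i j * bm G" "bm (G + H) = bm G * bm H"
  by (simp_all add: bm_def)

lemma gdeg_empty [simp]: "gdeg {#} k = 0"
  and gdeg_add_mset: "gdeg (add_mset (i, j) G) k = (if k = i then 1 else 0) + (if k = j then 1 else 0) + gdeg G k"
  and gdeg_union: "gdeg (G + H) k = gdeg G k + gdeg H k"
  by (simp_all add: gdeg_def)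

lemma bm_mhom: "bm G \<in> mhom (gdeg G)"
proof (induction G)
  case empty
  then show ?case by (simp add: mhom_def)
next
  case (add e G)
  obtain i j where e: "e = (i, j)" by (cases e)
  have "gdeg (add_mset (i, j) G) = (\<lambda>k. (if k = i then 1 else 0) + (if k = j then 1 else 0) + gdeg G k)"
    by (simp add: fun_eq_iff gdeg_add_mset)
  then show ?case
    using mhom_mult[OF br_mhom add, of i j] by (simp add: e)
qed

lemma SL2_invariant_bm: "SL2_invariant (bm G)"
  by (induction G)
    (auto intro!: SL2_invariant_mult SL2_invariant_br SL2_invariant_Const[of 1, simplified])

lemma invar_bm: "invar (bm G)"
  by (intro invar_if_SL2_invariant SL2_invariant_bm)

lemma invar_add: "invar f \<Longrightarrow> invar g \<Longrightarrow> invar (f + g)"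
  and invar_diff: "invar f \<Longrightarrow> invar g \<Longrightarrow> invar (f - g)"
  and invar_scale: "invar f \<Longrightarrow> invar (scale c f)"
  by (simp_all add: invar_def)

lemma invar_0 [simp]: "invar 0"
  by (simp add: invar_def)

definition bspan :: "(8 \<Rightarrow> nat) \<Rightarrow> coord qpoly set"
  where "bspan D = qpoly.span {bm G | G. gdeg G = D}"

lemma bspan_mhom_invar: "f \<in> bspan D \<Longrightarrow> f \<in> mhom D \<and> invar f"
  unfolding bspan_def
proof (induction f rule: qpoly.span_induct)
  case base
  show ?case
    unfolding qpoly.subspace_def by (auto simp: mhom_add mhom_scale invar_add invar_scale)
qed (use bm_mhom invar_bm in auto)

lemma subst_span:
  assumes "f \<in> qpoly.span A" "\<And>x. x \<in> A \<Longrightarrow> subst g x \<in> B" "qpoly.subspace B"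
  shows "subst g f \<in> B"
  using assms(1)
proof (induction f rule: qpoly.span_induct)
  case base
  show ?case
    using assms(3) unfolding qpoly.subspace_def by auto
qed (use assms(2) in auto)

lemma br_mult_bspan:
  assumes "f \<in> bspan E" "\<And>k. D k = (if k = i then 1 else 0) + (if k = j then 1 else 0) + E k"
  shows "br i j * f \<in> bspan D"
  using assms(1) unfolding bspan_def
proof (induction f rule: qpoly.span_induct)
  case base
  have *: "br i j * scale c y = scale c (br i j * y)" for c y
    by (simp add: scale_def mult.left_commute)
  show ?case
    by (rule qpoly.subspaceI) (simp_all add: * distrib_left qpoly.span_add qpoly.span_zero qpoly.span_scale)
next
  case (step x)
  then obtain G where G: "x = bm G" "gdeg G = E" by auto
  then have "gdeg (add_mset (i, j) G) = D"
    using assms(2) by (auto simp: gdeg_add_mset fun_eq_iff)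
  then have "bm (add_mset (i, j) G) \<in> qpoly.span {bm G | G. gdeg G = D}"
    by (blast intro: qpoly.span_base)
  then show ?case by (simp add: G)
qed

lemma merge_br:
  assumes "a \<noteq> j" "b \<noteq> j"
  shows "subst (merge i j) (br a b) = br a b" "subst (merge i j) (br j b) = br i b"
    "subst (merge i j) (br a j) = br a i"
  using assms by (auto simp: br_def merge_def)

text \<open>\<open>k\<close> of the edge ends at \<open>i\<close> are moved to the isolated vertex \<open>j\<close>.\<close>

lemma lift_bm:
  assumes "i \<noteq> j" "gdeg G' j = 0" "k \<le> gdeg G' i"
  shows "\<exists>G. gdeg G = (gdeg G')(i := gdeg G' i - k, j := k) \<and> subst (merge i j) (bm G) = bm G'"
  using assms(2,3)
proof (induction G' arbitrary: k)
  case empty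
  then show ?case by (intro exI[of _ "{#}"]) (auto simp: fun_eq_iff)
next
  case (add e G')
  obtain a b where e: "e = (a, b)" by (cases e)
  have ab: "a \<noteq> j" "b \<noteq> j" "gdeg G' j = 0"
    using add.prems(1) by (auto simp: e gdeg_add_mset split: if_splits)
  show ?case
  proof (cases "k \<le> gdeg G' i")
    case True
    from add.IH[OF ab(3) True] obtain G
      where G: "gdeg G = (gdeg G')(i := gdeg G' i - k, j := k)" "subst (merge i j) (bm G) = bm G'"
      by blast
    show ?thesis
      using G ab assms(1) True
      by (intro exI[of _ "add_mset e G"]) (auto simp: e gdeg_add_mset merge_br fun_eq_iff)
  next
    case False
    show ?thesis
    \<comment> \<open>More ends have to be moved than the remaining edges have at \<open>i\<close>.
      So all of theirs are moved, and the new edge contributes the rest: one end, or possibly two if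
      it is a loop at \<open>i\<close>.\<close>
    proof (cases "a = i \<and> b = i")
      case True
      obtain G where G: "gdeg G = (gdeg G')(i := 0, j := gdeg G' i)" "subst (merge i j) (bm G) = bm G'"
        using add.IH[OF ab(3), of "gdeg G' i"] unfolding diff_self_eq_0 by blast
      show ?thesis
      proof (cases "k = gdeg G' i + 1")
        case k: True
        show ?thesis
          using G ab assms(1) True k
          by (intro exI[of _ "add_mset (j, i) G"]) (auto simp: e gdeg_add_mset merge_br fun_eq_iff)
      next
        case False
        then have k: "k = gdeg G' i + 2"
          using add.prems(2) \<open>\<not> k \<le> gdeg G' i\<close> True by (simp add: e gdeg_add_mset)
        show ?thesis
          using G ab assms(1) True k
          by (intro exI[of _ "add_mset (j, j) G"]) (auto simp: e gdeg_add_mset merge_br fun_eq_iff)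
      qed
    next
      case ni: False
      have k: "k = Suc (gdeg G' i)" "a = i \<or> b = i"
        using add.prems(2) False ni by (auto simp: e gdeg_add_mset split: if_splits)
      obtain G where G: "gdeg G = (gdeg G')(i := 0, j := gdeg G' i)" "subst (merge i j) (bm G) = bm G'"
        using add.IH[OF ab(3), of "gdeg G' i"] unfolding diff_self_eq_0 by blast
      show ?thesis
      proof (cases "a = i")
        case True
        then show ?thesis
          using G ab assms(1) k ni
          by (intro exI[of _ "add_mset (j, b) G"]) (auto simp: e gdeg_add_mset merge_br fun_eq_iff)
      next
        case False
        then show ?thesis
          using G ab assms(1) k ni
          by (intro exI[of _ "add_mset (a, j) G"]) (auto simp: e gdeg_add_mset merge_br fun_eq_iff)
      qed
    qed
  qed
qed

text \<open>Linear extension of \<open>lift_bm\<close>: merging two points maps bracket polynomials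
  onto the bracket polynomials of the merged multidegree. It supplies the correction term in
  \<open>first_fundamental_theorem\<close>.\<close>

lemma lift_bspan:
  assumes "i \<noteq> j" "h \<in> bspan (D(i := D i + D j, j := 0))"
  shows "\<exists>f. f \<in> bspan D \<and> subst (merge i j) f = h"
  using assms(2) unfolding bspan_def
proof (induction h rule: qpoly.span_induct)
  case base
  show ?case
  proof (rule qpoly.subspaceI; clarsimp)
    show "\<exists>f. f \<in> qpoly.span {bm G |G. gdeg G = D} \<and> subst (merge i j) f = 0"
      by (intro exI[of _ 0]) (simp add: qpoly.span_zero)
    fix f g assume "f \<in> qpoly.span {bm G |G. gdeg G = D}" "g \<in> qpoly.span {bm G |G. gdeg G = D}"
    then show "\<exists>h. h \<in> qpoly.span {bm G |G. gdeg G = D} \<and>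
        subst (merge i j) h = subst (merge i j) f + subst (merge i j) g"
      by (intro exI[of _ "f + g"]) (simp add: qpoly.span_add)
  next
    fix f c assume "f \<in> qpoly.span {bm G |G. gdeg G = D}"
    then show "\<exists>h. h \<in> qpoly.span {bm G |G. gdeg G = D} \<and>
        subst (merge i j) h = scale c (subst (merge i j) f)"
      by (intro exI[of _ "scale c f"]) (simp add: qpoly.span_scale)
  qed
next
  case (step x)
  then obtain G' where G': "x = bm G'" "gdeg G' = D(i := D i + D j, j := 0)" by auto
  obtain G where G: "gdeg G = (gdeg G')(i := gdeg G' i - D j, j := D j)" "subst (merge i j) (bm G) = bm G'"
    using lift_bm[OF assms(1), of G' "D j"] assms(1) by (auto simp: G')
  moreover have "(gdeg G')(i := gdeg G' i - D j, j := D j) = D"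
    using assms(1) by (auto simp: G' fun_eq_iff)
  ultimately show ?case
    using G'(1) by (intro exI[of _ "bm G"]) (auto intro!: qpoly.span_base)
qed

lemma merge_mhom:
  assumes "i \<noteq> j" "f \<in> mhom D"
  shows "subst (merge i j) f \<in> mhom (D(i := D i + D j, j := 0))"
  unfolding mhom_def
proof (safe)
  fix k
  define \<mu> where "\<mu> u = (if u = XX j then XX i else if u = YY j then YY i else u)" for u
  have \<mu>: "merge i j u \<in> whomog (pw k) (pw k (\<mu> u))" for u
    using whomog_Var[of "\<mu> u" "pw k"] by (auto simp: merge_def \<mu>_def)
  consider "k = j" | "k = i" | "k \<noteq> i" "k \<noteq> j" by blast
  then show "subst (merge i j) f \<in> whomog (pw k) ((D(i := D i + D j, j := 0)) k)"
  proof cases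
    case 1
    have "pw k (\<mu> u) = 0" for u
      using assms(1) 1 by (auto simp: pw_def \<mu>_def)
    then have "subst (merge i j) f \<in> whomog (pw k) 0"
      using \<mu> by (intro whomog_subst[where w = "\<lambda>_. 0"] whomog_zero_weight) metis
    then show ?thesis using 1 by simp
  next
    case 2
    have "pw k (\<mu> u) = pw i u + pw j u" for u
      using assms(1) 2 by (auto simp: pw_def \<mu>_def)
    moreover have "f \<in> whomog (\<lambda>u. pw i u + pw j u) (D i + D j)"
      using assms(2) by (intro whomog_add_weights) (auto simp: mhom_def)
    ultimately have "subst (merge i j) f \<in> whomog (pw k) (D i + D j)"
      using \<mu> by (intro whomog_subst[where w = "\<lambda>u. pw i u + pw j u"]) metis
    then show ?thesis using 2 assms(1) by simp
  next
    case 3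
    have "pw k (\<mu> u) = pw k u" for u
      using 3 by (auto simp: pw_def \<mu>_def)
    then have "subst (merge i j) f \<in> whomog (pw k) (D k)"
      using \<mu> assms(2) by (intro whomog_subst[where w = "pw k"]) (auto simp: mhom_def)
    then show ?thesis using 3 by simp
  qed
qed

lemma merge_invar:
  assumes "invar f"
  shows "invar (subst (merge i j) f)"
  unfolding invar_def
proof (intro allI impI)
  fix a b c d :: rat
  assume "a * d - b * c = 1"
  then have f: "subst (mat_act a b c d) f = f"
    using assms by (simp add: invar_def)
  have "subst (mat_act a b c d) (merge i j u) = subst (merge i j) (mat_act a b c d u)" for u
    by (cases u) (auto simp: merge_def mat_act_def)
  then have "subst (mat_act a b c d) (subst (merge i j) f) = subst (merge i j) (subst (mat_act a b c d) f)"
    by (simp add: subst_subst)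
  then show "subst (mat_act a b c d) (subst (merge i j) f) = subst (merge i j) f"
    by (simp add: f)
qed

lemma invar_divisor:
  assumes "i \<noteq> j" "invar (br i j * g)"
  shows "invar g"
  unfolding invar_def
proof (intro allI impI)
  fix a b c d :: rat
  assume det: "a * d - b * c = 1"
  have "invar (br i j)"
    by (intro invar_if_SL2_invariant SL2_invariant_br)
  then have "br i j * subst (mat_act a b c d) g = br i j * g"
    using assms(2) det unfolding invar_def by (metis subst_mult)
  then show "subst (mat_act a b c d) g = g"
    using br_nonzero[OF assms(1)] by simp
qed

text \<open>Base case. With a single point (x, y) the diagonal matrices leave only a power of x y,
  and a shear excludes positive powers, so the invariant is constant.\<close>

lemma invar_one_point:
  assumes "invar f" "f \<in> mhom D" "\<And>k. k \<noteq> i \<Longrightarrow> D k = 0"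
  shows "f \<in> bspan D"
proof -
  define x where "x = Var (XX i)"
  define y where "y = Var (YY i)"
  define M where "M a b = Poly_Mapping.single (XX i) a + Poly_Mapping.single (YY i) b" for a b :: nat
  have mon_M: "mon (M a b) = x ^ a * y ^ b" for a b
    by (simp add: M_def mon_conv_msubst msubst_add x_def y_def)
  have M: "m = M (Poly_Mapping.lookup m (XX i)) (Poly_Mapping.lookup m (YY i))"
    "Poly_Mapping.lookup m (XX i) + Poly_Mapping.lookup m (YY i) = D i"
    if "m \<in> Poly_Mapping.keys f" for m
  proof -
    have wt: "wt (pw k) m = D k" for k
      using assms(2) that by (auto simp: mhom_def whomog_def)
    from wt[of i] show "Poly_Mapping.lookup m (XX i) + Poly_Mapping.lookup m (YY i) = D i"
      by (simp add: wt_pw)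
    have 0: "Poly_Mapping.lookup m (XX k) = 0 \<and> Poly_Mapping.lookup m (YY k) = 0" if "k \<noteq> i" for k
      using wt[of k] assms(3)[OF that] by (simp add: wt_pw)
    show "m = M (Poly_Mapping.lookup m (XX i)) (Poly_Mapping.lookup m (YY i))"
    proof (rule poly_mapping_eqI)
      fix u
      show "Poly_Mapping.lookup m u =
          Poly_Mapping.lookup (M (Poly_Mapping.lookup m (XX i)) (Poly_Mapping.lookup m (YY i))) u"
        by (cases u) (use 0 in \<open>force simp: M_def lookup_add lookup_single when_def\<close>)+
    qed
  qed
  \<comment> \<open>The diagonal matrix with entries 2 and 1/2 multiplies x^a y^b by 2^(a-b), so
    invariance forces a = b in every monomial of \<open>f\<close>.\<close>
  define \<gamma> :: "coord monom \<Rightarrow> rat"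
    where "\<gamma> m = 2 ^ Poly_Mapping.lookup m (XX i) * (1/2) ^ Poly_Mapping.lookup m (YY i)" for m
  have "f = subst (mat_act 2 0 0 (1/2)) f"
    using assms(1) by (simp add: invar_def)
  also have "\<dots> = (\<Sum>m\<in>Poly_Mapping.keys f. Const (Poly_Mapping.lookup f m * \<gamma> m) * mon m)"
    unfolding subst_msubst
  proof (intro sum.cong refl)
    fix m assume m: "m \<in> Poly_Mapping.keys f"
    have "msubst (mat_act 2 0 0 (1/2)) (M a b) = (Const 2 * x) ^ a * (Const (1/2) * y) ^ b" for a b
      by (simp add: M_def msubst_add mat_act_def x_def y_def)
    then have "msubst (mat_act 2 0 0 (1/2)) (M a b) = Const (2 ^ a * (1/2) ^ b) * mon (M a b)" for a b
      by (simp only: mon_M power_mult_distrib Const_mult Const_power mult_ac)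
    then have "msubst (mat_act 2 0 0 (1/2)) m = Const (\<gamma> m) * mon m"
      using M(1)[OF m] unfolding \<gamma>_def by metis
    then show "Const (Poly_Mapping.lookup f m) * msubst (mat_act 2 0 0 (1/2)) m =
        Const (Poly_Mapping.lookup f m * \<gamma> m) * mon m"
      by (simp add: Const_mult mult_ac)
  qed
  finally have f: "f = (\<Sum>m\<in>Poly_Mapping.keys f. Const (Poly_Mapping.lookup f m * \<gamma> m) * mon m)" .
  have eq: "Poly_Mapping.lookup m (XX i) = Poly_Mapping.lookup m (YY i)" if m: "m \<in> Poly_Mapping.keys f" for m
  proof -
    have "Poly_Mapping.lookup f m =
        Poly_Mapping.lookup (\<Sum>m\<in>Poly_Mapping.keys f. Const (Poly_Mapping.lookup f m * \<gamma> m) * mon m) m"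
      using f by simp
    also have "\<dots> = Poly_Mapping.lookup f m * \<gamma> m"
      using m by (simp add: lookup_sum lookup_Const_mult lookup_mon if_distrib sum.delta cong: if_cong)
    finally have "\<gamma> m = 1" using m by (simp add: in_keys_iff)
    then have "(2::rat) ^ Poly_Mapping.lookup m (XX i) = 2 ^ Poly_Mapping.lookup m (YY i)"
      by (simp add: \<gamma>_def field_simps power_divide)
    then show ?thesis by simp
  qed
  define a where "a = D i div 2"
  have sub: "Poly_Mapping.keys f \<subseteq> {M a a}"
  proof
    fix m assume m: "m \<in> Poly_Mapping.keys f"
    have "Poly_Mapping.lookup m (YY i) = a"
      using M(2)[OF m] eq[OF m] by (simp add: a_def)
    then show "m \<in> {M a a}" using M(1)[OF m] eq[OF m] by simp
  qed
  define c where "c = Poly_Mapping.lookup f (M a a)"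
  have fc: "f = Const c * (x ^ a * y ^ a)"
    using subst_superset[OF _ sub, of Var] by (simp add: c_def mon_conv_msubst[symmetric] mon_M)
  show ?thesis
  proof (cases "f = 0 \<or> a = 0")
    case True
    then consider "f = 0" | "f \<noteq> 0" "a = 0" by blast
    then show ?thesis
    proof cases
      case 1
      then show ?thesis by (simp add: bspan_def qpoly.span_zero)
    next
      case 2
      then obtain m where m: "m \<in> Poly_Mapping.keys f" by fastforce
      have "D i = 0" using M(2)[OF m] eq[OF m] 2(2) unfolding a_def by presburger
      then have "gdeg {#} = D" using assms(3) by (metis ext gdeg_empty)
      then have "bm {#} \<in> bspan D" unfolding bspan_def by (blast intro: qpoly.span_base)
      moreover have "f = scale c (bm {#})" using fc 2 by (simp add: scale_def)
      ultimately show ?thesis by (simp add: bspan_def qpoly.span_scale)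
    qed
  next
    case False
    \<comment> \<open>Invariance under the shear x -> x + y. Evaluated at x = 0, y = 1 the left side
      is 0 because a > 0, while the right side is c.\<close>
    have "Const c * (x ^ a * y ^ a) = Const c * ((x + y) ^ a * y ^ a)"
    proof -
      have "f = subst (mat_act 1 1 0 1) f"
        using assms(1) by (simp add: invar_def)
      then show ?thesis
        unfolding fc by (simp add: x_def y_def mat_act_def)
    qed
    then have "subst h (Const c * (x ^ a * y ^ a)) = subst h (Const c * ((x + y) ^ a * y ^ a))"
      for h :: "coord \<Rightarrow> coord qpoly"
      by (rule arg_cong)
    from this[of "\<lambda>u. if u = XX i then 0 else 1"] have "c = 0"
      using False by (auto simp: x_def y_def power_0_left)
    then show ?thesis using False fc by simp
  qed
qed

text \<open>Merge two points \<open>i\<close>, \<open>j\<close> that both occur: the result is an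
  invariant of fewer points, hence a bracket polynomial, and lifts to a bracket polynomial
  \<open>f'\<close> of the original multidegree. The difference \<open>f - f'\<close> vanishes when
  the points coincide, so it is \<open>br i j\<close> times an invariant of smaller degree. In the
  induction measure the total degree is weighted by 9, more than the number of labels, so the drop
  in degree outweighs any change in the number of points that occur.\<close>

theorem first_fundamental_theorem:
  assumes "invar f" "f \<in> mhom D"
  shows "f \<in> bspan D"
  using assms
proof (induction "(\<Sum>i\<in>UNIV. D i) * 9 + card {i. D i > 0}" arbitrary: f D rule: less_induct)
  case less
  have card8: "card {i :: 8. Q i} \<le> 8" for Q
    using card_mono[of "UNIV :: 8 set" "{i. Q i}"] by simp
  show ?case
  proof (cases "\<exists>i j. i \<noteq> j \<and> D i > 0 \<and> D j > 0")
    case False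
    have "\<exists>i. \<forall>k. k \<noteq> i \<longrightarrow> D k = 0"
      using False by (cases "\<exists>i. D i > 0") (metis not_gr_zero)+
    then obtain i where "\<And>k. k \<noteq> i \<Longrightarrow> D k = 0" by blast
    then show ?thesis using invar_one_point[OF less.prems] by blast
  next
    case True
    then obtain i j where ij: "i \<noteq> j" "D i > 0" "D j > 0" by blast
    define D' where "D' = D(i := D i + D j, j := 0)"
    have "(\<Sum>k\<in>UNIV. D' k) = (\<Sum>k\<in>UNIV. D k)"
      using ij(1) by (simp add: D'_def sum.remove[of UNIV i] sum.remove[of "UNIV - {i}" j])
    moreover have "{k. D' k > 0} \<subset> {k. D k > 0}"
      using ij by (auto simp: D'_def)
    then have "card {k. D' k > 0} < card {k. D k > 0}"
      by (intro psubset_card_mono) auto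
    ultimately have "subst (merge i j) f \<in> bspan D'"
      using merge_mhom[OF ij(1) less.prems(2)] merge_invar[OF less.prems(1)]
      by (intro less.hyps) (simp_all add: D'_def)
    then obtain f' where f': "f' \<in> bspan D" "subst (merge i j) f' = subst (merge i j) f"
      using lift_bspan[OF ij(1)] unfolding D'_def by blast
    have k: "f - f' \<in> mhom D" "invar (f - f')"
      using bspan_mhom_invar[OF f'(1)] less.prems by (simp_all add: mhom_diff invar_diff)
    then have "br i j dvd f - f'"
      using ij(1) f'(2) by (intro br_dvd_if_merge_vanish[of i j _ "D j"]) (auto simp: mhom_def)
    then obtain g where g: "f - f' = br i j * g" by (auto simp: dvd_def)
    define E where "E k = D k - ((if k = i then 1 else 0) + (if k = j then 1 else 0))" for k
    have DE: "D k = (if k = i then 1 else 0) + (if k = j then 1 else 0) + E k" for k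
      using ij by (auto simp: E_def)
    have "g \<in> mhom E"
      unfolding mhom_def
    proof safe
      fix l
      show "g \<in> whomog (pw l) (E l)"
        unfolding E_def
      proof (rule whomog_divisor[OF br_nonzero[OF ij(1)]])
        show "br i j \<in> whomog (pw l) ((if l = i then 1 else 0) + (if l = j then 1 else 0))"
          using br_mhom by (simp add: mhom_def)
        show "br i j * g \<in> whomog (pw l) (D l)"
          using k(1) by (simp add: g mhom_def)
      qed
    qed
    moreover have "invar g"
      using invar_divisor[OF ij(1)] k(2) by (simp add: g)
    moreover have "(\<Sum>k\<in>UNIV. D k) = 2 + (\<Sum>k\<in>UNIV. E k)"
      by (simp add: DE sum.distrib)
    ultimately have "g \<in> bspan E"
      using card8[of "\<lambda>k. E k > 0"] by (intro less.hyps) simp_all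
    then have "br i j * g \<in> bspan D"
      using DE by (rule br_mult_bspan)
    then have "f' + br i j * g \<in> bspan D"
      using f'(1) by (simp add: bspan_def qpoly.span_add)
    then show ?thesis by (simp flip: g)
  qed
qed

section \<open>Fourteen invariants\<close>

datatype vi = P0 | P12 | P13 | P14 | P23 | P24 | P34 | Q1 | Q2 | Q3 | Q4 | R1 | R2 | TT

lemma UNIV_vi: "UNIV = {P0, P12, P13, P14, P23, P24, P34, Q1, Q2, Q3, Q4, R1, R2, TT}"
  using vi.exhaust by auto

instance vi :: finite
  by standard (simp add: UNIV_vi)

text \<open>A pair of points is a binary quadratic form, that is, a vector of the three-dimensional
  quadratic space of such forms. \<open>dot\<close> and \<open>vol\<close> are the scalar product and the volume form of
  that space.\<close>

definition dot :: "8 \<Rightarrow> 8 \<Rightarrow> 8 \<Rightarrow> 8 \<Rightarrow> coord qpoly"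
  where "dot a b c d = - (br a c * br b d + br a d * br b c)"

definition vol :: "8 \<Rightarrow> 8 \<Rightarrow> 8 \<Rightarrow> 8 \<Rightarrow> 8 \<Rightarrow> 8 \<Rightarrow> coord qpoly"
  where "vol a b c d e f = 2 * (br a d * br c f * br e b + br b c * br d e * br f a)"

text \<open>Let v_1, ..., v_4 be the vectors of the pairs 01, 23, 45, 67 and n_i the bracket of pair
  i, so that n_i^2 is the norm of v_i. Indices of the names refer to these vectors. The signs of
  \<open>Q2\<close> and \<open>Q4\<close> make Cramer's rule free of signs. \<open>TT\<close> is a
  difference because the two products v_1.v_3 v_2.v_4 and v_1.v_4 v_2.v_3 have the same leading
  monomial in the degeneration used later.\<close>

fun sb :: "vi \<Rightarrow> coord qpoly" where
  "sb P0 = br 0 1 * br 2 3 * br 4 5 * br 6 7"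
| "sb P12 = dot 0 1 2 3 * br 4 5 * br 6 7"
| "sb P13 = dot 0 1 4 5 * br 2 3 * br 6 7"
| "sb P14 = dot 0 1 6 7 * br 2 3 * br 4 5"
| "sb P23 = dot 2 3 4 5 * br 0 1 * br 6 7"
| "sb P24 = dot 2 3 6 7 * br 0 1 * br 4 5"
| "sb P34 = dot 4 5 6 7 * br 0 1 * br 2 3"
| "sb Q1 = vol 2 3 4 5 6 7 * br 0 1"
| "sb Q2 = - (vol 0 1 4 5 6 7 * br 2 3)"
| "sb Q3 = vol 0 1 2 3 6 7 * br 4 5"
| "sb Q4 = - (vol 0 1 2 3 4 5 * br 6 7)"
| "sb R1 = dot 0 1 2 3 * dot 4 5 6 7"
| "sb R2 = dot 0 1 4 5 * dot 2 3 6 7"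
| "sb TT = dot 0 1 4 5 * dot 2 3 6 7 - dot 0 1 6 7 * dot 2 3 4 5"

definition rp :: "(8 \<Rightarrow> nat) \<Rightarrow> coord qpoly set"
  where "rp D = {f. SL2_invariant f \<and> f \<in> mhom D}"

lemma Rpiece_rp: "Rpiece d = rp (\<lambda>_. d)"
  by (simp add: Rpiece_mhom rp_def)

lemma SL2_invariant_uminus: "SL2_invariant f \<Longrightarrow> SL2_invariant (- f)"
  using SL2_invariant_mult[OF SL2_invariant_Const[of "-1"], of f] by simp

lemma rp_add: "f \<in> rp D \<Longrightarrow> g \<in> rp D \<Longrightarrow> f + g \<in> rp D"
  and rp_uminus: "f \<in> rp D \<Longrightarrow> - f \<in> rp D"
  and rp_mult: "f \<in> rp D \<Longrightarrow> g \<in> rp D' \<Longrightarrow> f * g \<in> rp (\<lambda>i. D i + D' i)"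
  and rp_scale: "f \<in> rp D \<Longrightarrow> scale c f \<in> rp D"
  and rp_0: "0 \<in> rp D"
  and rp_1: "1 \<in> rp (\<lambda>_. 0)"
proof -
  assume f: "f \<in> rp D"
  show "g \<in> rp D \<Longrightarrow> f + g \<in> rp D" "g \<in> rp D' \<Longrightarrow> f * g \<in> rp (\<lambda>i. D i + D' i)"
    using f by (simp_all add: rp_def SL2_invariant_add SL2_invariant_mult mhom_add mhom_mult)
  show "- f \<in> rp D"
    using f mhom_scale[of f D "-1"] by (simp add: rp_def SL2_invariant_uminus scale_def)
  show "scale c f \<in> rp D"
    using f mhom_scale[of f D c] by (simp add: rp_def SL2_invariant_mult scale_def)
next
  show "0 \<in> rp D" "1 \<in> rp (\<lambda>_. 0)"
    using SL2_invariant_Const[of 0] SL2_invariant_Const[of 1] by (simp_all add: rp_def mhom_def)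
qed

lemma rp_diff: "f \<in> rp D \<Longrightarrow> g \<in> rp D \<Longrightarrow> f - g \<in> rp D"
  using rp_add[of f D "- g"] rp_uminus[of g D] by simp

lemma rp_br: "br i j \<in> rp (\<lambda>k. (if k = i then 1 else 0) + (if k = j then 1 else 0))"
  by (simp add: rp_def br_mhom SL2_invariant_br)

lemma rp_cong: "f \<in> rp D \<Longrightarrow> (\<And>k. D k = D' k) \<Longrightarrow> f \<in> rp D'"
  by (metis ext)

definition dl :: "8 \<Rightarrow> 8 \<Rightarrow> nat"
  where "dl i k = (if k = i then 1 else 0)"

lemma rp_dot: "dot a b c d \<in> rp (\<lambda>k. dl a k + dl b k + dl c k + dl d k)"
  unfolding dot_def
  by (intro rp_uminus rp_add; rule rp_cong[OF rp_mult[OF rp_br rp_br]]; simp add: dl_def)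

lemma rp_vol: "vol a b c d e f \<in> rp (\<lambda>k. dl a k + dl b k + dl c k + dl d k + dl e k + dl f k)"
proof -
  have "br a d * br c f * br e b + br b c * br d e * br f a
      \<in> rp (\<lambda>k. dl a k + dl b k + dl c k + dl d k + dl e k + dl f k)"
    by (intro rp_add; rule rp_cong[OF rp_mult[OF rp_mult[OF rp_br rp_br] rp_br]]; simp add: dl_def)
  from rp_scale[OF this, of 2] show ?thesis
    by (simp add: vol_def scale_def)
qed

lemma rp_br': "br i j \<in> rp (\<lambda>k. dl i k + dl j k)"
  using rp_br by (simp add: dl_def)

lemma dl_total: "dl 0 k + dl 1 k + dl 2 k + dl 3 k + dl 4 k + dl 5 k + dl 6 k + dl 7 k = 1"
proof -
  have "\<forall>k. dl 0 k + dl 1 k + dl 2 k + dl 3 k + dl 4 k + dl 5 k + dl 6 k + dl 7 k = 1"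
    unfolding forall_8 by (simp add: dl_def)
  then show ?thesis by blast
qed

lemma sb_Rpiece: "sb v \<in> V"
proof -
  have *: "f \<in> V" if "f \<in> rp D" "\<And>k. D k = dl 0 k + dl 1 k + dl 2 k + dl 3 k + dl 4 k + dl 5 k + dl 6 k + dl 7 k" for f D
    using rp_cong[OF that(1), of "\<lambda>_. 1"] that(2) dl_total by (simp add: Rpiece_rp)
  have O: "sb P0 \<in> V"
    unfolding sb.simps by (rule *[OF rp_mult[OF rp_mult[OF rp_mult[OF rp_br' rp_br'] rp_br'] rp_br']]) simp
  have P: "sb P12 \<in> V" "sb P13 \<in> V" "sb P14 \<in> V" "sb P23 \<in> V" "sb P24 \<in> V" "sb P34 \<in> V"
    unfolding sb.simps by (rule *[OF rp_mult[OF rp_mult[OF rp_dot rp_br'] rp_br']], simp)+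
  have Q: "sb Q1 \<in> V" "sb Q3 \<in> V" "sb Q2 \<in> V" "sb Q4 \<in> V"
    unfolding sb.simps
    by ((rule *[OF rp_mult[OF rp_vol rp_br']] *[OF rp_uminus[OF rp_mult[OF rp_vol rp_br']]]), simp)+
  have D: "dot a b c d * dot e f g h \<in> rp (\<lambda>k. dl a k + dl b k + dl c k + dl d k + (dl e k + dl f k + dl g k + dl h k))"
    for a b c d e f g h
    by (rule rp_mult[OF rp_dot rp_dot])
  have R: "sb R1 \<in> V" "sb R2 \<in> V"
    unfolding sb.simps by (rule *[OF D], simp)+
  have T': "dot 0 1 6 7 * dot 2 3 4 5 \<in> V"
    by (rule *[OF D]) simp
  have T: "sb TT \<in> V"
    using rp_diff R(2) T' by (simp add: Rpiece_rp)
  show ?thesis by (cases v) (use O P Q R T in auto)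
qed

lemma dot_sym: "dot c d a b = dot a b c d"
  unfolding dot_def by (simp add: br_swap[of c] br_swap[of d] algebra_simps)

lemma vol_perm:
  "vol a b e f c d = - vol a b c d e f"
  "vol c d a b e f = - vol a b c d e f"
  "vol c d e f a b = vol a b c d e f"
  "vol e f a b c d = vol a b c d e f"
  "vol e f c d a b = - vol a b c d e f"
  unfolding vol_def br_def by (simp_all add: algebra_simps)

text \<open>This and the next two identities expand the trace of a product of k matrices of size 2
  by 2, one per pair. Each matrix is half the sum of a scalar part, the bracket of its pair, and a
  traceless part, its vector; traces of products of traceless parts are scalar products, volumes,
  and for k = 4 an alternating sum of products of scalar products. The denominator is
  2^(k-1).\<close>

lemma two_cycle: "2 * (br a d * br c b) = br a b * br c d + dot a b c d"
  unfolding dot_def br_def by (simp add: algebra_simps)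

lemma three_cycle: "4 * (br c f * (br e h * br g d)) = br c d * br e f * br g h
   + dot c d e f * br g h + dot c d g h * br e f + dot e f g h * br c d + vol c d e f g h"
  unfolding dot_def vol_def br_def by (simp add: algebra_simps)

lemma four_cycle: "8 * (br a d * (br c f * (br e h * br g b))) =
   br a b * br c d * br e f * br g h + dot a b c d * br e f * br g h + dot a b e f * br c d * br g h
   + dot a b g h * br c d * br e f + dot c d e f * br a b * br g h + dot c d g h * br a b * br e f
   + dot e f g h * br a b * br c d + vol c d e f g h * br a b + vol a b e f g h * br c d
   + vol a b c d g h * br e f + vol a b c d e f * br g h
   + dot a b c d * dot e f g h - dot a b e f * dot c d g h + dot a b g h * dot c d e f"
  unfolding dot_def vol_def br_def by (simp add: algebra_simps)

lemmas cherry_swaps =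
  dot_sym[where c = 2 and d = 3 and a = 0 and b = 1]
  dot_sym[where c = 4 and d = 5 and a = 0 and b = 1]
  dot_sym[where c = 4 and d = 5 and a = 2 and b = 3]
  dot_sym[where c = 6 and d = 7 and a = 0 and b = 1]
  dot_sym[where c = 6 and d = 7 and a = 2 and b = 3]
  dot_sym[where c = 6 and d = 7 and a = 4 and b = 5]
  vol_perm[where a = 0 and b = 1 and c = 2 and d = 3 and e = 4 and f = 5]
  vol_perm[where a = 0 and b = 1 and c = 2 and d = 3 and e = 6 and f = 7]
  vol_perm[where a = 0 and b = 1 and c = 4 and d = 5 and e = 6 and f = 7]
  vol_perm[where a = 2 and b = 3 and c = 4 and d = 5 and e = 6 and f = 7]

lemma span_sb_divide:
  fixes x :: "coord qpoly"
  assumes "numeral n * x \<in> qpoly.span A"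
  shows "x \<in> qpoly.span A"
proof -
  have "Const (1 / numeral n) * numeral n = (1 :: coord qpoly)"
    using Const_mult[of "1 / numeral n" "numeral n"] by simp
  then have "x = scale (1 / numeral n) (numeral n * x)"
    by (simp add: scale_def flip: mult.assoc)
  then show ?thesis using assms qpoly.span_scale by metis
qed

lemma span_sb_intros:
  "sb v \<in> qpoly.span (range sb)"
  "x \<in> qpoly.span (range sb) \<Longrightarrow> x + sb v \<in> qpoly.span (range sb)"
  "x \<in> qpoly.span (range sb) \<Longrightarrow> x - sb v \<in> qpoly.span (range sb)"
  by (simp_all add: qpoly.span_add qpoly.span_diff qpoly.span_base)

text \<open>A matching of even with odd labels is a permutation of the four pairs. Each of its
  cycles is a trace, expanded by the identity for its length, and a fixed pair contributes its
  bracket; this settles all 24 permutations.\<close>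

lemma bipartite_matching_in_span:
  assumes "distinct [a, b, c, d]" "set [a, b, c, d] \<subseteq> {1, 3, 5, 7}"
  shows "br 0 a * (br 2 b * (br 4 c * br 6 d)) \<in> qpoly.span (range sb)"
proof -
  have 0: "br 0 1 * (br 2 3 * (br 4 5 * br 6 7)) = sb P0"
    by simp
  have 1: "2 * (br 0 1 * (br 2 3 * (br 4 7 * br 6 5))) = sb P0 + sb P34"
    using arg_cong[OF two_cycle[of 4 7 6 5], of "(*) (br 0 1 * br 2 3)"] by (simp add: cherry_swaps algebra_simps)
  have 2: "2 * (br 0 1 * (br 2 5 * (br 4 3 * br 6 7))) = sb P0 + sb P23"
    using arg_cong[OF two_cycle[of 2 5 4 3], of "(*) (br 0 1 * br 6 7)"] by (simp add: cherry_swaps algebra_simps)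
  have 3: "4 * (br 0 1 * (br 2 5 * (br 4 7 * br 6 3))) = sb P0 + sb P23 + sb P24 + sb P34 + sb Q1"
    using arg_cong[OF three_cycle[of 2 5 4 7 6 3], of "(*) (br 0 1)"] by (simp add: cherry_swaps algebra_simps)
  have 4: "4 * (br 0 1 * (br 2 7 * (br 4 3 * br 6 5))) = sb P0 + sb P23 + sb P24 + sb P34 - sb Q1"
    using arg_cong[OF three_cycle[of 2 7 6 5 4 3], of "(*) (br 0 1)"] by (simp add: cherry_swaps algebra_simps)
  have 5: "2 * (br 0 1 * (br 2 7 * (br 4 5 * br 6 3))) = sb P0 + sb P24"
    using arg_cong[OF two_cycle[of 2 7 6 3], of "(*) (br 0 1 * br 4 5)"] by (simp add: cherry_swaps algebra_simps)
  have 6: "2 * (br 0 3 * (br 2 1 * (br 4 5 * br 6 7))) = sb P0 + sb P12"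
    using arg_cong[OF two_cycle[of 0 3 2 1], of "(*) (br 4 5 * br 6 7)"] by (simp add: cherry_swaps algebra_simps)
  have 7: "4 * (br 0 3 * (br 2 1 * (br 4 7 * br 6 5))) = sb P0 + sb P12 + sb P34 + sb R1"
    using arg_cong2[OF two_cycle[of 0 3 2 1] two_cycle[of 4 7 6 5], of "(*)"] by (simp add: algebra_simps)
  have 8: "4 * (br 0 3 * (br 2 5 * (br 4 1 * br 6 7))) = sb P0 + sb P12 + sb P13 + sb P23 - sb Q4"
    using arg_cong[OF three_cycle[of 0 3 2 5 4 1], of "(*) (br 6 7)"] by (simp add: cherry_swaps algebra_simps)
  have 9: "8 * (br 0 3 * (br 2 5 * (br 4 7 * br 6 1))) = sb P0 + sb P12 + sb P13 + sb P14 + sb P23 + sb P24 + sb P34 + sb Q1 - sb Q2 + sb Q3 - sb Q4 + sb R1 - sb TT"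
    using four_cycle[of 0 3 2 5 4 7 6 1] by (simp add: cherry_swaps algebra_simps)
  have 10: "8 * (br 0 3 * (br 2 7 * (br 4 1 * br 6 5))) = sb P0 + sb P12 + sb P13 + sb P14 + sb P23 + sb P24 + sb P34 - sb Q1 + sb Q2 + sb Q3 - sb Q4 + sb R1 + sb TT"
    using four_cycle[of 0 3 2 7 6 5 4 1] by (simp add: cherry_swaps algebra_simps)
  have 11: "4 * (br 0 3 * (br 2 7 * (br 4 5 * br 6 1))) = sb P0 + sb P12 + sb P14 + sb P24 + sb Q3"
    using arg_cong[OF three_cycle[of 0 3 2 7 6 1], of "(*) (br 4 5)"] by (simp add: cherry_swaps algebra_simps)
  have 12: "4 * (br 0 5 * (br 2 1 * (br 4 3 * br 6 7))) = sb P0 + sb P12 + sb P13 + sb P23 + sb Q4"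
    using arg_cong[OF three_cycle[of 0 5 4 3 2 1], of "(*) (br 6 7)"] by (simp add: cherry_swaps algebra_simps)
  have 13: "8 * (br 0 5 * (br 2 1 * (br 4 7 * br 6 3))) = sb P0 + sb P12 + sb P13 + sb P14 + sb P23 + sb P24 + sb P34 + sb Q1 - sb Q2 - sb Q3 + sb Q4 + sb R1 + sb TT"
    using four_cycle[of 0 5 4 7 6 3 2 1] by (simp add: cherry_swaps algebra_simps)
  have 14: "2 * (br 0 5 * (br 2 3 * (br 4 1 * br 6 7))) = sb P0 + sb P13"
    using arg_cong[OF two_cycle[of 0 5 4 1], of "(*) (br 2 3 * br 6 7)"] by (simp add: cherry_swaps algebra_simps)
  have 15: "4 * (br 0 5 * (br 2 3 * (br 4 7 * br 6 1))) = sb P0 + sb P13 + sb P14 + sb P34 - sb Q2"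
    using arg_cong[OF three_cycle[of 0 5 4 7 6 1], of "(*) (br 2 3)"] by (simp add: cherry_swaps algebra_simps)
  have 16: "4 * (br 0 5 * (br 2 7 * (br 4 1 * br 6 3))) = sb P0 + sb P13 + sb P24 + sb R2"
    using arg_cong2[OF two_cycle[of 0 5 4 1] two_cycle[of 2 7 6 3], of "(*)"] by (simp add: algebra_simps)
  have 17: "8 * (br 0 5 * (br 2 7 * (br 4 3 * br 6 1))) = sb P0 + sb P12 + sb P13 + sb P14 + sb P23 + sb P24 + sb P34 - sb Q1 - sb Q2 + sb Q3 + sb Q4 - sb R1 + sb R2 + sb R2 - sb TT"
    using four_cycle[of 0 5 4 3 2 7 6 1] by (simp add: cherry_swaps algebra_simps)
  have 18: "8 * (br 0 7 * (br 2 1 * (br 4 3 * br 6 5))) = sb P0 + sb P12 + sb P13 + sb P14 + sb P23 + sb P24 + sb P34 - sb Q1 + sb Q2 - sb Q3 + sb Q4 + sb R1 - sb TT"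
    using four_cycle[of 0 7 6 5 4 3 2 1] by (simp add: cherry_swaps algebra_simps)
  have 19: "4 * (br 0 7 * (br 2 1 * (br 4 5 * br 6 3))) = sb P0 + sb P12 + sb P14 + sb P24 - sb Q3"
    using arg_cong[OF three_cycle[of 0 7 6 3 2 1], of "(*) (br 4 5)"] by (simp add: cherry_swaps algebra_simps)
  have 20: "4 * (br 0 7 * (br 2 3 * (br 4 1 * br 6 5))) = sb P0 + sb P13 + sb P14 + sb P34 + sb Q2"
    using arg_cong[OF three_cycle[of 0 7 6 5 4 1], of "(*) (br 2 3)"] by (simp add: cherry_swaps algebra_simps)
  have 21: "2 * (br 0 7 * (br 2 3 * (br 4 5 * br 6 1))) = sb P0 + sb P14"
    using arg_cong[OF two_cycle[of 0 7 6 1], of "(*) (br 2 3 * br 4 5)"] by (simp add: cherry_swaps algebra_simps)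
  have 22: "8 * (br 0 7 * (br 2 5 * (br 4 1 * br 6 3))) = sb P0 + sb P12 + sb P13 + sb P14 + sb P23 + sb P24 + sb P34 + sb Q1 + sb Q2 - sb Q3 - sb Q4 - sb R1 + sb R2 + sb R2 - sb TT"
    using four_cycle[of 0 7 6 3 2 5 4 1] by (simp add: cherry_swaps algebra_simps)
  have 23: "4 * (br 0 7 * (br 2 5 * (br 4 3 * br 6 1))) = sb P0 + sb P14 + sb P23 + sb R2 - sb TT"
    using arg_cong2[OF two_cycle[of 0 7 6 1] two_cycle[of 2 5 4 3], of "(*)"] by (simp add: algebra_simps)
  note span = span_sb_intros
  have span: "br 0 1 * (br 2 3 * (br 4 5 * br 6 7)) \<in> qpoly.span (range sb)"
    "br 0 1 * (br 2 3 * (br 4 7 * br 6 5)) \<in> qpoly.span (range sb)"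
    "br 0 1 * (br 2 5 * (br 4 3 * br 6 7)) \<in> qpoly.span (range sb)"
    "br 0 1 * (br 2 5 * (br 4 7 * br 6 3)) \<in> qpoly.span (range sb)"
    "br 0 1 * (br 2 7 * (br 4 3 * br 6 5)) \<in> qpoly.span (range sb)"
    "br 0 1 * (br 2 7 * (br 4 5 * br 6 3)) \<in> qpoly.span (range sb)"
    "br 0 3 * (br 2 1 * (br 4 5 * br 6 7)) \<in> qpoly.span (range sb)"
    "br 0 3 * (br 2 1 * (br 4 7 * br 6 5)) \<in> qpoly.span (range sb)"
    "br 0 3 * (br 2 5 * (br 4 1 * br 6 7)) \<in> qpoly.span (range sb)"
    "br 0 3 * (br 2 5 * (br 4 7 * br 6 1)) \<in> qpoly.span (range sb)"
    "br 0 3 * (br 2 7 * (br 4 1 * br 6 5)) \<in> qpoly.span (range sb)"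
    "br 0 3 * (br 2 7 * (br 4 5 * br 6 1)) \<in> qpoly.span (range sb)"
    "br 0 5 * (br 2 1 * (br 4 3 * br 6 7)) \<in> qpoly.span (range sb)"
    "br 0 5 * (br 2 1 * (br 4 7 * br 6 3)) \<in> qpoly.span (range sb)"
    "br 0 5 * (br 2 3 * (br 4 1 * br 6 7)) \<in> qpoly.span (range sb)"
    "br 0 5 * (br 2 3 * (br 4 7 * br 6 1)) \<in> qpoly.span (range sb)"
    "br 0 5 * (br 2 7 * (br 4 1 * br 6 3)) \<in> qpoly.span (range sb)"
    "br 0 5 * (br 2 7 * (br 4 3 * br 6 1)) \<in> qpoly.span (range sb)"
    "br 0 7 * (br 2 1 * (br 4 3 * br 6 5)) \<in> qpoly.span (range sb)"
    "br 0 7 * (br 2 1 * (br 4 5 * br 6 3)) \<in> qpoly.span (range sb)"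
    "br 0 7 * (br 2 3 * (br 4 1 * br 6 5)) \<in> qpoly.span (range sb)"
    "br 0 7 * (br 2 3 * (br 4 5 * br 6 1)) \<in> qpoly.span (range sb)"
    "br 0 7 * (br 2 5 * (br 4 1 * br 6 3)) \<in> qpoly.span (range sb)"
    "br 0 7 * (br 2 5 * (br 4 3 * br 6 1)) \<in> qpoly.span (range sb)"
    subgoal unfolding 0 by (intro span_sb_intros)
    subgoal by (rule span_sb_divide[of "num.Bit0 num.One"], unfold 1, intro span_sb_intros)
    subgoal by (rule span_sb_divide[of "num.Bit0 num.One"], unfold 2, intro span_sb_intros)
    subgoal by (rule span_sb_divide[of "num.Bit0 (num.Bit0 num.One)"], unfold 3, intro span_sb_intros)
    subgoal by (rule span_sb_divide[of "num.Bit0 (num.Bit0 num.One)"], unfold 4, intro span_sb_intros)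
    subgoal by (rule span_sb_divide[of "num.Bit0 num.One"], unfold 5, intro span_sb_intros)
    subgoal by (rule span_sb_divide[of "num.Bit0 num.One"], unfold 6, intro span_sb_intros)
    subgoal by (rule span_sb_divide[of "num.Bit0 (num.Bit0 num.One)"], unfold 7, intro span_sb_intros)
    subgoal by (rule span_sb_divide[of "num.Bit0 (num.Bit0 num.One)"], unfold 8, intro span_sb_intros)
    subgoal by (rule span_sb_divide[of "num.Bit0 (num.Bit0 (num.Bit0 num.One))"], unfold 9, intro span_sb_intros)
    subgoal by (rule span_sb_divide[of "num.Bit0 (num.Bit0 (num.Bit0 num.One))"], unfold 10, intro span_sb_intros)
    subgoal by (rule span_sb_divide[of "num.Bit0 (num.Bit0 num.One)"], unfold 11, intro span_sb_intros)
    subgoal by (rule span_sb_divide[of "num.Bit0 (num.Bit0 num.One)"], unfold 12, intro span_sb_intros)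
    subgoal by (rule span_sb_divide[of "num.Bit0 (num.Bit0 (num.Bit0 num.One))"], unfold 13, intro span_sb_intros)
    subgoal by (rule span_sb_divide[of "num.Bit0 num.One"], unfold 14, intro span_sb_intros)
    subgoal by (rule span_sb_divide[of "num.Bit0 (num.Bit0 num.One)"], unfold 15, intro span_sb_intros)
    subgoal by (rule span_sb_divide[of "num.Bit0 (num.Bit0 num.One)"], unfold 16, intro span_sb_intros)
    subgoal by (rule span_sb_divide[of "num.Bit0 (num.Bit0 (num.Bit0 num.One))"], unfold 17, intro span_sb_intros)
    subgoal by (rule span_sb_divide[of "num.Bit0 (num.Bit0 (num.Bit0 num.One))"], unfold 18, intro span_sb_intros)
    subgoal by (rule span_sb_divide[of "num.Bit0 (num.Bit0 num.One)"], unfold 19, intro span_sb_intros)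
    subgoal by (rule span_sb_divide[of "num.Bit0 (num.Bit0 num.One)"], unfold 20, intro span_sb_intros)
    subgoal by (rule span_sb_divide[of "num.Bit0 num.One"], unfold 21, intro span_sb_intros)
    subgoal by (rule span_sb_divide[of "num.Bit0 (num.Bit0 (num.Bit0 num.One))"], unfold 22, intro span_sb_intros)
    subgoal by (rule span_sb_divide[of "num.Bit0 (num.Bit0 num.One)"], unfold 23, intro span_sb_intros)
    done
  show ?thesis
    using assms span by auto
qed

section \<open>Kempe's theorem\<close>

text \<open>One point of each pair, so that a perfect matching between \<open>Ev\<close> and its
  complement is a permutation of the pairs.\<close>

definition Ev :: "8 set"
  where "Ev = {0, 2, 4, 6}"

lemma not_in_Ev: "- Ev = {1, 3, 5, 7}"
  using UNIV_8 by (auto simp: Ev_def)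

definition bip :: "(8 \<times> 8) multiset \<Rightarrow> bool"
  where "bip G \<longleftrightarrow> (\<forall>(i, j)\<in>#G. (i \<in> Ev) \<noteq> (j \<in> Ev))"

lemma bip_simps [simp]: "bip {#}" "bip (add_mset (i, j) G) \<longleftrightarrow> (i \<in> Ev) \<noteq> (j \<in> Ev) \<and> bip G"
  by (auto simp: bip_def)

definition inner :: "8 set \<Rightarrow> (8 \<times> 8) multiset \<Rightarrow> nat"
  where "inner A G = size (filter_mset (\<lambda>(i, j). i \<in> A \<and> j \<in> A) G)"

lemma inner_simps [simp]: "inner A {#} = 0"
  "inner A (add_mset (i, j) G) = (if i \<in> A \<and> j \<in> A then 1 else 0) + inner A G"
  by (simp_all add: inner_def)

lemma inner_pos: "inner A G > 0 \<Longrightarrow> \<exists>i j. (i, j) \<in># G \<and> i \<in> A \<and> j \<in> A"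
proof (induction G)
  case (add e G)
  obtain a b where "e = (a, b)" by (cases e)
  with add show ?case by (cases "a \<in> A \<and> b \<in> A") force+
qed simp

text \<open>A crossing edge adds 1 to both degree sums, and an inner edge adds 2 to one of them,
  which the other side of the equation compensates. Since both sides have four vertices, a regular
  graph has equally many inner edges on each.\<close>

lemma inner_balance:
  "(\<Sum>i\<in>Ev. gdeg G i) + 2 * inner (- Ev) G = (\<Sum>i\<in>- Ev. gdeg G i) + 2 * inner Ev G"
proof (induction G)
  case (add e G)
  obtain a b where "e = (a, b)" by (cases e)
  then show ?case using add by (simp add: gdeg_add_mset sum.distrib)
qed simp

lemma bip_if_inner_0: "inner Ev G = 0 \<Longrightarrow> inner (- Ev) G = 0 \<Longrightarrow> bip G"
  by (induction G) (auto split: if_splits)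

definition bipspan :: "nat \<Rightarrow> coord qpoly set"
  where "bipspan d = qpoly.span {bm G | G. bip G \<and> gdeg G = (\<lambda>_. d)}"

text \<open>As long as an edge lies inside the even labels, one lies inside the odd labels too. The
  Pluecker relation replaces these two edges by two crossing ones, in two ways, without changing
  degrees.\<close>

lemma bm_in_bipspan:
  assumes "gdeg G = (\<lambda>_. n)"
  shows "bm G \<in> bipspan n"
  using assms
proof (induction "inner Ev G" arbitrary: G rule: less_induct)
  case less
  have bal: "inner (- Ev) G = inner Ev G"
    using inner_balance[of G] less.prems by (simp add: not_in_Ev) (simp add: Ev_def)
  show ?case
  proof (cases "inner Ev G = 0")
    case True
    then show ?thesis
      using bip_if_inner_0 bal less.prems unfolding bipspan_def by (intro qpoly.span_base) auto
  next
    case False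
    obtain a b where ab: "(a, b) \<in># G" "a \<in> Ev" "b \<in> Ev"
      using inner_pos False by blast
    obtain c d where cd: "(c, d) \<in># G" "c \<notin> Ev" "d \<notin> Ev"
      using inner_pos[of "- Ev" G] False bal by auto
    obtain H' where H': "G = add_mset (a, b) H'"
      using ab(1) by (blast dest: multi_member_split)
    then have "(c, d) \<in># H'"
      using cd ab by auto
    then obtain H where G: "G = add_mset (a, b) (add_mset (c, d) H)"
      using H' by (blast dest: multi_member_split)
    have "gdeg (add_mset (a, c) (add_mset (b, d) H)) = gdeg G"
      "gdeg (add_mset (a, d) (add_mset (b, c) H)) = gdeg G"
      by (intro ext; simp only: G gdeg_add_mset add_ac)+
    then have "bm (add_mset (a, c) (add_mset (b, d) H)) \<in> bipspan n"
      "bm (add_mset (a, d) (add_mset (b, c) H)) \<in> bipspan n"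
      by (intro less.hyps; use less.prems ab cd in \<open>simp add: G\<close>)+
    moreover have "bm G = bm (add_mset (a, c) (add_mset (b, d) H)) - bm (add_mset (a, d) (add_mset (b, c) H))"
    proof -
      have "bm G = br a b * br c d * bm H" by (simp add: G mult.assoc)
      then show ?thesis unfolding pluecker[of a b c d] by (simp add: algebra_simps)
    qed
    ultimately show ?thesis
      using less.prems by (simp add: bipspan_def qpoly.span_diff)
  qed
qed

definition mlt :: "(8 \<times> 8) multiset \<Rightarrow> 8 \<Rightarrow> 8 \<Rightarrow> nat"
  where "mlt G i j = count G (i, j) + count G (j, i)"

lemma mlt_add_mset:
  "mlt (add_mset (a, b) G) k l = (if b = l then if a = k then 1 else 0 else 0)
    + (if a = l then if b = k then 1 else 0 else 0) + mlt G k l"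
  "mlt (add_mset (a, b) G) k l = (if a = k then if b = l then 1 else 0 else 0)
    + (if b = k then if a = l then 1 else 0 else 0) + mlt G k l"
  unfolding mlt_def count_add_mset prod.inject
  by (cases "a = k"; cases "b = l"; cases "a = l"; cases "b = k";
      simp only: if_True if_False simp_thms refl add_0 add_0_right add_Suc add_Suc_right One_nat_def)+

lemma bip_gdeg:
  assumes "bip G"
  shows "i \<in> Ev \<Longrightarrow> gdeg G i = (\<Sum>j\<in>- Ev. mlt G i j)"
    and "j \<notin> Ev \<Longrightarrow> gdeg G j = (\<Sum>i\<in>Ev. mlt G i j)"
proof -
  have *: "(if k = a then 1 else 0) + (if k = b then 1 else 0) + n =
      (if b \<in> A then if a = k then 1 else 0 else 0) + (if a \<in> A then if b = k then 1 else 0 else 0) + (n :: nat)"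
    if "(a \<in> A) \<noteq> (b \<in> A)" "k \<notin> A" for k a b :: 8 and A n
  proof (cases "a \<in> A")
    case True
    then have "b \<notin> A" "k \<noteq> a" using that by auto
    with True show ?thesis
      by (cases "b = k"; simp only: eq_commute[of k b] eq_commute[of k a] if_True if_False simp_thms refl add_0 add_0_right)
  next
    case False
    then have "b \<in> A" "k \<noteq> b" using that by auto
    with False show ?thesis
      by (cases "a = k"; simp only: eq_commute[of k b] eq_commute[of k a] if_True if_False simp_thms refl add_0 add_0_right)
  qed
  have "(i \<in> Ev \<longrightarrow> gdeg G i = (\<Sum>j\<in>- Ev. mlt G i j)) \<and> (j \<notin> Ev \<longrightarrow> gdeg G j = (\<Sum>i\<in>Ev. mlt G i j))"
    using assms
  proof (induction G)
    case empty
    then show ?case by (simp add: mlt_def)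
  next
    case (add e G)
    obtain a b where e: "e = (a, b)" by (cases e)
    have G: "bip G" and ab: "(a \<in> Ev) \<noteq> (b \<in> Ev)" "(a \<in> - Ev) \<noteq> (b \<in> - Ev)"
      using add.prems by (auto simp: e)
    have "gdeg (add_mset e G) i = (\<Sum>j\<in>- Ev. mlt (add_mset e G) i j)" if "i \<in> Ev"
    proof -
      have "gdeg G i = (\<Sum>j\<in>- Ev. mlt G i j)" using add.IH[OF G] that by blast
      then show ?thesis
        unfolding e gdeg_add_mset mlt_add_mset(1) sum.distrib sum.delta'[OF finite]
        using *[OF ab(2), of i] that by simp
    qed
    moreover have "gdeg (add_mset e G) j = (\<Sum>i\<in>Ev. mlt (add_mset e G) i j)" if "j \<notin> Ev"
    proof -
      have "gdeg G j = (\<Sum>i\<in>Ev. mlt G i j)" using add.IH[OF G] that by blast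
      then show ?thesis
        unfolding e gdeg_add_mset mlt_add_mset(2) sum.distrib sum.delta'[OF finite]
        using *[OF ab(1) that] by (simp only: add.commute)
    qed
    ultimately show ?case by blast
  qed
  then show "i \<in> Ev \<Longrightarrow> gdeg G i = (\<Sum>j\<in>- Ev. mlt G i j)"
    and "j \<notin> Ev \<Longrightarrow> gdeg G j = (\<Sum>i\<in>Ev. mlt G i j)" by blast+
qed

text \<open>Hall's theorem for a 4 by 4 matrix with equal positive line sums, in the form of
  Frobenius and Koenig: if every permutation meets a zero entry, there is a zero block of r rows and
  s columns with r + s = 5, which the line sums exclude.\<close>

lemma hall4:
  fixes N :: "8 \<Rightarrow> 8 \<Rightarrow> nat"
  assumes rows: "N 0 1 + N 0 3 + N 0 5 + N 0 7 = Suc d" "N 2 1 + N 2 3 + N 2 5 + N 2 7 = Suc d"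
      "N 4 1 + N 4 3 + N 4 5 + N 4 7 = Suc d" "N 6 1 + N 6 3 + N 6 5 + N 6 7 = Suc d"
    and cols: "N 0 1 + N 2 1 + N 4 1 + N 6 1 = Suc d" "N 0 3 + N 2 3 + N 4 3 + N 6 3 = Suc d"
      "N 0 5 + N 2 5 + N 4 5 + N 6 5 = Suc d" "N 0 7 + N 2 7 + N 4 7 + N 6 7 = Suc d"
  shows "\<exists>a b c d. distinct [a, b, c, d] \<and> set [a, b, c, d] \<subseteq> {1, 3, 5, 7} \<and>
    N 0 a > 0 \<and> N 2 b > 0 \<and> N 4 c > 0 \<and> N 6 d > 0"
proof (rule ccontr)
  assume no: "\<not> ?thesis"
  define z where "z i j \<longleftrightarrow> N i j = 0" for i j
  have perm: "z 0 a \<or> z 2 b \<or> z 4 c \<or> z 6 d"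
    if "distinct [a, b, c, d]" "set [a, b, c, d] \<subseteq> {1, 3, 5, 7}" for a b c d
    using no that unfolding z_def by (metis gr0I)
  have perms: "z 0 1 \<or> z 2 3 \<or> z 4 5 \<or> z 6 7"
    "z 0 1 \<or> z 2 3 \<or> z 4 7 \<or> z 6 5"
    "z 0 1 \<or> z 2 5 \<or> z 4 3 \<or> z 6 7"
    "z 0 1 \<or> z 2 5 \<or> z 4 7 \<or> z 6 3"
    "z 0 1 \<or> z 2 7 \<or> z 4 3 \<or> z 6 5"
    "z 0 1 \<or> z 2 7 \<or> z 4 5 \<or> z 6 3"
    "z 0 3 \<or> z 2 1 \<or> z 4 5 \<or> z 6 7"
    "z 0 3 \<or> z 2 1 \<or> z 4 7 \<or> z 6 5"
    "z 0 3 \<or> z 2 5 \<or> z 4 1 \<or> z 6 7"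
    "z 0 3 \<or> z 2 5 \<or> z 4 7 \<or> z 6 1"
    "z 0 3 \<or> z 2 7 \<or> z 4 1 \<or> z 6 5"
    "z 0 3 \<or> z 2 7 \<or> z 4 5 \<or> z 6 1"
    "z 0 5 \<or> z 2 1 \<or> z 4 3 \<or> z 6 7"
    "z 0 5 \<or> z 2 1 \<or> z 4 7 \<or> z 6 3"
    "z 0 5 \<or> z 2 3 \<or> z 4 1 \<or> z 6 7"
    "z 0 5 \<or> z 2 3 \<or> z 4 7 \<or> z 6 1"
    "z 0 5 \<or> z 2 7 \<or> z 4 1 \<or> z 6 3"
    "z 0 5 \<or> z 2 7 \<or> z 4 3 \<or> z 6 1"
    "z 0 7 \<or> z 2 1 \<or> z 4 3 \<or> z 6 5"
    "z 0 7 \<or> z 2 1 \<or> z 4 5 \<or> z 6 3"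
    "z 0 7 \<or> z 2 3 \<or> z 4 1 \<or> z 6 5"
    "z 0 7 \<or> z 2 3 \<or> z 4 5 \<or> z 6 1"
    "z 0 7 \<or> z 2 5 \<or> z 4 1 \<or> z 6 3"
    "z 0 7 \<or> z 2 5 \<or> z 4 3 \<or> z 6 1"
    by (rule perm; simp)+
  \<comment> \<open>All blocks of sizes 1 by 4, 2 by 3, 3 by 2 and 4 by 1. A zero block with r + s =
    5 would force the rows to have their whole mass in 4 - s = r - 1 columns, too few for r
    rows.\<close>
  have blocks: "\<not> (z 0 1 \<and> z 0 3 \<and> z 0 5 \<and> z 0 7)"
    "\<not> (z 2 1 \<and> z 2 3 \<and> z 2 5 \<and> z 2 7)"
    "\<not> (z 4 1 \<and> z 4 3 \<and> z 4 5 \<and> z 4 7)"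
    "\<not> (z 6 1 \<and> z 6 3 \<and> z 6 5 \<and> z 6 7)"
    "\<not> (z 0 1 \<and> z 0 3 \<and> z 0 5 \<and> z 2 1 \<and> z 2 3 \<and> z 2 5)"
    "\<not> (z 0 1 \<and> z 0 3 \<and> z 0 7 \<and> z 2 1 \<and> z 2 3 \<and> z 2 7)"
    "\<not> (z 0 1 \<and> z 0 5 \<and> z 0 7 \<and> z 2 1 \<and> z 2 5 \<and> z 2 7)"
    "\<not> (z 0 3 \<and> z 0 5 \<and> z 0 7 \<and> z 2 3 \<and> z 2 5 \<and> z 2 7)"
    "\<not> (z 0 1 \<and> z 0 3 \<and> z 0 5 \<and> z 4 1 \<and> z 4 3 \<and> z 4 5)"
    "\<not> (z 0 1 \<and> z 0 3 \<and> z 0 7 \<and> z 4 1 \<and> z 4 3 \<and> z 4 7)"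
    "\<not> (z 0 1 \<and> z 0 5 \<and> z 0 7 \<and> z 4 1 \<and> z 4 5 \<and> z 4 7)"
    "\<not> (z 0 3 \<and> z 0 5 \<and> z 0 7 \<and> z 4 3 \<and> z 4 5 \<and> z 4 7)"
    "\<not> (z 0 1 \<and> z 0 3 \<and> z 0 5 \<and> z 6 1 \<and> z 6 3 \<and> z 6 5)"
    "\<not> (z 0 1 \<and> z 0 3 \<and> z 0 7 \<and> z 6 1 \<and> z 6 3 \<and> z 6 7)"
    "\<not> (z 0 1 \<and> z 0 5 \<and> z 0 7 \<and> z 6 1 \<and> z 6 5 \<and> z 6 7)"
    "\<not> (z 0 3 \<and> z 0 5 \<and> z 0 7 \<and> z 6 3 \<and> z 6 5 \<and> z 6 7)"
    "\<not> (z 2 1 \<and> z 2 3 \<and> z 2 5 \<and> z 4 1 \<and> z 4 3 \<and> z 4 5)"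
    "\<not> (z 2 1 \<and> z 2 3 \<and> z 2 7 \<and> z 4 1 \<and> z 4 3 \<and> z 4 7)"
    "\<not> (z 2 1 \<and> z 2 5 \<and> z 2 7 \<and> z 4 1 \<and> z 4 5 \<and> z 4 7)"
    "\<not> (z 2 3 \<and> z 2 5 \<and> z 2 7 \<and> z 4 3 \<and> z 4 5 \<and> z 4 7)"
    "\<not> (z 2 1 \<and> z 2 3 \<and> z 2 5 \<and> z 6 1 \<and> z 6 3 \<and> z 6 5)"
    "\<not> (z 2 1 \<and> z 2 3 \<and> z 2 7 \<and> z 6 1 \<and> z 6 3 \<and> z 6 7)"
    "\<not> (z 2 1 \<and> z 2 5 \<and> z 2 7 \<and> z 6 1 \<and> z 6 5 \<and> z 6 7)"
    "\<not> (z 2 3 \<and> z 2 5 \<and> z 2 7 \<and> z 6 3 \<and> z 6 5 \<and> z 6 7)"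
    "\<not> (z 4 1 \<and> z 4 3 \<and> z 4 5 \<and> z 6 1 \<and> z 6 3 \<and> z 6 5)"
    "\<not> (z 4 1 \<and> z 4 3 \<and> z 4 7 \<and> z 6 1 \<and> z 6 3 \<and> z 6 7)"
    "\<not> (z 4 1 \<and> z 4 5 \<and> z 4 7 \<and> z 6 1 \<and> z 6 5 \<and> z 6 7)"
    "\<not> (z 4 3 \<and> z 4 5 \<and> z 4 7 \<and> z 6 3 \<and> z 6 5 \<and> z 6 7)"
    "\<not> (z 0 1 \<and> z 0 3 \<and> z 2 1 \<and> z 2 3 \<and> z 4 1 \<and> z 4 3)"
    "\<not> (z 0 1 \<and> z 0 5 \<and> z 2 1 \<and> z 2 5 \<and> z 4 1 \<and> z 4 5)"
    "\<not> (z 0 1 \<and> z 0 7 \<and> z 2 1 \<and> z 2 7 \<and> z 4 1 \<and> z 4 7)"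
    "\<not> (z 0 3 \<and> z 0 5 \<and> z 2 3 \<and> z 2 5 \<and> z 4 3 \<and> z 4 5)"
    "\<not> (z 0 3 \<and> z 0 7 \<and> z 2 3 \<and> z 2 7 \<and> z 4 3 \<and> z 4 7)"
    "\<not> (z 0 5 \<and> z 0 7 \<and> z 2 5 \<and> z 2 7 \<and> z 4 5 \<and> z 4 7)"
    "\<not> (z 0 1 \<and> z 0 3 \<and> z 2 1 \<and> z 2 3 \<and> z 6 1 \<and> z 6 3)"
    "\<not> (z 0 1 \<and> z 0 5 \<and> z 2 1 \<and> z 2 5 \<and> z 6 1 \<and> z 6 5)"
    "\<not> (z 0 1 \<and> z 0 7 \<and> z 2 1 \<and> z 2 7 \<and> z 6 1 \<and> z 6 7)"
    "\<not> (z 0 3 \<and> z 0 5 \<and> z 2 3 \<and> z 2 5 \<and> z 6 3 \<and> z 6 5)"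
    "\<not> (z 0 3 \<and> z 0 7 \<and> z 2 3 \<and> z 2 7 \<and> z 6 3 \<and> z 6 7)"
    "\<not> (z 0 5 \<and> z 0 7 \<and> z 2 5 \<and> z 2 7 \<and> z 6 5 \<and> z 6 7)"
    "\<not> (z 0 1 \<and> z 0 3 \<and> z 4 1 \<and> z 4 3 \<and> z 6 1 \<and> z 6 3)"
    "\<not> (z 0 1 \<and> z 0 5 \<and> z 4 1 \<and> z 4 5 \<and> z 6 1 \<and> z 6 5)"
    "\<not> (z 0 1 \<and> z 0 7 \<and> z 4 1 \<and> z 4 7 \<and> z 6 1 \<and> z 6 7)"
    "\<not> (z 0 3 \<and> z 0 5 \<and> z 4 3 \<and> z 4 5 \<and> z 6 3 \<and> z 6 5)"
    "\<not> (z 0 3 \<and> z 0 7 \<and> z 4 3 \<and> z 4 7 \<and> z 6 3 \<and> z 6 7)"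
    "\<not> (z 0 5 \<and> z 0 7 \<and> z 4 5 \<and> z 4 7 \<and> z 6 5 \<and> z 6 7)"
    "\<not> (z 2 1 \<and> z 2 3 \<and> z 4 1 \<and> z 4 3 \<and> z 6 1 \<and> z 6 3)"
    "\<not> (z 2 1 \<and> z 2 5 \<and> z 4 1 \<and> z 4 5 \<and> z 6 1 \<and> z 6 5)"
    "\<not> (z 2 1 \<and> z 2 7 \<and> z 4 1 \<and> z 4 7 \<and> z 6 1 \<and> z 6 7)"
    "\<not> (z 2 3 \<and> z 2 5 \<and> z 4 3 \<and> z 4 5 \<and> z 6 3 \<and> z 6 5)"
    "\<not> (z 2 3 \<and> z 2 7 \<and> z 4 3 \<and> z 4 7 \<and> z 6 3 \<and> z 6 7)"
    "\<not> (z 2 5 \<and> z 2 7 \<and> z 4 5 \<and> z 4 7 \<and> z 6 5 \<and> z 6 7)"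
    "\<not> (z 0 1 \<and> z 2 1 \<and> z 4 1 \<and> z 6 1)"
    "\<not> (z 0 3 \<and> z 2 3 \<and> z 4 3 \<and> z 6 3)"
    "\<not> (z 0 5 \<and> z 2 5 \<and> z 4 5 \<and> z 6 5)"
    "\<not> (z 0 7 \<and> z 2 7 \<and> z 4 7 \<and> z 6 7)"
    unfolding z_def by (((intro notI, elim conjE)?, use rows cols in linarith)+)
  show False using perms blocks by sat
qed


lemma crossing_edges_ne:
  assumes "i \<in> A" "i' \<in> A" "j \<notin> A" "j' \<notin> A" "i \<noteq> i'"
    "x = (i, j) \<or> x = (j, i)" "y = (i', j') \<or> y = (j', i')"
  shows "x \<noteq> y"
  using assms by blast

lemma gdeg_perfect_matching:
  assumes "distinct [a, b, c, e]" "set [a, b, c, e] \<subseteq> {1, 3, 5, 7}"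
  shows "gdeg {#(0, a), (2, b), (4, c), (6, e)#} k = 1"
proof -
  have "card (set [a, b, c, e]) = card {1, 3, 5, 7 :: 8}"
    using distinct_card[OF assms(1)] by simp
  then have "set [a, b, c, e] = set [1, 3, 5, 7]"
    using card_subset_eq[OF _ assms(2)] by simp
  then have "mset [a, b, c, e] = mset [1, 3, 5, 7]"
    using set_eq_iff_mset_eq_distinct[of "[a, b, c, e]" "[1, 3, 5, 7]"] assms(1) by simp
  then have *: "{#a, b, c, e#} = {#1, 3, 5, 7#}" by simp
  have "gdeg {#(0, a), (2, b), (4, c), (6, e)#} k =
      (\<Sum>x\<in>#{#0, 2, 4, 6#} + {#a, b, c, e#}. if k = x then 1 else 0)"
    by (simp only: gdeg_add_mset gdeg_empty sum_mset.union image_mset_union image_mset_add_mset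
        sum_mset.add_mset image_mset_empty sum_mset.empty add_ac)
  also have "\<dots> = 1"
  proof -
    have "\<forall>k. (\<Sum>x\<in>#{#0, 2, 4, 6#} + {#1, 3, 5, 7 :: 8#}. if k = x then 1 else 0 :: nat) = 1"
      unfolding forall_8 by simp
    then show ?thesis unfolding * by blast
  qed
  finally show ?thesis .
qed

text \<open>The matrix of edge multiplicities has constant line sums, so \<open>hall4\<close> finds
  a perfect matching among the edges, and removing it leaves a graph regular of degree
  \<open>d\<close>. Orientation affects the bracket monomial of the matching only by a sign.\<close>

lemma bip_split_matching:
  assumes G: "bip G" "gdeg G = (\<lambda>_. Suc d)"
  shows "\<exists>M H. G = M + H \<and> bip H \<and> gdeg H = (\<lambda>_. d) \<and> bm M \<in> qpoly.span (range sb)"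
proof -
  have rows: "(\<Sum>j\<in>- Ev. mlt G i j) = Suc d" if "i \<in> Ev" for i
    using bip_gdeg(1)[OF G(1) that] G(2) by simp
  have cols: "(\<Sum>i\<in>Ev. mlt G i j) = Suc d" if "j \<notin> Ev" for j
    using bip_gdeg(2)[OF G(1) that] G(2) by simp
  have "\<exists>a b c e. distinct [a, b, c, e] \<and> set [a, b, c, e] \<subseteq> {1, 3, 5, 7} \<and>
      mlt G 0 a > 0 \<and> mlt G 2 b > 0 \<and> mlt G 4 c > 0 \<and> mlt G 6 e > 0"
    by (rule hall4[of "mlt G" d])
      (use rows[of 0] rows[of 2] rows[of 4] rows[of 6] cols[of 1] cols[of 3] cols[of 5] cols[of 7]
        in \<open>simp_all add: not_in_Ev, simp_all add: Ev_def\<close>)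
  then obtain a b c e where abce: "distinct [a, b, c, e]" "set [a, b, c, e] \<subseteq> {1, 3, 5, 7}"
    and pos: "mlt G 0 a > 0" "mlt G 2 b > 0" "mlt G 4 c > 0" "mlt G 6 e > 0"
    by blast
  have edge: "\<exists>x. x \<in># G \<and> (x = (i, j) \<or> x = (j, i))" if "mlt G i j > 0" for i j
    using that by (auto simp: mlt_def)
  obtain x0 where x0: "x0 \<in># G" "x0 = (0, a) \<or> x0 = (a, 0)" using edge[OF pos(1)] by blast
  obtain x1 where x1: "x1 \<in># G" "x1 = (2, b) \<or> x1 = (b, 2)" using edge[OF pos(2)] by blast
  obtain x2 where x2: "x2 \<in># G" "x2 = (4, c) \<or> x2 = (c, 4)" using edge[OF pos(3)] by blast
  obtain x3 where x3: "x3 \<in># G" "x3 = (6, e) \<or> x3 = (e, 6)" using edge[OF pos(4)] by blast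
  have odd: "a \<notin> Ev" "b \<notin> Ev" "c \<notin> Ev" "e \<notin> Ev"
    using abce(2) by (simp_all flip: not_in_Ev)
  have ne: "x0 \<noteq> x1" "x0 \<noteq> x2" "x0 \<noteq> x3" "x1 \<noteq> x2" "x1 \<noteq> x3" "x2 \<noteq> x3"
    by (rule crossing_edges_ne[where A = Ev, OF _ _ _ _ _ x0(2) x1(2)]
        crossing_edges_ne[where A = Ev, OF _ _ _ _ _ x0(2) x2(2)]
        crossing_edges_ne[where A = Ev, OF _ _ _ _ _ x0(2) x3(2)]
        crossing_edges_ne[where A = Ev, OF _ _ _ _ _ x1(2) x2(2)]
        crossing_edges_ne[where A = Ev, OF _ _ _ _ _ x1(2) x3(2)]
        crossing_edges_ne[where A = Ev, OF _ _ _ _ _ x2(2) x3(2)];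
        use odd in \<open>simp add: Ev_def\<close>)+
  define M where "M = {#x0, x1, x2, x3#}"
  have "M = mset_set {x0, x1, x2, x3}"
    using ne by (simp add: M_def)
  also have "\<dots> \<subseteq># mset_set (set_mset G)"
    using x0(1) x1(1) x2(1) x3(1) by (intro subset_imp_msubset_mset_set) auto
  also have "\<dots> \<subseteq># G"
    by (rule mset_set_set_mset_msubset)
  finally have "M \<subseteq># G" .
  then obtain H where H: "G = M + H"
    using mset_subset_eq_exists_conv by blast
  have "bm M = br 0 a * (br 2 b * (br 4 c * br 6 e)) \<or> bm M = - (br 0 a * (br 2 b * (br 4 c * br 6 e)))"
    using x0(2) x1(2) x2(2) x3(2)
    by (auto simp: M_def br_swap[of a 0] br_swap[of b 2] br_swap[of c 4] br_swap[of e 6])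
  then have "bm M \<in> qpoly.span (range sb)"
    using bipartite_matching_in_span[OF abce] qpoly.span_neg by metis
  moreover have "bip H"
    using G(1) by (simp add: H bip_def)
  moreover have "gdeg M k = 1" for k
  proof -
    have "gdeg M k = gdeg {#(0, a), (2, b), (4, c), (6, e)#} k"
      using x0(2) x1(2) x2(2) x3(2) by (elim disjE; simp only: M_def gdeg_add_mset add_ac)
    also have "\<dots> = 1"
      by (rule gdeg_perfect_matching[OF abce])
    finally show ?thesis .
  qed
  then have "gdeg H = (\<lambda>_. d)"
    using fun_cong[OF G(2)] by (auto simp: H gdeg_union fun_eq_iff)
  ultimately show ?thesis using H by blast
qed

lemma subspace_subst_homog: "qpoly.subspace (subst g ` homog d)"
proof (rule qpoly.subspaceI)
  show "0 \<in> subst g ` homog d"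
    by (rule image_eqI[of _ _ 0]) (simp_all add: homog_whomog)
  fix x y c assume "x \<in> subst g ` homog d"
  then obtain p where p: "x = subst g p" "p \<in> homog d" by auto
  show "scale c x \<in> subst g ` homog d"
    using p by (intro image_eqI[of _ _ "scale c p"]) (simp_all add: homog_whomog whomog_scale)
  assume "y \<in> subst g ` homog d"
  then obtain q where q: "y = subst g q" "q \<in> homog d" by auto
  show "x + y \<in> subst g ` homog d"
    using p q by (intro image_eqI[of _ _ "p + q"]) (simp_all add: homog_whomog whomog_add)
qed

lemma homog_mult: "p \<in> homog d \<Longrightarrow> q \<in> homog e \<Longrightarrow> p * q \<in> homog (d + e)"
  by (simp add: homog_whomog whomog_mult)

lemma homog_Var: "Var v \<in> homog 1"
  using whomog_Var[of v "\<lambda>_. 1"] by (simp add: homog_whomog)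

declare homog_Var [unfolded One_nat_def, simp]

lemma bip_bm_in_image:
  assumes "bip G" "gdeg G = (\<lambda>_. d)"
  shows "bm G \<in> subst sb ` homog d"
  using assms
proof (induction d arbitrary: G)
  case 0
  have "G = {#}"
  proof (rule ccontr)
    assume "G \<noteq> {#}"
    then obtain i j H where "G = add_mset (i, j) H" by (metis multiset_cases surj_pair)
    then have "gdeg G i > 0" by (simp add: gdeg_add_mset)
    then show False using 0 by simp
  qed
  then show ?case
    by (intro image_eqI[of _ _ 1]) (simp_all add: homog_whomog)
next
  case (Suc d)
  obtain M H where M: "G = M + H" "bip H" "gdeg H = (\<lambda>_. d)" "bm M \<in> qpoly.span (range sb)"
    using bip_split_matching[OF Suc.prems] by blast
  have "sb v \<in> subst sb ` homog 1" for v
    by (rule image_eqI[of _ _ "Var v"]) simp_all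
  then have "qpoly.span (range sb) \<subseteq> subst sb ` homog 1"
    by (intro qpoly.span_minimal subspace_subst_homog) auto
  then obtain p where p: "bm M = subst sb p" "p \<in> homog 1" using M(4) by auto
  obtain q where q: "bm H = subst sb q" "q \<in> homog d" using Suc.IH[OF M(2,3)] by auto
  show ?case
    using homog_mult[OF p(2) q(2)] by (intro image_eqI[of _ _ "p * q"]) (simp_all add: M(1) p q)
qed

lemma Rpiece_mult: "f \<in> Rpiece d \<Longrightarrow> g \<in> Rpiece e \<Longrightarrow> f * g \<in> Rpiece (d + e)"
  using rp_mult[of f "\<lambda>_. d" g "\<lambda>_. e"] by (simp add: Rpiece_rp)

lemma Rpiece_1: "1 \<in> Rpiece 0"
  using rp_1 by (simp add: Rpiece_rp)

lemma subspace_Rpiece: "qpoly.subspace (Rpiece d)"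
  by (rule qpoly.subspaceI) (auto simp: Rpiece_rp rp_0 rp_add rp_scale)

lemma subst_in_Rpiece:
  assumes "\<And>v. g v \<in> V" "p \<in> homog d"
  shows "subst g p \<in> Rpiece d"
  unfolding subst_msubst
proof (intro qpoly.subspace_sum[OF subspace_Rpiece])
  fix m assume m: "m \<in> Poly_Mapping.keys p"
  have "msubst g m \<in> Rpiece (wt (\<lambda>_. 1) m)" for m
  proof (induction m rule: mon_induct)
    case (add v m)
    then show ?case using Rpiece_mult[OF assms(1) add] by (simp add: msubst_add wt_add)
  qed (simp add: Rpiece_1)
  then have "msubst g m \<in> Rpiece d"
    using assms(2) m by (metis (mono_tags, lifting) homog_whomog mem_Collect_eq whomog_def)
  then show "Const (Poly_Mapping.lookup p m) * msubst g m \<in> Rpiece d"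
    using qpoly.subspace_scale[OF subspace_Rpiece] by (simp add: scale_def)
qed

text \<open>The chain is: invariants, bracket monomials, bipartite bracket monomials, products of
  \<open>d\<close> matchings, polynomials of degree \<open>d\<close> in \<open>sb\<close>.\<close>

theorem kempe: "Rpiece d = subst sb ` homog d"
proof
  show "subst sb ` homog d \<subseteq> Rpiece d"
    using subst_in_Rpiece[of sb, OF sb_Rpiece] by blast
  show "Rpiece d \<subseteq> subst sb ` homog d"
  proof
    fix f assume "f \<in> Rpiece d"
    then have "f \<in> bspan (\<lambda>_. d)"
      by (intro first_fundamental_theorem invar_if_SL2_invariant) (simp_all add: Rpiece_mhom)
    moreover have "bspan (\<lambda>_. d) \<subseteq> bipspan d"
      unfolding bspan_def using bm_in_bipspan
      by (intro qpoly.span_minimal) (auto simp: bipspan_def)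
    moreover have "bipspan d \<subseteq> subst sb ` homog d"
      unfolding bipspan_def using bip_bm_in_image
      by (intro qpoly.span_minimal subspace_subst_homog) auto
    ultimately show "f \<in> subst sb ` homog d" by blast
  qed
qed

section \<open>The fourteen quadrics\<close>

text \<open>Indexed by the variables so that \<open>rel v\<close> is, up to a scalar, the derivative
  of \<open>cubic\<close> in direction \<open>v\<close>, except that \<open>R1\<close>,
  \<open>R2\<close>, \<open>TT\<close> are mixed by an invertible matrix. \<open>rel P0\<close> is
  the Gram determinant, the other \<open>P\<close> rows are products of two volumes, the
  \<open>Q\<close> rows are Cramer's rule, and the last three only regroup factors.\<close>

fun rel :: "vi \<Rightarrow> vi qpoly" where
  "rel P0 = Var R1 * Var R1 + 2 * (Var R1 * Var TT) + Var TT * Var TT + Var P12 * Var P12 + Var P13 * Var P13 + Var P14 * Var P14 + Var P23 * Var P23 + Var P24 * Var P24 + Var P34 * Var P34 - 3 * (Var P0 * Var P0) - 4 * (Var R1 * Var R2) - Var Q1 * Var Q1 - Var Q2 * Var Q2 - Var Q3 * Var Q3 - Var Q4 * Var Q4"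
| "rel P12 = Var P0 * Var P12 + 2 * (Var P34 * Var R2) - Var Q1 * Var Q2 - Var P13 * Var P23 - Var P14 * Var P24 - Var P34 * Var TT - Var P34 * Var R1"
| "rel P13 = Var P0 * Var P13 + Var P24 * Var R1 - Var Q1 * Var Q3 - Var P12 * Var P23 - Var P14 * Var P34 - Var P24 * Var TT"
| "rel P14 = Var P0 * Var P14 + Var P23 * Var R1 + Var P23 * Var TT - Var Q1 * Var Q4 - Var P12 * Var P24 - Var P13 * Var P34"
| "rel P23 = Var P0 * Var P23 + Var P14 * Var R1 + Var P14 * Var TT - Var Q2 * Var Q3 - Var P12 * Var P13 - Var P24 * Var P34"
| "rel P24 = Var P0 * Var P24 + Var P13 * Var R1 - Var Q2 * Var Q4 - Var P12 * Var P14 - Var P23 * Var P34 - Var P13 * Var TT"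
| "rel P34 = Var P0 * Var P34 + 2 * (Var P12 * Var R2) - Var Q3 * Var Q4 - Var P13 * Var P14 - Var P23 * Var P24 - Var P12 * Var TT - Var P12 * Var R1"
| "rel Q1 = Var P0 * Var Q1 + Var P12 * Var Q2 + Var P13 * Var Q3 + Var P14 * Var Q4"
| "rel Q2 = Var P0 * Var Q2 + Var P12 * Var Q1 + Var P23 * Var Q3 + Var P24 * Var Q4"
| "rel Q3 = Var P0 * Var Q3 + Var P13 * Var Q1 + Var P23 * Var Q2 + Var P34 * Var Q4"
| "rel Q4 = Var P0 * Var Q4 + Var P14 * Var Q1 + Var P24 * Var Q2 + Var P34 * Var Q3"
| "rel R1 = Var P12 * Var P34 - Var P0 * Var R1"
| "rel R2 = Var P13 * Var P24 - Var P0 * Var R2"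
| "rel TT = Var P14 * Var P23 + Var P0 * Var TT - Var P0 * Var R2"

definition J :: "vi qpoly set"
  where "J = {p. \<exists>h. p = (\<Sum>v\<in>UNIV. h v * rel v)}"

lemma J_add: "x \<in> J \<Longrightarrow> y \<in> J \<Longrightarrow> x + y \<in> J"
proof -
  assume "x \<in> J" "y \<in> J"
  then obtain h k where "x = (\<Sum>v\<in>UNIV. h v * rel v)" "y = (\<Sum>v\<in>UNIV. k v * rel v)"
    by (auto simp: J_def)
  then have "x + y = (\<Sum>v\<in>UNIV. (h v + k v) * rel v)"
    by (simp add: distrib_right sum.distrib)
  then show ?thesis unfolding J_def by (intro CollectI exI[of _ "\<lambda>v. h v + k v"])
qed

lemma J_mult: "x \<in> J \<Longrightarrow> p * x \<in> J"
proof -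
  assume "x \<in> J"
  then obtain h where "x = (\<Sum>v\<in>UNIV. h v * rel v)"
    by (auto simp: J_def)
  then have "p * x = (\<Sum>v\<in>UNIV. (p * h v) * rel v)"
    by (simp add: sum_distrib_left mult.assoc)
  then show ?thesis unfolding J_def by (intro CollectI exI[of _ "\<lambda>v. p * h v"])
qed

lemma J_uminus: "x \<in> J \<Longrightarrow> - x \<in> J"
  using J_mult[of x "-1"] by simp

lemma J_diff: "x \<in> J \<Longrightarrow> y \<in> J \<Longrightarrow> x - y \<in> J"
  using J_add[of x "- y"] J_uminus[of y] by simp

lemma J_rel: "rel v \<in> J"
proof -
  have "rel v = (\<Sum>u\<in>UNIV. if u = v then rel u else 0)"
    by simp
  also have "\<dots> = (\<Sum>u\<in>UNIV. (if u = v then 1 else 0) * rel u)"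
    by (intro sum.cong) auto
  finally show ?thesis unfolding J_def by (intro CollectI exI[of _ "\<lambda>u. if u = v then 1 else 0"])
qed

lemma J_0: "0 \<in> J"
  using J_mult[OF J_rel, of 0] by simp

lemmas J_intros = J_add J_diff J_uminus J_rel J_mult

text \<open>Weights for which the listed monomials \<open>GB\<close> are the leading monomials of elements of
  the ideal \<open>J\<close>; they were found by computing a Groebner basis.\<close>

fun wgt :: "vi \<Rightarrow> nat" where
"wgt P0 = 1"
| "wgt P12 = 55"
| "wgt P13 = 116"
| "wgt P14 = 105"
| "wgt P23 = 108"
| "wgt P24 = 112"
| "wgt P34 = 58"
| "wgt Q1 = 127"
| "wgt Q2 = 127"
| "wgt Q3 = 122"
| "wgt Q4 = 128"
| "wgt R1 = 98"
| "wgt R2 = 208"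
| "wgt TT = 145"

definition wbelow :: "('v \<Rightarrow> nat) \<Rightarrow> nat \<Rightarrow> 'v qpoly \<Rightarrow> bool"
  where "wbelow w n p \<longleftrightarrow> (\<forall>m\<in>Poly_Mapping.keys p. wt w m < n)"

abbreviation below :: "nat \<Rightarrow> vi qpoly \<Rightarrow> bool"
  where "below \<equiv> wbelow wgt"

lemma wbelow_0: "wbelow w n 0"
  by (simp add: wbelow_def)

lemma wbelow_add: "wbelow w n p \<Longrightarrow> wbelow w n q \<Longrightarrow> wbelow w n (p + q)"
  using keys_add[of p q] by (auto simp: wbelow_def)

lemma wbelow_uminus: "wbelow w n p \<Longrightarrow> wbelow w n (- p)"
  by (simp add: wbelow_def)

lemma wbelow_diff: "wbelow w n p \<Longrightarrow> wbelow w n q \<Longrightarrow> wbelow w n (p - q)"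
  using wbelow_add[of w n p "- q"] wbelow_uminus[of w n q] by simp

lemma wbelow_Const_mult: "wbelow w n p \<Longrightarrow> wbelow w n (Const c * p)"
  by (auto simp: wbelow_def in_keys_iff lookup_Const_mult)

lemma wbelow_numeral_mult: "wbelow w n p \<Longrightarrow> wbelow w n (numeral k * p)"
  using wbelow_Const_mult[of w n p "numeral k"] by simp

lemma wbelow_mon: "wbelow w n (mon m) \<longleftrightarrow> wt w m < n"
  by (simp add: wbelow_def)

lemma wbelow_Var2: "w a + w b < n \<Longrightarrow> wbelow w n (Var a * Var b)"
  and wbelow_Var3: "w a + (w b + w c) < n \<Longrightarrow> wbelow w n (Var a * (Var b * Var c))"
  and wbelow_Var4: "w a + (w b + (w c + w d)) < n \<Longrightarrow> wbelow w n (Var a * (Var b * (Var c * Var d)))"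
  unfolding Var_conv_mon mon_add[symmetric] wbelow_mon by (simp_all add: wt_add)

lemma wbelow_mult:
  assumes "\<And>m. m \<in> Poly_Mapping.keys p \<Longrightarrow> wt w m \<le> k" "wbelow w n q"
  shows "wbelow w (k + n) (p * q)"
  unfolding wbelow_def
proof
  fix m assume "m \<in> Poly_Mapping.keys (p * q)"
  then obtain a b where "m = a + b" "a \<in> Poly_Mapping.keys p" "b \<in> Poly_Mapping.keys q"
    using keys_mult by blast
  then show "wt w m < k + n"
    using assms by (fastforce simp: wbelow_def wt_add intro: add_le_less_mono)
qed

lemmas below_intros = wbelow_add wbelow_diff wbelow_uminus wbelow_numeral_mult
  wbelow_Var2 wbelow_Var3 wbelow_Var4

definition ml :: "'v list \<Rightarrow> 'v monom"
  where "ml L = (\<Sum>v\<leftarrow>L. Poly_Mapping.single v 1)"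

lemma ml_simps [simp]: "ml [] = 0" "ml (v # L) = Poly_Mapping.single v 1 + ml L"
  by (simp_all add: ml_def)

text \<open>Some non-zero multiple of the monomial is congruent modulo \<open>J\<close> to monomials
  of strictly smaller weight, so the monomial can be eliminated. Only weights are compared; no order
  on monomials is chosen.\<close>

definition gred :: "vi list \<Rightarrow> bool"
  where "gred L \<longleftrightarrow> (\<exists>c r. c \<noteq> 0 \<and> Const c * mon (ml L) - r \<in> J \<and> below (wt wgt (ml L)) r)"

lemma gredI:
  assumes "numeral c * prod_list (map Var L) = r + x" "x \<in> J" "below (sum_list (map wgt L)) r"
  shows "gred L"
proof -
  have 1: "prod_list (map Var L) = mon (ml L)"
    by (induction L) (simp_all add: mon_add Var_conv_mon)
  have 2: "sum_list (map wgt L) = wt wgt (ml L)"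
    by (induction L) (simp_all add: wt_add)
  have "Const (numeral c) * mon (ml L) - r = x"
    using assms(1) by (simp add: 1)
  then show ?thesis
    using assms(2,3) unfolding gred_def 2
    by (intro exI[of _ "numeral c"] exI[of _ r]) simp
qed

definition GB :: "vi list list"
  where "GB = [[R1, R2],
  [P34, R2],
  [P24, TT],
  [Q1, Q4],
  [P14, TT],
  [P13, TT],
  [P12, R2],
  [P13, Q3],
  [P24, Q4],
  [P13, Q1],
  [P24, Q2],
  [P12, P34],
  [P13, P24],
  [P14, P23],
  [P12, Q1, Q2],
  [P34, Q3, Q4],
  [P12, P14, Q1],
  [P14, P34, Q4],
  [P23, P34, Q3],
  [P12, P23, Q2],
  [P23, Q2, Q3],
  [Q3, Q4, R1],
  [P14, P24, R1],
  [Q1, Q2, R1],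
  [P23, P24, P34],
  [P13, P14, R1],
  [P12, P13, P23],
  [P23, P24, R1],
  [P13, P23, R1],
  [P13, P14, P34],
  [P12, P14, P24],
  [P14, Q4, R1],
  [P14, Q1, R1],
  [P23, Q3, R1],
  [P23, Q2, R1]]"

text \<open>Each case is a certificate: an identity between a multiple of the monomial, the lighter
  remainder \<open>r\<close> and an explicit combination \<open>x\<close> of the quadrics. The
  fourteen quadratic entries use a single quadric, the cubic ones have linear coefficients. That the
  list is long enough follows later from the independence of the monomials divisible by no
  entry.\<close>

lemma gred_GB: "\<forall>L\<in>set GB. gred L"
proof -
  have 0: "gred [R1, R2]"
    by (rule gredI[where c = "num.Bit0 (num.Bit0 num.One)"
        and r = "Var TT * Var TT + 2 * (Var R1 * Var TT) + Var P13 * Var P13 + Var P24 * Var P24 + Var P23 * Var P23 + Var P14 * Var P14 + Var R1 * Var R1 + Var P34 * Var P34 + Var P12 * Var P12 - Var Q4 * Var Q4 - Var Q1 * Var Q1 - Var Q2 * Var Q2 - Var Q3 * Var Q3 - 3 * (Var P0 * Var P0)"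
        and x = "- (rel P0)"];
      (intro J_intros below_intros)?; simp add: algebra_simps)
  have 1: "gred [P34, R2]"
    by (rule gredI[where c = "num.Bit0 num.One"
        and r = "Var Q1 * Var Q2 + Var P13 * Var P23 + Var P14 * Var P24 + Var P34 * Var TT + Var P34 * Var R1 - Var P0 * Var P12"
        and x = "rel P12"];
      (intro J_intros below_intros)?; simp add: algebra_simps)
  have 2: "gred [P24, TT]"
    by (rule gredI[where c = "num.One"
        and r = "Var P24 * Var R1 + Var P0 * Var P13 - Var Q1 * Var Q3 - Var P12 * Var P23 - Var P14 * Var P34"
        and x = "- (rel P13)"];
      (intro J_intros below_intros)?; simp add: algebra_simps)
  have 3: "gred [Q1, Q4]"
    by (rule gredI[where c = "num.One"
        and r = "Var P23 * Var TT + Var P23 * Var R1 + Var P0 * Var P14 - Var P13 * Var P34 - Var P12 * Var P24"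
        and x = "- (rel P14)"];
      (intro J_intros below_intros)?; simp add: algebra_simps)
  have 4: "gred [P14, TT]"
    by (rule gredI[where c = "num.One"
        and r = "Var Q2 * Var Q3 + Var P12 * Var P13 + Var P24 * Var P34 - Var P14 * Var R1 - Var P0 * Var P23"
        and x = "rel P23"];
      (intro J_intros below_intros)?; simp add: algebra_simps)
  have 5: "gred [P13, TT]"
    by (rule gredI[where c = "num.One"
        and r = "Var P13 * Var R1 + Var P0 * Var P24 - Var Q2 * Var Q4 - Var P23 * Var P34 - Var P12 * Var P14"
        and x = "- (rel P24)"];
      (intro J_intros below_intros)?; simp add: algebra_simps)
  have 6: "gred [P12, R2]"
    by (rule gredI[where c = "num.Bit0 num.One"
        and r = "Var Q3 * Var Q4 + Var P13 * Var P14 + Var P23 * Var P24 + Var P12 * Var TT + Var P12 * Var R1 - Var P0 * Var P34"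
        and x = "rel P34"];
      (intro J_intros below_intros)?; simp add: algebra_simps)
  have 7: "gred [P13, Q3]"
    by (rule gredI[where c = "num.One"
        and r = "- (Var P14 * Var Q4) - Var P12 * Var Q2 - Var P0 * Var Q1"
        and x = "rel Q1"];
      (intro J_intros below_intros)?; simp add: algebra_simps)
  have 8: "gred [P24, Q4]"
    by (rule gredI[where c = "num.One"
        and r = "- (Var P23 * Var Q3) - Var P12 * Var Q1 - Var P0 * Var Q2"
        and x = "rel Q2"];
      (intro J_intros below_intros)?; simp add: algebra_simps)
  have 9: "gred [P13, Q1]"
    by (rule gredI[where c = "num.One"
        and r = "- (Var P23 * Var Q2) - Var P34 * Var Q4 - Var P0 * Var Q3"
        and x = "rel Q3"];
      (intro J_intros below_intros)?; simp add: algebra_simps)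
  have 10: "gred [P24, Q2]"
    by (rule gredI[where c = "num.One"
        and r = "- (Var P14 * Var Q1) - Var P34 * Var Q3 - Var P0 * Var Q4"
        and x = "rel Q4"];
      (intro J_intros below_intros)?; simp add: algebra_simps)
  have 11: "gred [P12, P34]"
    by (rule gredI[where c = "num.One"
        and r = "Var P0 * Var R1"
        and x = "rel R1"];
      (intro J_intros below_intros)?; simp add: algebra_simps)
  have 12: "gred [P13, P24]"
    by (rule gredI[where c = "num.One"
        and r = "Var P0 * Var R2"
        and x = "rel R2"];
      (intro J_intros below_intros)?; simp add: algebra_simps)
  have 13: "gred [P14, P23]"
    by (rule gredI[where c = "num.One"
        and r = "Var P0 * Var R2 - Var P0 * Var TT"
        and x = "rel TT"];
      (intro J_intros below_intros)?; simp add: algebra_simps)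
  have 14: "gred [P12, Q1, Q2]"
    by (rule gredI[where c = "num.Bit0 (num.Bit1 num.One)"
        and r = "3 * (Var P0 * (Var TT * Var TT)) + 3 * (Var P0 * (Var P34 * Var P34)) + 3 * (Var P0 * (Var P12 * Var P12)) - 3 * (Var P0 * (Var Q1 * Var Q1)) - 3 * (Var P0 * (Var Q2 * Var Q2)) - 3 * (Var P0 * (Var R1 * Var R1)) - 3 * (Var P0 * (Var P0 * Var P0))"
        and x = "Var P13 * rel P13 + Var P14 * rel P14 + Var P23 * rel P23 + Var P24 * rel P24 + 2 * (Var Q1 * rel Q1) + 2 * (Var Q2 * rel Q2) + 8 * (Var R2 * rel R1) + 2 * (Var TT * rel R2) - Var P0 * rel P0 - 4 * (Var R1 * rel R1) - 2 * (Var R1 * rel TT) - 2 * (Var TT * rel TT) - 2 * (Var R1 * rel R2) - 2 * (Var P12 * rel P12) - 2 * (Var P34 * rel P34) - Var Q3 * rel Q3 - Var Q4 * rel Q4 - 4 * (Var TT * rel R1)"];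
      (intro J_intros below_intros)?; simp add: algebra_simps)
  have 15: "gred [P34, Q3, Q4]"
    by (rule gredI[where c = "num.Bit0 (num.Bit1 num.One)"
        and r = "3 * (Var P0 * (Var TT * Var TT)) + 3 * (Var P0 * (Var P34 * Var P34)) + 3 * (Var P0 * (Var P12 * Var P12)) - 3 * (Var P0 * (Var Q4 * Var Q4)) - 3 * (Var P0 * (Var Q3 * Var Q3)) - 3 * (Var P0 * (Var R1 * Var R1)) - 3 * (Var P0 * (Var P0 * Var P0))"
        and x = "Var P13 * rel P13 + Var P14 * rel P14 + Var P23 * rel P23 + Var P24 * rel P24 + 2 * (Var Q3 * rel Q3) + 2 * (Var Q4 * rel Q4) + 8 * (Var R2 * rel R1) + 2 * (Var TT * rel R2) - Var P0 * rel P0 - 4 * (Var R1 * rel R1) - 2 * (Var R1 * rel TT) - 2 * (Var TT * rel TT) - 2 * (Var R1 * rel R2) - 2 * (Var P12 * rel P12) - 2 * (Var P34 * rel P34) - Var Q1 * rel Q1 - Var Q2 * rel Q2 - 4 * (Var TT * rel R1)"];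
      (intro J_intros below_intros)?; simp add: algebra_simps)
  have 16: "gred [P12, P14, Q1]"
    by (rule gredI[where c = "num.Bit0 num.One"
        and r = "Var P0 * (Var Q3 * Var TT) + Var P0 * (Var P24 * Var Q1) - Var P0 * (Var P14 * Var Q2) - Var P0 * (Var Q3 * Var R1) - Var P0 * (Var P12 * Var Q4)"
        and x = "Var P12 * rel Q4 + Var P14 * rel Q2 + Var Q3 * rel R2 - Var P24 * rel Q1 - Var Q3 * rel R1 - Var Q3 * rel TT"];
      (intro J_intros below_intros)?; simp add: algebra_simps)
  have 17: "gred [P14, P34, Q4]"
    by (rule gredI[where c = "num.Bit0 num.One"
        and r = "Var P0 * (Var Q2 * Var TT) + Var P0 * (Var P13 * Var Q4) - Var P0 * (Var P14 * Var Q3) - Var P0 * (Var Q2 * Var R1) - Var P0 * (Var P34 * Var Q1)"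
        and x = "Var P14 * rel Q3 + Var Q2 * rel R2 + Var P34 * rel Q1 - Var P13 * rel Q4 - Var Q2 * rel TT - Var Q2 * rel R1"];
      (intro J_intros below_intros)?; simp add: algebra_simps)
  have 18: "gred [P23, P34, Q3]"
    by (rule gredI[where c = "num.Bit0 num.One"
        and r = "Var P0 * (Var Q1 * Var TT) + Var P0 * (Var P24 * Var Q3) - Var P0 * (Var P23 * Var Q4) - Var P0 * (Var Q1 * Var R1) - Var P0 * (Var P34 * Var Q2)"
        and x = "Var P23 * rel Q4 + Var P34 * rel Q2 + Var Q1 * rel R2 - Var Q1 * rel TT - Var P24 * rel Q3 - Var Q1 * rel R1"];
      (intro J_intros below_intros)?; simp add: algebra_simps)
  have 19: "gred [P12, P23, Q2]"
    by (rule gredI[where c = "num.Bit0 num.One"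
        and r = "Var P0 * (Var Q4 * Var TT) + Var P0 * (Var P13 * Var Q2) - Var P0 * (Var P23 * Var Q1) - Var P0 * (Var Q4 * Var R1) - Var P0 * (Var P12 * Var Q3)"
        and x = "Var P12 * rel Q3 + Var P23 * rel Q1 + Var Q4 * rel R2 - Var P13 * rel Q2 - Var Q4 * rel R1 - Var Q4 * rel TT"];
      (intro J_intros below_intros)?; simp add: algebra_simps)
  have 20: "gred [P23, Q2, Q3]"
    by (rule gredI[where c = "num.Bit0 (num.Bit0 (num.Bit1 num.One))"
        and r = "12 * (Var P0 * (Var R2 * Var TT)) + 3 * (Var P0 * (Var Q4 * Var Q4)) + 3 * (Var P0 * (Var Q1 * Var Q1)) + 3 * (Var P0 * (Var P23 * Var P23)) + 3 * (Var P0 * (Var P14 * Var P14)) + 3 * (Var P0 * (Var R1 * Var R1)) + 3 * (Var P0 * (Var P0 * Var P0)) - 9 * (Var P0 * (Var TT * Var TT)) - 3 * (Var P0 * (Var Q2 * Var Q2)) - 3 * (Var P0 * (Var Q3 * Var Q3)) - 6 * (Var P0 * (Var R1 * Var TT)) - 3 * (Var P0 * (Var P13 * Var P13)) - 3 * (Var P0 * (Var P24 * Var P24)) - 3 * (Var P0 * (Var P34 * Var P34)) - 3 * (Var P0 * (Var P12 * Var P12))"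
        and x = "Var P0 * rel P0 + 4 * (Var R1 * rel R1) + 8 * (Var R1 * rel TT) + 8 * (Var TT * rel TT) + 2 * (Var P12 * rel P12) + 2 * (Var P13 * rel P13) + 2 * (Var P24 * rel P24) + 2 * (Var P34 * rel P34) + 4 * (Var Q2 * rel Q2) + 4 * (Var Q3 * rel Q3) + 4 * (Var TT * rel R1) + 4 * (Var TT * rel R2) - 4 * (Var R1 * rel R2) - 4 * (Var P14 * rel P14) - 4 * (Var P23 * rel P23) - 2 * (Var Q1 * rel Q1) - 2 * (Var Q4 * rel Q4) - 8 * (Var R2 * rel R1)"];
      (intro J_intros below_intros)?; simp add: algebra_simps)
  have 21: "gred [Q3, Q4, R1]"
    by (rule gredI[where c = "num.Bit0 num.One"
        and r = "Var P12 * (Var TT * Var TT) + Var P12 * (Var P12 * Var P12) + Var P0 * (Var P34 * Var R1) - Var P12 * (Var Q4 * Var Q4) - Var P12 * (Var Q3 * Var Q3) - Var P12 * (Var R1 * Var R1) - Var P0 * (Var P0 * Var P12)"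
        and x = "Var P34 * rel R1 - 2 * (Var P0 * rel P12) - Var P12 * rel P0 - Var P13 * rel P23 - Var P14 * rel P24 - 2 * (Var P34 * rel R2) - 2 * (Var P34 * rel TT) - Var Q1 * rel Q2 - 2 * (Var R1 * rel P34) - Var P23 * rel P13 - Var P24 * rel P14 - Var Q2 * rel Q1"];
      (intro J_intros below_intros)?; simp add: algebra_simps)
  have 22: "gred [P14, P24, R1]"
    by (rule gredI[where c = "num.Bit0 num.One"
        and r = "Var P24 * (Var P24 * Var P34) + Var P14 * (Var P14 * Var P34) + Var P0 * (Var P12 * Var R1) - Var P34 * (Var Q3 * Var Q3) - Var P0 * (Var P0 * Var P34)"
        and x = "Var P0 * rel P34 + Var P12 * rel R2 + Var P12 * rel TT + Var Q3 * rel Q4 + Var P14 * rel P13 + Var P24 * rel P23"];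
      (intro J_intros below_intros)?; simp add: algebra_simps)
  have 23: "gred [Q1, Q2, R1]"
    by (rule gredI[where c = "num.Bit0 num.One"
        and r = "Var P34 * (Var TT * Var TT) + Var P34 * (Var P34 * Var P34) + Var P0 * (Var P12 * Var R1) - Var P34 * (Var Q1 * Var Q1) - Var P34 * (Var Q2 * Var Q2) - Var P34 * (Var R1 * Var R1) - Var P0 * (Var P0 * Var P34)"
        and x = "Var P12 * rel R1 - 2 * (Var P0 * rel P34) - Var P34 * rel P0 - Var P13 * rel P14 - Var P23 * rel P24 - 2 * (Var P12 * rel R2) - 2 * (Var P12 * rel TT) - Var Q3 * rel Q4 - Var P14 * rel P13 - Var P24 * rel P23 - Var Q4 * rel Q3 - 2 * (Var R1 * rel P12)"];
      (intro J_intros below_intros)?; simp add: algebra_simps)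
  have 24: "gred [P23, P24, P34]"
    by (rule gredI[where c = "num.Bit0 (num.Bit1 num.One)"
        and r = "3 * (Var P0 * (Var P24 * Var P24)) + 3 * (Var P0 * (Var P23 * Var P23)) + 3 * (Var P0 * (Var P34 * Var P34)) - 3 * (Var P0 * (Var Q1 * Var Q1)) - 3 * (Var P0 * (Var P0 * Var P0))"
        and x = "Var R1 * rel TT + Var TT * rel TT + Var R1 * rel R2 + Var P12 * rel P12 + Var P13 * rel P13 + Var P14 * rel P14 + 2 * (Var Q1 * rel Q1) + 2 * (Var R2 * rel R1) - Var P0 * rel P0 - Var R1 * rel R1 - 2 * (Var P23 * rel P23) - 2 * (Var P24 * rel P24) - 2 * (Var P34 * rel P34) - Var Q2 * rel Q2 - Var Q3 * rel Q3 - Var Q4 * rel Q4 - Var TT * rel R1 - Var TT * rel R2"];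
      (intro J_intros below_intros)?; simp add: algebra_simps)
  have 25: "gred [P13, P14, R1]"
    by (rule gredI[where c = "num.Bit0 num.One"
        and r = "Var P12 * (Var P13 * Var P13) + Var P12 * (Var P14 * Var P14) + Var P0 * (Var P34 * Var R1) - Var P12 * (Var Q2 * Var Q2) - Var P0 * (Var P0 * Var P12)"
        and x = "Var P0 * rel P12 + Var P13 * rel P23 + Var P14 * rel P24 + Var P34 * rel R2 + Var P34 * rel TT + Var Q2 * rel Q1"];
      (intro J_intros below_intros)?; simp add: algebra_simps)
  have 26: "gred [P12, P13, P23]"
    by (rule gredI[where c = "num.Bit0 (num.Bit1 num.One)"
        and r = "3 * (Var P0 * (Var P13 * Var P13)) + 3 * (Var P0 * (Var P23 * Var P23)) + 3 * (Var P0 * (Var P12 * Var P12)) - 3 * (Var P0 * (Var Q4 * Var Q4)) - 3 * (Var P0 * (Var P0 * Var P0))"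
        and x = "Var R1 * rel TT + Var TT * rel TT + Var R1 * rel R2 + Var P14 * rel P14 + Var P24 * rel P24 + Var P34 * rel P34 + 2 * (Var Q4 * rel Q4) + 2 * (Var R2 * rel R1) - Var P0 * rel P0 - Var R1 * rel R1 - 2 * (Var P12 * rel P12) - 2 * (Var P13 * rel P13) - 2 * (Var P23 * rel P23) - Var Q1 * rel Q1 - Var Q2 * rel Q2 - Var Q3 * rel Q3 - Var TT * rel R1 - Var TT * rel R2"];
      (intro J_intros below_intros)?; simp add: algebra_simps)
  have 27: "gred [P23, P24, R1]"
    by (rule gredI[where c = "num.Bit0 num.One"
        and r = "Var P12 * (Var P24 * Var P24) + Var P12 * (Var P23 * Var P23) + Var P0 * (Var P34 * Var R1) - Var P12 * (Var Q1 * Var Q1) - Var P0 * (Var P0 * Var P12)"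
        and x = "Var P0 * rel P12 + Var P34 * rel R2 + Var P34 * rel TT + Var Q1 * rel Q2 + Var P23 * rel P13 + Var P24 * rel P14"];
      (intro J_intros below_intros)?; simp add: algebra_simps)
  have 28: "gred [P13, P23, R1]"
    by (rule gredI[where c = "num.Bit0 num.One"
        and r = "Var P13 * (Var P13 * Var P34) + Var P23 * (Var P23 * Var P34) + Var P0 * (Var P12 * Var R1) - Var P34 * (Var Q4 * Var Q4) - Var P0 * (Var P0 * Var P34)"
        and x = "Var P0 * rel P34 + Var P13 * rel P14 + Var P23 * rel P24 + Var P12 * rel R2 + Var P12 * rel TT + Var Q4 * rel Q3"];
      (intro J_intros below_intros)?; simp add: algebra_simps)
  have 29: "gred [P13, P14, P34]"
    by (rule gredI[where c = "num.Bit0 (num.Bit1 num.One)"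
        and r = "3 * (Var P0 * (Var P13 * Var P13)) + 3 * (Var P0 * (Var P14 * Var P14)) + 3 * (Var P0 * (Var P34 * Var P34)) - 3 * (Var P0 * (Var Q2 * Var Q2)) - 3 * (Var P0 * (Var P0 * Var P0))"
        and x = "Var R1 * rel TT + Var TT * rel TT + Var R1 * rel R2 + Var P12 * rel P12 + Var P23 * rel P23 + Var P24 * rel P24 + 2 * (Var Q2 * rel Q2) + 2 * (Var R2 * rel R1) - Var P0 * rel P0 - Var R1 * rel R1 - 2 * (Var P13 * rel P13) - 2 * (Var P14 * rel P14) - 2 * (Var P34 * rel P34) - Var Q1 * rel Q1 - Var Q3 * rel Q3 - Var Q4 * rel Q4 - Var TT * rel R1 - Var TT * rel R2"];
      (intro J_intros below_intros)?; simp add: algebra_simps)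
  have 30: "gred [P12, P14, P24]"
    by (rule gredI[where c = "num.Bit0 (num.Bit1 num.One)"
        and r = "3 * (Var P0 * (Var P24 * Var P24)) + 3 * (Var P0 * (Var P14 * Var P14)) + 3 * (Var P0 * (Var P12 * Var P12)) - 3 * (Var P0 * (Var Q3 * Var Q3)) - 3 * (Var P0 * (Var P0 * Var P0))"
        and x = "Var R1 * rel TT + Var TT * rel TT + Var R1 * rel R2 + Var P13 * rel P13 + Var P23 * rel P23 + Var P34 * rel P34 + 2 * (Var Q3 * rel Q3) + 2 * (Var R2 * rel R1) - Var P0 * rel P0 - Var R1 * rel R1 - 2 * (Var P12 * rel P12) - 2 * (Var P14 * rel P14) - 2 * (Var P24 * rel P24) - Var Q1 * rel Q1 - Var Q2 * rel Q2 - Var Q4 * rel Q4 - Var TT * rel R1 - Var TT * rel R2"];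
      (intro J_intros below_intros)?; simp add: algebra_simps)
  have 31: "gred [P14, Q4, R1]"
    by (rule gredI[where c = "num.Bit0 num.One"
        and r = "Var P12 * (Var Q2 * Var TT) + Var P12 * (Var P13 * Var Q4) - Var P12 * (Var P14 * Var Q3) - Var P12 * (Var Q2 * Var R1) - Var P0 * (Var Q1 * Var R1)"
        and x = "Var Q1 * rel TT + Var P24 * rel Q3 + Var R1 * rel Q1 + Var Q4 * rel P23 - Var P23 * rel Q4 - Var Q1 * rel R2 - Var Q3 * rel P24 - Var TT * rel Q1"];
      (intro J_intros below_intros)?; simp add: algebra_simps)
  have 32: "gred [P14, Q1, R1]"
    by (rule gredI[where c = "num.Bit0 num.One"
        and r = "Var P34 * (Var Q3 * Var TT) + Var P24 * (Var P34 * Var Q1) - Var P14 * (Var P34 * Var Q2) - Var P34 * (Var Q3 * Var R1) - Var P0 * (Var Q4 * Var R1)"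
        and x = "Var P13 * rel Q2 + Var Q1 * rel P23 + Var Q4 * rel TT + Var R1 * rel Q4 - Var P23 * rel Q1 - Var Q2 * rel P13 - Var TT * rel Q4 - Var Q4 * rel R2"];
      (intro J_intros below_intros)?; simp add: algebra_simps)
  have 33: "gred [P23, Q3, R1]"
    by (rule gredI[where c = "num.Bit0 num.One"
        and r = "Var P12 * (Var Q1 * Var TT) + Var P12 * (Var P24 * Var Q3) - Var P12 * (Var P23 * Var Q4) - Var P12 * (Var Q1 * Var R1) - Var P0 * (Var Q2 * Var R1)"
        and x = "Var P13 * rel Q4 + Var Q2 * rel TT + Var Q3 * rel P14 + Var R1 * rel Q2 - Var P14 * rel Q3 - Var Q2 * rel R2 - Var TT * rel Q2 - Var Q4 * rel P13"];
      (intro J_intros below_intros)?; simp add: algebra_simps)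
  have 34: "gred [P23, Q2, R1]"
    by (rule gredI[where c = "num.Bit0 num.One"
        and r = "Var P34 * (Var Q4 * Var TT) + Var P13 * (Var P34 * Var Q2) - Var P23 * (Var P34 * Var Q1) - Var P34 * (Var Q4 * Var R1) - Var P0 * (Var Q3 * Var R1)"
        and x = "Var P24 * rel Q1 + Var Q2 * rel P14 + Var Q3 * rel TT + Var R1 * rel Q3 - Var P14 * rel Q2 - Var Q1 * rel P24 - Var Q3 * rel R2 - Var TT * rel Q3"];
      (intro J_intros below_intros)?; simp add: algebra_simps)
  show ?thesis
    unfolding GB_def by (simp add: 0 1 2 3 4 5 6 7 8 9 10 11 12 13 14 15 16 17 18 19 20 21 22 23 24 25 26 27 28 29 30 31 32 33 34)
qed

definition Std :: "vi monom set"
  where "Std = {m. \<forall>L\<in>set GB. \<forall>m'. m \<noteq> ml L + m'}"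

lemma keys_Const_mult: "Poly_Mapping.keys (Const c * p) \<subseteq> Poly_Mapping.keys p"
  by (auto simp: in_keys_iff lookup_Const_mult)

text \<open>A non-standard monomial is a multiple of an entry of \<open>GB\<close>; rewriting that
  entry strictly lowers the weight of every monomial, so the reduction terminates.\<close>

lemma normal_form_mon: "\<exists>r. mon m - r \<in> J \<and> Poly_Mapping.keys r \<subseteq> Std"
proof (induction "wt wgt m" arbitrary: m rule: less_induct)
  case less
  show ?case
  proof (cases "m \<in> Std")
    case True
    then show ?thesis by (intro exI[of _ "mon m"]) (simp add: J_0)
  next
    case False
    then obtain L m' where L: "L \<in> set GB" and m: "m = ml L + m'" by (auto simp: Std_def)
    obtain c r where c: "c \<noteq> 0" "Const c * mon (ml L) - r \<in> J" "below (wt wgt (ml L)) r"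
      using gred_GB L unfolding gred_def by blast
    define p where "p = Const (1 / c) * (mon m' * r)"
    have "Const (1 / c) * Const c = (1 :: vi qpoly)"
      using c(1) by (simp flip: Const_mult)
    then have "mon m = Const (1 / c) * Const c * mon m" by simp
    also have "\<dots> = Const (1 / c) * (mon m' * (Const c * mon (ml L)))"
      by (simp add: m mon_add mult_ac)
    finally have "mon m - p = Const (1 / c) * (mon m' * (Const c * mon (ml L) - r))"
      by (simp add: p_def right_diff_distrib)
    then have mp: "mon m - p \<in> J"
      using J_mult[OF J_mult[OF c(2)]] by simp
    have "below (wt wgt m) p"
      using wbelow_Const_mult[OF wbelow_mult[of "mon m'" wgt "wt wgt m'", OF _ c(3)]]
      by (simp add: p_def m wt_add add.commute)
    then have "\<exists>r. mon k - r \<in> J \<and> Poly_Mapping.keys r \<subseteq> Std" if "k \<in> Poly_Mapping.keys p" for k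
      using less.hyps that by (auto simp: wbelow_def)
    then obtain R where R: "\<And>k. k \<in> Poly_Mapping.keys p \<Longrightarrow> mon k - R k \<in> J \<and> Poly_Mapping.keys (R k) \<subseteq> Std"
      by metis
    define q where "q = (\<Sum>k\<in>Poly_Mapping.keys p. Const (Poly_Mapping.lookup p k) * R k)"
    have "p - q = (\<Sum>k\<in>Poly_Mapping.keys p. Const (Poly_Mapping.lookup p k) * (mon k - R k))"
      by (simp add: q_def right_diff_distrib sum_subtractf flip: poly_eq_sum_monos)
    also have "\<dots> \<in> J"
    proof -
      have "(\<Sum>k\<in>A. Const (Poly_Mapping.lookup p k) * (mon k - R k)) \<in> J" if "A \<subseteq> Poly_Mapping.keys p" "finite A" for A
        using that(2,1) by (induction A) (use R in \<open>auto simp: J_0 intro!: J_add J_mult\<close>)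
      then show ?thesis by simp
    qed
    finally have "mon m - q \<in> J"
      using J_add[OF mp, of "p - q"] by simp
    moreover have "Poly_Mapping.keys q \<subseteq> Std"
    proof -
      have "Poly_Mapping.keys (Const (Poly_Mapping.lookup p k) * R k) \<subseteq> Std" if "k \<in> Poly_Mapping.keys p" for k
        using R[OF that] keys_Const_mult[of "Poly_Mapping.lookup p k" "R k"] by blast
      then show ?thesis
        unfolding q_def by (intro order.trans[OF keys_sum] UN_least)
    qed
    ultimately show ?thesis by blast
  qed
qed

lemma normal_form: "\<exists>r. p - r \<in> J \<and> Poly_Mapping.keys r \<subseteq> Std"
proof -
  have "\<exists>r. (\<Sum>m\<in>A. Const (h m) * mon m) - r \<in> J \<and> Poly_Mapping.keys r \<subseteq> Std" if "finite A" for A and h :: "vi monom \<Rightarrow> rat"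
    using that
  proof (induction A)
    case empty
    then show ?case by (intro exI[of _ 0]) (simp add: J_0)
  next
    case (insert m A)
    obtain r where r: "(\<Sum>m\<in>A. Const (h m) * mon m) - r \<in> J" "Poly_Mapping.keys r \<subseteq> Std"
      using insert.IH by blast
    obtain r' where r': "mon m - r' \<in> J" "Poly_Mapping.keys r' \<subseteq> Std"
      using normal_form_mon by blast
    have "Const (h m) * (mon m - r') + ((\<Sum>m\<in>A. Const (h m) * mon m) - r) \<in> J"
      using r(1) r'(1) by (intro J_add J_mult)
    then have "(\<Sum>m\<in>insert m A. Const (h m) * mon m) - (Const (h m) * r' + r) \<in> J"
      using insert.hyps by (simp add: algebra_simps)
    moreover have "Poly_Mapping.keys (Const (h m) * r' + r) \<subseteq> Std"
      using r(2) r'(2) keys_add[of "Const (h m) * r'" r] keys_Const_mult[of "h m" r'] by blast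
    ultimately show ?case by blast
  qed
  from this[of "Poly_Mapping.keys p" "Poly_Mapping.lookup p"] show ?thesis
    by (simp flip: poly_eq_sum_monos)
qed

section \<open>Independence of the standard monomials\<close>

datatype pc = Z1 | Z2 | Z3 | Z4 | CW | CV | CE

lemma UNIV_pc: "UNIV = {Z1, Z2, Z3, Z4, CW, CV, CE}"
  using pc.exhaust by auto

text \<open>The eight points are put in four clusters of two nearby points; the centres of the
  clusters are \<open>0\<close>, \<open>CW\<close>, \<open>CE\<close> and \<open>CE + CV\<close>. For the weights \<open>om\<close> the
  leading form of each of the fourteen invariants is a monomial.\<close>

definition pt :: "coord \<Rightarrow> pc qpoly"
  where "pt u = (case u of
      XX i \<Rightarrow> if i = 0 then - Var Z1 else if i = 1 then Var Z1
        else if i = 2 then Var CW - Var Z2 else if i = 3 then Var CW + Var Z2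
        else if i = 4 then Var CE - Var Z3 else if i = 5 then Var CE + Var Z3
        else if i = 6 then Var CE + Var CV - Var Z4 else Var CE + Var CV + Var Z4
    | YY i \<Rightarrow> 1)"

lemma pt_simps:
  "pt (XX 0) = - Var Z1" "pt (XX 1) = Var Z1"
  "pt (XX 2) = Var CW - Var Z2" "pt (XX 3) = Var CW + Var Z2"
  "pt (XX 4) = Var CE - Var Z3" "pt (XX 5) = Var CE + Var Z3"
  "pt (XX 6) = Var CE + Var CV - Var Z4" "pt (XX 7) = Var CE + Var CV + Var Z4"
  "pt (YY i) = 1"
  by (simp_all add: pt_def)

fun om :: "pc \<Rightarrow> nat" where
  "om CW = 1" | "om CV = 1" | "om CE = 2" | "om _ = 0"

text \<open>The leading monomials can be read off: the bracket inside a cluster is a multiple of its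
  \<open>Z\<close>, a scalar product has the squared distance of the two centres as top form, and a
  volume the product of the three distances. The heaviest variable of each distance survives; for
  \<open>TT\<close> the common term \<open>CE\<close>^4 cancels.\<close>

fun el :: "vi \<Rightarrow> pc list" where
  "el P0 = [Z1, Z2, Z3, Z4]"
| "el P12 = [Z3, Z4, CW, CW]"
| "el P13 = [Z2, Z4, CE, CE]"
| "el P14 = [Z2, Z3, CE, CE]"
| "el P23 = [Z1, Z4, CE, CE]"
| "el P24 = [Z1, Z3, CE, CE]"
| "el P34 = [Z1, Z2, CV, CV]"
| "el Q1 = [Z1, CV, CE, CE]"
| "el Q2 = [Z2, CV, CE, CE]"
| "el Q3 = [Z3, CW, CE, CE]"
| "el Q4 = [Z4, CW, CE, CE]"
| "el R1 = [CW, CW, CV, CV]"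
| "el R2 = [CE, CE, CE, CE]"
| "el TT = [CW, CV, CE, CE]"

definition lead :: "pc qpoly \<Rightarrow> pc monom \<Rightarrow> bool"
  where "lead p \<alpha> \<longleftrightarrow> (\<exists>c r. c \<noteq> 0 \<and> p = Const c * mon \<alpha> + r \<and> wbelow om (wt om \<alpha>) r)"

lemma mon_ml: "mon (ml L) = prod_list (map Var L)"
  by (induction L) (simp_all add: mon_add Var_conv_mon)

lemma wt_ml: "wt w (ml L) = sum_list (map w L)"
  by (induction L) (simp_all add: wt_add)

lemma lookup_ml: "Poly_Mapping.lookup (ml L) x = count_list L x"
  by (induction L) (simp_all add: lookup_add lookup_single)

lemma leadI:
  assumes "c \<noteq> 0" "p = Const c * prod_list (map Var L) + r" "wbelow om (sum_list (map om L)) r"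
  shows "lead p (ml L)"
  using assms unfolding lead_def mon_ml wt_ml by blast

lemma lead_1: "lead 1 0"
  unfolding lead_def by (intro exI[of _ 1] exI[of _ 0]) (simp add: wbelow_0)

lemma lead_mult:
  assumes "lead p \<alpha>" "lead q \<beta>"
  shows "lead (p * q) (\<alpha> + \<beta>)"
proof -
  obtain c r where p: "c \<noteq> 0" "p = Const c * mon \<alpha> + r" "wbelow om (wt om \<alpha>) r"
    using assms(1) unfolding lead_def by blast
  obtain d s where q: "d \<noteq> 0" "q = Const d * mon \<beta> + s" "wbelow om (wt om \<beta>) s"
    using assms(2) unfolding lead_def by blast
  have "p * q = Const (c * d) * mon (\<alpha> + \<beta>) + (Const c * (mon \<alpha> * s) + (Const d * (mon \<beta> * r) + r * s))"
    unfolding p(2) q(2) by (simp add: Const_mult mon_add algebra_simps)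
  moreover have "wbelow om (wt om (\<alpha> + \<beta>)) (mon \<alpha> * s)"
    using wbelow_mult[of "mon \<alpha>" om "wt om \<alpha>", OF _ q(3)] by (simp add: wt_add)
  moreover have "wbelow om (wt om (\<alpha> + \<beta>)) (mon \<beta> * r)"
    using wbelow_mult[of "mon \<beta>" om "wt om \<beta>", OF _ p(3)] by (simp add: wt_add add.commute)
  moreover have "wbelow om (wt om (\<alpha> + \<beta>)) (r * s)"
    using wbelow_mult[OF _ q(3), of r "wt om \<alpha>"] p(3) by (simp add: wt_add wbelow_def less_imp_le)
  ultimately show ?thesis
    unfolding lead_def using p(1) q(1)
    by (intro exI[of _ "c * d"]
        exI[of _ "Const c * (mon \<alpha> * s) + (Const d * (mon \<beta> * r) + r * s)"])
      (auto intro!: wbelow_add wbelow_Const_mult)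
qed

lemma lead_sb: "lead (subst pt (sb v)) (ml (el v))"
proof -
  have P0: "lead (subst pt (sb P0)) (ml (el P0))"
    by (rule leadI[where L = "el P0" and c = "16" and r = "0"]; (intro below_intros wbelow_0)?; simp add: dot_def vol_def br_def pt_simps algebra_simps)
  have P12: "lead (subst pt (sb P12)) (ml (el P12))"
    by (rule leadI[where L = "el P12" and c = "-8" and r = "8 * (Var Z1 * (Var Z1 * (Var Z3 * Var Z4))) + 8 * (Var Z2 * (Var Z2 * (Var Z3 * Var Z4)))"]; (intro below_intros wbelow_0)?; simp add: dot_def vol_def br_def pt_simps algebra_simps)
  have P13: "lead (subst pt (sb P13)) (ml (el P13))"
    by (rule leadI[where L = "el P13" and c = "-8" and r = "8 * (Var Z1 * (Var Z1 * (Var Z2 * Var Z4))) + 8 * (Var Z2 * (Var Z3 * (Var Z3 * Var Z4)))"]; (intro below_intros wbelow_0)?; simp add: dot_def vol_def br_def pt_simps algebra_simps)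
  have P14: "lead (subst pt (sb P14)) (ml (el P14))"
    by (rule leadI[where L = "el P14" and c = "-8" and r = "8 * (Var Z1 * (Var Z1 * (Var Z2 * Var Z3))) + 8 * (Var Z2 * (Var Z3 * (Var Z4 * Var Z4))) - 8 * (Var Z2 * (Var Z3 * (Var CV * Var CV))) - 16 * (Var Z2 * (Var Z3 * (Var CV * Var CE)))"]; (intro below_intros wbelow_0)?; simp add: dot_def vol_def br_def pt_simps algebra_simps)
  have P23: "lead (subst pt (sb P23)) (ml (el P23))"
    by (rule leadI[where L = "el P23" and c = "-8" and r = "16 * (Var Z1 * (Var Z4 * (Var CW * Var CE))) + 8 * (Var Z1 * (Var Z2 * (Var Z2 * Var Z4))) + 8 * (Var Z1 * (Var Z3 * (Var Z3 * Var Z4))) - 8 * (Var Z1 * (Var Z4 * (Var CW * Var CW)))"]; (intro below_intros wbelow_0)?; simp add: dot_def vol_def br_def pt_simps algebra_simps)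
  have P24: "lead (subst pt (sb P24)) (ml (el P24))"
    by (rule leadI[where L = "el P24" and c = "-8" and r = "16 * (Var Z1 * (Var Z3 * (Var CW * Var CV))) + 16 * (Var Z1 * (Var Z3 * (Var CW * Var CE))) + 8 * (Var Z1 * (Var Z2 * (Var Z2 * Var Z3))) + 8 * (Var Z1 * (Var Z3 * (Var Z4 * Var Z4))) - 8 * (Var Z1 * (Var Z3 * (Var CW * Var CW))) - 8 * (Var Z1 * (Var Z3 * (Var CV * Var CV))) - 16 * (Var Z1 * (Var Z3 * (Var CV * Var CE)))"]; (intro below_intros wbelow_0)?; simp add: dot_def vol_def br_def pt_simps algebra_simps)
  have P34: "lead (subst pt (sb P34)) (ml (el P34))"
    by (rule leadI[where L = "el P34" and c = "-8" and r = "8 * (Var Z1 * (Var Z2 * (Var Z3 * Var Z3))) + 8 * (Var Z1 * (Var Z2 * (Var Z4 * Var Z4)))"]; (intro below_intros wbelow_0)?; simp add: dot_def vol_def br_def pt_simps algebra_simps)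
  have Q1: "lead (subst pt (sb Q1)) (ml (el Q1))"
    by (rule leadI[where L = "el Q1" and c = "-8" and r = "16 * (Var Z1 * (Var CW * (Var CV * Var CE))) + 8 * (Var Z1 * (Var Z2 * (Var Z2 * Var CV))) + 8 * (Var Z1 * (Var Z3 * (Var Z3 * Var CW))) + 8 * (Var Z1 * (Var Z4 * (Var Z4 * Var CE))) + 8 * (Var Z1 * (Var CW * (Var CV * Var CV))) - 8 * (Var Z1 * (Var Z3 * (Var Z3 * Var CV))) - 8 * (Var Z1 * (Var Z3 * (Var Z3 * Var CE))) - 8 * (Var Z1 * (Var Z4 * (Var Z4 * Var CW))) - 8 * (Var Z1 * (Var CW * (Var CW * Var CV))) - 8 * (Var Z1 * (Var CV * (Var CV * Var CE)))"]; (intro below_intros wbelow_0)?; simp add: dot_def vol_def br_def pt_simps algebra_simps)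
  have Q2: "lead (subst pt (sb Q2)) (ml (el Q2))"
    by (rule leadI[where L = "el Q2" and c = "8" and r = "8 * (Var Z2 * (Var Z3 * (Var Z3 * Var CV))) + 8 * (Var Z2 * (Var Z3 * (Var Z3 * Var CE))) + 8 * (Var Z2 * (Var CV * (Var CV * Var CE))) - 8 * (Var Z1 * (Var Z1 * (Var Z2 * Var CV))) - 8 * (Var Z2 * (Var Z4 * (Var Z4 * Var CE)))"]; (intro below_intros wbelow_0)?; simp add: dot_def vol_def br_def pt_simps algebra_simps)
  have Q3: "lead (subst pt (sb Q3)) (ml (el Q3))"
    by (rule leadI[where L = "el Q3" and c = "-8" and r = "8 * (Var Z1 * (Var Z1 * (Var Z3 * Var CV))) + 8 * (Var Z1 * (Var Z1 * (Var Z3 * Var CE))) + 8 * (Var Z3 * (Var Z4 * (Var Z4 * Var CW))) + 8 * (Var Z3 * (Var CW * (Var CW * Var CV))) + 8 * (Var Z3 * (Var CW * (Var CW * Var CE))) - 8 * (Var Z1 * (Var Z1 * (Var Z3 * Var CW))) - 8 * (Var Z2 * (Var Z2 * (Var Z3 * Var CV))) - 8 * (Var Z2 * (Var Z2 * (Var Z3 * Var CE))) - 8 * (Var Z3 * (Var CW * (Var CV * Var CV))) - 16 * (Var Z3 * (Var CW * (Var CV * Var CE)))"]; (intro below_intros wbelow_0)?; simp add: dot_def vol_def br_def pt_simps algebra_simps)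
  have Q4: "lead (subst pt (sb Q4)) (ml (el Q4))"
    by (rule leadI[where L = "el Q4" and c = "8" and r = "8 * (Var Z1 * (Var Z1 * (Var Z4 * Var CW))) + 8 * (Var Z2 * (Var Z2 * (Var Z4 * Var CE))) - 8 * (Var Z1 * (Var Z1 * (Var Z4 * Var CE))) - 8 * (Var Z3 * (Var Z3 * (Var Z4 * Var CW))) - 8 * (Var Z4 * (Var CW * (Var CW * Var CE)))"]; (intro below_intros wbelow_0)?; simp add: dot_def vol_def br_def pt_simps algebra_simps)
  have R1: "lead (subst pt (sb R1)) (ml (el R1))"
    by (rule leadI[where L = "el R1" and c = "4" and r = "4 * (Var Z1 * (Var Z1 * (Var Z3 * Var Z3))) + 4 * (Var Z1 * (Var Z1 * (Var Z4 * Var Z4))) + 4 * (Var Z2 * (Var Z2 * (Var Z3 * Var Z3))) + 4 * (Var Z2 * (Var Z2 * (Var Z4 * Var Z4))) - 4 * (Var Z1 * (Var Z1 * (Var CV * Var CV))) - 4 * (Var Z2 * (Var Z2 * (Var CV * Var CV))) - 4 * (Var Z3 * (Var Z3 * (Var CW * Var CW))) - 4 * (Var Z4 * (Var Z4 * (Var CW * Var CW)))"]; (intro below_intros wbelow_0)?; simp add: dot_def vol_def br_def pt_simps algebra_simps)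
  have R2: "lead (subst pt (sb R2)) (ml (el R2))"
    by (rule leadI[where L = "el R2" and c = "4" and r = "8 * (Var Z1 * (Var Z1 * (Var CW * Var CV))) + 8 * (Var Z1 * (Var Z1 * (Var CW * Var CE))) + 8 * (Var Z3 * (Var Z3 * (Var CW * Var CV))) + 8 * (Var Z3 * (Var Z3 * (Var CW * Var CE))) + 8 * (Var CV * (Var CE * (Var CE * Var CE))) + 4 * (Var Z1 * (Var Z1 * (Var Z2 * Var Z2))) + 4 * (Var Z1 * (Var Z1 * (Var Z4 * Var Z4))) + 4 * (Var Z2 * (Var Z2 * (Var Z3 * Var Z3))) + 4 * (Var Z3 * (Var Z3 * (Var Z4 * Var Z4))) + 4 * (Var CW * (Var CW * (Var CE * Var CE))) + 4 * (Var CV * (Var CV * (Var CE * Var CE))) - 4 * (Var Z1 * (Var Z1 * (Var CW * Var CW))) - 4 * (Var Z1 * (Var Z1 * (Var CV * Var CV))) - 4 * (Var Z1 * (Var Z1 * (Var CE * Var CE))) - 4 * (Var Z2 * (Var Z2 * (Var CE * Var CE))) - 4 * (Var Z3 * (Var Z3 * (Var CW * Var CW))) - 4 * (Var Z3 * (Var Z3 * (Var CV * Var CV))) - 4 * (Var Z3 * (Var Z3 * (Var CE * Var CE))) - 4 * (Var Z4 * (Var Z4 * (Var CE * Var CE))) - 8 * (Var Z1 * (Var Z1 * (Var CV * Var CE))) - 8 * (Var Z3 * (Var Z3 * (Var CV * Var CE))) - 8 * (Var CW * (Var CV * (Var CE * Var CE))) - 8 * (Var CW * (Var CE * (Var CE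 * Var CE)))"]; (intro below_intros wbelow_0)?; simp add: dot_def vol_def br_def pt_simps algebra_simps)
  have TT: "lead (subst pt (sb TT)) (ml (el TT))"
    by (rule leadI[where L = "el TT" and c = "8" and r = "8 * (Var Z1 * (Var Z1 * (Var CW * Var CV))) + 8 * (Var Z2 * (Var Z2 * (Var CV * Var CE))) + 8 * (Var Z3 * (Var Z3 * (Var CW * Var CV))) + 8 * (Var Z3 * (Var Z3 * (Var CW * Var CE))) + 8 * (Var CW * (Var CV * (Var CV * Var CE))) + 4 * (Var Z1 * (Var Z1 * (Var Z4 * Var Z4))) + 4 * (Var Z2 * (Var Z2 * (Var Z3 * Var Z3))) + 4 * (Var Z2 * (Var Z2 * (Var CV * Var CV))) + 4 * (Var Z4 * (Var Z4 * (Var CW * Var CW))) - 4 * (Var Z1 * (Var Z1 * (Var Z3 * Var Z3))) - 4 * (Var Z1 * (Var Z1 * (Var CV * Var CV))) - 4 * (Var Z2 * (Var Z2 * (Var Z4 * Var Z4))) - 4 * (Var Z3 * (Var Z3 * (Var CW * Var CW))) - 4 * (Var CW * (Var CW * (Var CV * Var CV))) - 8 * (Var Z1 * (Var Z1 * (Var CV * Var CE))) - 8 * (Var Z4 * (Var Z4 * (Var CW * Var CE))) - 8 * (Var CW * (Var CW * (Var CV * Var CE)))"]; (intro below_intros wbelow_0)?; simp add: dot_def vol_def br_def pt_simps algebra_simps)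
  show ?thesis
    by (cases v) (simp_all only: P0 P12 P13 P14 P23 P24 P34 Q1 Q2 Q3 Q4 R1 R2 TT)
qed

text \<open>The exponent of \<open>x\<close> in the leading monomial of the image of a monomial.\<close>

definition ex :: "vi monom \<Rightarrow> pc \<Rightarrow> nat"
  where "ex m x = (\<Sum>v\<in>UNIV. Poly_Mapping.lookup m v * count_list (el v) x)"

lemma ex_add: "ex (m + n) x = ex m x + ex n x"
  by (simp add: ex_def lookup_add distrib_right sum.distrib)

lemma ex_single: "ex (Poly_Mapping.single v 1) x = count_list (el v) x"
proof -
  have "ex (Poly_Mapping.single v 1) x = (\<Sum>u\<in>UNIV. if u = v then count_list (el u) x else 0)"
    unfolding ex_def by (intro sum.cong) (auto simp: lookup_single when_def)
  then show ?thesis by simp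
qed

lemma lead_mon: "\<exists>\<alpha>. lead (subst (\<lambda>v. subst pt (sb v)) (mon m)) \<alpha> \<and> Poly_Mapping.lookup \<alpha> = ex m"
proof (induction m rule: mon_induct)
  case single
  show ?case by (intro exI[of _ 0]) (auto simp: lead_1 ex_def fun_eq_iff)
next
  case (add v m)
  then obtain \<alpha> where "lead (subst (\<lambda>v. subst pt (sb v)) (mon m)) \<alpha>" "Poly_Mapping.lookup \<alpha> = ex m" by blast
  then have "lead (subst (\<lambda>v. subst pt (sb v)) (mon (Poly_Mapping.single v 1 + m))) (ml (el v) + \<alpha>)"
    using lead_mult[OF lead_sb[of v]] by (simp add: mon_add del: One_nat_def flip: Var_conv_mon)
  moreover have "Poly_Mapping.lookup (ml (el v) + \<alpha>) = ex (Poly_Mapping.single v 1 + m)"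
    using \<open>Poly_Mapping.lookup \<alpha> = ex m\<close>
    by (simp add: fun_eq_iff ex_add ex_single lookup_add lookup_ml del: One_nat_def)
  ultimately show ?case by blast
qed

text \<open>A pair of natural numbers of which one is zero is determined by its difference. Each
  forbidden product of two variables yields such a pair of exponents.\<close>

lemma comp:
  fixes x y x' y' :: nat
  assumes "x = 0 \<or> y = 0" "x' = 0 \<or> y' = 0" "x + y' = x' + y"
  shows "x = x' \<and> y = y'"
  using assms by (elim disjE) simp_all

text \<open>A triple with minimum zero is determined up to nothing once its differences are known,
  since the only freedom is adding a constant to all three entries.\<close>

lemma excess:
  fixes r p q :: nat
  assumes "r = 0 \<or> p = 0 \<or> q = 0" "r' = 0 \<or> p' = 0 \<or> q' = 0" "p + r' = p' + r" "q + r' = q' + r"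
  shows "r = r'"
  using assms by (elim disjE) simp_all

text \<open>Variables are the exponents of the nine variables that remain on one face; the first
  sixteen hypotheses say that both monomials are standard, and the equations compare exponents in
  the leading monomials. The unknowns are recovered in turn, each time because the equations fix a
  difference of two non-negative quantities while standardness kills one of them.
  \<open>face2\<close> is the same elimination on the other kind of face.\<close>

lemma face1:
  fixes P a b c d e r s t :: nat
  assumes "r = 0 \<or> s = 0" "b = 0 \<or> t = 0" "a = 0 \<or> t = 0" "P = 0 \<or> s = 0" "a = 0 \<or> d = 0"
      "d = 0 \<or> e = 0 \<or> r = 0" "a = 0 \<or> b = 0 \<or> r = 0" "b = 0 \<or> e = 0 \<or> r = 0"
    and "r' = 0 \<or> s' = 0" "b' = 0 \<or> t' = 0" "a' = 0 \<or> t' = 0" "P' = 0 \<or> s' = 0" "a' = 0 \<or> d' = 0"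
      "d' = 0 \<or> e' = 0 \<or> r' = 0" "a' = 0 \<or> b' = 0 \<or> r' = 0" "b' = 0 \<or> e' = 0 \<or> r' = 0"
    and eqs: "a + b + c = a' + b' + c'" "P + b + d = P' + b' + d'" "P + a + e = P' + a' + e'"
      "2 * P + d + e + 2 * r + t = 2 * P' + d' + e' + 2 * r' + t'" "c + 2 * r + t = c' + 2 * r' + t'"
      "a + b + c + d + e + 2 * s + t = a' + b' + c' + d' + e' + 2 * s' + t'"
  shows "P = P' \<and> a = a' \<and> b = b' \<and> c = c' \<and> d = d' \<and> e = e' \<and> r = r' \<and> s = s' \<and> t = t'"
proof -
  have 1: "s = s' \<and> r + P = r' + P'"
  proof (rule comp)
    show "s = 0 \<or> r + P = 0" "s' = 0 \<or> r' + P' = 0"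
      using assms(1,4,9,12) by auto
    show "s + (r' + P') = s' + (r + P)" using eqs by linarith
  qed
  \<comment> \<open>The four cubic-or-quadratic conditions between these exponents combine to say
    that one of \<open>r\<close>, \<open>b + d\<close>, \<open>a + e\<close> vanishes, so
    \<open>excess\<close> applies to this triple.\<close>
  have "b + d + r' = b' + d' + r" "a + e + r' = a' + e' + r"
    using 1 eqs by linarith+
  moreover have "r = 0 \<or> b + d = 0 \<or> a + e = 0" "r' = 0 \<or> b' + d' = 0 \<or> a' + e' = 0"
    using assms(5-8,13-16) unfolding add_is_0 by argo+
  ultimately have 2: "r = r'"
    using excess by blast
  have 3: "a + b = a' + b' \<and> t = t'"
  proof (rule comp)
    show "a + b = 0 \<or> t = 0" "a' + b' = 0 \<or> t' = 0"
      using assms(2,3,10,11) by auto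
    show "a + b + t' = a' + b' + t" using eqs 1 2 by linarith
  qed
  have "a = a' \<and> d = d'"
  proof (rule comp)
    show "a = 0 \<or> d = 0" "a' = 0 \<or> d' = 0" by (fact assms)+
    show "a + d' = a' + d" using eqs 1 2 3 by linarith
  qed
  then show ?thesis
    using 1 2 3 eqs by linarith
qed

lemma face2:
  fixes P a b c d e r s t :: nat
  assumes "r = 0 \<or> s = 0" "a = 0 \<or> t = 0" "c = 0 \<or> e = 0" "P = 0 \<or> s = 0" "a = 0 \<or> e = 0"
      "d = 0 \<or> e = 0 \<or> r = 0" "a = 0 \<or> b = 0 \<or> r = 0" "b = 0 \<or> d = 0 \<or> r = 0"
    and "r' = 0 \<or> s' = 0" "a' = 0 \<or> t' = 0" "c' = 0 \<or> e' = 0" "P' = 0 \<or> s' = 0" "a' = 0 \<or> e' = 0"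
      "d' = 0 \<or> e' = 0 \<or> r' = 0" "a' = 0 \<or> b' = 0 \<or> r' = 0" "b' = 0 \<or> d' = 0 \<or> r' = 0"
    and eqs: "a + b + c = a' + b' + c'" "P + a + d = P' + a' + d'" "P + b + e = P' + b' + e'"
      "2 * P + d + e + 2 * r + t = 2 * P' + d' + e' + 2 * r' + t'" "c + 2 * r + t = c' + 2 * r' + t'"
      "a + b + c + d + e + 2 * s + t = a' + b' + c' + d' + e' + 2 * s' + t'"
  shows "P = P' \<and> a = a' \<and> b = b' \<and> c = c' \<and> d = d' \<and> e = e' \<and> r = r' \<and> s = s' \<and> t = t'"
proof -
  have 1: "s = s' \<and> r + P = r' + P'"
  proof (rule comp)
    show "s = 0 \<or> r + P = 0" "s' = 0 \<or> r' + P' = 0"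
      using assms(1,4,9,12) by auto
    show "s + (r' + P') = s' + (r + P)" using eqs by linarith
  qed
  have "a + d + r' = a' + d' + r" "b + e + r' = b' + e' + r"
    using 1 eqs by linarith+
  moreover have "r = 0 \<or> a + d = 0 \<or> b + e = 0" "r' = 0 \<or> a' + d' = 0 \<or> b' + e' = 0"
    using assms(5-8,13-16) unfolding add_is_0 by argo+
  ultimately have 2: "r = r'"
    using excess by blast
  have 3: "a + c = a' + c' \<and> e = e'"
  proof (rule comp)
    show "a + c = 0 \<or> e = 0" "a' + c' = 0 \<or> e' = 0"
      using assms(3,5,11,13) by auto
    show "a + c + e' = a' + c' + e" using eqs 1 2 by linarith
  qed
  have "a = a' \<and> t = t'"
  proof (rule comp)
    show "a = 0 \<or> t = 0" "a' = 0 \<or> t' = 0" by (fact assms)+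
    show "a + t' = a' + t" using eqs 1 2 3 by linarith
  qed
  then show ?thesis
    using 1 2 3 eqs by linarith
qed

lemma Std_lookup:
  assumes "m \<in> Std"
  shows "\<forall>L\<in>set GB. \<exists>v\<in>set L. Poly_Mapping.lookup m v < count_list L v"
proof (rule ballI, rule ccontr)
  fix L assume L: "L \<in> set GB" and no: "\<not> (\<exists>v\<in>set L. Poly_Mapping.lookup m v < count_list L v)"
  have "m = ml L + (m - ml L)"
  proof (rule poly_mapping_eqI)
    fix v
    have "count_list L v \<le> Poly_Mapping.lookup m v"
      using no by (cases "v \<in> set L") (auto simp: not_less)
    then show "Poly_Mapping.lookup m v = Poly_Mapping.lookup (ml L + (m - ml L)) v"
      by (simp add: lookup_add lookup_minus lookup_ml)
  qed
  then show False using assms L by (auto simp: Std_def)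
qed

text \<open>For each cluster collect the variables other than \<open>P0\<close> whose leading
  monomial involves its \<open>Z\<close>. Standardness forces one of the four groups to be absent,
  which determines the exponent of \<open>P0\<close> and reduces the comparison to a face with nine
  variables.\<close>

lemma Std_ex_inj:
  assumes "m \<in> Std" "m' \<in> Std" "ex m = ex m'"
  shows "m = m'"
proof -
  define f g where "f = Poly_Mapping.lookup m" and "g = Poly_Mapping.lookup m'"
  have f: "\<forall>L\<in>set GB. \<exists>v\<in>set L. f v < count_list L v" and g: "\<forall>L\<in>set GB. \<exists>v\<in>set L. g v < count_list L v"
    using Std_lookup assms(1,2) unfolding f_def g_def by blast+
  note f = f[unfolded GB_def, simplified] and g = g[unfolded GB_def, simplified]
  have ex: "ex m x = ex m' x" for x using assms(3) by simp
  have z: "f P0 + f P23 + f P24 + f P34 + f Q1 = g P0 + g P23 + g P24 + g P34 + g Q1"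
    "f P0 + f P13 + f P14 + f P34 + f Q2 = g P0 + g P13 + g P14 + g P34 + g Q2"
    "f P0 + f P12 + f P14 + f P24 + f Q3 = g P0 + g P12 + g P14 + g P24 + g Q3"
    "f P0 + f P12 + f P13 + f P23 + f Q4 = g P0 + g P12 + g P13 + g P23 + g Q4"
    using ex[of Z1] ex[of Z2] ex[of Z3] ex[of Z4]
    unfolding ex_def UNIV_vi f_def[symmetric] g_def[symmetric] by simp_all
  have c: "2 * f P12 + f Q3 + f Q4 + 2 * f R1 + f TT = 2 * g P12 + g Q3 + g Q4 + 2 * g R1 + g TT"
    "2 * f P34 + f Q1 + f Q2 + 2 * f R1 + f TT = 2 * g P34 + g Q1 + g Q2 + 2 * g R1 + g TT"
    "f P13 + f P14 + f P23 + f P24 + f Q1 + f Q2 + f Q3 + f Q4 + 2 * f R2 + f TT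
      = g P13 + g P14 + g P23 + g P24 + g Q1 + g Q2 + g Q3 + g Q4 + 2 * g R2 + g TT"
    using ex[of CW] ex[of CV] ex[of CE]
    unfolding ex_def UNIV_vi f_def[symmetric] g_def[symmetric] by simp_all
  \<comment> \<open>the exponent of \<open>P0\<close> is the least of the exponents of \<open>Z1\<close> to \<open>Z4\<close>\<close>
  have mf: "(f P23 = 0 \<and> f P24 = 0 \<and> f P34 = 0 \<and> f Q1 = 0) \<or> (f P13 = 0 \<and> f P14 = 0 \<and> f P34 = 0 \<and> f Q2 = 0)
      \<or> (f P12 = 0 \<and> f P14 = 0 \<and> f P24 = 0 \<and> f Q3 = 0) \<or> (f P12 = 0 \<and> f P13 = 0 \<and> f P23 = 0 \<and> f Q4 = 0)"
    using f by sat
  have mg: "(g P23 = 0 \<and> g P24 = 0 \<and> g P34 = 0 \<and> g Q1 = 0) \<or> (g P13 = 0 \<and> g P14 = 0 \<and> g P34 = 0 \<and> g Q2 = 0)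
      \<or> (g P12 = 0 \<and> g P14 = 0 \<and> g P24 = 0 \<and> g Q3 = 0) \<or> (g P12 = 0 \<and> g P13 = 0 \<and> g P23 = 0 \<and> g Q4 = 0)"
    using g by sat
  have P0: "f P0 = g P0"
    using mf mg z by linarith
  have "f v = g v" for v
    using mf
  proof (elim disjE conjE)
    assume f0: "f P23 = 0" "f P24 = 0" "f P34 = 0" "f Q1 = 0"
    then have g0: "g P23 = 0" "g P24 = 0" "g P34 = 0" "g Q1 = 0" using z(1) P0 by linarith+
    have "f P12 = g P12 \<and> f P13 = g P13 \<and> f P14 = g P14 \<and> f Q2 = g Q2 \<and> f Q3 = g Q3 \<and> f Q4 = g Q4
        \<and> f R1 = g R1 \<and> f R2 = g R2 \<and> f TT = g TT"
      by (rule face1; (use z c f0 g0 P0 in linarith)?; use f g in sat)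
    then show ?thesis using f0 g0 P0 by (cases v) simp_all
  next
    assume f0: "f P13 = 0" "f P14 = 0" "f P34 = 0" "f Q2 = 0"
    then have g0: "g P13 = 0" "g P14 = 0" "g P34 = 0" "g Q2 = 0" using z(2) P0 by linarith+
    have "f P12 = g P12 \<and> f P24 = g P24 \<and> f P23 = g P23 \<and> f Q1 = g Q1 \<and> f Q3 = g Q3 \<and> f Q4 = g Q4
        \<and> f R1 = g R1 \<and> f R2 = g R2 \<and> f TT = g TT"
      by (rule face2; (use z c f0 g0 P0 in linarith)?; use f g in sat)
    then show ?thesis using f0 g0 P0 by (cases v) simp_all
  next
    \<comment> \<open>This face and the next are mirror images of the two before under reversing the
      order of the four clusters, which interchanges the roles of \<open>CW\<close> and
      \<open>CV\<close>.\<close>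
    assume f0: "f P12 = 0" "f P14 = 0" "f P24 = 0" "f Q3 = 0"
    then have g0: "g P12 = 0" "g P14 = 0" "g P24 = 0" "g Q3 = 0" using z(3) P0 by linarith+
    have "f P34 = g P34 \<and> f P13 = g P13 \<and> f P23 = g P23 \<and> f Q4 = g Q4 \<and> f Q2 = g Q2 \<and> f Q1 = g Q1
        \<and> f R1 = g R1 \<and> f R2 = g R2 \<and> f TT = g TT"
      by (rule face2; (use z c f0 g0 P0 in linarith)?; use f g in sat)
    then show ?thesis using f0 g0 P0 by (cases v) simp_all
  next
    assume f0: "f P12 = 0" "f P13 = 0" "f P23 = 0" "f Q4 = 0"
    then have g0: "g P12 = 0" "g P13 = 0" "g P23 = 0" "g Q4 = 0" using z(4) P0 by linarith+
    have "f P34 = g P34 \<and> f P24 = g P24 \<and> f P14 = g P14 \<and> f Q3 = g Q3 \<and> f Q2 = g Q2 \<and> f Q1 = g Q1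
        \<and> f R1 = g R1 \<and> f R2 = g R2 \<and> f TT = g TT"
      by (rule face1; (use z c f0 g0 P0 in linarith)?; use f g in sat)
    then show ?thesis using f0 g0 P0 by (cases v) simp_all
  qed
  then show ?thesis
    unfolding f_def g_def by (rule poly_mapping_eqI)
qed

text \<open>Distinct standard monomials have distinct leading monomials. Take one whose leading
  monomial has maximal weight: in the image of \<open>p\<close> the coefficient there comes from it
  alone and cannot cancel.\<close>

lemma Std_independent:
  assumes "Poly_Mapping.keys p \<subseteq> Std" "subst sb p = 0"
  shows "p = 0"
proof (rule ccontr)
  assume "p \<noteq> 0"
  define h where "h = (\<lambda>v. subst pt (sb v))"
  obtain \<alpha> where \<alpha>: "\<And>m. lead (subst h (mon m)) (\<alpha> m)" "\<And>m. Poly_Mapping.lookup (\<alpha> m) = ex m"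
    using lead_mon unfolding h_def by metis
  have inj: "m = m'" if "m \<in> Std" "m' \<in> Std" "\<alpha> m = \<alpha> m'" for m m'
    using Std_ex_inj[OF that(1,2)] \<alpha>(2) that(3) by metis
  define M where "M = Max ((\<lambda>m. wt om (\<alpha> m)) ` Poly_Mapping.keys p)"
  have "M \<in> (\<lambda>m. wt om (\<alpha> m)) ` Poly_Mapping.keys p"
    unfolding M_def using \<open>p \<noteq> 0\<close> by (intro Max_in) auto
  then obtain m0 where m0: "m0 \<in> Poly_Mapping.keys p" "wt om (\<alpha> m0) = M" by auto
  have le: "wt om (\<alpha> m) \<le> M" if "m \<in> Poly_Mapping.keys p" for m
    unfolding M_def using that by (intro Max_ge) auto
  have coeff: "Poly_Mapping.lookup (subst h (mon m)) (\<alpha> m0) = 0" if "m \<in> Poly_Mapping.keys p" "m \<noteq> m0" for m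
  proof -
    obtain c r where r: "subst h (mon m) = Const c * mon (\<alpha> m) + r" "wbelow om (wt om (\<alpha> m)) r"
      using \<alpha>(1)[of m] unfolding lead_def by blast
    have "\<alpha> m0 \<notin> Poly_Mapping.keys r"
      using r(2) le[OF that(1)] m0(2) by (auto simp: wbelow_def)
    moreover have "\<alpha> m \<noteq> \<alpha> m0"
      using inj that m0(1) assms(1) by blast
    ultimately show ?thesis
      by (simp add: r(1) lookup_add lookup_Const_mult lookup_mon in_keys_iff)
  qed
  have coeff0: "Poly_Mapping.lookup (subst h (mon m0)) (\<alpha> m0) \<noteq> 0"
  proof -
    obtain c r where r: "c \<noteq> 0" "subst h (mon m0) = Const c * mon (\<alpha> m0) + r" "wbelow om (wt om (\<alpha> m0)) r"
      using \<alpha>(1)[of m0] unfolding lead_def by blast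
    then have "\<alpha> m0 \<notin> Poly_Mapping.keys r"
      by (auto simp: wbelow_def)
    then show ?thesis
      using r(1) by (simp add: r(2) lookup_add lookup_Const_mult lookup_mon in_keys_iff)
  qed
  have "0 = subst h p"
    using arg_cong[OF assms(2), of "subst pt"] by (simp add: subst_subst h_def)
  also have "\<dots> = (\<Sum>m\<in>Poly_Mapping.keys p. Const (Poly_Mapping.lookup p m) * subst h (mon m))"
    unfolding subst_mon by (rule subst_msubst)
  finally have "0 = (\<Sum>m\<in>Poly_Mapping.keys p. Poly_Mapping.lookup p m * Poly_Mapping.lookup (subst h (mon m)) (\<alpha> m0))"
    by (metis (no_types, lifting) lookup_Const_mult lookup_sum lookup_zero sum.cong)
  also have "\<dots> = (\<Sum>m\<in>{m0}. Poly_Mapping.lookup p m * Poly_Mapping.lookup (subst h (mon m)) (\<alpha> m0))"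
    using m0(1) coeff by (intro sum.mono_neutral_right) auto
  finally show False
    using coeff0 m0(1) by (simp add: in_keys_iff)
qed

section \<open>The quadrics vanish on the ring of invariants\<close>

text \<open>\<open>fa\<close>, \<open>fb\<close>, \<open>fc\<close> are, up to the sign of the
  middle one, the coefficients of the binary quadratic form vanishing at the two points. In them
  \<open>dot\<close> is the polarised discriminant and \<open>vol\<close> is twice a determinant up
  to sign.\<close>

definition fa :: "8 \<Rightarrow> 8 \<Rightarrow> coord qpoly" where "fa i j = Var (YY i) * Var (YY j)"
definition fb :: "8 \<Rightarrow> 8 \<Rightarrow> coord qpoly" where "fb i j = Var (XX i) * Var (YY j) + Var (XX j) * Var (YY i)"
definition fc :: "8 \<Rightarrow> 8 \<Rightarrow> coord qpoly" where "fc i j = Var (XX i) * Var (XX j)"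

lemma dot_coord: "dot a b c d = fb a b * fb c d - 2 * (fa a b * fc c d) - 2 * (fc a b * fa c d)"
  unfolding dot_def br_def fa_def fb_def fc_def by (simp add: algebra_simps)

lemma dot_self: "dot a b a b = br a b * br a b"
  unfolding dot_def by (simp add: br_swap[of b a])

lemma vol_coord: "vol a b c d e f = 2 * (fa a b * fb c d * fc e f + fb a b * fc c d * fa e f
    + fc a b * fa c d * fb e f - fc a b * fb c d * fa e f - fa a b * fc c d * fb e f
    - fb a b * fa c d * fc e f)"
  unfolding vol_def br_def fa_def fb_def fc_def by (simp add: algebra_simps)

text \<open>Four vectors of a three-dimensional space satisfy the linear relation whose coefficients
  are the signed volumes of the other three; this is its scalar product with the vector of the pair
  \<open>i\<close>, \<open>j\<close>.\<close>

lemma cramer: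
  "dot i j a b * vol c d e f g h - dot i j c d * vol a b e f g h
    + dot i j e f * vol a b c d g h - dot i j g h * vol a b c d e f = 0"
  unfolding vol_coord dot_coord by (simp add: algebra_simps)

text \<open>The product of two volumes is minus the determinant of the 3 by 3 matrix of mutual
  scalar products; the sign comes from the discriminant of the quadratic space.\<close>

lemma vol_vol:
  "vol a b c d e f * vol i j k l m n =
    - (dot a b i j * (dot c d k l * dot e f m n - dot c d m n * dot e f k l)
     - dot a b k l * (dot c d i j * dot e f m n - dot c d m n * dot e f i j)
     + dot a b m n * (dot c d i j * dot e f k l - dot c d k l * dot e f i j))"
  unfolding vol_coord dot_coord by (simp add: algebra_simps)

lemmas vec_simps = dot_self
  dot_sym[of 2 3 0 1]
  dot_sym[of 4 5 0 1]
  dot_sym[of 4 5 2 3]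
  dot_sym[of 6 7 0 1]
  dot_sym[of 6 7 2 3]
  dot_sym[of 6 7 4 5]

lemma cramer_sb:
  "br 0 1 * br 0 1 * vol 2 3 4 5 6 7 - dot 0 1 2 3 * vol 0 1 4 5 6 7
    + dot 0 1 4 5 * vol 0 1 2 3 6 7 - dot 0 1 6 7 * vol 0 1 2 3 4 5 = 0"
  "dot 0 1 2 3 * vol 2 3 4 5 6 7 - br 2 3 * br 2 3 * vol 0 1 4 5 6 7
    + dot 2 3 4 5 * vol 0 1 2 3 6 7 - dot 2 3 6 7 * vol 0 1 2 3 4 5 = 0"
  "dot 0 1 4 5 * vol 2 3 4 5 6 7 - dot 2 3 4 5 * vol 0 1 4 5 6 7
    + br 4 5 * br 4 5 * vol 0 1 2 3 6 7 - dot 4 5 6 7 * vol 0 1 2 3 4 5 = 0"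
  "dot 0 1 6 7 * vol 2 3 4 5 6 7 - dot 2 3 6 7 * vol 0 1 4 5 6 7
    + dot 4 5 6 7 * vol 0 1 2 3 6 7 - br 6 7 * br 6 7 * vol 0 1 2 3 4 5 = 0"
  using cramer[of 0 1 0 1 2 3 4 5 6 7] cramer[of 2 3 0 1 2 3 4 5 6 7]
    cramer[of 4 5 0 1 2 3 4 5 6 7] cramer[of 6 7 0 1 2 3 4 5 6 7]
  by (simp_all only: vec_simps)

lemma subst_rel_Q: "subst sb (rel Q1) = 0" "subst sb (rel Q2) = 0" "subst sb (rel Q3) = 0" "subst sb (rel Q4) = 0"
proof -
  \<comment> \<open>The factor 0 is then rewritten backwards into Cramer's relation, of which the
    quadric is the multiple by the three remaining brackets. The other three cases are
    alike.\<close>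
  have "subst sb (rel Q1) = br 2 3 * br 4 5 * br 6 7 * 0"
    unfolding cramer_sb(1)[symmetric] by (simp add: algebra_simps)
  then show "subst sb (rel Q1) = 0" by simp
  have "subst sb (rel Q2) = br 0 1 * br 4 5 * br 6 7 * 0"
    unfolding cramer_sb(2)[symmetric] by (simp add: algebra_simps)
  then show "subst sb (rel Q2) = 0" by simp
  have "subst sb (rel Q3) = br 0 1 * br 2 3 * br 6 7 * 0"
    unfolding cramer_sb(3)[symmetric] by (simp add: algebra_simps)
  then show "subst sb (rel Q3) = 0" by simp
  have "subst sb (rel Q4) = br 0 1 * br 2 3 * br 4 5 * 0"
    unfolding cramer_sb(4)[symmetric] by (simp add: algebra_simps)
  then show "subst sb (rel Q4) = 0" by simp
qed

text \<open>The only product of two different \<open>Q\<close> variables in each of these quadrics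
  is a product of two volumes sharing two vectors; expanded by \<open>vol_vol\<close> and with norms
  written as squared brackets, it cancels the other terms.\<close>

lemma subst_rel_P:
  "subst sb (rel P12) = 0" "subst sb (rel P13) = 0" "subst sb (rel P14) = 0"
  "subst sb (rel P23) = 0" "subst sb (rel P24) = 0" "subst sb (rel P34) = 0"
proof -
  have Q: "sb Q1 * sb Q2 = - (vol 2 3 4 5 6 7 * vol 0 1 4 5 6 7 * (br 0 1 * br 2 3))"
    "sb Q1 * sb Q3 = vol 2 3 4 5 6 7 * vol 0 1 2 3 6 7 * (br 0 1 * br 4 5)"
    "sb Q1 * sb Q4 = - (vol 2 3 4 5 6 7 * vol 0 1 2 3 4 5 * (br 0 1 * br 6 7))"
    "sb Q2 * sb Q3 = - (vol 0 1 4 5 6 7 * vol 0 1 2 3 6 7 * (br 2 3 * br 4 5))"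
    "sb Q2 * sb Q4 = vol 0 1 4 5 6 7 * vol 0 1 2 3 4 5 * (br 2 3 * br 6 7)"
    "sb Q3 * sb Q4 = - (vol 0 1 2 3 6 7 * vol 0 1 2 3 4 5 * (br 4 5 * br 6 7))"
    by (simp_all add: mult_ac)
  note Q' = Q[unfolded vol_vol, unfolded vec_simps]
  show "subst sb (rel P12) = 0"
    by (simp only: rel.simps subst_add subst_diff subst_mult subst_Var subst_numeral Q') (simp add: algebra_simps)
  show "subst sb (rel P13) = 0"
    by (simp only: rel.simps subst_add subst_diff subst_mult subst_Var subst_numeral Q') (simp add: algebra_simps)
  show "subst sb (rel P14) = 0"
    by (simp only: rel.simps subst_add subst_diff subst_mult subst_Var subst_numeral Q') (simp add: algebra_simps)
  show "subst sb (rel P23) = 0"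
    by (simp only: rel.simps subst_add subst_diff subst_mult subst_Var subst_numeral Q') (simp add: algebra_simps)
  show "subst sb (rel P24) = 0"
    by (simp only: rel.simps subst_add subst_diff subst_mult subst_Var subst_numeral Q') (simp add: algebra_simps)
  show "subst sb (rel P34) = 0"
    by (simp only: rel.simps subst_add subst_diff subst_mult subst_Var subst_numeral Q') (simp add: algebra_simps)
qed

lemma subst_rel_R: "subst sb (rel R1) = 0" "subst sb (rel R2) = 0" "subst sb (rel TT) = 0"
  by (simp_all add: algebra_simps)

text \<open>The last quadric is the Gram determinant of four vectors of a three-dimensional space.\<close>

lemma subst_rel_P0: "subst sb (rel P0) = 0"
proof -
  have Q: "sb Q1 * sb Q1 = vol 2 3 4 5 6 7 * vol 2 3 4 5 6 7 * (br 0 1 * br 0 1)"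
    "sb Q2 * sb Q2 = vol 0 1 4 5 6 7 * vol 0 1 4 5 6 7 * (br 2 3 * br 2 3)"
    "sb Q3 * sb Q3 = vol 0 1 2 3 6 7 * vol 0 1 2 3 6 7 * (br 4 5 * br 4 5)"
    "sb Q4 * sb Q4 = vol 0 1 2 3 4 5 * vol 0 1 2 3 4 5 * (br 6 7 * br 6 7)"
    by (simp_all add: mult_ac)
  note Q' = Q[unfolded vol_vol, unfolded vec_simps]
  \<comment> \<open>Cramer's relation times a volume: after \<open>vol_vol\<close> this is, up to
    sign, the expansion of the 4 by 4 Gram determinant along its first row.\<close>
  have "vol 2 3 4 5 6 7 * vol 2 3 4 5 6 7 * (br 0 1 * br 0 1) - vol 2 3 4 5 6 7 * vol 0 1 4 5 6 7 * dot 0 1 2 3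
    + vol 2 3 4 5 6 7 * vol 0 1 2 3 6 7 * dot 0 1 4 5 - vol 2 3 4 5 6 7 * vol 0 1 2 3 4 5 * dot 0 1 6 7 = 0"
    using arg_cong[OF cramer_sb(1), of "\<lambda>t. vol 2 3 4 5 6 7 * t"] by (simp add: algebra_simps)
  note gram = this[unfolded vol_vol, unfolded vec_simps]
  show ?thesis
    using gram
    by (simp only: rel.simps subst_add subst_diff subst_mult subst_Var subst_numeral Q') (simp add: algebra_simps)
qed

lemma subst_rel: "subst sb (rel v) = 0"
  by (cases v) (simp_all only: subst_rel_P0 subst_rel_P subst_rel_Q subst_rel_R)

text \<open>Reduce \<open>p\<close> modulo \<open>J\<close> to a combination of standard monomials.
  If \<open>p\<close> is in the kernel then so is the remainder, which is zero by
  independence.\<close>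

theorem kernel_subst_sb: "subst sb p = 0 \<longleftrightarrow> p \<in> J"
proof -
  have ker: "subst sb q = 0" if "q \<in> J" for q
    using that by (auto simp: J_def subst_rel)
  obtain r where r: "p - r \<in> J" "Poly_Mapping.keys r \<subseteq> Std" using normal_form by blast
  have "p \<in> J" if "subst sb p = 0"
  proof -
    have "subst sb r = 0" using ker[OF r(1)] that by simp
    then have "r = 0" using Std_independent r(2) by blast
    then show ?thesis using r(1) by simp
  qed
  then show ?thesis using ker by blast
qed

lemma GB_long: "\<forall>L\<in>set GB. length L \<ge> 2"
  by (simp add: GB_def)

text \<open>All entries of \<open>GB\<close> have degree at least two, so linear forms are already
  in normal form. This yields the linear independence of the fourteen invariants.\<close>

lemma linear_in_J:
  assumes "p \<in> homog 1" "p \<in> J"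
  shows "p = 0"
proof (rule Std_independent)
  show "subst sb p = 0" using assms(2) kernel_subst_sb by blast
  show "Poly_Mapping.keys p \<subseteq> Std"
  proof
    fix m assume "m \<in> Poly_Mapping.keys p"
    then have m: "wt (\<lambda>_. 1) m = 1" using assms(1) by (auto simp: homog_whomog whomog_def)
    have "m \<noteq> ml L + m'" if "L \<in> set GB" for L m'
    proof
      assume "m = ml L + m'"
      then have "length L \<le> 1" using m by (simp add: wt_add wt_ml sum_list_triv)
      then show False using GB_long that by fastforce
    qed
    then show "m \<in> Std" by (simp add: Std_def)
  qed
qed

section \<open>The cubic and its partial derivatives\<close>

text \<open>A potential of the quadrics: the cubic form whose gradient is, up to an invertible
  constant matrix, the vector of the \<open>rel v\<close>.\<close>

definition cubic :: "vi qpoly"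
  where "cubic = Var P0 * (Var P12 * Var P12 + Var P13 * Var P13 + Var P14 * Var P14
      + Var P23 * Var P23 + Var P24 * Var P24 + Var P34 * Var P34
      - Var Q1 * Var Q1 - Var Q2 * Var Q2 - Var Q3 * Var Q3 - Var Q4 * Var Q4
      + (Var R1 + Var TT) * (Var R1 + Var TT) - 4 * (Var R1 * Var R2) - Var P0 * Var P0)
    - 2 * (Var P12 * Var Q1 * Var Q2 + Var P13 * Var Q1 * Var Q3 + Var P14 * Var Q1 * Var Q4
      + Var P23 * Var Q2 * Var Q3 + Var P24 * Var Q2 * Var Q4 + Var P34 * Var Q3 * Var Q4)
    - 2 * (Var P12 * Var P13 * Var P23 + Var P12 * Var P14 * Var P24
      + Var P13 * Var P14 * Var P34 + Var P23 * Var P24 * Var P34)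
    + 2 * (Var P12 * Var P34 * (2 * Var R2 - Var TT - Var R1) + Var P13 * Var P24 * (Var R1 - Var TT)
      + Var P14 * Var P23 * (Var R1 + Var TT))"

lemma pd_cubic:
  "pd P0 cubic = rel P0"
  "pd P12 cubic = 2 * rel P12" "pd P13 cubic = 2 * rel P13" "pd P14 cubic = 2 * rel P14"
  "pd P23 cubic = 2 * rel P23" "pd P24 cubic = 2 * rel P24" "pd P34 cubic = 2 * rel P34"
  "pd Q1 cubic = - 2 * rel Q1" "pd Q2 cubic = - 2 * rel Q2" "pd Q3 cubic = - 2 * rel Q3" "pd Q4 cubic = - 2 * rel Q4"
  "pd R1 cubic = 2 * rel R2 + 2 * rel TT - 2 * rel R1"
  "pd R2 cubic = 4 * rel R1"
  "pd TT cubic = 2 * rel TT - 2 * rel R1 - 2 * rel R2"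
  unfolding cubic_def by (simp_all add: pd_mult pd_Var algebra_simps)

text \<open>Inverts the matrix of \<open>pd_cubic\<close>, so that quadrics and derivatives span the
  same space; only the block of \<open>R1\<close>, \<open>R2\<close>, \<open>TT\<close> is not
  diagonal.\<close>

lemma rel_pd_cubic:
  "rel P0 = pd P0 cubic"
  "rel P12 = Const (1/2) * pd P12 cubic" "rel P13 = Const (1/2) * pd P13 cubic" "rel P14 = Const (1/2) * pd P14 cubic"
  "rel P23 = Const (1/2) * pd P23 cubic" "rel P24 = Const (1/2) * pd P24 cubic" "rel P34 = Const (1/2) * pd P34 cubic"
  "rel Q1 = Const (-1/2) * pd Q1 cubic" "rel Q2 = Const (-1/2) * pd Q2 cubic"
  "rel Q3 = Const (-1/2) * pd Q3 cubic" "rel Q4 = Const (-1/2) * pd Q4 cubic"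
  "rel R1 = Const (1/4) * pd R2 cubic"
  "rel R2 = Const (1/4) * (pd R1 cubic - pd TT cubic)"
  "rel TT = Const (1/4) * (pd R1 cubic + pd TT cubic + pd R2 cubic)"
proof -
  have h: "Const (1/2) * 2 = (1 :: vi qpoly)" "Const (-1/2) * -2 = (1 :: vi qpoly)" "Const (1/4) * 4 = (1 :: vi qpoly)"
    using Const_mult[of "1/2" 2] Const_mult[of "-1/2" "-2"] Const_mult[of "1/4" 4] by simp_all
  have k: "Const (1/2) * (2 * p) = p" "Const (-1/2) * (-2 * p) = p" "Const (1/4) * (4 * p) = p" for p :: "vi qpoly"
    by (simp_all only: h mult.assoc[symmetric] mult_1)
  have "pd R1 cubic - pd TT cubic = 4 * rel R2" "pd R1 cubic + pd TT cubic + pd R2 cubic = 4 * rel TT"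
    unfolding pd_cubic by (simp_all only: algebra_simps) simp_all
  then show "rel P0 = pd P0 cubic"
    "rel P12 = Const (1/2) * pd P12 cubic" "rel P13 = Const (1/2) * pd P13 cubic" "rel P14 = Const (1/2) * pd P14 cubic"
    "rel P23 = Const (1/2) * pd P23 cubic" "rel P24 = Const (1/2) * pd P24 cubic" "rel P34 = Const (1/2) * pd P34 cubic"
    "rel Q1 = Const (-1/2) * pd Q1 cubic" "rel Q2 = Const (-1/2) * pd Q2 cubic"
    "rel Q3 = Const (-1/2) * pd Q3 cubic" "rel Q4 = Const (-1/2) * pd Q4 cubic"
    "rel R1 = Const (1/4) * pd R2 cubic"
    "rel R2 = Const (1/4) * (pd R1 cubic - pd TT cubic)"
    "rel TT = Const (1/4) * (pd R1 cubic + pd TT cubic + pd R2 cubic)"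
    by (simp_all only: pd_cubic k)
qed

lemma pd_cubic_in_J: "pd v cubic \<in> J"
proof -
  show ?thesis
    by (cases v; simp only: pd_cubic; intro J_add J_diff J_mult J_rel)
qed

lemma cubic_homog: "cubic \<in> homog 3"
proof -
  have 2: "Var a * Var b \<in> homog 2" for a b :: vi
    using homog_mult[OF homog_Var homog_Var, of a b] unfolding one_add_one .
  have n: "numeral k * p \<in> homog d" if "p \<in> homog d" for k d and p :: "vi qpoly"
    using whomog_Const_mult[of p "\<lambda>_. 1" d "numeral k"] that by (simp add: homog_whomog)
  have a: "p + q \<in> homog d" "p - q \<in> homog d" if "p \<in> homog d" "q \<in> homog d" for d and p q :: "vi qpoly"
    using that by (simp_all add: homog_whomog whomog_add whomog_diff)
  have 21: "p * q \<in> homog 3" "q * p \<in> homog 3" if "p \<in> homog 2" "q \<in> homog 1" for p q :: "vi qpoly"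
    using homog_mult[OF that] homog_mult[OF that(2,1)] by (simp, simp add: numeral_3_eq_3)
  have 11: "p * q \<in> homog 2" if "p \<in> homog 1" "q \<in> homog 1" for p q :: "vi qpoly"
    using homog_mult[OF that] unfolding one_add_one .
  show ?thesis
    unfolding cubic_def
    by (intro a(1) a(2) n 21(1)[OF 2] 21(2)[OF _ homog_Var] 11 homog_Var)
qed

lemma cubic_nonzero: "cubic \<noteq> 0"
proof
  assume "cubic = 0"
  then have "subst (\<lambda>v. if v = P0 then 1 else 0) cubic = (0 :: vi qpoly)" by simp
  then show False by (simp add: cubic_def)
qed

section \<open>There are no linear syzygies\<close>

fun rq :: "vi \<Rightarrow> (vi \<Rightarrow> rat) \<Rightarrow> rat" where
  "rq P0 x = 2 * (x R1 * x TT) + x R1 * x R1 + x TT * x TT + x P12 * x P12 + x P13 * x P13 + x P14 * x P14 + x P23 * x P23 + x P24 * x P24 + x P34 * x P34 - x Q1 * x Q1 - x Q2 * x Q2 - x Q3 * x Q3 - x Q4 * x Q4 - 3 * (x P0 * x P0) - 4 * (x R1 * x R2)"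
| "rq P12 x = 2 * (x P34 * x R2) + x P0 * x P12 - x Q1 * x Q2 - x P13 * x P23 - x P14 * x P24 - x P34 * x TT - x P34 * x R1"
| "rq P13 x = x P0 * x P13 + x P24 * x R1 - x Q1 * x Q3 - x P12 * x P23 - x P14 * x P34 - x P24 * x TT"
| "rq P14 x = x P0 * x P14 + x P23 * x R1 + x P23 * x TT - x Q1 * x Q4 - x P12 * x P24 - x P13 * x P34"
| "rq P23 x = x P0 * x P23 + x P14 * x R1 + x P14 * x TT - x Q2 * x Q3 - x P12 * x P13 - x P24 * x P34"
| "rq P24 x = x P0 * x P24 + x P13 * x R1 - x Q2 * x Q4 - x P12 * x P14 - x P23 * x P34 - x P13 * x TT"
| "rq P34 x = 2 * (x P12 * x R2) + x P0 * x P34 - x Q3 * x Q4 - x P13 * x P14 - x P23 * x P24 - x P12 * x TT - x P12 * x R1"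
| "rq Q1 x = x P0 * x Q1 + x P12 * x Q2 + x P13 * x Q3 + x P14 * x Q4"
| "rq Q2 x = x P0 * x Q2 + x P12 * x Q1 + x P23 * x Q3 + x P24 * x Q4"
| "rq Q3 x = x P0 * x Q3 + x P13 * x Q1 + x P23 * x Q2 + x P34 * x Q4"
| "rq Q4 x = x P0 * x Q4 + x P14 * x Q1 + x P24 * x Q2 + x P34 * x Q3"
| "rq R1 x = x P12 * x P34 - x P0 * x R1"
| "rq R2 x = x P13 * x P24 - x P0 * x R2"
| "rq TT x = x P14 * x P23 + x P0 * x TT - x P0 * x R2"

definition rb :: "vi \<Rightarrow> (vi \<Rightarrow> rat) \<Rightarrow> (vi \<Rightarrow> rat) \<Rightarrow> rat"
  where "rb v x y = rq v (\<lambda>u. x u + y u) - rq v x - rq v y"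

text \<open>An entry of the Hessian matrix of the quadratic form with coefficients \<open>g\<close>
  in the quadrics; the diagonal entries therefore carry a factor 2.\<close>

definition tab :: "(vi \<Rightarrow> rat) \<Rightarrow> vi \<Rightarrow> vi \<Rightarrow> rat"
  where "tab g p q = (\<Sum>v\<in>UNIV. g v * rb v (\<lambda>u. if u = p then 1 else 0) (\<lambda>u. if u = q then 1 else 0))"

lemma tab_simps:
  "tab g P0 P0 = - (6 * g P0)"
  "tab g P0 P12 = g P12"
  "tab g P0 P13 = g P13"
  "tab g P0 P14 = g P14"
  "tab g P0 P23 = g P23"
  "tab g P0 P24 = g P24"
  "tab g P0 P34 = g P34"
  "tab g P0 Q1 = g Q1"
  "tab g P0 Q2 = g Q2"
  "tab g P0 Q3 = g Q3"
  "tab g P0 Q4 = g Q4"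
  "tab g P0 R1 = - (g R1)"
  "tab g P0 R2 = - (g R2) - g TT"
  "tab g P0 TT = g TT"
  "tab g P12 P12 = 2 * g P0"
  "tab g P12 P13 = - (g P23)"
  "tab g P12 P14 = - (g P24)"
  "tab g P12 P23 = - (g P13)"
  "tab g P12 P24 = - (g P14)"
  "tab g P12 P34 = g R1"
  "tab g P12 Q1 = g Q2"
  "tab g P12 Q2 = g Q1"
  "tab g P12 Q3 = 0"
  "tab g P12 Q4 = 0"
  "tab g P12 R1 = - (g P34)"
  "tab g P12 R2 = 2 * g P34"
  "tab g P12 TT = - (g P34)"
  "tab g P13 P13 = 2 * g P0"
  "tab g P13 P14 = - (g P34)"
  "tab g P13 P23 = - (g P12)"
  "tab g P13 P24 = g R2"
  "tab g P13 P34 = - (g P14)"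
  "tab g P13 Q1 = g Q3"
  "tab g P13 Q2 = 0"
  "tab g P13 Q3 = g Q1"
  "tab g P13 Q4 = 0"
  "tab g P13 R1 = g P24"
  "tab g P13 R2 = 0"
  "tab g P13 TT = - (g P24)"
  "tab g P14 P14 = 2 * g P0"
  "tab g P14 P23 = g TT"
  "tab g P14 P24 = - (g P12)"
  "tab g P14 P34 = - (g P13)"
  "tab g P14 Q1 = g Q4"
  "tab g P14 Q2 = 0"
  "tab g P14 Q3 = 0"
  "tab g P14 Q4 = g Q1"
  "tab g P14 R1 = g P23"
  "tab g P14 R2 = 0"
  "tab g P14 TT = g P23"
  "tab g P23 P23 = 2 * g P0"
  "tab g P23 P24 = - (g P34)"
  "tab g P23 P34 = - (g P24)"
  "tab g P23 Q1 = 0"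
  "tab g P23 Q2 = g Q3"
  "tab g P23 Q3 = g Q2"
  "tab g P23 Q4 = 0"
  "tab g P23 R1 = g P14"
  "tab g P23 R2 = 0"
  "tab g P23 TT = g P14"
  "tab g P24 P24 = 2 * g P0"
  "tab g P24 P34 = - (g P23)"
  "tab g P24 Q1 = 0"
  "tab g P24 Q2 = g Q4"
  "tab g P24 Q3 = 0"
  "tab g P24 Q4 = g Q2"
  "tab g P24 R1 = g P13"
  "tab g P24 R2 = 0"
  "tab g P24 TT = - (g P13)"
  "tab g P34 P34 = 2 * g P0"
  "tab g P34 Q1 = 0"
  "tab g P34 Q2 = 0"
  "tab g P34 Q3 = g Q4"
  "tab g P34 Q4 = g Q3"
  "tab g P34 R1 = - (g P12)"
  "tab g P34 R2 = 2 * g P12"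
  "tab g P34 TT = - (g P12)"
  "tab g Q1 Q1 = - (2 * g P0)"
  "tab g Q1 Q2 = - (g P12)"
  "tab g Q1 Q3 = - (g P13)"
  "tab g Q1 Q4 = - (g P14)"
  "tab g Q1 R1 = 0"
  "tab g Q1 R2 = 0"
  "tab g Q1 TT = 0"
  "tab g Q2 Q2 = - (2 * g P0)"
  "tab g Q2 Q3 = - (g P23)"
  "tab g Q2 Q4 = - (g P24)"
  "tab g Q2 R1 = 0"
  "tab g Q2 R2 = 0"
  "tab g Q2 TT = 0"
  "tab g Q3 Q3 = - (2 * g P0)"
  "tab g Q3 Q4 = - (g P34)"
  "tab g Q3 R1 = 0"
  "tab g Q3 R2 = 0"
  "tab g Q3 TT = 0"
  "tab g Q4 Q4 = - (2 * g P0)"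
  "tab g Q4 R1 = 0"
  "tab g Q4 R2 = 0"
  "tab g Q4 TT = 0"
  "tab g R1 R1 = 2 * g P0"
  "tab g R1 R2 = - (4 * g P0)"
  "tab g R1 TT = 2 * g P0"
  "tab g R2 R2 = 0"
  "tab g R2 TT = 0"
  "tab g TT TT = 2 * g P0"
  by (simp_all add: tab_def rb_def UNIV_vi)

lemma rq_add3: "rq v (\<lambda>u. x u + y u + z u) = rq v x + rq v y + rq v z + rb v x y + rb v x z + rb v y z"
  by (cases v) (simp_all add: rb_def algebra_simps)

lemma subst_rel_point: "subst (\<lambda>u. Const (x u)) (rel v) = Const (rq v x)"
  by (cases v) (simp_all add: Const_mult Const_add Const_diff)

text \<open>The relation is a cubic form in \<open>x\<close> that vanishes identically, so its
  polarisation vanishes at all triples of unit vectors. This is a sparse linear system for the 196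
  coefficients, and enough of its equations can be solved one after another.\<close>

lemma no_linear_relation:
  fixes c :: "vi \<Rightarrow> vi \<Rightarrow> rat"
  assumes "\<And>x. (\<Sum>v\<in>UNIV. (\<Sum>u\<in>UNIV. c v u * x u) * rq v x) = 0"
  shows "c v u = 0"
proof -
  define \<Phi> where "\<Phi> x = (\<Sum>v\<in>UNIV. (\<Sum>u\<in>UNIV. c v u * x u) * rq v x)" for x
  define F where "F v x = (\<Sum>u\<in>UNIV. c v u * x u)" for v x
  have F_add: "F v (\<lambda>u. x u + y u) = F v x + F v y" for v x y
    by (simp add: F_def algebra_simps sum.distrib)
  have F_unit: "F v (\<lambda>u. if u = a then 1 else 0) = c v a" for v a
    by (simp add: F_def if_distrib cong: if_cong)
  \<comment> \<open>Polarisation by inclusion and exclusion of a product of a linear and a quadratic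
    form.\<close>
  have pol: "F v (\<lambda>u. x u + y u + z u) * rq v (\<lambda>u. x u + y u + z u)
      - F v (\<lambda>u. x u + y u) * rq v (\<lambda>u. x u + y u) - F v (\<lambda>u. x u + z u) * rq v (\<lambda>u. x u + z u)
      - F v (\<lambda>u. y u + z u) * rq v (\<lambda>u. y u + z u) + F v x * rq v x + F v y * rq v y + F v z * rq v z
      = F v x * rb v y z + F v y * rb v x z + F v z * rb v x y" for v x y z
  proof -
    have r: "rq v (\<lambda>u. x u + y u) = rb v x y + rq v x + rq v y" for x y
      by (simp add: rb_def)
    show ?thesis
      unfolding rq_add3 unfolding r F_add by (simp add: algebra_simps)
  qed
  have E: "tab (\<lambda>v. c v a) b d + tab (\<lambda>v. c v b) a d + tab (\<lambda>v. c v d) a b = 0" for a b d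
  proof -
    define x y z :: "vi \<Rightarrow> rat" where "x = (\<lambda>u. if u = a then 1 else 0)"
      and "y = (\<lambda>u. if u = b then 1 else 0)" and "z = (\<lambda>u. if u = d then 1 else 0)"
    have "(\<Sum>v\<in>UNIV. F v x * rb v y z + F v y * rb v x z + F v z * rb v x y) =
        \<Phi> (\<lambda>u. x u + y u + z u) - \<Phi> (\<lambda>u. x u + y u) - \<Phi> (\<lambda>u. x u + z u) - \<Phi> (\<lambda>u. y u + z u)
          + \<Phi> x + \<Phi> y + \<Phi> z"
      unfolding \<Phi>_def F_def[symmetric] pol[symmetric] by (simp add: sum.distrib sum_subtractf)
    also have "\<dots> = 0" using assms by (simp add: \<Phi>_def)
    finally show ?thesis
      by (simp add: tab_def sum.distrib x_def y_def z_def F_unit)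
  qed
  \<comment> \<open>Elimination in three rounds \<open>z0\<close>, \<open>z1\<close>,
    \<open>z2\<close>: each round uses equations that determine new coefficients once those of the
    earlier rounds are known to vanish.\<close>
  have z0_0: "c P0 P0 = 0" "c P0 P12 = 0" "c P0 P13 = 0" "c P0 P14 = 0" "c P0 P23 = 0" "c P0 P24 = 0" "c P0 P34 = 0" "c P0 Q1 = 0" "c P0 Q2 = 0" "c P0 Q3 = 0" "c P0 Q4 = 0" "c P0 R1 = 0" "c P0 R2 = 0" "c P0 TT = 0"
    using E[of P0 P0 P0] E[of P12 P12 P12] E[of P13 P13 P13] E[of P14 P14 P14] E[of P23 P23 P23] E[of P24 P24 P24] E[of P34 P34 P34] E[of Q1 R1 R1] E[of Q2 R1 R1] E[of Q3 R1 R1] E[of Q4 R1 R1] E[of R1 R1 R1] E[of R2 TT TT] E[of TT TT TT]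
    by (simp_all add: tab_simps)
  have z0_1: "c P12 P34 = 0" "c P12 Q1 = 0" "c P12 Q2 = 0" "c P12 Q3 = 0" "c P12 Q4 = 0" "c P12 R1 = 0" "c P12 R2 = 0" "c P12 TT = 0" "c P13 P24 = 0" "c P13 Q1 = 0" "c P13 Q2 = 0" "c P13 Q3 = 0" "c P13 Q4 = 0" "c P13 R1 = 0"
    using E[of P34 Q1 Q2] E[of P34 Q1 R2] E[of P34 Q2 R2] E[of P14 P24 Q3] E[of P13 P23 Q4] E[of Q1 Q2 R1] E[of Q1 Q2 R2] E[of Q1 Q2 TT] E[of P24 Q1 Q3] E[of P24 Q1 R1] E[of P14 P34 Q2] E[of P24 Q3 R1] E[of P12 P23 Q4] E[of Q1 Q3 R1]
    by (simp_all add: tab_simps)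
  have z0_2: "c P13 R2 = 0" "c P13 TT = 0" "c P14 P23 = 0" "c P14 Q1 = 0" "c P14 Q2 = 0" "c P14 Q3 = 0" "c P14 Q4 = 0" "c P14 R1 = 0" "c P14 R2 = 0" "c P14 TT = 0" "c P23 P14 = 0" "c P23 Q1 = 0" "c P23 Q2 = 0" "c P23 Q3 = 0"
    using E[of Q1 Q3 R2] E[of Q1 Q3 TT] E[of P23 Q1 Q4] E[of P23 Q1 R1] E[of P13 P34 Q2] E[of P12 P24 Q3] E[of P23 Q4 R1] E[of Q1 Q4 R1] E[of Q1 Q4 R2] E[of Q1 Q4 TT] E[of P14 Q2 Q3] E[of P24 P34 Q1] E[of P14 Q2 R1] E[of P14 Q3 R1]
    by (simp_all add: tab_simps)
  have z0_3: "c P23 Q4 = 0" "c P23 R1 = 0" "c P23 R2 = 0" "c P23 TT = 0" "c P24 P13 = 0" "c P24 Q1 = 0" "c P24 Q2 = 0" "c P24 Q3 = 0" "c P24 Q4 = 0" "c P24 R1 = 0" "c P24 R2 = 0" "c P24 TT = 0" "c P34 P12 = 0" "c P34 Q1 = 0"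
    using E[of P12 P13 Q4] E[of Q2 Q3 R1] E[of Q2 Q3 R2] E[of Q2 Q3 TT] E[of P13 Q2 Q4] E[of P23 P34 Q1] E[of P13 Q2 R1] E[of P12 P14 Q3] E[of P13 Q4 R1] E[of Q2 Q4 R1] E[of Q2 Q4 R2] E[of Q2 Q4 TT] E[of P12 Q3 Q4] E[of P23 P24 Q1]
    by (simp_all add: tab_simps)
  have z0_4: "c P34 Q2 = 0" "c P34 Q3 = 0" "c P34 Q4 = 0" "c P34 R1 = 0" "c P34 R2 = 0" "c P34 TT = 0" "c Q1 R2 = 0" "c Q2 R2 = 0" "c Q3 R2 = 0" "c Q4 R2 = 0" "c R2 R2 = 0" "c TT R2 = 0"
    using E[of P13 P14 Q2] E[of P12 Q3 R2] E[of P12 Q4 R2] E[of Q3 Q4 R1] E[of Q3 Q4 R2] E[of Q3 Q4 TT] E[of P13 Q3 R2] E[of P23 Q3 R2] E[of P13 Q1 R2] E[of P14 Q1 R2] E[of P13 P24 R2] E[of P14 P23 R2]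
    by (simp_all add: tab_simps)
  have z1_0: "c R1 R1 = 0" "c TT TT = 0" "c P12 P12 = 0" "c P13 P13 = 0" "c P14 P14 = 0" "c P23 P23 = 0" "c P24 P24 = 0" "c P34 P34 = 0" "c Q1 Q1 = 0" "c Q2 Q2 = 0" "c Q3 Q3 = 0" "c Q4 Q4 = 0" "c P12 P0 = 0" "c P23 P13 = 0"
    using E[of P0 R1 R1] E[of P0 TT TT] E[of P0 P12 P12] E[of P0 P13 P13] E[of P0 P14 P14] E[of P0 P23 P23] E[of P0 P24 P24] E[of P0 P34 P34] E[of P0 Q1 Q1] E[of P0 Q2 Q2] E[of P0 Q3 Q3] E[of P0 Q4 Q4] E[of P0 P0 P12] E[of P12 P13 P13]
    by (simp_all add: tab_simps z0_0 z0_1 z0_2 z0_3 z0_4)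
  have z1_1: "c P24 P14 = 0" "c P13 P23 = 0" "c P14 P24 = 0" "c R1 P34 = 0" "c Q2 Q1 = 0" "c Q1 Q2 = 0" "c P13 P0 = 0" "c P23 P12 = 0" "c P34 P14 = 0" "c P12 P23 = 0" "c R2 P24 = 0" "c P14 P34 = 0" "c Q3 Q1 = 0" "c Q1 Q3 = 0"
    using E[of P12 P14 P14] E[of P12 P23 P23] E[of P12 P24 P24] E[of P12 P34 P34] E[of P12 Q1 Q1] E[of P12 Q2 Q2] E[of P0 P0 P13] E[of P12 P12 P13] E[of P13 P14 P14] E[of P13 P23 P23] E[of P13 P24 P24] E[of P13 P34 P34] E[of P13 Q1 Q1] E[of P13 Q3 Q3]
    by (simp_all add: tab_simps z0_0 z0_1 z0_2 z0_3 z0_4)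
  have z1_2: "c P14 P0 = 0" "c P24 P12 = 0" "c P34 P13 = 0" "c TT P23 = 0" "c P12 P24 = 0" "c P13 P34 = 0" "c Q4 Q1 = 0" "c Q1 Q4 = 0" "c P23 P0 = 0" "c P13 P12 = 0" "c P12 P13 = 0" "c TT P14 = 0" "c P34 P24 = 0" "c P24 P34 = 0"
    using E[of P0 P0 P14] E[of P12 P12 P14] E[of P13 P13 P14] E[of P14 P23 P23] E[of P14 P24 P24] E[of P14 P34 P34] E[of P14 Q1 Q1] E[of P14 Q4 Q4] E[of P0 P0 P23] E[of P12 P12 P23] E[of P13 P13 P23] E[of P14 P14 P23] E[of P23 P24 P24] E[of P23 P34 P34]
    by (simp_all add: tab_simps z0_0 z0_1 z0_2 z0_3 z0_4)
  have z1_3: "c Q3 Q2 = 0" "c Q2 Q3 = 0" "c P24 P0 = 0" "c P14 P12 = 0" "c R2 P13 = 0" "c P12 P14 = 0" "c P34 P23 = 0" "c P23 P34 = 0" "c Q4 Q2 = 0" "c Q2 Q4 = 0" "c P34 P0 = 0" "c R1 P12 = 0" "c P14 P13 = 0" "c P13 P14 = 0"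
    using E[of P23 Q2 Q2] E[of P23 Q3 Q3] E[of P0 P0 P24] E[of P12 P12 P24] E[of P13 P13 P24] E[of P14 P14 P24] E[of P23 P23 P24] E[of P24 P34 P34] E[of P24 Q2 Q2] E[of P24 Q4 Q4] E[of P0 P0 P34] E[of P12 P12 P34] E[of P13 P13 P34] E[of P14 P14 P34]
    by (simp_all add: tab_simps z0_0 z0_1 z0_2 z0_3 z0_4)
  have z1_4: "c P24 P23 = 0" "c P23 P24 = 0" "c Q4 Q3 = 0" "c Q3 Q4 = 0" "c Q1 P0 = 0" "c Q2 P12 = 0" "c Q3 P13 = 0" "c Q4 P14 = 0" "c Q2 P0 = 0" "c Q1 P12 = 0" "c Q3 P23 = 0" "c Q4 P24 = 0" "c Q3 P0 = 0" "c Q1 P13 = 0"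
    using E[of P23 P23 P34] E[of P24 P24 P34] E[of P34 Q3 Q3] E[of P34 Q4 Q4] E[of P0 P0 Q1] E[of P12 P12 Q1] E[of P13 P13 Q1] E[of P14 P14 Q1] E[of P0 P0 Q2] E[of P12 P12 Q2] E[of P23 P23 Q2] E[of P24 P24 Q2] E[of P0 P0 Q3] E[of P13 P13 Q3]
    by (simp_all add: tab_simps z0_0 z0_1 z0_2 z0_3 z0_4)
  have z1_5: "c Q2 P23 = 0" "c Q4 P34 = 0" "c Q4 P0 = 0" "c Q1 P14 = 0" "c Q2 P24 = 0" "c Q3 P34 = 0" "c R1 P0 = 0" "c TT P0 = 0" "c Q3 P12 = 0" "c Q4 TT = 0" "c Q4 R1 = 0" "c Q4 P12 = 0" "c Q3 TT = 0" "c Q3 R1 = 0"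
    using E[of P23 P23 Q3] E[of P34 P34 Q3] E[of P0 P0 Q4] E[of P14 P14 Q4] E[of P24 P24 Q4] E[of P34 P34 Q4] E[of P0 P0 R1] E[of P0 P0 TT] E[of P0 P12 Q3] E[of P34 Q3 TT] E[of P34 Q3 R1] E[of P0 P12 Q4] E[of P34 Q4 TT] E[of P34 Q4 R1]
    by (simp_all add: tab_simps z0_0 z0_1 z0_2 z0_3 z0_4)
  have z1_6: "c R2 P0 = 0" "c Q2 P13 = 0" "c Q4 P13 = 0" "c Q2 R1 = 0" "c Q2 TT = 0" "c Q2 P14 = 0" "c Q3 P14 = 0" "c Q1 P23 = 0" "c Q4 P23 = 0" "c Q1 R1 = 0" "c Q1 TT = 0" "c Q1 P24 = 0" "c Q3 P24 = 0" "c Q1 P34 = 0"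
    using E[of P0 P13 P24] E[of P0 P13 Q2] E[of P0 P13 Q4] E[of P24 Q4 R1] E[of P24 Q4 TT] E[of P0 P14 Q2] E[of P0 P14 Q3] E[of P0 P23 Q1] E[of P0 P23 Q4] E[of P14 Q4 R1] E[of P14 Q4 TT] E[of P0 P24 Q1] E[of P0 P24 Q3] E[of P0 P34 Q1]
    by (simp_all add: tab_simps z0_0 z0_1 z0_2 z0_3 z0_4)
  have z1_7: "c Q2 P34 = 0"
    using E[of P0 P34 Q2]
    by (simp_all add: tab_simps z0_0 z0_1 z0_2 z0_3 z0_4)
  have z2_0: "c TT P34 = 0" "c R1 R2 = 0" "c R1 TT = 0" "c R2 P14 = 0" "c TT P13 = 0" "c TT P24 = 0" "c R2 P23 = 0" "c TT P12 = 0" "c R1 P24 = 0" "c R1 P14 = 0" "c R2 R1 = 0" "c R2 TT = 0" "c R1 P23 = 0" "c R1 P13 = 0"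
    using E[of P0 P34 TT] E[of P12 P34 R2] E[of P12 P34 TT] E[of P13 P14 P24] E[of P13 P14 P23] E[of P14 P23 P24] E[of P13 P23 P24] E[of P0 P12 TT] E[of P0 P24 R1] E[of P12 P14 P34] E[of P13 P24 R1] E[of P13 P24 TT] E[of P12 P23 P34] E[of P0 P13 R1]
    by (simp_all add: tab_simps z0_0 z0_1 z0_2 z0_3 z0_4 z1_0 z1_1 z1_2 z1_3 z1_4 z1_5 z1_6 z1_7)
  have z2_1: "c R2 P12 = 0" "c TT R1 = 0" "c R2 P34 = 0" "c TT Q4 = 0" "c R2 Q3 = 0" "c R1 Q2 = 0" "c R1 Q1 = 0" "c TT Q1 = 0" "c R2 Q4 = 0" "c TT Q3 = 0" "c TT Q2 = 0" "c R1 Q4 = 0" "c R2 Q1 = 0" "c R1 Q3 = 0"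
    using E[of P12 P13 P24] E[of P14 P23 R1] E[of P13 P24 P34] E[of P14 P23 Q4] E[of P13 P24 Q3] E[of P12 P34 Q2] E[of P0 Q1 R1] E[of P0 Q1 TT] E[of P13 P24 Q4] E[of P14 P23 Q3] E[of P0 Q2 TT] E[of P12 P34 Q4] E[of P13 P24 Q1] E[of P0 Q3 R1]
    by (simp_all add: tab_simps z0_0 z0_1 z0_2 z0_3 z0_4 z1_0 z1_1 z1_2 z1_3 z1_4 z1_5 z1_6 z1_7)
  have z2_2: "c R2 Q2 = 0"
    using E[of P13 P24 Q2]
    by (simp_all add: tab_simps z0_0 z0_1 z0_2 z0_3 z0_4 z1_0 z1_1 z1_2 z1_3 z1_4 z1_5 z1_6 z1_7)
  show ?thesis
    by (cases v; cases u) (simp_all only: z0_0 z0_1 z0_2 z0_3 z0_4 z1_0 z1_1 z1_2 z1_3 z1_4 z1_5 z1_6 z1_7 z2_0 z2_1 z2_2)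
qed

lemma single_1_eq_iff: "Poly_Mapping.single x (Suc 0) = Poly_Mapping.single w (Suc 0) \<longleftrightarrow> x = w"
proof
  assume "Poly_Mapping.single x (Suc 0) = Poly_Mapping.single w (Suc 0)"
  then have "Poly_Mapping.keys (Poly_Mapping.single x (Suc 0)) = Poly_Mapping.keys (Poly_Mapping.single w (Suc 0))"
    by simp
  then show "x = w" by simp
qed simp

lemma homog_1_expand:
  fixes p :: "'v::finite qpoly"
  assumes "p \<in> homog 1"
  shows "p = (\<Sum>u\<in>UNIV. Const (Poly_Mapping.lookup p (Poly_Mapping.single u 1)) * Var u)"
proof (rule poly_mapping_eqI)
  fix m
  show "Poly_Mapping.lookup p m = Poly_Mapping.lookup (\<Sum>u\<in>UNIV. Const (Poly_Mapping.lookup p (Poly_Mapping.single u 1)) * Var u) m"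
  proof (cases "wt (\<lambda>_. 1) m = 1")
    case True
    then have "m \<noteq> 0" by auto
    then obtain w where w: "w \<in> Poly_Mapping.keys m" by (metis all_not_in_conv keys_eq_empty)
    have "wt (\<lambda>_. 1) m = (\<Sum>u\<in>UNIV. Poly_Mapping.lookup m u)"
      by (simp add: wt_UNIV)
    also have "\<dots> = Poly_Mapping.lookup m w + (\<Sum>u\<in>UNIV - {w}. Poly_Mapping.lookup m u)"
      by (rule sum.remove) auto
    finally have s: "Poly_Mapping.lookup m w + (\<Sum>u\<in>UNIV - {w}. Poly_Mapping.lookup m u) = 1"
      using True by simp
    have 1: "Poly_Mapping.lookup m w = 1" "(\<Sum>u\<in>UNIV - {w}. Poly_Mapping.lookup m u) = 0"
    proof -
      have "Poly_Mapping.lookup m w \<ge> 1" using w by (simp add: in_keys_iff Suc_le_eq)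
      then show "Poly_Mapping.lookup m w = 1" "(\<Sum>u\<in>UNIV - {w}. Poly_Mapping.lookup m u) = 0"
        using s by linarith+
    qed
    have "Poly_Mapping.lookup m u = 0" if "u \<noteq> w" for u
      using 1(2) that by simp
    then have m: "m = Poly_Mapping.single w 1"
      using 1(1) by (intro poly_mapping_eqI) (auto simp: lookup_single when_def)
    have "Poly_Mapping.lookup (\<Sum>u\<in>UNIV. Const (Poly_Mapping.lookup p (Poly_Mapping.single u 1)) * Var u) m = (\<Sum>u\<in>UNIV. if u = w then Poly_Mapping.lookup p (Poly_Mapping.single u 1) else 0)"
      unfolding lookup_sum
      by (intro sum.cong) (auto simp: m lookup_Const_mult Var_conv_mon lookup_mon single_1_eq_iff)
    then show ?thesis by (simp add: m)
  next
    case False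
    then have "Poly_Mapping.lookup p m = 0"
      using assms by (auto simp: homog_whomog whomog_def in_keys_iff)
    moreover have "Poly_Mapping.lookup (Const (Poly_Mapping.lookup p (Poly_Mapping.single u 1)) * Var u) m = 0" for u
      using False by (auto simp: lookup_Const_mult Var_conv_mon lookup_mon)
    ultimately show ?thesis by (simp add: lookup_sum)
  qed
qed

theorem no_linear_syzygy:
  assumes "\<And>v. f v \<in> homog 1" "(\<Sum>v\<in>UNIV. f v * rel v) = 0"
  shows "f v = 0"
proof -
  define c where "c v u = Poly_Mapping.lookup (f v) (Poly_Mapping.single u 1)" for v u
  have f: "f v = (\<Sum>u\<in>UNIV. Const (c v u) * Var u)" for v
    unfolding c_def by (rule homog_1_expand[OF assms(1)])
  have "(\<Sum>v\<in>UNIV. (\<Sum>u\<in>UNIV. c v u * x u) * rq v x) = 0" for x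
  proof -
    have "subst (\<lambda>u. Const (x u)) (\<Sum>v\<in>UNIV. f v * rel v) = (0 :: vi qpoly)"
      using assms(2) by simp
    then have "Const (\<Sum>v\<in>UNIV. (\<Sum>u\<in>UNIV. c v u * x u) * rq v x) = (0 :: vi qpoly)"
      by (simp add: f subst_rel_point Const_sum Const_mult)
    then show ?thesis by simp
  qed
  then have "c v u = 0" for v u by (rule no_linear_relation)
  then show ?thesis using f[of v] by simp
qed

section \<open>The action of the symmetric group\<close>

text \<open>Twice the action of the transposition of labels 1 and 2, which mixes the first two
  pairs; the factor 2 clears the denominators.\<close>

fun n12 :: "vi \<Rightarrow> vi qpoly" where
  "n12 P0 = Var P0 - Var P12"
| "n12 P12 = - (3 * Var P0) - Var P12"
| "n12 P13 = Var P13 - Var P23 - Var Q4"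
| "n12 P14 = Var P14 - Var P24 + Var Q3"
| "n12 P23 = - (Var P13) + Var P23 - Var Q4"
| "n12 P24 = - (Var P14) + Var P24 + Var Q3"
| "n12 P34 = Var P34 - Var R1"
| "n12 Q1 = Var Q1 + Var Q2 - Var TT"
| "n12 Q2 = Var Q1 + Var Q2 + Var TT"
| "n12 Q3 = 2 * Var P14 + 2 * Var P24"
| "n12 Q4 = - (2 * Var P13) - 2 * Var P23"
| "n12 R1 = - (3 * Var P34) - Var R1"
| "n12 R2 = - (Var P34) - Var Q1 + Var Q2 - Var R1 + 2 * Var R2 - Var TT"
| "n12 TT = - (2 * Var Q1) + 2 * Var Q2"

text \<open>\<open>mc1\<close>, \<open>mc2\<close>, \<open>mc3\<close> interchange two adjacent
  pairs as wholes. They permute the indices, volumes being alternating, and are even permutations of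
  the labels.\<close>

fun mc1 :: "vi \<Rightarrow> vi qpoly" where
  "mc1 P0 = Var P0"
| "mc1 P12 = Var P12"
| "mc1 P13 = Var P23"
| "mc1 P14 = Var P24"
| "mc1 P23 = Var P13"
| "mc1 P24 = Var P14"
| "mc1 P34 = Var P34"
| "mc1 Q1 = - (Var Q2)"
| "mc1 Q2 = - (Var Q1)"
| "mc1 Q3 = - (Var Q3)"
| "mc1 Q4 = - (Var Q4)"
| "mc1 R1 = Var R1"
| "mc1 R2 = Var R2 - Var TT"
| "mc1 TT = - (Var TT)"

fun mc2 :: "vi \<Rightarrow> vi qpoly" where
  "mc2 P0 = Var P0"
| "mc2 P12 = Var P13"
| "mc2 P13 = Var P12"
| "mc2 P14 = Var P14"
| "mc2 P23 = Var P23"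
| "mc2 P24 = Var P34"
| "mc2 P34 = Var P24"
| "mc2 Q1 = - (Var Q1)"
| "mc2 Q2 = - (Var Q3)"
| "mc2 Q3 = - (Var Q2)"
| "mc2 Q4 = - (Var Q4)"
| "mc2 R1 = Var R2"
| "mc2 R2 = Var R1"
| "mc2 TT = Var R1 - Var R2 + Var TT"

fun mc3 :: "vi \<Rightarrow> vi qpoly" where
  "mc3 P0 = Var P0"
| "mc3 P12 = Var P12"
| "mc3 P13 = Var P14"
| "mc3 P14 = Var P13"
| "mc3 P23 = Var P24"
| "mc3 P24 = Var P23"
| "mc3 P34 = Var P34"
| "mc3 Q1 = - (Var Q1)"
| "mc3 Q2 = - (Var Q2)"
| "mc3 Q3 = - (Var Q4)"
| "mc3 Q4 = - (Var Q3)"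
| "mc3 R1 = Var R1"
| "mc3 R2 = Var R2 - Var TT"
| "mc3 TT = - (Var TT)"


text \<open>Swapping the two points of a pair fixes its quadratic form and negates its bracket. So
  the sign is -1 exactly if that bracket is a factor of the invariant, that is, if the
  \<open>Z\<close> of the pair divides its leading monomial.\<close>

definition eps :: "pc \<Rightarrow> vi \<Rightarrow> rat"
  where "eps x v = (if x \<in> set (el v) then -1 else 1)"

lemma perm_act_simps:
  "perm_act \<sigma> (p + q) = perm_act \<sigma> p + perm_act \<sigma> q"
  "perm_act \<sigma> (p - q) = perm_act \<sigma> p - perm_act \<sigma> q"
  "perm_act \<sigma> (p * q) = perm_act \<sigma> p * perm_act \<sigma> q"
  "perm_act \<sigma> 1 = 1"
  "perm_act \<sigma> (- p) = - perm_act \<sigma> p"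
  "perm_act \<sigma> (scale c p) = scale c (perm_act \<sigma> p)"
  "perm_act \<sigma> (br i j) = br (\<sigma> i) (\<sigma> j)"
  "perm_act \<sigma> (dot i j k l) = dot (\<sigma> i) (\<sigma> j) (\<sigma> k) (\<sigma> l)"
  "perm_act \<sigma> (vol i j k l m n) = vol (\<sigma> i) (\<sigma> j) (\<sigma> k) (\<sigma> l) (\<sigma> m) (\<sigma> n)"
  by (simp_all add: perm_act_def br_def dot_def vol_def)

lemma perm_act_comp: "perm_act \<sigma> (perm_act \<tau> p) = perm_act (\<sigma> \<circ> \<tau>) p"
proof -
  have "Var (perm_coord \<sigma> (perm_coord \<tau> u)) = Var (perm_coord (\<sigma> \<circ> \<tau>) u)" for u
    by (cases u) simp_all
  then show ?thesis by (simp add: perm_act_def subst_subst)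
qed

lemma perm_act_id [simp]: "perm_act id p = p"
proof -
  have "perm_coord id u = u" for u by (cases u) simp_all
  then show ?thesis by (simp add: perm_act_def)
qed

text \<open>By the first fundamental theorem \<open>V\<close> is spanned by bracket monomials of
  regular graphs, and relabelling vertices preserves these.\<close>

lemma perm_act_V:
  assumes "x \<in> V" "\<sigma> permutes UNIV"
  shows "perm_act \<sigma> x \<in> V"
proof -
  have "x \<in> bspan (\<lambda>_. 1)"
    using assms(1) by (intro first_fundamental_theorem invar_if_SL2_invariant) (simp_all add: Rpiece_mhom)
  then show ?thesis
    unfolding bspan_def perm_act_def
  proof (rule subst_span[OF _ _ subspace_Rpiece])
    fix y assume "y \<in> {bm G |G. gdeg G = (\<lambda>_. 1)}"
    then obtain G where G: "y = bm G" "gdeg G = (\<lambda>_. 1)" by blast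
    define H where "H = image_mset (map_prod \<sigma> \<sigma>) G"
    have "perm_act \<sigma> (bm G) = bm H"
      unfolding H_def by (induction G) (auto simp: perm_act_simps)
    moreover have "gdeg H (\<sigma> k) = gdeg G k" for k
      unfolding H_def by (induction G) (auto simp: gdeg_add_mset permutes_inj[OF assms(2)] inj_eq)
    then have "gdeg H k = 1" for k
      using permutes_surj[OF assms(2)] G(2) by (metis surj_def)
    then have "bm H \<in> V"
      using bm_mhom[of H] SL2_invariant_bm[of H] by (simp add: Rpiece_mhom) (metis ext)
    ultimately show "subst (\<lambda>u. Var (perm_coord \<sigma> u)) y \<in> V"
      by (simp add: G perm_act_def)
  qed
qed

definition perm_mat :: "(8 \<Rightarrow> 8) \<Rightarrow> (vi \<Rightarrow> vi qpoly) \<Rightarrow> bool"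
  where "perm_mat \<sigma> M \<longleftrightarrow> \<sigma> permutes UNIV \<and> (\<forall>v. M v \<in> homog 1 \<and> perm_act \<sigma> (sb v) = subst sb (M v))"

abbreviation tp :: "8 \<Rightarrow> 8 \<Rightarrow> 8 \<Rightarrow> 8"
  where "tp \<equiv> Transposition.transpose"

lemma tp_permutes: "tp a b permutes UNIV"
  by (rule permutes_swap_id) auto

lemma sign_tp: "a \<noteq> b \<Longrightarrow> sign (tp a b) = -1"
  by (simp add: sign_swap_id)

lemma permutation_if_permutes: "(\<sigma> :: 8 \<Rightarrow> 8) permutes UNIV \<Longrightarrow> permutation \<sigma>"
  unfolding permutation_permutes by (metis finite)

lemma sign_cherry_swap:
  fixes a b c d :: 8
  assumes "a \<noteq> c" "b \<noteq> d"
  shows "sign (tp a c \<circ> tp b d) = (1 :: int)"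
  using assms by (simp add: sign_compose permutation_if_permutes tp_permutes sign_swap_id)

lemma dot_swap: "dot b a c d = dot a b c d" "dot c d b a = dot c d a b"
  unfolding dot_def by simp_all

lemma vol_swap: "vol b a c d e f = vol a b c d e f" "vol c d b a e f = vol c d a b e f" "vol c d e f b a = vol c d e f a b"
  unfolding vol_coord fa_def fb_def fc_def by (simp_all add: algebra_simps)

lemma homog_intros:
  "p \<in> homog d \<Longrightarrow> q \<in> homog d \<Longrightarrow> p + q \<in> homog d"
  "p \<in> homog d \<Longrightarrow> q \<in> homog d \<Longrightarrow> p - q \<in> homog d"
  "p \<in> homog d \<Longrightarrow> - p \<in> homog d"
  "p \<in> homog d \<Longrightarrow> Const c * p \<in> homog d"
  "p \<in> homog d \<Longrightarrow> numeral k * p \<in> homog d"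
  "Var v \<in> homog 1"
  using whomog_Const_mult[of p "\<lambda>_. 1" d "numeral k"]
  by (simp_all add: homog_whomog whomog_add whomog_diff whomog_uminus whomog_Const_mult)
    (use whomog_Var[of v "\<lambda>_. 1"] in simp)

lemma perm_mat_eps:
  "perm_mat (tp 0 1) (\<lambda>v. Const (eps Z1 v) * Var v)"
  "perm_mat (tp 2 3) (\<lambda>v. Const (eps Z2 v) * Var v)"
  "perm_mat (tp 4 5) (\<lambda>v. Const (eps Z3 v) * Var v)"
  "perm_mat (tp 6 7) (\<lambda>v. Const (eps Z4 v) * Var v)"
proof -
  have "perm_act (tp 0 1) (sb v) = Const (eps Z1 v) * sb v" for v
    by (cases v) (simp_all add: eps_def perm_act_simps Transposition.transpose_def br_swap[of 1 0]
        dot_swap[where a = 0 and b = 1] vol_swap[where a = 0 and b = 1])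
  moreover have "perm_act (tp 2 3) (sb v) = Const (eps Z2 v) * sb v" for v
    by (cases v) (simp_all add: eps_def perm_act_simps Transposition.transpose_def br_swap[of 3 2]
        dot_swap[where a = 2 and b = 3] vol_swap[where a = 2 and b = 3])
  moreover have "perm_act (tp 4 5) (sb v) = Const (eps Z3 v) * sb v" for v
    by (cases v) (simp_all add: eps_def perm_act_simps Transposition.transpose_def br_swap[of 5 4]
        dot_swap[where a = 4 and b = 5] vol_swap[where a = 4 and b = 5])
  moreover have "perm_act (tp 6 7) (sb v) = Const (eps Z4 v) * sb v" for v
    by (cases v) (simp_all add: eps_def perm_act_simps Transposition.transpose_def br_swap[of 7 6]
        dot_swap[where a = 6 and b = 7] vol_swap[where a = 6 and b = 7])
  ultimately show
    "perm_mat (tp 0 1) (\<lambda>v. Const (eps Z1 v) * Var v)"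
    "perm_mat (tp 2 3) (\<lambda>v. Const (eps Z2 v) * Var v)"
    "perm_mat (tp 4 5) (\<lambda>v. Const (eps Z3 v) * Var v)"
    "perm_mat (tp 6 7) (\<lambda>v. Const (eps Z4 v) * Var v)"
    by (simp_all add: perm_mat_def tp_permutes homog_intros(4) del: One_nat_def add: homog_Var)
qed

lemma cherry_swap_permutes: "tp a b \<circ> tp c d permutes UNIV"
  by (intro permutes_compose tp_permutes)

lemma perm_mat_mc:
  "perm_mat (tp 0 2 \<circ> tp 1 3) mc1"
  "perm_mat (tp 2 4 \<circ> tp 3 5) mc2"
  "perm_mat (tp 4 6 \<circ> tp 5 7) mc3"
proof -
  have h: "mc1 v \<in> homog 1" "mc2 v \<in> homog 1" "mc3 v \<in> homog 1" for v
    by (cases v; simp only: mc1.simps mc2.simps mc3.simps; intro homog_intros)+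
  have "perm_act (tp 0 2 \<circ> tp 1 3) (sb v) = subst sb (mc1 v)" for v
    by (cases v) (simp_all add: perm_act_simps Transposition.transpose_def cherry_swaps algebra_simps)
  moreover have "perm_act (tp 2 4 \<circ> tp 3 5) (sb v) = subst sb (mc2 v)" for v
    by (cases v) (simp_all add: perm_act_simps Transposition.transpose_def cherry_swaps algebra_simps)
  moreover have "perm_act (tp 4 6 \<circ> tp 5 7) (sb v) = subst sb (mc3 v)" for v
    by (cases v) (simp_all add: perm_act_simps Transposition.transpose_def cherry_swaps algebra_simps)
  ultimately show
    "perm_mat (tp 0 2 \<circ> tp 1 3) mc1"
    "perm_mat (tp 2 4 \<circ> tp 3 5) mc2"
    "perm_mat (tp 4 6 \<circ> tp 5 7) mc3"
    using h by (simp_all only: perm_mat_def cherry_swap_permutes simp_thms)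
qed

text \<open>Only the pairs among the labels 0 to 3 are expanded into coordinates. The forms of the
  pairs 45 and 67 stay symbolic, since the transposition of 1 and 2 does not touch them.\<close>

lemmas fabc_low =
  br_def[of 0 1] br_def[of 2 3] br_def[of 0 2] br_def[of 1 3]
  fa_def[of 0 1] fa_def[of 2 3] fa_def[of 0 2] fa_def[of 1 3]
  fb_def[of 0 1] fb_def[of 2 3] fb_def[of 0 2] fb_def[of 1 3]
  fc_def[of 0 1] fc_def[of 2 3] fc_def[of 0 2] fc_def[of 1 3]

lemma perm_act_12: "2 * perm_act (tp 1 2) (sb v) = subst sb (n12 v)"
proof -
  show ?thesis
    by (cases v)
      (simp_all only: sb.simps perm_act_simps Transposition.transpose_def n12.simps subst_add subst_diff
        subst_uminus subst_mult subst_numeral subst_Var,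
       simp_all add: dot_coord vol_coord fabc_low algebra_simps)
qed

lemma perm_mat_12: "perm_mat (tp 1 2) (\<lambda>v. Const (1/2) * n12 v)"
proof -
  have "n12 v \<in> homog 1" for v
    by (cases v; simp only: n12.simps; intro homog_intros)
  moreover have "perm_act (tp 1 2) (sb v) = subst sb (Const (1/2) * n12 v)" for v
  proof -
    have "Const (1/2) * 2 = (1 :: coord qpoly)"
      using Const_mult[of "1/2" 2] by simp
    then show ?thesis
      by (simp add: perm_act_12[symmetric] flip: mult.assoc)
  qed
  ultimately show ?thesis
    by (simp add: perm_mat_def tp_permutes homog_intros(4))
qed

lemma cubic_eps: "subst (\<lambda>v. Const (eps Z1 v) * Var v) cubic = - cubic"
  unfolding cubic_def by (simp add: eps_def)

lemma cubic_mc: "subst mc1 cubic = cubic" "subst mc2 cubic = cubic" "subst mc3 cubic = cubic"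
  unfolding cubic_def by (simp_all add: algebra_simps)

text \<open>The factor is the sign of the transposition times 2^3, from the doubling in
  \<open>n12\<close>.\<close>

lemma cubic_n12: "subst n12 cubic = - 8 * cubic"
  unfolding cubic_def by (simp add: algebra_simps)

lemma subst_half_n12:
  assumes "p \<in> homog 3"
  shows "subst (\<lambda>v. Const (1/2) * n12 v) p = Const (1/8) * subst n12 p"
proof -
  have "subst (\<lambda>v. Const (1/2) ^ 1 * n12 v) p = Const (1/2) ^ 3 * subst n12 p"
    using assms by (intro subst_scaled) (simp add: homog_whomog)
  then show ?thesis by (simp add: power3_eq_cube flip: Const_mult)
qed

section \<open>Bases of the space of invariants\<close>

lemma V_eq_span: "V = qpoly.span (range sb)"
proof
  show "qpoly.span (range sb) \<subseteq> V"
    using sb_Rpiece by (intro qpoly.span_minimal subspace_Rpiece) auto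
  show "V \<subseteq> qpoly.span (range sb)"
  proof
    fix x assume "x \<in> V"
    then obtain p where p: "x = subst sb p" "p \<in> homog 1" using kempe[of 1] by auto
    have "subst sb p = (\<Sum>u\<in>UNIV. scale (Poly_Mapping.lookup p (Poly_Mapping.single u 1)) (sb u))"
      by (subst homog_1_expand[OF p(2)]) (simp add: scale_def)
    also have "\<dots> \<in> qpoly.span (range sb)"
      by (intro qpoly.span_sum qpoly.span_scale qpoly.span_base) auto
    finally show "x \<in> qpoly.span (range sb)" by (simp add: p)
  qed
qed

lemma sb_combination_0:
  assumes "(\<Sum>u\<in>UNIV. scale (c u) (sb u)) = 0"
  shows "c u = 0"
proof -
  define p where "p = (\<Sum>u\<in>UNIV. Const (c u) * Var u)"
  have "p \<in> homog 1"
    unfolding p_def homog_whomog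
    by (intro whomog_sum whomog_Const_mult) (use homog_Var in \<open>simp add: homog_whomog\<close>)
  moreover have "p \<in> J"
    using assms by (simp add: p_def scale_def flip: kernel_subst_sb)
  ultimately have "p = 0" by (rule linear_in_J)
  have "Poly_Mapping.lookup p (Poly_Mapping.single u 1) = (\<Sum>w\<in>UNIV. if w = u then c w else 0)"
    unfolding p_def lookup_sum
    by (intro sum.cong) (auto simp: lookup_Const_mult Var_conv_mon lookup_mon single_1_eq_iff)
  then show ?thesis by (simp add: \<open>p = 0\<close>)
qed

lemma inj_sb: "inj sb"
proof (rule injI, rule ccontr)
  fix x y assume xy: "sb x = sb y" "x \<noteq> y"
  have "(\<Sum>u\<in>UNIV. scale (if u = x then 1 else if u = y then -1 else 0) (sb u)) =
      (\<Sum>u\<in>UNIV. (if u = x then sb x else 0) - (if u = y then sb y else 0))"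
    using xy(2) by (intro sum.cong) (auto simp: scale_def)
  also have "\<dots> = 0" using xy(1) by (simp add: sum_subtractf)
  finally show False using sb_combination_0[of "\<lambda>u. if u = x then 1 else if u = y then -1 else 0" x] by simp
qed

lemma is_basis_sb: "is_basis sb"
proof -
  have "qpoly.independent (range sb)"
  proof (rule qpoly.independent_if_scalars_zero)
    show "finite (range sb)" by simp
    fix f x assume "(\<Sum>x\<in>range sb. scale (f x) x) = 0" and x: "x \<in> range sb"
    then have "(\<Sum>u\<in>UNIV. scale (f (sb u)) (sb u)) = 0"
      by (simp add: sum.reindex[OF inj_sb] comp_def)
    then have "f (sb u) = 0" for u by (rule sb_combination_0)
    then show "f x = 0" using x by auto
  qed
  then show ?thesis
    by (simp add: is_basis_def inj_sb V_eq_span del: One_nat_def)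
qed

locale basis =
  fixes b :: "'n::finite \<Rightarrow> coord qpoly"
  assumes is_basis: "is_basis b"
begin

lemma inj_b: "inj b" and indep: "qpoly.independent (range b)" and span_b: "qpoly.span (range b) = V"
  using is_basis by (auto simp: is_basis_def)

lemma b_in_V: "b j \<in> V"
  using qpoly.span_base[of "b j" "range b"] span_b by auto

lemma incl_add: "x \<in> V \<Longrightarrow> y \<in> V \<Longrightarrow> incl b (x + y) = incl b x + incl b y"
  by (simp add: incl_def qpoly.representation_add[OF indep] span_b qpoly.scale_left_distrib sum.distrib)

lemma incl_scale: "x \<in> V \<Longrightarrow> incl b (scale c x) = scale c (incl b x)"
  by (simp add: incl_def qpoly.representation_scale[OF indep] span_b qpoly.scale_sum_right)

lemma incl_0: "incl b 0 = 0"
  by (simp add: incl_def qpoly.representation_zero)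

lemma incl_sum: "(\<And>x. x \<in> A \<Longrightarrow> f x \<in> V) \<Longrightarrow> incl b (sum f A) = (\<Sum>x\<in>A. incl b (f x))"
proof (induction A rule: infinite_finite_induct)
  case (insert x A)
  then have "sum f A \<in> V" by (intro qpoly.subspace_sum[OF subspace_Rpiece]) auto
  then show ?case using insert by (simp add: incl_add)
qed (simp_all add: incl_0)

lemma incl_basis: "incl b (b j) = Var j"
proof -
  have "incl b (b j) = (\<Sum>k\<in>UNIV. if k = j then Var k else 0)"
    unfolding incl_def
    by (intro sum.cong)
      (auto simp: qpoly.representation_basis[OF indep] inj_eq[OF inj_b] scale_def)
  then show ?thesis by simp
qed

definition co :: "coord qpoly \<Rightarrow> 'n \<Rightarrow> rat"
  where "co x j = qpoly.representation (range b) x (b j)"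

lemma expand_V: "x \<in> V \<Longrightarrow> x = (\<Sum>j\<in>UNIV. scale (co x j) (b j))"
  using qpoly.sum_representation_eq[OF indep, of x "range b"] span_b
  by (simp add: co_def sum.reindex[OF inj_b] comp_def)

lemma incl_co: "incl b x = (\<Sum>j\<in>UNIV. scale (co x j) (Var j))"
  by (simp add: incl_def co_def)

lemma incl_homog: "incl b x \<in> homog 1"
  unfolding incl_co homog_whomog
  by (intro whomog_sum whomog_scale) (use homog_Var in \<open>simp add: homog_whomog\<close>)

text \<open>The universal property of the symmetric algebra in degree one: substituting the values
  of a linear map at the basis computes that map on all of \<open>V\<close>.\<close>

lemma subst_incl:
  assumes "x \<in> V" "\<And>y z. y \<in> V \<Longrightarrow> z \<in> V \<Longrightarrow> F (y + z) = F y + F z"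
    and "\<And>y c. y \<in> V \<Longrightarrow> F (scale c y) = scale c (F y)" "\<And>j. g j = F (b j)"
  shows "subst g (incl b x) = F x"
proof -
  have F0: "F 0 = 0"
    using assms(3)[of 0 0] qpoly.subspace_0[OF subspace_Rpiece] by (simp add: scale_def)
  have F_sum: "F (sum f A) = (\<Sum>x\<in>A. F (f x))" if "\<And>x. x \<in> A \<Longrightarrow> f x \<in> V" for f and A :: "'n set"
    using that
  proof (induction A rule: infinite_finite_induct)
    case (insert x A)
    then have "sum f A \<in> V" by (intro qpoly.subspace_sum[OF subspace_Rpiece]) auto
    then show ?case using insert by (simp add: assms(2))
  qed (simp_all add: F0)
  have "F x = F (\<Sum>j\<in>UNIV. scale (co x j) (b j))"
    using expand_V[OF assms(1)] by simp
  also have "\<dots> = (\<Sum>j\<in>UNIV. scale (co x j) (g j))"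
    using b_in_V qpoly.subspace_scale[OF subspace_Rpiece]
    by (simp add: F_sum assms(3,4))
  finally show ?thesis by (simp add: incl_co)
qed

lemma sym_act_incl:
  assumes "x \<in> V" "\<sigma> permutes UNIV"
  shows "sym_act b \<sigma> (incl b x) = incl b (perm_act \<sigma> x)"
  unfolding sym_act_def
  by (rule subst_incl[OF assms(1)])
    (simp_all add: perm_act_simps incl_add incl_scale perm_act_V assms(2) del: One_nat_def)

lemma sym_act_comp:
  assumes "\<sigma> permutes UNIV" "\<tau> permutes UNIV"
  shows "sym_act b \<sigma> (sym_act b \<tau> p) = sym_act b (\<sigma> \<circ> \<tau>) p"
proof -
  have "sym_act b \<sigma> (incl b (perm_act \<tau> (b j))) = incl b (perm_act (\<sigma> \<circ> \<tau>) (b j))" for j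
    using sym_act_incl[OF perm_act_V[OF b_in_V assms(2)] assms(1)] by (simp add: perm_act_comp)
  then show ?thesis by (simp add: sym_act_def subst_subst)
qed

text \<open>\<open>Y\<close> and the later \<open>Th\<close> are the mutually inverse coordinate
  changes between the special basis \<open>sb\<close> and the given basis \<open>b\<close>; all
  explicit computations are transported along them.\<close>

definition Y :: "vi \<Rightarrow> 'n qpoly"
  where "Y v = incl b (sb v)"

lemma subst_Y_linear:
  assumes "l \<in> homog 1"
  shows "subst Y l = incl b (subst sb l)"
proof -
  have "subst Y l = (\<Sum>u\<in>UNIV. scale (Poly_Mapping.lookup l (Poly_Mapping.single u 1)) (incl b (sb u)))"
    by (subst homog_1_expand[OF assms]) (simp add: scale_def Y_def)
  also have "\<dots> = incl b (\<Sum>u\<in>UNIV. scale (Poly_Mapping.lookup l (Poly_Mapping.single u 1)) (sb u))"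
    using sb_Rpiece qpoly.subspace_scale[OF subspace_Rpiece] by (simp add: incl_sum incl_scale)
  also have "(\<Sum>u\<in>UNIV. scale (Poly_Mapping.lookup l (Poly_Mapping.single u 1)) (sb u)) = subst sb l"
    by (subst (2) homog_1_expand[OF assms]) (simp add: scale_def)
  finally show ?thesis .
qed

lemma sym_act_subst_Y:
  assumes "perm_mat \<sigma> M"
  shows "sym_act b \<sigma> (subst Y p) = subst Y (subst M p)"
proof -
  have "sym_act b \<sigma> (Y v) = subst Y (M v)" for v
    using assms sym_act_incl[OF sb_Rpiece, of \<sigma> v] subst_Y_linear[of "M v"]
    by (simp add: perm_mat_def Y_def)
  then show ?thesis by (simp add: sym_act_def subst_subst)
qed

definition Th :: "'n \<Rightarrow> vi qpoly"
  where "Th j = incl sb (b j)"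

end

interpretation sb: basis sb
  by standard (rule is_basis_sb)

context basis
begin

lemma Y_Th: "subst Y (subst Th p) = p"
proof -
  have "subst Y (Th j) = Var j" for j
  proof -
    have "subst Y (incl sb (b j)) = incl b (b j)"
      by (rule sb.subst_incl[OF b_in_V]) (simp_all add: incl_add incl_scale Y_def)
    then show ?thesis by (simp add: Th_def incl_basis)
  qed
  then show ?thesis by (simp add: subst_subst)
qed

lemma Th_Y: "subst Th (subst Y q) = q"
proof -
  have "subst Th (Y v) = Var v" for v
  proof -
    have "subst Th (incl b (sb v)) = incl sb (sb v)"
      by (rule subst_incl[OF sb_Rpiece]) (simp_all add: sb.incl_add sb.incl_scale Th_def)
    then show ?thesis by (simp add: Y_def sb.incl_basis)
  qed
  then show ?thesis by (simp add: subst_subst)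
qed

lemma subst_b_incl: "x \<in> V \<Longrightarrow> subst b (incl b x) = x"
  by (rule subst_incl) simp_all

lemma subst_b_Y: "subst b (subst Y q) = subst sb q"
  using subst_b_incl[OF sb_Rpiece] by (simp add: subst_subst Y_def)

lemma homog_subst_Th: "p \<in> homog d \<Longrightarrow> subst Th p \<in> homog d"
  using whomog_subst[of Th "\<lambda>_. 1" "\<lambda>_. 1" p d] sb.incl_homog by (simp add: homog_whomog Th_def)

lemma homog_subst_Y: "p \<in> homog d \<Longrightarrow> subst Y p \<in> homog d"
  using whomog_subst[of Y "\<lambda>_. 1" "\<lambda>_. 1" p d] incl_homog by (simp add: homog_whomog Y_def)

section \<open>The skew-invariant cubic\<close>

definition s where "s = subst Y cubic"

text \<open>The permutations that act on \<open>s\<close> by their sign. They are closed under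
  composition, so it suffices to find generators among them.\<close>

definition K :: "(8 \<Rightarrow> 8) \<Rightarrow> bool"
  where "K \<sigma> \<longleftrightarrow> \<sigma> permutes UNIV \<and> sym_act b \<sigma> s = scale (of_int (sign \<sigma>)) s"

lemma K_comp:
  assumes "K \<sigma>" "K \<tau>"
  shows "K (\<sigma> \<circ> \<tau>)"
proof -
  have p: "\<sigma> permutes UNIV" "\<tau> permutes UNIV" using assms by (auto simp: K_def)
  have "sym_act b (\<sigma> \<circ> \<tau>) s = sym_act b \<sigma> (sym_act b \<tau> s)"
    by (simp add: sym_act_comp p)
  also have "\<dots> = scale (of_int (sign \<tau>)) (sym_act b \<sigma> s)"
    using assms(2) by (simp add: K_def sym_act_def)
  also have "\<dots> = scale (of_int (sign (\<sigma> \<circ> \<tau>))) s"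
    using assms(1) sign_compose[OF permutation_if_permutes[OF p(1)] permutation_if_permutes[OF p(2)]]
    by (simp add: K_def mult.commute)
  finally show ?thesis using permutes_compose[OF p(2,1)] by (simp add: K_def)
qed

lemma K_mat:
  assumes "perm_mat \<sigma> M" "subst M cubic = Const (of_int (sign \<sigma>)) * cubic"
  shows "K \<sigma>"
  using assms sym_act_subst_Y[OF assms(1), of cubic]
  by (simp add: K_def s_def perm_mat_def scale_def)

lemma K_generators: "K (tp 0 1)" "K (tp 1 2)"
  "K (tp 0 2 \<circ> tp 1 3)" "K (tp 2 4 \<circ> tp 3 5)" "K (tp 4 6 \<circ> tp 5 7)"
proof -
  show "K (tp 0 1)"
    by (rule K_mat[OF perm_mat_eps(1)]) (simp add: sign_tp cubic_eps)
  show "K (tp 1 2)"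
  proof (rule K_mat[OF perm_mat_12])
    have "Const (1/8) * (- 8 * cubic) = - cubic"
    proof -
      have "Const (1/8) * 8 = (1 :: vi qpoly)" using Const_mult[of "1/8" 8] by simp
      then have "Const (1/8) * 8 * cubic = cubic" by simp
      then show ?thesis by (simp add: mult.assoc)
    qed
    then show "subst (\<lambda>v. Const (1/2) * n12 v) cubic = Const (of_int (sign (tp 1 2))) * cubic"
      by (simp add: sign_tp subst_half_n12[OF cubic_homog] cubic_n12)
  qed
  show "K (tp 0 2 \<circ> tp 1 3)" "K (tp 2 4 \<circ> tp 3 5)" "K (tp 4 6 \<circ> tp 5 7)"
    by (rule K_mat[OF perm_mat_mc(1)] K_mat[OF perm_mat_mc(2)] K_mat[OF perm_mat_mc(3)];
      simp add: sign_cherry_swap cubic_mc)+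
qed

lemma K_tp_conj:
  assumes "K \<sigma>" "\<sigma> \<circ> \<sigma> = id" "K (tp i j)"
  shows "K (tp (\<sigma> i) (\<sigma> j))"
proof -
  have "bij \<sigma>" using assms(1) permutes_bij by (auto simp: K_def)
  have "\<sigma> \<circ> tp i j \<circ> \<sigma> = tp (\<sigma> i) (\<sigma> j) \<circ> \<sigma> \<circ> \<sigma>"
    using inj_eq[OF bij_is_inj[OF \<open>bij \<sigma>\<close>]] assms(2)
    by (auto simp: fun_eq_iff Transposition.transpose_def)
  also have "\<dots> = tp (\<sigma> i) (\<sigma> j)"
    using assms(2) by (simp add: comp_assoc)
  finally show ?thesis
    using K_comp[OF K_comp[OF assms(1,3)] assms(1)] by simp
qed

lemma K_id: "K id"
proof -
  have "sym_act b id p = p" for p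
    using incl_basis by (simp add: sym_act_def)
  then show ?thesis by (simp add: K_def permutes_id)
qed

lemma K_tp_trans:
  assumes "K (tp i j)" "K (tp j k)"
  shows "K (tp i k)"
proof (cases "i = k \<or> i = j \<or> j = k")
  case True
  then show ?thesis using assms K_id by (auto simp: transpose_same)
next
  case False
  have "K (tp (tp i j j) (tp i j k))"
    by (rule K_tp_conj) (use assms in \<open>simp_all add: fun_eq_iff\<close>)
  moreover have "tp i j j = i" "tp i j k = k" using False by (auto simp: Transposition.transpose_def)
  ultimately show ?thesis by simp
qed

text \<open>Conjugation by the swaps of adjacent pairs carries the transposition (0 1) to (2 3), (4
  5), (6 7), and (1 2) to (1 4), (1 6). These connect all labels, and \<open>K_tp_trans\<close>
  gives the remaining transpositions.\<close>

lemma K_tp: "K (tp i j)"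
proof -
  have inv: "tp a c \<circ> tp e d \<circ> (tp a c \<circ> tp e d) = id" if "distinct [a, e, c, d]" for a e c d :: 8
    using that by (auto simp: fun_eq_iff Transposition.transpose_def)
  note conj1 = K_tp_conj[OF K_generators(3) inv]
  note conj2 = K_tp_conj[OF K_generators(4) inv]
  note conj3 = K_tp_conj[OF K_generators(5) inv]
  have 23: "K (tp 2 3)" using conj1[OF _ K_generators(1)] by (simp add: Transposition.transpose_def)
  have 45: "K (tp 4 5)" using conj2[OF _ 23] by (simp add: Transposition.transpose_def)
  have 67: "K (tp 6 7)" using conj3[OF _ 45] by (simp add: Transposition.transpose_def)
  have 14: "K (tp 1 4)" using conj2[OF _ K_generators(2)] by (simp add: Transposition.transpose_def)
  have 16: "K (tp 1 6)" using conj3[OF _ 14] by (simp add: Transposition.transpose_def)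
  have sym: "K (tp i j) \<Longrightarrow> K (tp j i)" for i j by (simp add: transpose_commute)
  have 1: "\<forall>i. K (tp 1 i)"
    unfolding forall_8
    using K_id sym[OF K_generators(1)] K_generators(2) K_tp_trans[OF K_generators(2) 23] 14
      K_tp_trans[OF 14 45] 16 K_tp_trans[OF 16 67]
    by (simp add: transpose_same)
  then show ?thesis using K_tp_trans sym by blast
qed

lemma skew_s: "skew_invariant b s"
proof -
  have "K \<sigma>" if "\<sigma> permutes UNIV" for \<sigma>
    using that
  proof (rule permutes_induct)
    show "finite (UNIV :: 8 set)" by simp
    show "K id" by (rule K_id)
    show "K (tp i j \<circ> p)" if "K p" for i j p
      using K_comp[OF K_tp that] .
  qed
  then show ?thesis by (auto simp: skew_invariant_def K_def)
qed

end

section \<open>The skew-average of cubics\<close>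

lemma eps_simps:
  "eps Z1 P0 = (if Z1 \<in> set (el P0) then -1 else 1)"
  "eps Z2 P0 = (if Z2 \<in> set (el P0) then -1 else 1)"
  "eps Z3 P0 = (if Z3 \<in> set (el P0) then -1 else 1)"
  "eps Z4 P0 = (if Z4 \<in> set (el P0) then -1 else 1)"
  "eps Z1 P12 = (if Z1 \<in> set (el P12) then -1 else 1)"
  "eps Z2 P12 = (if Z2 \<in> set (el P12) then -1 else 1)"
  "eps Z3 P12 = (if Z3 \<in> set (el P12) then -1 else 1)"
  "eps Z4 P12 = (if Z4 \<in> set (el P12) then -1 else 1)"
  "eps Z1 P13 = (if Z1 \<in> set (el P13) then -1 else 1)"
  "eps Z2 P13 = (if Z2 \<in> set (el P13) then -1 else 1)"
  "eps Z3 P13 = (if Z3 \<in> set (el P13) then -1 else 1)"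
  "eps Z4 P13 = (if Z4 \<in> set (el P13) then -1 else 1)"
  "eps Z1 P14 = (if Z1 \<in> set (el P14) then -1 else 1)"
  "eps Z2 P14 = (if Z2 \<in> set (el P14) then -1 else 1)"
  "eps Z3 P14 = (if Z3 \<in> set (el P14) then -1 else 1)"
  "eps Z4 P14 = (if Z4 \<in> set (el P14) then -1 else 1)"
  "eps Z1 P23 = (if Z1 \<in> set (el P23) then -1 else 1)"
  "eps Z2 P23 = (if Z2 \<in> set (el P23) then -1 else 1)"
  "eps Z3 P23 = (if Z3 \<in> set (el P23) then -1 else 1)"
  "eps Z4 P23 = (if Z4 \<in> set (el P23) then -1 else 1)"
  "eps Z1 P24 = (if Z1 \<in> set (el P24) then -1 else 1)"
  "eps Z2 P24 = (if Z2 \<in> set (el P24) then -1 else 1)"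
  "eps Z3 P24 = (if Z3 \<in> set (el P24) then -1 else 1)"
  "eps Z4 P24 = (if Z4 \<in> set (el P24) then -1 else 1)"
  "eps Z1 P34 = (if Z1 \<in> set (el P34) then -1 else 1)"
  "eps Z2 P34 = (if Z2 \<in> set (el P34) then -1 else 1)"
  "eps Z3 P34 = (if Z3 \<in> set (el P34) then -1 else 1)"
  "eps Z4 P34 = (if Z4 \<in> set (el P34) then -1 else 1)"
  "eps Z1 Q1 = (if Z1 \<in> set (el Q1) then -1 else 1)"
  "eps Z2 Q1 = (if Z2 \<in> set (el Q1) then -1 else 1)"
  "eps Z3 Q1 = (if Z3 \<in> set (el Q1) then -1 else 1)"
  "eps Z4 Q1 = (if Z4 \<in> set (el Q1) then -1 else 1)"
  "eps Z1 Q2 = (if Z1 \<in> set (el Q2) then -1 else 1)"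
  "eps Z2 Q2 = (if Z2 \<in> set (el Q2) then -1 else 1)"
  "eps Z3 Q2 = (if Z3 \<in> set (el Q2) then -1 else 1)"
  "eps Z4 Q2 = (if Z4 \<in> set (el Q2) then -1 else 1)"
  "eps Z1 Q3 = (if Z1 \<in> set (el Q3) then -1 else 1)"
  "eps Z2 Q3 = (if Z2 \<in> set (el Q3) then -1 else 1)"
  "eps Z3 Q3 = (if Z3 \<in> set (el Q3) then -1 else 1)"
  "eps Z4 Q3 = (if Z4 \<in> set (el Q3) then -1 else 1)"
  "eps Z1 Q4 = (if Z1 \<in> set (el Q4) then -1 else 1)"
  "eps Z2 Q4 = (if Z2 \<in> set (el Q4) then -1 else 1)"
  "eps Z3 Q4 = (if Z3 \<in> set (el Q4) then -1 else 1)"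
  "eps Z4 Q4 = (if Z4 \<in> set (el Q4) then -1 else 1)"
  "eps Z1 R1 = (if Z1 \<in> set (el R1) then -1 else 1)"
  "eps Z2 R1 = (if Z2 \<in> set (el R1) then -1 else 1)"
  "eps Z3 R1 = (if Z3 \<in> set (el R1) then -1 else 1)"
  "eps Z4 R1 = (if Z4 \<in> set (el R1) then -1 else 1)"
  "eps Z1 R2 = (if Z1 \<in> set (el R2) then -1 else 1)"
  "eps Z2 R2 = (if Z2 \<in> set (el R2) then -1 else 1)"
  "eps Z3 R2 = (if Z3 \<in> set (el R2) then -1 else 1)"
  "eps Z4 R2 = (if Z4 \<in> set (el R2) then -1 else 1)"
  "eps Z1 TT = (if Z1 \<in> set (el TT) then -1 else 1)"
  "eps Z2 TT = (if Z2 \<in> set (el TT) then -1 else 1)"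
  "eps Z3 TT = (if Z3 \<in> set (el TT) then -1 else 1)"
  "eps Z4 TT = (if Z4 \<in> set (el TT) then -1 else 1)"
  by (simp_all only: eps_def)

lemmas eps_values [simp] = eps_simps[simplified]

text \<open>The cubic monomial is fixed by the transposition inside some pair, an odd permutation,
  so its skew-average equals its own negative and is zero.\<close>

definition dead :: "vi \<Rightarrow> vi \<Rightarrow> vi \<Rightarrow> bool"
  where "dead u v w \<longleftrightarrow> (\<exists>x\<in>{Z1, Z2, Z3, Z4}. eps x u * (eps x v * eps x w) = 1)"

text \<open>\<open>r12\<close>, \<open>rc1\<close>, \<open>rc2\<close>, \<open>rc3\<close> produce
  cubics with vanishing skew-average: on cubics \<open>n12\<close> is 8 times the action of an odd
  permutation, while the swaps of pairs are even.\<close>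

definition r12 :: "vi qpoly \<Rightarrow> vi qpoly" where "r12 p = subst n12 p + 8 * p"
definition rc1 :: "vi qpoly \<Rightarrow> vi qpoly" where "rc1 p = subst mc1 p - p"
definition rc2 :: "vi qpoly \<Rightarrow> vi qpoly" where "rc2 p = subst mc2 p - p"
definition rc3 :: "vi qpoly \<Rightarrow> vi qpoly" where "rc3 p = subst mc3 p - p"

text \<open>Abstracts the cubics whose skew-average is a multiple of that of \<open>P0\<close>^3.
  The reduction of all cubics to this one monomial is thereby a computation in the coordinates
  \<open>vi\<close>, independent of the chosen basis.\<close>

locale skew_closed =
  fixes good :: "vi qpoly \<Rightarrow> bool"
  assumes good_add: "good p \<Longrightarrow> good q \<Longrightarrow> good (p + q)"
    and good_Const_mult: "good p \<Longrightarrow> good (Const c * p)"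
    and good_dead: "dead u v w \<Longrightarrow> good (Var u * (Var v * Var w))"
    and good_r12: "good (r12 (Var u * (Var v * Var w)))"
    and good_rc1: "good (rc1 (Var u * (Var v * Var w)))"
    and good_rc2: "good (rc2 (Var u * (Var v * Var w)))"
    and good_rc3: "good (rc3 (Var u * (Var v * Var w)))"
    and good_P0: "good (Var P0 * (Var P0 * Var P0))"
begin

lemma good_uminus: "good p \<Longrightarrow> good (- p)"
  using good_Const_mult[of p "-1"] by simp

lemma good_diff: "good p \<Longrightarrow> good q \<Longrightarrow> good (p - q)"
  using good_add[OF _ good_uminus, of p q] by simp

lemma good_numeral_mult: "good p \<Longrightarrow> good (numeral k * p)"
  using good_Const_mult[of p "numeral k"] by simp

lemma goodI: "good p" if "numeral k * p = q" "good q"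
proof -
  have "Const (inverse (numeral k)) * Const (numeral k) = (1 :: vi qpoly)"
    by (subst Const_mult[symmetric]) simp
  then have "Const (inverse (numeral k)) * Const (numeral k) * p = p" by simp
  then have "Const (inverse (numeral k)) * q = p"
    by (simp add: that(1)[symmetric] mult.assoc)
  then show ?thesis using good_Const_mult[OF that(2), of "inverse (numeral k)"] by simp
qed

lemmas good_intros = good_add good_diff good_uminus good_numeral_mult good_r12 good_rc1 good_rc2 good_rc3

text \<open>Every cubic monomial that is not killed by one of the transpositions inside the pairs
  is reduced to the cube of \<open>P0\<close>, by a chain of linear relations found by computer.\<close>

lemma good_monomial: "good (Var u * (Var v * Var w))"
proof -
  have k_P0_R1_TT: "good (Var P0 * (Var R1 * Var TT))"
    by (rule goodI[where k = "num.One" and q = "- (rc1 (Var P0 * (Var R1 * Var R2)))"];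
      ((intro good_intros)?; ((rule good_P0) | (rule good_dead))?)?;
      simp add: r12_def rc1_def rc2_def rc3_def dead_def eps_simps algebra_simps)
  have k_P12_P34_TT: "good (Var P12 * (Var P34 * Var TT))"
    by (rule goodI[where k = "num.One" and q = "- (rc1 (Var P12 * (Var P34 * Var R2)))"];
      ((intro good_intros)?; ((rule good_P0 | rule k_P0_R1_TT) | (rule good_dead))?)?;
      simp add: r12_def rc1_def rc2_def rc3_def dead_def eps_simps algebra_simps)
  have k_P0_P12_P12: "good (Var P0 * (Var P12 * Var P12))"
    by (rule goodI[where k = "num.Bit1 num.One" and q = "r12 (Var P0 * (Var P0 * Var P0)) - 9 * (Var P0 * (Var P0 * Var P0)) + 3 * (Var P0 * (Var P0 * Var P12)) + (Var P12 * (Var P12 * Var P12))"];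
      ((intro good_intros)?; ((rule good_P0 | rule k_P0_R1_TT | rule k_P12_P34_TT) | (rule good_dead))?)?;
      simp add: r12_def rc1_def rc2_def rc3_def dead_def eps_simps algebra_simps)
  have k_P0_P13_P13: "good (Var P0 * (Var P13 * Var P13))"
    by (rule goodI[where k = "num.One" and q = "rc2 (Var P0 * (Var P12 * Var P12)) + (Var P0 * (Var P12 * Var P12))"];
      ((intro good_intros)?; ((rule good_P0 | rule k_P0_R1_TT | rule k_P12_P34_TT | rule k_P0_P12_P12) | (rule good_dead))?)?;
      simp add: r12_def rc1_def rc2_def rc3_def dead_def eps_simps algebra_simps)
  have k_P0_P23_P23: "good (Var P0 * (Var P23 * Var P23))"
    by (rule goodI[where k = "num.One" and q = "rc1 (Var P0 * (Var P13 * Var P13)) + (Var P0 * (Var P13 * Var P13))"];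
      ((intro good_intros)?; ((rule good_P0 | rule k_P0_R1_TT | rule k_P12_P34_TT | rule k_P0_P12_P12 | rule k_P0_P13_P13) | (rule good_dead))?)?;
      simp add: r12_def rc1_def rc2_def rc3_def dead_def eps_simps algebra_simps)
  have k_P0_P14_P14: "good (Var P0 * (Var P14 * Var P14))"
    by (rule goodI[where k = "num.One" and q = "rc3 (Var P0 * (Var P13 * Var P13)) + (Var P0 * (Var P13 * Var P13))"];
      ((intro good_intros)?; ((rule good_P0 | rule k_P0_R1_TT | rule k_P12_P34_TT | rule k_P0_P12_P12 | rule k_P0_P13_P13 | rule k_P0_P23_P23) | (rule good_dead))?)?;
      simp add: r12_def rc1_def rc2_def rc3_def dead_def eps_simps algebra_simps)
  have k_P0_P24_P24: "good (Var P0 * (Var P24 * Var P24))"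
    by (rule goodI[where k = "num.One" and q = "rc1 (Var P0 * (Var P14 * Var P14)) + (Var P0 * (Var P14 * Var P14))"];
      ((intro good_intros)?; ((rule good_P0 | rule k_P0_R1_TT | rule k_P12_P34_TT | rule k_P0_P12_P12 | rule k_P0_P13_P13 | rule k_P0_P23_P23 | rule k_P0_P14_P14) | (rule good_dead))?)?;
      simp add: r12_def rc1_def rc2_def rc3_def dead_def eps_simps algebra_simps)
  have k_P0_P34_P34: "good (Var P0 * (Var P34 * Var P34))"
    by (rule goodI[where k = "num.One" and q = "rc2 (Var P0 * (Var P24 * Var P24)) + (Var P0 * (Var P24 * Var P24))"];
      ((intro good_intros)?; ((rule good_P0 | rule k_P0_R1_TT | rule k_P12_P34_TT | rule k_P0_P12_P12 | rule k_P0_P13_P13 | rule k_P0_P23_P23 | rule k_P0_P14_P14 | rule k_P0_P24_P24) | (rule good_dead))?)?;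
      simp add: r12_def rc1_def rc2_def rc3_def dead_def eps_simps algebra_simps)
  have k_P12_P14_P24: "good (Var P12 * (Var P14 * Var P24))"
    by (rule goodI[where k = "num.Bit0 (num.Bit0 (num.Bit0 num.One))" and q = "- (r12 (Var P12 * (Var Q3 * Var Q3))) - 12 * (Var P0 * (Var P14 * Var P14)) - 24 * (Var P0 * (Var P14 * Var P24)) - 12 * (Var P0 * (Var P24 * Var P24)) - 4 * (Var P12 * (Var P14 * Var P14)) - 4 * (Var P12 * (Var P24 * Var P24)) + 8 * (Var P12 * (Var Q3 * Var Q3))"];
      ((intro good_intros)?; ((rule good_P0 | rule k_P0_R1_TT | rule k_P12_P34_TT | rule k_P0_P12_P12 | rule k_P0_P13_P13 | rule k_P0_P23_P23 | rule k_P0_P14_P14 | rule k_P0_P24_P24 | rule k_P0_P34_P34) | (rule good_dead))?)?;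
      simp add: r12_def rc1_def rc2_def rc3_def dead_def eps_simps algebra_simps)
  have k_P13_P14_P34: "good (Var P13 * (Var P14 * Var P34))"
    by (rule goodI[where k = "num.One" and q = "rc2 (Var P12 * (Var P14 * Var P24)) + (Var P12 * (Var P14 * Var P24))"];
      ((intro good_intros)?; ((rule good_P0 | rule k_P0_R1_TT | rule k_P12_P34_TT | rule k_P0_P12_P12 | rule k_P0_P13_P13 | rule k_P0_P23_P23 | rule k_P0_P14_P14 | rule k_P0_P24_P24 | rule k_P0_P34_P34 | rule k_P12_P14_P24) | (rule good_dead))?)?;
      simp add: r12_def rc1_def rc2_def rc3_def dead_def eps_simps algebra_simps)
  have k_P23_P24_P34: "good (Var P23 * (Var P24 * Var P34))"
    by (rule goodI[where k = "num.One" and q = "rc1 (Var P13 * (Var P14 * Var P34)) + (Var P13 * (Var P14 * Var P34))"];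
      ((intro good_intros)?; ((rule good_P0 | rule k_P0_R1_TT | rule k_P12_P34_TT | rule k_P0_P12_P12 | rule k_P0_P13_P13 | rule k_P0_P23_P23 | rule k_P0_P14_P14 | rule k_P0_P24_P24 | rule k_P0_P34_P34 | rule k_P12_P14_P24 | rule k_P13_P14_P34) | (rule good_dead))?)?;
      simp add: r12_def rc1_def rc2_def rc3_def dead_def eps_simps algebra_simps)
  have k_P12_P13_P23: "good (Var P12 * (Var P13 * Var P23))"
    by (rule goodI[where k = "num.One" and q = "- (rc3 (Var P12 * (Var P13 * Var P23))) + (Var P12 * (Var P14 * Var P24))"];
      ((intro good_intros)?; ((rule good_P0 | rule k_P0_R1_TT | rule k_P12_P34_TT | rule k_P0_P12_P12 | rule k_P0_P13_P13 | rule k_P0_P23_P23 | rule k_P0_P14_P14 | rule k_P0_P24_P24 | rule k_P0_P34_P34 | rule k_P12_P14_P24 | rule k_P13_P14_P34 | rule k_P23_P24_P34) | (rule good_dead))?)?;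
      simp add: r12_def rc1_def rc2_def rc3_def dead_def eps_simps algebra_simps)
  have k_P0_Q3_Q3: "good (Var P0 * (Var Q3 * Var Q3))"
    by (rule goodI[where k = "num.Bit0 (num.Bit0 (num.Bit0 num.One))" and q = "r12 (Var P0 * (Var Q3 * Var Q3)) - 4 * (Var P0 * (Var P14 * Var P14)) - 8 * (Var P0 * (Var P14 * Var P24)) - 4 * (Var P0 * (Var P24 * Var P24)) + 4 * (Var P12 * (Var P14 * Var P14)) + 8 * (Var P12 * (Var P14 * Var P24)) + 4 * (Var P12 * (Var P24 * Var P24))"];
      ((intro good_intros)?; ((rule good_P0 | rule k_P0_R1_TT | rule k_P12_P34_TT | rule k_P0_P12_P12 | rule k_P0_P13_P13 | rule k_P0_P23_P23 | rule k_P0_P14_P14 | rule k_P0_P24_P24 | rule k_P0_P34_P34 | rule k_P12_P14_P24 | rule k_P13_P14_P34 | rule k_P23_P24_P34 | rule k_P12_P13_P23) | (rule good_dead))?)?;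
      simp add: r12_def rc1_def rc2_def rc3_def dead_def eps_simps algebra_simps)
  have k_P0_Q2_Q2: "good (Var P0 * (Var Q2 * Var Q2))"
    by (rule goodI[where k = "num.One" and q = "- (rc2 (Var P0 * (Var Q2 * Var Q2))) + (Var P0 * (Var Q3 * Var Q3))"];
      ((intro good_intros)?; ((rule good_P0 | rule k_P0_R1_TT | rule k_P12_P34_TT | rule k_P0_P12_P12 | rule k_P0_P13_P13 | rule k_P0_P23_P23 | rule k_P0_P14_P14 | rule k_P0_P24_P24 | rule k_P0_P34_P34 | rule k_P12_P14_P24 | rule k_P13_P14_P34 | rule k_P23_P24_P34 | rule k_P12_P13_P23 | rule k_P0_Q3_Q3) | (rule good_dead))?)?;
      simp add: r12_def rc1_def rc2_def rc3_def dead_def eps_simps algebra_simps)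
  have k_P0_Q1_Q1: "good (Var P0 * (Var Q1 * Var Q1))"
    by (rule goodI[where k = "num.One" and q = "- (rc1 (Var P0 * (Var Q1 * Var Q1))) + (Var P0 * (Var Q2 * Var Q2))"];
      ((intro good_intros)?; ((rule good_P0 | rule k_P0_R1_TT | rule k_P12_P34_TT | rule k_P0_P12_P12 | rule k_P0_P13_P13 | rule k_P0_P23_P23 | rule k_P0_P14_P14 | rule k_P0_P24_P24 | rule k_P0_P34_P34 | rule k_P12_P14_P24 | rule k_P13_P14_P34 | rule k_P23_P24_P34 | rule k_P12_P13_P23 | rule k_P0_Q3_Q3 | rule k_P0_Q2_Q2) | (rule good_dead))?)?;
      simp add: r12_def rc1_def rc2_def rc3_def dead_def eps_simps algebra_simps)
  have k_P0_Q4_Q4: "good (Var P0 * (Var Q4 * Var Q4))"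
    by (rule goodI[where k = "num.One" and q = "rc3 (Var P0 * (Var Q3 * Var Q3)) + (Var P0 * (Var Q3 * Var Q3))"];
      ((intro good_intros)?; ((rule good_P0 | rule k_P0_R1_TT | rule k_P12_P34_TT | rule k_P0_P12_P12 | rule k_P0_P13_P13 | rule k_P0_P23_P23 | rule k_P0_P14_P14 | rule k_P0_P24_P24 | rule k_P0_P34_P34 | rule k_P12_P14_P24 | rule k_P13_P14_P34 | rule k_P23_P24_P34 | rule k_P12_P13_P23 | rule k_P0_Q3_Q3 | rule k_P0_Q2_Q2 | rule k_P0_Q1_Q1) | (rule good_dead))?)?;
      simp add: r12_def rc1_def rc2_def rc3_def dead_def eps_simps algebra_simps)
  have k_P12_Q1_Q2: "good (Var P12 * (Var Q1 * Var Q2))"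
    by (rule goodI[where k = "num.Bit0 (num.Bit0 (num.Bit0 num.One))" and q = "r12 (Var P12 * (Var TT * Var TT)) + 12 * (Var P0 * (Var Q1 * Var Q1)) - 24 * (Var P0 * (Var Q1 * Var Q2)) + 12 * (Var P0 * (Var Q2 * Var Q2)) + 4 * (Var P12 * (Var Q1 * Var Q1)) + 4 * (Var P12 * (Var Q2 * Var Q2)) - 8 * (Var P12 * (Var TT * Var TT))"];
      ((intro good_intros)?; ((rule good_P0 | rule k_P0_R1_TT | rule k_P12_P34_TT | rule k_P0_P12_P12 | rule k_P0_P13_P13 | rule k_P0_P23_P23 | rule k_P0_P14_P14 | rule k_P0_P24_P24 | rule k_P0_P34_P34 | rule k_P12_P14_P24 | rule k_P13_P14_P34 | rule k_P23_P24_P34 | rule k_P12_P13_P23 | rule k_P0_Q3_Q3 | rule k_P0_Q2_Q2 | rule k_P0_Q1_Q1 | rule k_P0_Q4_Q4) | (rule good_dead))?)?;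
      simp add: r12_def rc1_def rc2_def rc3_def dead_def eps_simps algebra_simps)
  have k_P13_Q1_Q3: "good (Var P13 * (Var Q1 * Var Q3))"
    by (rule goodI[where k = "num.One" and q = "rc2 (Var P12 * (Var Q1 * Var Q2)) + (Var P12 * (Var Q1 * Var Q2))"];
      ((intro good_intros)?; ((rule good_P0 | rule k_P0_R1_TT | rule k_P12_P34_TT | rule k_P0_P12_P12 | rule k_P0_P13_P13 | rule k_P0_P23_P23 | rule k_P0_P14_P14 | rule k_P0_P24_P24 | rule k_P0_P34_P34 | rule k_P12_P14_P24 | rule k_P13_P14_P34 | rule k_P23_P24_P34 | rule k_P12_P13_P23 | rule k_P0_Q3_Q3 | rule k_P0_Q2_Q2 | rule k_P0_Q1_Q1 | rule k_P0_Q4_Q4 | rule k_P12_Q1_Q2) | (rule good_dead))?)?;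
      simp add: r12_def rc1_def rc2_def rc3_def dead_def eps_simps algebra_simps)
  have k_P23_Q2_Q3: "good (Var P23 * (Var Q2 * Var Q3))"
    by (rule goodI[where k = "num.One" and q = "rc1 (Var P13 * (Var Q1 * Var Q3)) + (Var P13 * (Var Q1 * Var Q3))"];
      ((intro good_intros)?; ((rule good_P0 | rule k_P0_R1_TT | rule k_P12_P34_TT | rule k_P0_P12_P12 | rule k_P0_P13_P13 | rule k_P0_P23_P23 | rule k_P0_P14_P14 | rule k_P0_P24_P24 | rule k_P0_P34_P34 | rule k_P12_P14_P24 | rule k_P13_P14_P34 | rule k_P23_P24_P34 | rule k_P12_P13_P23 | rule k_P0_Q3_Q3 | rule k_P0_Q2_Q2 | rule k_P0_Q1_Q1 | rule k_P0_Q4_Q4 | rule k_P12_Q1_Q2 | rule k_P13_Q1_Q3) | (rule good_dead))?)?;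
      simp add: r12_def rc1_def rc2_def rc3_def dead_def eps_simps algebra_simps)
  have k_P14_Q1_Q4: "good (Var P14 * (Var Q1 * Var Q4))"
    by (rule goodI[where k = "num.One" and q = "rc3 (Var P13 * (Var Q1 * Var Q3)) + (Var P13 * (Var Q1 * Var Q3))"];
      ((intro good_intros)?; ((rule good_P0 | rule k_P0_R1_TT | rule k_P12_P34_TT | rule k_P0_P12_P12 | rule k_P0_P13_P13 | rule k_P0_P23_P23 | rule k_P0_P14_P14 | rule k_P0_P24_P24 | rule k_P0_P34_P34 | rule k_P12_P14_P24 | rule k_P13_P14_P34 | rule k_P23_P24_P34 | rule k_P12_P13_P23 | rule k_P0_Q3_Q3 | rule k_P0_Q2_Q2 | rule k_P0_Q1_Q1 | rule k_P0_Q4_Q4 | rule k_P12_Q1_Q2 | rule k_P13_Q1_Q3 | rule k_P23_Q2_Q3) | (rule good_dead))?)?;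
      simp add: r12_def rc1_def rc2_def rc3_def dead_def eps_simps algebra_simps)
  have k_P24_Q2_Q4: "good (Var P24 * (Var Q2 * Var Q4))"
    by (rule goodI[where k = "num.One" and q = "rc1 (Var P14 * (Var Q1 * Var Q4)) + (Var P14 * (Var Q1 * Var Q4))"];
      ((intro good_intros)?; ((rule good_P0 | rule k_P0_R1_TT | rule k_P12_P34_TT | rule k_P0_P12_P12 | rule k_P0_P13_P13 | rule k_P0_P23_P23 | rule k_P0_P14_P14 | rule k_P0_P24_P24 | rule k_P0_P34_P34 | rule k_P12_P14_P24 | rule k_P13_P14_P34 | rule k_P23_P24_P34 | rule k_P12_P13_P23 | rule k_P0_Q3_Q3 | rule k_P0_Q2_Q2 | rule k_P0_Q1_Q1 | rule k_P0_Q4_Q4 | rule k_P12_Q1_Q2 | rule k_P13_Q1_Q3 | rule k_P23_Q2_Q3 | rule k_P14_Q1_Q4) | (rule good_dead))?)?;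
      simp add: r12_def rc1_def rc2_def rc3_def dead_def eps_simps algebra_simps)
  have k_P34_Q3_Q4: "good (Var P34 * (Var Q3 * Var Q4))"
    by (rule goodI[where k = "num.One" and q = "rc2 (Var P24 * (Var Q2 * Var Q4)) + (Var P24 * (Var Q2 * Var Q4))"];
      ((intro good_intros)?; ((rule good_P0 | rule k_P0_R1_TT | rule k_P12_P34_TT | rule k_P0_P12_P12 | rule k_P0_P13_P13 | rule k_P0_P23_P23 | rule k_P0_P14_P14 | rule k_P0_P24_P24 | rule k_P0_P34_P34 | rule k_P12_P14_P24 | rule k_P13_P14_P34 | rule k_P23_P24_P34 | rule k_P12_P13_P23 | rule k_P0_Q3_Q3 | rule k_P0_Q2_Q2 | rule k_P0_Q1_Q1 | rule k_P0_Q4_Q4 | rule k_P12_Q1_Q2 | rule k_P13_Q1_Q3 | rule k_P23_Q2_Q3 | rule k_P14_Q1_Q4 | rule k_P24_Q2_Q4) | (rule good_dead))?)?;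
      simp add: r12_def rc1_def rc2_def rc3_def dead_def eps_simps algebra_simps)
  have k_P0_TT_TT: "good (Var P0 * (Var TT * Var TT))"
    by (rule goodI[where k = "num.Bit0 (num.Bit0 (num.Bit0 num.One))" and q = "r12 (Var P0 * (Var TT * Var TT)) - 4 * (Var P0 * (Var Q1 * Var Q1)) + 8 * (Var P0 * (Var Q1 * Var Q2)) - 4 * (Var P0 * (Var Q2 * Var Q2)) + 4 * (Var P12 * (Var Q1 * Var Q1)) - 8 * (Var P12 * (Var Q1 * Var Q2)) + 4 * (Var P12 * (Var Q2 * Var Q2))"];
      ((intro good_intros)?; ((rule good_P0 | rule k_P0_R1_TT | rule k_P12_P34_TT | rule k_P0_P12_P12 | rule k_P0_P13_P13 | rule k_P0_P23_P23 | rule k_P0_P14_P14 | rule k_P0_P24_P24 | rule k_P0_P34_P34 | rule k_P12_P14_P24 | rule k_P13_P14_P34 | rule k_P23_P24_P34 | rule k_P12_P13_P23 | rule k_P0_Q3_Q3 | rule k_P0_Q2_Q2 | rule k_P0_Q1_Q1 | rule k_P0_Q4_Q4 | rule k_P12_Q1_Q2 | rule k_P13_Q1_Q3 | rule k_P23_Q2_Q3 | rule k_P14_Q1_Q4 | rule k_P24_Q2_Q4 | rule k_P34_Q3_Q4) | (rule good_dead))?)?;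
      simp add: r12_def rc1_def rc2_def rc3_def dead_def eps_simps algebra_simps)
  have k_P0_R2_TT: "good (Var P0 * (Var R2 * Var TT))"
    by (rule goodI[where k = "num.Bit0 num.One" and q = "- (rc1 (Var P0 * (Var R2 * Var R2))) + (Var P0 * (Var TT * Var TT))"];
      ((intro good_intros)?; ((rule good_P0 | rule k_P0_R1_TT | rule k_P12_P34_TT | rule k_P0_P12_P12 | rule k_P0_P13_P13 | rule k_P0_P23_P23 | rule k_P0_P14_P14 | rule k_P0_P24_P24 | rule k_P0_P34_P34 | rule k_P12_P14_P24 | rule k_P13_P14_P34 | rule k_P23_P24_P34 | rule k_P12_P13_P23 | rule k_P0_Q3_Q3 | rule k_P0_Q2_Q2 | rule k_P0_Q1_Q1 | rule k_P0_Q4_Q4 | rule k_P12_Q1_Q2 | rule k_P13_Q1_Q3 | rule k_P23_Q2_Q3 | rule k_P14_Q1_Q4 | rule k_P24_Q2_Q4 | rule k_P34_Q3_Q4 | rule k_P0_TT_TT) | (rule good_dead))?)?;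
      simp add: r12_def rc1_def rc2_def rc3_def dead_def eps_simps algebra_simps)
  have k_P13_P24_TT: "good (Var P13 * (Var P24 * Var TT))"
    by (rule goodI[where k = "num.Bit0 (num.Bit0 (num.Bit0 num.One))" and q = "r12 (Var P13 * (Var P24 * Var TT)) - 2 * (Var P13 * (Var P14 * Var Q1)) + 2 * (Var P13 * (Var P14 * Var Q2)) + 2 * (Var P13 * (Var P24 * Var Q1)) - 2 * (Var P13 * (Var P24 * Var Q2)) + 2 * (Var P13 * (Var Q1 * Var Q3)) - 2 * (Var P13 * (Var Q2 * Var Q3)) + 2 * (Var P14 * (Var P23 * Var Q1)) - 2 * (Var P14 * (Var P23 * Var Q2)) - 2 * (Var P23 * (Var P24 * Var Q1)) + 2 * (Var P23 * (Var P24 * Var Q2)) - 2 * (Var P23 * (Var Q1 * Var Q3)) + 2 * (Var P23 * (Var Q2 * Var Q3)) + 2 * (Var P14 * (Var Q1 * Var Q4)) - 2 * (Var P14 * (Var Q2 * Var Q4)) - 2 * (Var P24 * (Var Q1 * Var Q4)) + 2 * (Var P24 * (Var Q2 * Var Q4)) - 2 * (Var Q1 * (Var Q3 * Var Q4)) + 2 * (Var Q2 * (Var Q3 * Var Q4))"];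
      ((intro good_intros)?; ((rule good_P0 | rule k_P0_R1_TT | rule k_P12_P34_TT | rule k_P0_P12_P12 | rule k_P0_P13_P13 | rule k_P0_P23_P23 | rule k_P0_P14_P14 | rule k_P0_P24_P24 | rule k_P0_P34_P34 | rule k_P12_P14_P24 | rule k_P13_P14_P34 | rule k_P23_P24_P34 | rule k_P12_P13_P23 | rule k_P0_Q3_Q3 | rule k_P0_Q2_Q2 | rule k_P0_Q1_Q1 | rule k_P0_Q4_Q4 | rule k_P12_Q1_Q2 | rule k_P13_Q1_Q3 | rule k_P23_Q2_Q3 | rule k_P14_Q1_Q4 | rule k_P24_Q2_Q4 | rule k_P34_Q3_Q4 | rule k_P0_TT_TT | rule k_P0_R2_TT) | (rule good_dead))?)?;
      simp add: r12_def rc1_def rc2_def rc3_def dead_def eps_simps algebra_simps)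
  have k_P14_P23_TT: "good (Var P14 * (Var P23 * Var TT))"
    by (rule goodI[where k = "num.One" and q = "- (rc1 (Var P13 * (Var P24 * Var TT))) - (Var P13 * (Var P24 * Var TT))"];
      ((intro good_intros)?; ((rule good_P0 | rule k_P0_R1_TT | rule k_P12_P34_TT | rule k_P0_P12_P12 | rule k_P0_P13_P13 | rule k_P0_P23_P23 | rule k_P0_P14_P14 | rule k_P0_P24_P24 | rule k_P0_P34_P34 | rule k_P12_P14_P24 | rule k_P13_P14_P34 | rule k_P23_P24_P34 | rule k_P12_P13_P23 | rule k_P0_Q3_Q3 | rule k_P0_Q2_Q2 | rule k_P0_Q1_Q1 | rule k_P0_Q4_Q4 | rule k_P12_Q1_Q2 | rule k_P13_Q1_Q3 | rule k_P23_Q2_Q3 | rule k_P14_Q1_Q4 | rule k_P24_Q2_Q4 | rule k_P34_Q3_Q4 | rule k_P0_TT_TT | rule k_P0_R2_TT | rule k_P13_P24_TT) | (rule good_dead))?)?;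
      simp add: r12_def rc1_def rc2_def rc3_def dead_def eps_simps algebra_simps)
  have k_P12_P34_R1: "good (Var P12 * (Var P34 * Var R1))"
    by (rule goodI[where k = "num.Bit0 (num.Bit0 num.One)" and q = "- (r12 (Var P0 * (Var P34 * Var R1))) + r12 (Var P0 * (Var P34 * Var P34)) - 12 * (Var P0 * (Var P34 * Var P34)) + 12 * (Var P0 * (Var P34 * Var R1)) + 4 * (Var P12 * (Var P34 * Var P34))"];
      ((intro good_intros)?; ((rule good_P0 | rule k_P0_R1_TT | rule k_P12_P34_TT | rule k_P0_P12_P12 | rule k_P0_P13_P13 | rule k_P0_P23_P23 | rule k_P0_P14_P14 | rule k_P0_P24_P24 | rule k_P0_P34_P34 | rule k_P12_P14_P24 | rule k_P13_P14_P34 | rule k_P23_P24_P34 | rule k_P12_P13_P23 | rule k_P0_Q3_Q3 | rule k_P0_Q2_Q2 | rule k_P0_Q1_Q1 | rule k_P0_Q4_Q4 | rule k_P12_Q1_Q2 | rule k_P13_Q1_Q3 | rule k_P23_Q2_Q3 | rule k_P14_Q1_Q4 | rule k_P24_Q2_Q4 | rule k_P34_Q3_Q4 | rule k_P0_TT_TT | rule k_P0_R2_TT | rule k_P13_P24_TT | rule k_P14_P23_TT) | (rule good_dead))?)?;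
      simp add: r12_def rc1_def rc2_def rc3_def dead_def eps_simps algebra_simps)
  have k_P13_P24_R2: "good (Var P13 * (Var P24 * Var R2))"
    by (rule goodI[where k = "num.One" and q = "rc2 (Var P12 * (Var P34 * Var R1)) + (Var P12 * (Var P34 * Var R1))"];
      ((intro good_intros)?; ((rule good_P0 | rule k_P0_R1_TT | rule k_P12_P34_TT | rule k_P0_P12_P12 | rule k_P0_P13_P13 | rule k_P0_P23_P23 | rule k_P0_P14_P14 | rule k_P0_P24_P24 | rule k_P0_P34_P34 | rule k_P12_P14_P24 | rule k_P13_P14_P34 | rule k_P23_P24_P34 | rule k_P12_P13_P23 | rule k_P0_Q3_Q3 | rule k_P0_Q2_Q2 | rule k_P0_Q1_Q1 | rule k_P0_Q4_Q4 | rule k_P12_Q1_Q2 | rule k_P13_Q1_Q3 | rule k_P23_Q2_Q3 | rule k_P14_Q1_Q4 | rule k_P24_Q2_Q4 | rule k_P34_Q3_Q4 | rule k_P0_TT_TT | rule k_P0_R2_TT | rule k_P13_P24_TT | rule k_P14_P23_TT | rule k_P12_P34_R1) | (rule good_dead))?)?;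
      simp add: r12_def rc1_def rc2_def rc3_def dead_def eps_simps algebra_simps)
  have k_P14_P23_R2: "good (Var P14 * (Var P23 * Var R2))"
    by (rule goodI[where k = "num.One" and q = "rc1 (Var P13 * (Var P24 * Var R2)) + (Var P14 * (Var P23 * Var TT)) + (Var P13 * (Var P24 * Var R2))"];
      ((intro good_intros)?; ((rule good_P0 | rule k_P0_R1_TT | rule k_P12_P34_TT | rule k_P0_P12_P12 | rule k_P0_P13_P13 | rule k_P0_P23_P23 | rule k_P0_P14_P14 | rule k_P0_P24_P24 | rule k_P0_P34_P34 | rule k_P12_P14_P24 | rule k_P13_P14_P34 | rule k_P23_P24_P34 | rule k_P12_P13_P23 | rule k_P0_Q3_Q3 | rule k_P0_Q2_Q2 | rule k_P0_Q1_Q1 | rule k_P0_Q4_Q4 | rule k_P12_Q1_Q2 | rule k_P13_Q1_Q3 | rule k_P23_Q2_Q3 | rule k_P14_Q1_Q4 | rule k_P24_Q2_Q4 | rule k_P34_Q3_Q4 | rule k_P0_TT_TT | rule k_P0_R2_TT | rule k_P13_P24_TT | rule k_P14_P23_TT | rule k_P12_P34_R1 | rule k_P13_P24_R2) | (rule good_dead))?)?;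
      simp add: r12_def rc1_def rc2_def rc3_def dead_def eps_simps algebra_simps)
  have k_P14_P23_R1: "good (Var P14 * (Var P23 * Var R1))"
    by (rule goodI[where k = "num.One" and q = "- (rc2 (Var P14 * (Var P23 * Var R1))) + (Var P14 * (Var P23 * Var R2))"];
      ((intro good_intros)?; ((rule good_P0 | rule k_P0_R1_TT | rule k_P12_P34_TT | rule k_P0_P12_P12 | rule k_P0_P13_P13 | rule k_P0_P23_P23 | rule k_P0_P14_P14 | rule k_P0_P24_P24 | rule k_P0_P34_P34 | rule k_P12_P14_P24 | rule k_P13_P14_P34 | rule k_P23_P24_P34 | rule k_P12_P13_P23 | rule k_P0_Q3_Q3 | rule k_P0_Q2_Q2 | rule k_P0_Q1_Q1 | rule k_P0_Q4_Q4 | rule k_P12_Q1_Q2 | rule k_P13_Q1_Q3 | rule k_P23_Q2_Q3 | rule k_P14_Q1_Q4 | rule k_P24_Q2_Q4 | rule k_P34_Q3_Q4 | rule k_P0_TT_TT | rule k_P0_R2_TT | rule k_P13_P24_TT | rule k_P14_P23_TT | rule k_P12_P34_R1 | rule k_P13_P24_R2 | rule k_P14_P23_R2) | (rule good_dead))?)?;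
      simp add: r12_def rc1_def rc2_def rc3_def dead_def eps_simps algebra_simps)
  have k_P13_P24_R1: "good (Var P13 * (Var P24 * Var R1))"
    by (rule goodI[where k = "num.One" and q = "- (rc1 (Var P13 * (Var P24 * Var R1))) + (Var P14 * (Var P23 * Var R1))"];
      ((intro good_intros)?; ((rule good_P0 | rule k_P0_R1_TT | rule k_P12_P34_TT | rule k_P0_P12_P12 | rule k_P0_P13_P13 | rule k_P0_P23_P23 | rule k_P0_P14_P14 | rule k_P0_P24_P24 | rule k_P0_P34_P34 | rule k_P12_P14_P24 | rule k_P13_P14_P34 | rule k_P23_P24_P34 | rule k_P12_P13_P23 | rule k_P0_Q3_Q3 | rule k_P0_Q2_Q2 | rule k_P0_Q1_Q1 | rule k_P0_Q4_Q4 | rule k_P12_Q1_Q2 | rule k_P13_Q1_Q3 | rule k_P23_Q2_Q3 | rule k_P14_Q1_Q4 | rule k_P24_Q2_Q4 | rule k_P34_Q3_Q4 | rule k_P0_TT_TT | rule k_P0_R2_TT | rule k_P13_P24_TT | rule k_P14_P23_TT | rule k_P12_P34_R1 | rule k_P13_P24_R2 | rule k_P14_P23_R2 | rule k_P14_P23_R1) | (rule good_dead))?)?;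
      simp add: r12_def rc1_def rc2_def rc3_def dead_def eps_simps algebra_simps)
  have k_P12_P34_R2: "good (Var P12 * (Var P34 * Var R2))"
    by (rule goodI[where k = "num.One" and q = "- (rc2 (Var P12 * (Var P34 * Var R2))) + (Var P13 * (Var P24 * Var R1))"];
      ((intro good_intros)?; ((rule good_P0 | rule k_P0_R1_TT | rule k_P12_P34_TT | rule k_P0_P12_P12 | rule k_P0_P13_P13 | rule k_P0_P23_P23 | rule k_P0_P14_P14 | rule k_P0_P24_P24 | rule k_P0_P34_P34 | rule k_P12_P14_P24 | rule k_P13_P14_P34 | rule k_P23_P24_P34 | rule k_P12_P13_P23 | rule k_P0_Q3_Q3 | rule k_P0_Q2_Q2 | rule k_P0_Q1_Q1 | rule k_P0_Q4_Q4 | rule k_P12_Q1_Q2 | rule k_P13_Q1_Q3 | rule k_P23_Q2_Q3 | rule k_P14_Q1_Q4 | rule k_P24_Q2_Q4 | rule k_P34_Q3_Q4 | rule k_P0_TT_TT | rule k_P0_R2_TT | rule k_P13_P24_TT | rule k_P14_P23_TT | rule k_P12_P34_R1 | rule k_P13_P24_R2 | rule k_P14_P23_R2 | rule k_P14_P23_R1 | rule k_P13_P24_R1) | (rule good_dead))?)?;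
      simp add: r12_def rc1_def rc2_def rc3_def dead_def eps_simps algebra_simps)
  have k_P0_R1_R1: "good (Var P0 * (Var R1 * Var R1))"
    by (rule goodI[where k = "num.One" and q = "r12 (Var P0 * (Var P34 * Var P34)) - 9 * (Var P0 * (Var P34 * Var P34)) + 2 * (Var P0 * (Var P34 * Var R1)) + (Var P12 * (Var P34 * Var P34)) - 2 * (Var P12 * (Var P34 * Var R1)) + (Var P12 * (Var R1 * Var R1))"];
      ((intro good_intros)?; ((rule good_P0 | rule k_P0_R1_TT | rule k_P12_P34_TT | rule k_P0_P12_P12 | rule k_P0_P13_P13 | rule k_P0_P23_P23 | rule k_P0_P14_P14 | rule k_P0_P24_P24 | rule k_P0_P34_P34 | rule k_P12_P14_P24 | rule k_P13_P14_P34 | rule k_P23_P24_P34 | rule k_P12_P13_P23 | rule k_P0_Q3_Q3 | rule k_P0_Q2_Q2 | rule k_P0_Q1_Q1 | rule k_P0_Q4_Q4 | rule k_P12_Q1_Q2 | rule k_P13_Q1_Q3 | rule k_P23_Q2_Q3 | rule k_P14_Q1_Q4 | rule k_P24_Q2_Q4 | rule k_P34_Q3_Q4 | rule k_P0_TT_TT | rule k_P0_R2_TT | rule k_P13_P24_TT | rule k_P14_P23_TT | rule k_P12_P34_R1 | rule k_P13_P24_R2 | rule k_P14_P23_R2 | rule k_P14_P23_R1 | rule k_P13_P24_R1 | rule k_P12_P34_R2) | (rule good_dead))?)?;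
      simp add: r12_def rc1_def rc2_def rc3_def dead_def eps_simps algebra_simps)
  have k_P0_R2_R2: "good (Var P0 * (Var R2 * Var R2))"
    by (rule goodI[where k = "num.One" and q = "rc2 (Var P0 * (Var R1 * Var R1)) + (Var P0 * (Var R1 * Var R1))"];
      ((intro good_intros)?; ((rule good_P0 | rule k_P0_R1_TT | rule k_P12_P34_TT | rule k_P0_P12_P12 | rule k_P0_P13_P13 | rule k_P0_P23_P23 | rule k_P0_P14_P14 | rule k_P0_P24_P24 | rule k_P0_P34_P34 | rule k_P12_P14_P24 | rule k_P13_P14_P34 | rule k_P23_P24_P34 | rule k_P12_P13_P23 | rule k_P0_Q3_Q3 | rule k_P0_Q2_Q2 | rule k_P0_Q1_Q1 | rule k_P0_Q4_Q4 | rule k_P12_Q1_Q2 | rule k_P13_Q1_Q3 | rule k_P23_Q2_Q3 | rule k_P14_Q1_Q4 | rule k_P24_Q2_Q4 | rule k_P34_Q3_Q4 | rule k_P0_TT_TT | rule k_P0_R2_TT | rule k_P13_P24_TT | rule k_P14_P23_TT | rule k_P12_P34_R1 | rule k_P13_P24_R2 | rule k_P14_P23_R2 | rule k_P14_P23_R1 | rule k_P13_P24_R1 | rule k_P12_P34_R2 | rule k_P0_R1_R1) | (rule good_dead))?)?;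
      simp add: r12_def rc1_def rc2_def rc3_def dead_def eps_simps algebra_simps)
  have k_P0_R1_R2: "good (Var P0 * (Var R1 * Var R2))"
    by (rule goodI[where k = "num.One" and q = "rc2 (Var P0 * (Var R1 * Var TT)) + (Var P0 * (Var R2 * Var R2)) - (Var P0 * (Var R2 * Var TT)) + (Var P0 * (Var R1 * Var TT))"];
      ((intro good_intros)?; ((rule good_P0 | rule k_P0_R1_TT | rule k_P12_P34_TT | rule k_P0_P12_P12 | rule k_P0_P13_P13 | rule k_P0_P23_P23 | rule k_P0_P14_P14 | rule k_P0_P24_P24 | rule k_P0_P34_P34 | rule k_P12_P14_P24 | rule k_P13_P14_P34 | rule k_P23_P24_P34 | rule k_P12_P13_P23 | rule k_P0_Q3_Q3 | rule k_P0_Q2_Q2 | rule k_P0_Q1_Q1 | rule k_P0_Q4_Q4 | rule k_P12_Q1_Q2 | rule k_P13_Q1_Q3 | rule k_P23_Q2_Q3 | rule k_P14_Q1_Q4 | rule k_P24_Q2_Q4 | rule k_P34_Q3_Q4 | rule k_P0_TT_TT | rule k_P0_R2_TT | rule k_P13_P24_TT | rule k_P14_P23_TT | rule k_P12_P34_R1 | rule k_P13_P24_R2 | rule k_P14_P23_R2 | rule k_P14_P23_R1 | rule k_P13_P24_R1 | rule k_P12_P34_R2 | rule k_P0_R1_R1 | rule k_P0_R2_R2) | (rule good_dead))?)?;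
      simp add: r12_def rc1_def rc2_def rc3_def dead_def eps_simps algebra_simps)
  note alive = good_P0 k_P0_R1_TT k_P12_P34_TT k_P0_P12_P12 k_P0_P13_P13 k_P0_P23_P23 k_P0_P14_P14 k_P0_P24_P24 k_P0_P34_P34 k_P12_P14_P24 k_P13_P14_P34 k_P23_P24_P34 k_P12_P13_P23 k_P0_Q3_Q3 k_P0_Q2_Q2 k_P0_Q1_Q1 k_P0_Q4_Q4 k_P12_Q1_Q2 k_P13_Q1_Q3 k_P23_Q2_Q3 k_P14_Q1_Q4 k_P24_Q2_Q4 k_P34_Q3_Q4 k_P0_TT_TT k_P0_R2_TT k_P13_P24_TT k_P14_P23_TT k_P12_P34_R1 k_P13_P24_R2 k_P14_P23_R2 k_P14_P23_R1 k_P13_P24_R1 k_P12_P34_R2 k_P0_R1_R1 k_P0_R2_R2 k_P0_R1_R2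
  note alive_ac = alive[simplified mult_ac]
  \<comment> \<open>The 36 monomials collected in \<open>alive\<close> are, up to the order of
    factors, all those that change sign under each of the four transpositions inside a pair; every
    other cubic monomial is dead.\<close>
  have "dead u v w \<or> good (Var u * (Var v * Var w))"
    by (cases u; cases v; cases w; simp add: dead_def; simp only: mult_ac alive_ac)
  then show ?thesis using good_dead by blast
qed

lemma good_homog_3:
  assumes "p \<in> homog 3"
  shows "good p"
proof -
  have mon: "good (mon m)" if deg: "wt (\<lambda>_. 1) m = 3" for m
  proof -
    have split: "\<exists>v m'. m = Poly_Mapping.single v 1 + m'" if "m \<noteq> 0" for m :: "vi monom"
    proof -
      have "Poly_Mapping.keys m \<noteq> {}" using that by simp
      then obtain v where "v \<in> Poly_Mapping.keys m" by blast
      then have "m = Poly_Mapping.single v 1 + (m - Poly_Mapping.single v 1)"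
        by (intro poly_mapping_eqI) (auto simp: lookup_add lookup_minus lookup_single when_def in_keys_iff)
      then show ?thesis by blast
    qed
    have "m \<noteq> 0" using deg by auto
    then obtain u m1 where 1: "m = Poly_Mapping.single u 1 + m1" using split by blast
    have w1: "wt (\<lambda>_. 1) m1 = 2" using deg unfolding 1 wt_add wt_single by simp
    then have "m1 \<noteq> 0" by auto
    then obtain v m2 where 2: "m1 = Poly_Mapping.single v 1 + m2" using split by blast
    have w2: "wt (\<lambda>_. 1) m2 = 1" using w1 unfolding 2 wt_add wt_single by simp
    then have "m2 \<noteq> 0" by auto
    then obtain w m3 where 3: "m2 = Poly_Mapping.single w 1 + m3" using split by blast
    have w3: "wt (\<lambda>_. 1) m3 = 0" using w2 unfolding 3 wt_add wt_single by simp
    have "m3 = 0"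
    proof (rule ccontr)
      assume "m3 \<noteq> 0"
      then obtain z m4 where 4: "m3 = Poly_Mapping.single z 1 + m4" using split[of m3] by blast
      show False using w3 unfolding 4 wt_add wt_single by simp
    qed
    then have "mon m = Var u * (Var v * Var w)"
      unfolding 1 2 3 mon_add Var_conv_mon by simp
    then show ?thesis using good_monomial by simp
  qed
  have 0: "good 0" using good_Const_mult[OF good_P0, of 0] by simp
  have "good (\<Sum>m\<in>A. Const (Poly_Mapping.lookup p m) * mon m)" if "A \<subseteq> Poly_Mapping.keys p" for A
    using finite_subset[OF that finite_keys] that
  proof (induction A rule: finite_induct)
    case (insert m A)
    then have "wt (\<lambda>_. 1) m = 3" using assms by (auto simp: homog_whomog whomog_def)
    then show ?case using insert by (simp add: good_add good_Const_mult mon)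
  qed (simp add: 0)
  from this[of "Poly_Mapping.keys p"] show ?thesis
    using poly_eq_sum_monos[of p] by simp
qed

end

lemma eight_distinct: "0 \<noteq> (2 :: 8)" "1 \<noteq> (3 :: 8)" "2 \<noteq> (4 :: 8)" "3 \<noteq> (5 :: 8)" "4 \<noteq> (6 :: 8)" "5 \<noteq> (7 :: 8)"
  by simp_all

context basis
begin

lemma sym_act_add: "sym_act b \<sigma> (p + q) = sym_act b \<sigma> p + sym_act b \<sigma> q"
  and sym_act_scale: "sym_act b \<sigma> (scale c p) = scale c (sym_act b \<sigma> p)"
  by (simp_all add: sym_act_def)

lemma skew_average_add: "skew_average b (p + q) = skew_average b p + skew_average b q"
  by (simp add: skew_average_def sym_act_add qpoly.scale_right_distrib sum.distrib)

lemma skew_average_scale: "skew_average b (scale c p) = scale c (skew_average b p)"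
  by (simp add: skew_average_def sym_act_scale qpoly.scale_sum_right mult.commute)

text \<open>Composition with \<open>\<tau>\<close> permutes the terms of the sum, and each sign
  changes by the sign of \<open>\<tau>\<close>.\<close>

lemma skew_average_sym_act:
  assumes "\<tau> permutes UNIV"
  shows "skew_average b (sym_act b \<tau> p) = scale (of_int (sign \<tau>)) (skew_average b p)"
proof -
  have "scale (of_int (sign \<sigma>)) (sym_act b \<sigma> (sym_act b \<tau> p)) =
      scale (of_int (sign \<tau>) * of_int (sign (\<sigma> \<circ> \<tau>))) (sym_act b (\<sigma> \<circ> \<tau>) p)"
    if "\<sigma> permutes UNIV" for \<sigma>
  proof -
    have "sign \<tau> * sign (\<sigma> \<circ> \<tau>) = sign \<sigma>"
      using sign_compose[OF permutation_if_permutes[OF that] permutation_if_permutes[OF assms]]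
      by (simp add: sign_def)
    then have "of_int (sign \<tau>) * of_int (sign (\<sigma> \<circ> \<tau>)) = (of_int (sign \<sigma>) :: rat)"
      by (metis of_int_mult)
    then show ?thesis by (simp add: sym_act_comp that assms)
  qed
  then have "skew_average b (sym_act b \<tau> p) = (\<Sum>\<sigma> | \<sigma> permutes UNIV.
      scale (of_int (sign \<tau>)) (scale (of_int (sign (\<sigma> \<circ> \<tau>))) (sym_act b (\<sigma> \<circ> \<tau>) p)))"
    unfolding skew_average_def by (intro sum.cong) simp_all
  also have "\<dots> = (\<Sum>\<sigma> | \<sigma> permutes UNIV. scale (of_int (sign \<tau>)) (scale (of_int (sign \<sigma>)) (sym_act b \<sigma> p)))"
    by (rule sum_permutations_compose_right[OF assms, symmetric])
  finally show ?thesis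
    by (simp add: skew_average_def qpoly.scale_sum_right del: qpoly.scale_scale)
qed

lemma skew_average_skew:
  assumes "skew_invariant b p"
  shows "skew_average b p = scale (fact 8) p"
proof -
  have "scale (of_int (sign \<sigma>)) (sym_act b \<sigma> p) = p" if "\<sigma> permutes UNIV" for \<sigma>
    using assms that by (simp add: skew_invariant_def flip: of_int_mult)
  then have "skew_average b p = (\<Sum>\<sigma> | \<sigma> permutes (UNIV :: 8 set). p)"
    unfolding skew_average_def by (intro sum.cong) auto
  also have "\<dots> = scale (of_nat (card {\<sigma>. \<sigma> permutes (UNIV :: 8 set)})) p"
    by (rule qpoly.sum_constant_scale)
  also have "card {\<sigma>. \<sigma> permutes (UNIV :: 8 set)} = fact 8"
    by (rule card_permutations) auto
  finally show ?thesis by (simp add: of_nat_fact)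
qed

abbreviation avg :: "vi qpoly \<Rightarrow> 'n qpoly"
  where "avg p \<equiv> skew_average b (subst Y p)"

lemma avg_perm_mat:
  assumes "perm_mat \<sigma> M"
  shows "avg (subst M p) = scale (of_int (sign \<sigma>)) (avg p)"
  using assms skew_average_sym_act[of \<sigma> "subst Y p"] by (simp add: sym_act_subst_Y[OF assms]) (simp add: perm_mat_def)

lemma avg_dead:
  assumes "dead u v w"
  shows "avg (Var u * (Var v * Var w)) = 0"
proof -
  obtain x where x: "x \<in> {Z1, Z2, Z3, Z4}" "eps x u * (eps x v * eps x w) = 1"
    using assms by (auto simp: dead_def)
  obtain i j where ij: "i \<noteq> j" "perm_mat (tp i j) (\<lambda>v. Const (eps x v) * Var v)"
  proof -
    have "perm_mat (tp 0 1) (\<lambda>v. Const (eps x v) * Var v) \<or> perm_mat (tp 2 3) (\<lambda>v. Const (eps x v) * Var v) \<or>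
        perm_mat (tp 4 5) (\<lambda>v. Const (eps x v) * Var v) \<or> perm_mat (tp 6 7) (\<lambda>v. Const (eps x v) * Var v)"
      using x(1) perm_mat_eps by blast
    moreover have "0 \<noteq> (1 :: 8)" "2 \<noteq> (3 :: 8)" "4 \<noteq> (5 :: 8)" "6 \<noteq> (7 :: 8)" by simp_all
    ultimately show ?thesis using that by blast
  qed
  have "subst (\<lambda>v. Const (eps x v) * Var v) (Var u * (Var v * Var w)) =
      Const (eps x u * (eps x v * eps x w)) * (Var u * (Var v * Var w))"
    unfolding Const_mult by (simp add: mult_ac)
  then have "avg (Var u * (Var v * Var w)) = - avg (Var u * (Var v * Var w))"
    using avg_perm_mat[OF ij(2), of "Var u * (Var v * Var w)"] by (simp add: x(2) sign_tp ij(1))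
  then have "scale 2 (avg (Var u * (Var v * Var w))) = 0"
    using qpoly.scale_left_distrib[of 1 1 "avg (Var u * (Var v * Var w))"] by simp
  then show ?thesis by (simp add: qpoly.scale_eq_0_iff)
qed

lemma Var_mult_homog_3: "Var u * (Var v * Var w) \<in> homog 3"
  using homog_mult[OF homog_Var homog_mult[OF homog_Var homog_Var], of u v w] by (simp add: numeral_3_eq_3)

lemma avg_r12:
  assumes "p \<in> homog 3"
  shows "avg (r12 p) = 0"
proof -
  have "subst Y (Const (1/8) * subst n12 p) = scale (1/8) (subst Y (subst n12 p))"
    by (simp add: scale_def)
  then have "scale (1/8) (avg (subst n12 p)) = avg (Const (1/8) * subst n12 p)"
    by (simp only: skew_average_scale)
  also have "\<dots> = scale (- 1) (avg p)"
    using avg_perm_mat[OF perm_mat_12, of p] sign_tp[of 1 2] unfolding subst_half_n12[OF assms] by simp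
  finally have "scale 8 (scale (1/8) (avg (subst n12 p))) = scale 8 (scale (- 1) (avg p))"
    by (rule arg_cong)
  then have n: "avg (subst n12 p) = scale (- 8) (avg p)" unfolding qpoly.scale_scale by simp
  have "subst Y (8 * p) = scale 8 (subst Y p)" by (simp add: scale_def)
  then have "avg (r12 p) = scale (- 8) (avg p) + scale 8 (avg p)"
    unfolding r12_def subst_add skew_average_add n by (simp only: skew_average_scale)
  also have "\<dots> = scale (- 8 + 8) (avg p)" by (rule qpoly.scale_left_distrib[symmetric])
  finally show ?thesis by simp
qed

lemma avg_rc: "avg (rc1 p) = 0" "avg (rc2 p) = 0" "avg (rc3 p) = 0"
proof -
  have minus: "avg (p - q) = avg p - avg q" for p q
    using skew_average_add[of "subst Y (p - q)" "subst Y q"] by (simp add: eq_diff_eq)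
  have "avg (subst mc1 p) = avg p" "avg (subst mc2 p) = avg p" "avg (subst mc3 p) = avg p"
    using avg_perm_mat[OF perm_mat_mc(1), of p] avg_perm_mat[OF perm_mat_mc(2), of p]
      avg_perm_mat[OF perm_mat_mc(3), of p]
      sign_cherry_swap[OF eight_distinct(1,2)] sign_cherry_swap[OF eight_distinct(3,4)]
      sign_cherry_swap[OF eight_distinct(5,6)]
    by (simp_all only: of_int_1 qpoly.scale_one)
  then show "avg (rc1 p) = 0" "avg (rc2 p) = 0" "avg (rc3 p) = 0"
    unfolding rc1_def rc2_def rc3_def minus by simp_all
qed

text \<open>Averaging maps onto the skew-invariants, so this bounds the space of skew-invariant
  cubics by dimension one.\<close>

lemma avg_span:
  assumes "p \<in> homog 3"
  shows "\<exists>c. avg p = scale c (avg (Var P0 * (Var P0 * Var P0)))"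
proof -
  interpret skew_closed "\<lambda>p. \<exists>c. avg p = scale c (avg (Var P0 * (Var P0 * Var P0)))"
  proof
    fix p q u v w
    assume "\<exists>c. avg p = scale c (avg (Var P0 * (Var P0 * Var P0)))"
      "\<exists>c. avg q = scale c (avg (Var P0 * (Var P0 * Var P0)))"
    then show "\<exists>c. avg (p + q) = scale c (avg (Var P0 * (Var P0 * Var P0)))"
      by (metis subst_add skew_average_add qpoly.scale_left_distrib)
  next
    fix p c
    assume "\<exists>c. avg p = scale c (avg (Var P0 * (Var P0 * Var P0)))"
    then show "\<exists>d. avg (Const c * p) = scale d (avg (Var P0 * (Var P0 * Var P0)))"
      by (metis scale_def subst_scale skew_average_scale qpoly.scale_scale)
  next
    fix u v w assume "dead u v w"
    then show "\<exists>c. avg (Var u * (Var v * Var w)) = scale c (avg (Var P0 * (Var P0 * Var P0)))"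
      by (intro exI[of _ 0]) (simp only: avg_dead qpoly.scale_zero_left)
  next
    fix u v w :: vi
    show "\<exists>c. avg (r12 (Var u * (Var v * Var w))) = scale c (avg (Var P0 * (Var P0 * Var P0)))"
      by (intro exI[of _ 0]) (simp only: avg_r12[OF Var_mult_homog_3] qpoly.scale_zero_left)
    show "\<exists>c. avg (rc1 (Var u * (Var v * Var w))) = scale c (avg (Var P0 * (Var P0 * Var P0)))"
      "\<exists>c. avg (rc2 (Var u * (Var v * Var w))) = scale c (avg (Var P0 * (Var P0 * Var P0)))"
      "\<exists>c. avg (rc3 (Var u * (Var v * Var w))) = scale c (avg (Var P0 * (Var P0 * Var P0)))"
      by (intro exI[of _ 0]; simp only: avg_rc qpoly.scale_zero_left)+
  next
    show "\<exists>c. avg (Var P0 * (Var P0 * Var P0)) = scale c (avg (Var P0 * (Var P0 * Var P0)))"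
      by (intro exI[of _ 1]) (simp only: qpoly.scale_one)
  qed
  show ?thesis using good_homog_3[OF assms] .
qed

lemma s_homog: "s \<in> homog 3"
  unfolding s_def by (intro homog_subst_Y cubic_homog)

lemma s_nonzero: "s \<noteq> 0"
  using cubic_nonzero Th_Y[of cubic] by (auto simp: s_def)

text \<open>The average of the skew cubic \<open>s\<close> is 8! times \<open>s\<close>, hence not
  zero, and it is a multiple of the average in question. So the latter is not zero, without any sum
  over the group being evaluated.\<close>

lemma avg_P0: "\<exists>c. c \<noteq> 0 \<and> avg (Var P0 * (Var P0 * Var P0)) = scale c s"
proof -
  obtain c where "avg cubic = scale c (avg (Var P0 * (Var P0 * Var P0)))"
    using avg_span[OF cubic_homog] by blast
  then have c: "scale (fact 8) s = scale c (avg (Var P0 * (Var P0 * Var P0)))"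
    using skew_average_skew[OF skew_s] by (simp only: s_def)
  then have "c \<noteq> 0" using s_nonzero by (metis qpoly.scale_eq_0_iff fact_nonzero)
  then have "avg (Var P0 * (Var P0 * Var P0)) = scale (fact 8 / c) s"
  proof -
    have "scale (fact 8 / c) s = scale (inverse c) (scale (fact 8) s)"
      by (simp add: divide_inverse mult.commute)
    then show ?thesis by (simp only: c qpoly.scale_scale left_inverse[OF \<open>c \<noteq> 0\<close>] qpoly.scale_one)
  qed
  then show ?thesis using \<open>c \<noteq> 0\<close> by (intro exI[of _ "fact 8 / c"]) simp
qed

lemma skew_unique:
  assumes "p \<in> homog 3" "skew_invariant b p"
  shows "\<exists>c. p = scale c s"
proof -
  obtain c where "avg (subst Th p) = scale c (avg (Var P0 * (Var P0 * Var P0)))"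
    using avg_span[OF homog_subst_Th[OF assms(1)]] by blast
  then have "scale (fact 8) p = scale c (avg (Var P0 * (Var P0 * Var P0)))"
    using skew_average_skew[OF assms(2)] by (simp only: Y_Th)
  moreover obtain k where "avg (Var P0 * (Var P0 * Var P0)) = scale k s" using avg_P0 by blast
  ultimately have "scale (fact 8) p = scale (c * k) s" by (simp only: qpoly.scale_scale)
  from arg_cong[OF this, of "scale (inverse (fact 8))"] show ?thesis
    by (metis qpoly.scale_scale qpoly.scale_one left_inverse fact_nonzero)
qed

end

text \<open>Counting endpoints gives four edges. Sending the pairs 01, 23, 45, 67 to these edges,
  with orientation, is the required permutation.\<close>

lemma matching_permutation:
  assumes "matching \<Gamma>"
  obtains \<sigma> where "\<sigma> permutes UNIV" "perm_act \<sigma> (sb P0) = XG \<Gamma>"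
proof -
  have ne: "fst e \<noteq> snd e" if "e \<in> \<Gamma>" for e
    using assms that by (auto simp: matching_def)
  have ex: "\<exists>e\<in>\<Gamma>. v = fst e \<or> v = snd e" for v
    using assms unfolding matching_def by blast
  have un: "e = e'" if "e \<in> \<Gamma>" "e' \<in> \<Gamma>" "v \<in> {fst e, snd e}" "v \<in> {fst e', snd e'}" for e e' v
    using assms that unfolding matching_def by blast
  have "card (\<Union>e\<in>\<Gamma>. {fst e, snd e}) = (\<Sum>e\<in>\<Gamma>. card {fst e, snd e})"
  proof (rule card_UN_disjoint)
    have "{fst e, snd e} \<inter> {fst e', snd e'} = {}" if "e \<in> \<Gamma>" "e' \<in> \<Gamma>" "e \<noteq> e'" for e e'
      using un[OF that(1,2)] that(3) by (meson disjoint_iff)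
    then show "\<forall>e\<in>\<Gamma>. \<forall>e'\<in>\<Gamma>. e \<noteq> e' \<longrightarrow> {fst e, snd e} \<inter> {fst e', snd e'} = {}" by blast
  qed simp_all
  also have "(\<Union>e\<in>\<Gamma>. {fst e, snd e}) = UNIV" using ex by blast
  also have "(\<Sum>e\<in>\<Gamma>. card {fst e, snd e}) = (\<Sum>e\<in>\<Gamma>. 2)"
    by (intro sum.cong) (simp_all add: ne)
  finally have card: "card \<Gamma> = 4" by simp
  obtain es where es: "set es = \<Gamma>" "distinct es"
    using finite_distinct_list[of \<Gamma>] by auto
  then have "length es = 4" using card by (metis distinct_card)
  then obtain e1 e2 e3 e4 where e: "es = [e1, e2, e3, e4]"
    by (auto simp: length_Suc_conv numeral_eq_Suc)
  define \<sigma> :: "8 \<Rightarrow> 8" where "\<sigma> i =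
    (if i = 0 then fst e1 else if i = 1 then snd e1 else if i = 2 then fst e2 else if i = 3 then snd e2
     else if i = 4 then fst e3 else if i = 5 then snd e3 else if i = 6 then fst e4 else snd e4)" for i
  have \<sigma>: "\<sigma> 0 = fst e1" "\<sigma> 1 = snd e1" "\<sigma> 2 = fst e2" "\<sigma> 3 = snd e2"
    "\<sigma> 4 = fst e3" "\<sigma> 5 = snd e3" "\<sigma> 6 = fst e4" "\<sigma> 7 = snd e4"
    by (simp_all add: \<sigma>_def)
  have "surj \<sigma>"
    unfolding surj_def
  proof
    fix v
    show "\<exists>i. v = \<sigma> i"
    proof -
      obtain x where x: "x \<in> \<Gamma>" "v = fst x \<or> v = snd x" using ex by blast
      have "x = e1 \<or> x = e2 \<or> x = e3 \<or> x = e4" using x(1) unfolding es(1)[symmetric] e by simp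
      then show ?thesis using x(2) \<sigma> by metis
    qed
  qed
  then have "bij \<sigma>" using finite_UNIV_surj_inj[of \<sigma>] by (simp add: bij_def)
  then have "\<sigma> permutes UNIV" by (intro bij_imp_permutes) auto
  moreover have "perm_act \<sigma> (sb P0) = XG \<Gamma>"
  proof -
    have "XG \<Gamma> = prod_list (map (\<lambda>(i, j). br i j) es)"
      unfolding XG_def es(1)[symmetric] prod.distinct_set_conv_list[OF es(2)] by (simp add: br_def)
    then show ?thesis by (simp add: e perm_act_simps \<sigma> case_prod_unfold mult.assoc)
  qed
  ultimately show ?thesis by (rule that)
qed

context basis
begin

lemma skew_average_matching:
  assumes "matching \<Gamma>"
  shows "\<exists>c. c \<noteq> 0 \<and> skew_average b (incl b (XG \<Gamma>) ^ 3) = scale c s"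
proof -
  obtain \<sigma> where \<sigma>: "\<sigma> permutes UNIV" "perm_act \<sigma> (sb P0) = XG \<Gamma>"
    using matching_permutation[OF assms] .
  have "incl b (XG \<Gamma>) ^ 3 = sym_act b \<sigma> (subst Y (Var P0 * (Var P0 * Var P0)))"
    using sym_act_incl[OF sb_Rpiece \<sigma>(1), of P0] unfolding \<sigma>(2)
    by (simp add: power3_eq_cube sym_act_def Y_def del: sb.simps)
  then have *: "skew_average b (incl b (XG \<Gamma>) ^ 3) = scale (of_int (sign \<sigma>)) (avg (Var P0 * (Var P0 * Var P0)))"
    by (simp only: skew_average_sym_act[OF \<sigma>(1)])
  obtain c where c: "c \<noteq> 0" "avg (Var P0 * (Var P0 * Var P0)) = scale c s" using avg_P0 by blast
  then have "skew_average b (incl b (XG \<Gamma>) ^ 3) = scale (of_int (sign \<sigma>) * c) s"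
    unfolding * by (simp only: qpoly.scale_scale)
  moreover have "of_int (sign \<sigma>) * c \<noteq> 0" using c(1) by (simp add: sign_def)
  ultimately show ?thesis by blast
qed

end

section \<open>Closed subschemes of Proj\<close>

abbreviation ring_on :: "'a::comm_ring_1 set \<Rightarrow> 'a ring"
  where "ring_on C \<equiv> ring_of_type_algebra\<lparr>carrier := C\<rparr>"

text \<open>Ideals of a subring in terms of the ambient operations; for a subring \<open>C\<close>
  negatives are covered because -1 lies in it.\<close>

definition ideal_in :: "'a::comm_ring_1 set \<Rightarrow> 'a set \<Rightarrow> bool"
  where "ideal_in C P \<longleftrightarrow> P \<subseteq> C \<and> 0 \<in> P \<and> (\<forall>x\<in>P. \<forall>y\<in>P. x + y \<in> P) \<and> (\<forall>a\<in>C. \<forall>x\<in>P. a * x \<in> P)"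

locale subring_set =
  fixes C :: "'a::comm_ring_1 set"
  assumes one: "1 \<in> C" and minus: "x \<in> C \<Longrightarrow> - x \<in> C"
    and add: "x \<in> C \<Longrightarrow> y \<in> C \<Longrightarrow> x + y \<in> C" and mult: "x \<in> C \<Longrightarrow> y \<in> C \<Longrightarrow> x * y \<in> C"
begin

lemma zero: "0 \<in> C"
  using add[OF one minus[OF one]] by simp

lemma cring_ring_on: "cring (ring_on C)"
proof (rule cringI)
  have "\<exists>y\<in>C. y + x = 0" if "x \<in> C" for x
    using minus[OF that] by (intro bexI[of _ "- x"]) auto
  then show "abelian_group (ring_on C)"
    by (intro abelian_groupI) (auto simp: ring_of_type_algebra_def zero add algebra_simps)
  show "comm_monoid (ring_on C)"
    by (intro comm_monoidI) (auto simp: ring_of_type_algebra_def one mult algebra_simps)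
qed (auto simp: ring_of_type_algebra_def algebra_simps)

lemma ideal_ring_on: "ideal P (ring_on C) \<longleftrightarrow> ideal_in C P"
proof
  interpret R: cring "ring_on C" by (rule cring_ring_on)
  show "ideal_in C P" if "ideal P (ring_on C)"
  proof -
    interpret P: ideal P "ring_on C" by (rule that)
    show ?thesis
      unfolding ideal_in_def
      using P.a_subset P.zero_closed P.a_closed P.I_l_closed by (simp add: ring_of_type_algebra_def)
  qed
  assume P: "ideal_in C P"
  show "ideal P (ring_on C)"
  proof (rule idealI)
    show "ring (ring_on C)" by (rule R.ring_axioms)
    have "\<ominus>\<^bsub>ring_on C\<^esub> x = - x" if "x \<in> C" for x
      using that minus by (intro R.minus_equality) (auto simp: ring_of_type_algebra_def)
    moreover have "- x \<in> P" if "x \<in> P" for x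
      using P that minus[OF one] by (auto simp: ideal_in_def dest: bspec[of C _ "-1"])
    ultimately have "inv\<^bsub>add_monoid (ring_on C)\<^esub> x \<in> P" if "x \<in> P" for x
      using P that unfolding a_inv_def[symmetric] by (auto simp: ideal_in_def)
    then show "subgroup P (add_monoid (ring_on C))"
      using P by (intro subgroup.intro) (auto simp: ring_of_type_algebra_def ideal_in_def)
    show "x \<otimes>\<^bsub>ring_on C\<^esub> a \<in> P" "a \<otimes>\<^bsub>ring_on C\<^esub> x \<in> P" if "a \<in> P" "x \<in> carrier (ring_on C)" for a x
      using P that by (simp_all add: ring_of_type_algebra_def ideal_in_def mult.commute[of a])
  qed
qed

lemma primeideal_ring_on:
  "primeideal P (ring_on C) \<longleftrightarrow>
    ideal_in C P \<and> P \<noteq> C \<and> (\<forall>a\<in>C. \<forall>c\<in>C. a * c \<in> P \<longrightarrow> a \<in> P \<or> c \<in> P)"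
proof -
  have m: "monoid.mult (ring_of_type_algebra :: 'a ring) = (*)"
    by (simp add: ring_of_type_algebra_def)
  show ?thesis
    unfolding primeideal_def primeideal_axioms_def ideal_ring_on using cring_ring_on by (auto simp: m)
qed

lemma genideal_ring_on:
  "x \<in> Idl\<^bsub>ring_on C\<^esub> S \<longleftrightarrow> (\<forall>A. ideal_in C A \<and> S \<subseteq> A \<longrightarrow> x \<in> A)"
  by (auto simp: genideal_def ideal_ring_on)

text \<open>Generation by homogeneous elements is restated as a universal property: every ideal
  containing the homogeneous elements of \<open>P\<close> contains \<open>P\<close>. In this form it
  passes along images and preimages.\<close>

lemma Proj_ring_on:
  "P \<in> Proj (ring_on C) gr \<longleftrightarrow>
    ideal_in C P \<and> P \<noteq> C \<and> (\<forall>a\<in>C. \<forall>c\<in>C. a * c \<in> P \<longrightarrow> a \<in> P \<or> c \<in> P) \<and>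
    (\<forall>A. ideal_in C A \<and> P \<inter> (\<Union>d. gr d) \<subseteq> A \<longrightarrow> P \<subseteq> A) \<and> \<not> (\<Union>d\<in>{0<..}. gr d) \<subseteq> P"
  unfolding Proj_def mem_Collect_eq primeideal_ring_on set_eq_iff genideal_ring_on by blast

end

interpretation UNIV: subring_set UNIV
  by standard simp_all

lemma Sym_ring_on: "Sym = ring_on UNIV"
  by (simp add: Sym_def ring_of_type_algebra_def)

lemma ideal_in_diff: "ideal_in UNIV P \<Longrightarrow> x \<in> P \<Longrightarrow> y \<in> P \<Longrightarrow> x - y \<in> P"
  unfolding ideal_in_def by (metis UNIV_I add_uminus_conv_diff mult_minus1)

lemma ideal_in_sum: "ideal_in C P \<Longrightarrow> (\<And>x. x \<in> A \<Longrightarrow> f x \<in> P) \<Longrightarrow> sum f A \<in> P"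
  by (induction A rule: infinite_finite_induct) (auto simp: ideal_in_def)

lemma ideal_in_mult: "ideal_in UNIV P \<Longrightarrow> x \<in> P \<Longrightarrow> a * x \<in> P"
  and ideal_in_mult_right: "ideal_in UNIV P \<Longrightarrow> x \<in> P \<Longrightarrow> x * a \<in> P"
  by (simp_all add: ideal_in_def mult.commute[of x])

text \<open>For a surjective homomorphism \<open>f\<close> of graded rings whose kernel is generated by homogeneous
  elements, pulling back prime ideals identifies Proj of the target with a closed subset.\<close>

lemma Proj_quotient:
  fixes f :: "'a::comm_ring_1 \<Rightarrow> 'b::comm_ring_1"
  assumes hom: "f 1 = 1" "\<And>x y. f (x + y) = f x + f y" "\<And>x y. f (x * y) = f x * f y"
    and homogeneous: "S \<subseteq> (\<Union>d. gr d)" and kernel: "Idl\<^bsub>ring_on UNIV\<^esub> S = {x. f x = 0}"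
  shows "(\<lambda>Q. f -` Q) ` Proj (ring_on (range f)) (\<lambda>d. f ` gr d) = {P \<in> Proj (ring_on UNIV) gr. S \<subseteq> P}"
proof -
  have f0: "f 0 = 0" using hom(2)[of 0 0] by simp
  have f_minus: "f (- x) = - f x" for x using hom(2)[of x "- x"] f0 by (simp add: eq_neg_iff_add_eq_0 add.commute)
  have f_diff: "f (x - y) = f x - f y" for x y using hom(2)[of x "- y"] by (simp add: f_minus)
  interpret R: subring_set "range f"
    by standard (auto simp flip: hom f_minus)
  have S_ker: "f x = 0" if "x \<in> S" for x
    using kernel that by (auto simp: set_eq_iff UNIV.genideal_ring_on)
  have ker: "x \<in> A" if "f x = 0" "ideal_in UNIV A" "S \<subseteq> A" for x A
    using kernel that by (auto simp: set_eq_iff UNIV.genideal_ring_on)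
  have vimage: "ideal_in UNIV (f -` Q)" if "ideal_in (range f) Q" for Q
    using that by (auto simp: ideal_in_def f0 hom)
  have image: "ideal_in (range f) (f ` A)" if "ideal_in UNIV A" for A
    unfolding ideal_in_def
  proof (intro conjI ballI)
    show "0 \<in> f ` A" using that f0 by (metis ideal_in_def image_eqI)
    show "x + y \<in> f ` A" if "x \<in> f ` A" "y \<in> f ` A" for x y
      using that \<open>ideal_in UNIV A\<close> by (auto simp: ideal_in_def simp flip: hom)
    show "a * x \<in> f ` A" if "a \<in> range f" "x \<in> f ` A" for a x
      using that \<open>ideal_in UNIV A\<close> by (auto simp: ideal_in_def simp flip: hom)
  qed auto
  show ?thesis
  proof (intro equalityI subsetI)
    fix P assume "P \<in> (\<lambda>Q. f -` Q) ` Proj (ring_on (range f)) (\<lambda>d. f ` gr d)"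
    then obtain Q where P: "P = f -` Q" and "Q \<in> Proj (ring_on (range f)) (\<lambda>d. f ` gr d)" by blast
    then have Q: "ideal_in (range f) Q" "Q \<noteq> range f"
      "\<And>a c. f a * f c \<in> Q \<Longrightarrow> f a \<in> Q \<or> f c \<in> Q"
      "\<And>A. ideal_in (range f) A \<Longrightarrow> Q \<inter> (\<Union>d. f ` gr d) \<subseteq> A \<Longrightarrow> Q \<subseteq> A"
      "\<not> (\<Union>d\<in>{0<..}. f ` gr d) \<subseteq> Q"
      unfolding R.Proj_ring_on by blast+
    have "S \<subseteq> P" using Q(1) by (auto simp: P S_ker ideal_in_def)
    moreover have "P \<in> Proj (ring_on UNIV) gr"
      unfolding UNIV.Proj_ring_on
    proof (intro conjI ballI allI impI)
      show "ideal_in UNIV P" unfolding P by (rule vimage[OF Q(1)])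
      show "P \<noteq> UNIV" using Q(1,2) by (auto simp: P ideal_in_def)
      show "a \<in> P \<or> c \<in> P" if "a * c \<in> P" for a c using that Q(3) by (simp add: P hom)
      show "\<not> (\<Union>d\<in>{0<..}. gr d) \<subseteq> P" using Q(5) by (auto simp: P)
    next
      fix A assume A: "ideal_in UNIV A \<and> P \<inter> (\<Union>d. gr d) \<subseteq> A"
      have "Q \<inter> (\<Union>d. f ` gr d) \<subseteq> f ` A" using A by (auto simp: P)
      then have "Q \<subseteq> f ` A" by (intro Q(4) image) (use A in auto)
      show "P \<subseteq> A"
      proof
        fix p assume "p \<in> P"
        then obtain a where a: "a \<in> A" "f p = f a" using \<open>Q \<subseteq> f ` A\<close> by (auto simp: P)
        \<comment> \<open>The generators of the kernel are homogeneous and lie in \<open>P\<close>,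
          so they lie in \<open>A\<close>. Hence \<open>A\<close> contains the kernel, and
          \<open>p\<close> can be compared with \<open>a\<close> through their images.\<close>
        have "S \<subseteq> A" using A \<open>S \<subseteq> P\<close> homogeneous by blast
        then have "p - a \<in> A" using a(2) A by (intro ker) (auto simp: f_diff)
        then have "p - a + a \<in> A" using a(1) A unfolding ideal_in_def by blast
        then show "p \<in> A" by simp
      qed
    qed
    ultimately show "P \<in> {P \<in> Proj (ring_on UNIV) gr. S \<subseteq> P}" by blast
  next
    fix P assume "P \<in> {P \<in> Proj (ring_on UNIV) gr. S \<subseteq> P}"
    then have SP: "S \<subseteq> P" and P: "ideal_in UNIV P" "P \<noteq> UNIV"
      "\<And>a c. a * c \<in> P \<Longrightarrow> a \<in> P \<or> c \<in> P"
      "\<And>A. ideal_in UNIV A \<Longrightarrow> P \<inter> (\<Union>d. gr d) \<subseteq> A \<Longrightarrow> P \<subseteq> A"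
      "\<not> (\<Union>d\<in>{0<..}. gr d) \<subseteq> P"
      unfolding UNIV.Proj_ring_on by blast+
    have f_mem: "f x \<in> f ` P \<longleftrightarrow> x \<in> P" for x
    proof
      assume "f x \<in> f ` P"
      then obtain p where p: "p \<in> P" "f x = f p" by blast
      then have "x - p \<in> P" by (intro ker P(1) SP) (simp add: f_diff)
      then have "x - p + p \<in> P" using p(1) P(1) unfolding ideal_in_def by blast
      then show "x \<in> P" by simp
    qed auto
    have "f ` P \<in> Proj (ring_on (range f)) (\<lambda>d. f ` gr d)"
      unfolding R.Proj_ring_on
    proof (intro conjI ballI allI impI)
      show "ideal_in (range f) (f ` P)" by (rule image[OF P(1)])
      show "f ` P \<noteq> range f" using P(2) f_mem by blast
      show "a \<in> f ` P \<or> c \<in> f ` P" if ac: "a \<in> range f" "c \<in> range f" "a * c \<in> f ` P" for a c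
      proof -
        obtain x y where xy: "a = f x" "c = f y" using ac(1,2) by blast
        then have "x * y \<in> P" using ac(3) f_mem[of "x * y"] hom(3)[of x y] by simp
        then show ?thesis using P(3) f_mem unfolding xy by blast
      qed
      show "\<not> (\<Union>d\<in>{0<..}. f ` gr d) \<subseteq> f ` P" using P(5) f_mem by blast
    next
      fix A assume A: "ideal_in (range f) A \<and> f ` P \<inter> (\<Union>d. f ` gr d) \<subseteq> A"
      have "P \<subseteq> f -` A" by (intro P(4) vimage) (use A in auto)
      then show "f ` P \<subseteq> A" by blast
    qed
    moreover have "P = f -` f ` P" using f_mem by blast
    ultimately show "P \<in> (\<lambda>Q. f -` Q) ` Proj (ring_on (range f)) (\<lambda>d. f ` gr d)" by blast
  qed
qed

section \<open>Ideal, singular locus and syzygies in an arbitrary basis\<close>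

lemma pd_homog:
  assumes "p \<in> homog (Suc n)"
  shows "pd v p \<in> homog n"
  unfolding pd_def homog_whomog
proof (rule whomog_sum)
  fix m assume m: "m \<in> Poly_Mapping.keys p"
  show "Poly_Mapping.single (m - Poly_Mapping.single v 1) (Poly_Mapping.lookup p m * of_nat (Poly_Mapping.lookup m v))
      \<in> whomog (\<lambda>_. 1) n"
  proof (cases "Poly_Mapping.lookup m v = 0")
    case False
    then have eq: "m = Poly_Mapping.single v 1 + (m - Poly_Mapping.single v 1)"
      by (intro poly_mapping_eqI) (auto simp: lookup_add lookup_minus lookup_single when_def)
    have "wt (\<lambda>_. 1) m = Suc n" using assms m by (auto simp: homog_whomog whomog_def)
    then have "wt (\<lambda>_. 1) (m - Poly_Mapping.single v 1) = n"
      by (subst (asm) eq) (simp add: wt_add)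
    then show ?thesis
      unfolding single_conv_mon by (intro whomog_Const_mult) (simp add: whomog_mon)
  qed simp
qed

lemma cubic_euler: "3 * cubic = (\<Sum>v\<in>UNIV. Var v * pd v cubic)"
  unfolding UNIV_vi by (simp add: pd_cubic) (simp add: cubic_def algebra_simps)

lemma numeral_mult_eq_0: "numeral k * p = 0 \<Longrightarrow> p = 0" for p :: "'v qpoly"
proof -
  assume "numeral k * p = 0"
  then have "scale (numeral k) p = 0" by (simp add: scale_def)
  then show "p = 0" by (simp add: qpoly.scale_eq_0_iff)
qed

lemma subst_sb_cubic: "subst sb cubic = 0"
proof -
  have "subst sb (3 * cubic) = 0"
    unfolding cubic_euler using pd_cubic_in_J by (simp flip: kernel_subst_sb)
  then show ?thesis using numeral_mult_eq_0[of "num.Bit1 num.One"] by simp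
qed

lemma no_linear_syzygy_cubic:
  assumes "\<And>v. G v \<in> homog 1" "(\<Sum>v\<in>UNIV. G v * pd v cubic) = 0"
  shows "G v = 0"
proof -
  \<comment> \<open>The transpose of the matrix in \<open>pd_cubic\<close>, applied to
    \<open>G\<close>, turns a syzygy of the derivatives into one of the quadrics. The matrix is
    invertible, so \<open>G\<close> vanishes with \<open>F\<close>.\<close>
  define F where "F v = (case v of P0 \<Rightarrow> G P0
    | R1 \<Rightarrow> 4 * G R2 - 2 * G R1 - 2 * G TT | R2 \<Rightarrow> 2 * G R1 - 2 * G TT | TT \<Rightarrow> 2 * G R1 + 2 * G TT
    | Q1 \<Rightarrow> 2 * - G Q1 | Q2 \<Rightarrow> 2 * - G Q2 | Q3 \<Rightarrow> 2 * - G Q3 | Q4 \<Rightarrow> 2 * - G Q4 | _ \<Rightarrow> 2 * G v)" for v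
  have hom: "F v \<in> homog 1" for v
    unfolding F_def by (cases v; simp only: vi.case; intro homog_intros assms(1))
  have "(\<Sum>v\<in>UNIV. F v * rel v) = (\<Sum>v\<in>UNIV. G v * pd v cubic)"
    unfolding UNIV_vi
    by (simp add: F_def pd_cubic del: rel.simps) (simp add: algebra_simps del: rel.simps)
  then have F0: "F v = 0" for v
    by (intro no_linear_syzygy[of F, OF hom]) (simp only: assms(2))
  have "2 * (G R1 + G TT) = 0" "2 * (G R1 - G TT) = 0"
    using F0[of TT] F0[of R2] unfolding F_def by (simp_all only: vi.case distrib_left right_diff_distrib)
  then have R: "G R1 + G TT = 0" "G R1 - G TT = 0" using numeral_mult_eq_0 by blast+
  have "2 * G R1 = (G R1 + G TT) + (G R1 - G TT)" by simp
  then have "2 * G R1 = 0" by (simp only: R add_0)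
  then have R1: "G R1 = 0" by (rule numeral_mult_eq_0)
  with R have TT: "G TT = 0" by simp
  have "4 * G R2 = 0" using F0[of R1] by (simp add: F_def R1 TT)
  then have R2: "G R2 = 0" by (rule numeral_mult_eq_0)
  have double: "2 * x = 0 \<longleftrightarrow> x = 0" for x :: "vi qpoly" by (auto dest: numeral_mult_eq_0)
  show ?thesis
    using F0[of v, unfolded F_def] R1 R2 TT
    by (cases v; simp add: double)
qed

lemma homog_0_Const:
  fixes p :: "'v::finite qpoly"
  assumes "p \<in> homog 0"
  shows "p = Const (Poly_Mapping.lookup p 0)"
proof (rule poly_mapping_eqI)
  fix m
  show "Poly_Mapping.lookup p m = Poly_Mapping.lookup (Const (Poly_Mapping.lookup p 0)) m"
  proof (cases "m = 0")
    case False
    then have "Poly_Mapping.keys m \<noteq> {}" by simp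
    then obtain v where "v \<in> Poly_Mapping.keys m" by blast
    then have "mdeg m \<noteq> 0" by (auto simp: mdeg_def in_keys_iff)
    then have "m \<notin> Poly_Mapping.keys p" using assms by (auto simp: homog_def)
    then show ?thesis using False by (simp add: in_keys_iff Const_def lookup_single)
  qed (simp add: Const_def)
qed

context basis
begin

lemma subst_b_eq: "subst b p = subst sb (subst Th p)"
  using subst_b_Y[of "subst Th p"] by (simp add: Y_Th)

lemma Rpiece_eq: "Rpiece d = subst b ` homog d"
proof -
  have "subst sb q \<in> subst b ` homog d" if "q \<in> homog d" for q
    using subst_b_Y[of q] homog_subst_Y[OF that] by (metis image_eqI)
  moreover have "subst b p \<in> subst sb ` homog d" if "p \<in> homog d" for p
    using subst_b_eq[of p] homog_subst_Th[OF that] by blast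
  ultimately show ?thesis unfolding kempe by blast
qed

lemma Rcarrier_eq: "Rcarrier = range (subst b)"
proof (intro equalityI subsetI)
  fix x assume "x \<in> Rcarrier"
  then obtain h N where x: "x = (\<Sum>d<N. h d)" "\<And>d. h d \<in> Rpiece d" by (auto simp: Rcarrier_def)
  then have "\<forall>d. \<exists>p. h d = subst b p" unfolding Rpiece_eq by blast
  then obtain q where "\<And>d. h d = subst b (q d)" by metis
  then have "x = subst b (\<Sum>d<N. q d)" using x(1) by simp
  then show "x \<in> range (subst b)" by blast
next
  fix x assume "x \<in> range (subst b)"
  then obtain p where p: "x = subst b p" by blast
  obtain N where N: "(\<Sum>d<N. wcomp (\<lambda>_. 1) d p) = p" using ex_sum_wcomp by blast
  have "x = (\<Sum>d<N. subst b (wcomp (\<lambda>_. 1) d p))" unfolding p by (subst N[symmetric]) simp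
  moreover have "subst b (wcomp (\<lambda>_. 1) d p) \<in> Rpiece d" for d
    unfolding Rpiece_eq homog_whomog by (intro imageI wcomp_in_whomog)
  ultimately show "x \<in> Rcarrier"
    unfolding Rcarrier_def by (intro CollectI exI[of _ "\<lambda>d. subst b (wcomp (\<lambda>_. 1) d p)"] exI[of _ N]) auto
qed

lemma I_eq: "I b = {p. subst b p = 0}"
  by (simp add: I_def a_kernel_def' Sym_def Rring_def Sym_to_R_def ring_of_type_algebra_def)

text \<open>\<open>dY\<close> and \<open>dTh\<close> are the Jacobian matrices of the coordinate
  changes \<open>Y\<close> and \<open>Th\<close>; they are constant because these are
  linear.\<close>

definition dY :: "vi \<Rightarrow> 'n \<Rightarrow> rat"
  where "dY u i = co (sb u) i"

definition dTh :: "'n \<Rightarrow> vi \<Rightarrow> rat"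
  where "dTh i u = sb.co (b i) u"

lemma pd_sum_scale_Var: "pd i (\<Sum>j\<in>UNIV. scale (c j) (Var j)) = Const (c i)" for i :: "'w::finite"
proof -
  have "pd i (\<Sum>j\<in>UNIV. scale (c j) (Var j)) = (\<Sum>j\<in>UNIV. if j = i then Const (c j) else 0)"
    unfolding pd_sum by (intro sum.cong refl, simp only: pd_scale pd_Var, simp add: scale_def)
  then show ?thesis by simp
qed

lemma pd_Y: "pd i (Y u) = Const (dY u i)"
  unfolding Y_def dY_def incl_co by (rule pd_sum_scale_Var)

lemma pd_Th: "pd u (Th i) = Const (dTh i u)"
  unfolding Th_def dTh_def sb.incl_co by (rule pd_sum_scale_Var)

lemma dTh_dY: "(\<Sum>u\<in>UNIV. Const (dTh i u) * Const (dY u j)) = (if i = j then 1 else 0 :: 'n qpoly)"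
proof -
  have "pd j (subst Y (Th i)) = (\<Sum>u\<in>UNIV. Const (dTh i u) * Const (dY u j))"
    by (simp add: pd_subst pd_Th pd_Y)
  moreover have "subst Y (Th i) = Var i" using Y_Th[of "Var i"] by simp
  ultimately show ?thesis by (simp add: pd_Var)
qed

lemma pd_s: "pd i s = (\<Sum>u\<in>UNIV. subst Y (pd u cubic) * Const (dY u i))"
  by (simp add: s_def pd_subst pd_Y)

lemma pd_cubic_s: "subst Y (pd u cubic) = (\<Sum>i\<in>UNIV. pd i s * Const (dTh i u))"
proof -
  have "pd u cubic = pd u (subst Th s)" by (simp add: s_def Th_Y)
  also have "\<dots> = (\<Sum>i\<in>UNIV. subst Th (pd i s) * Const (dTh i u))" by (simp add: pd_subst pd_Th)
  finally show ?thesis by (simp add: Y_Th)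
qed

text \<open>By the chain rule the derivatives of \<open>s\<close> and the transported derivatives of
  \<open>cubic\<close> are constant combinations of each other, and the latter span the same space
  as the transported quadrics, which generate the kernel.\<close>

lemma Idl_pd_s: "Idl\<^bsub>Sym\<^esub> (range (\<lambda>i. pd i s)) = I b"
proof -
  have "p \<in> A" if p: "subst b p = 0" and A: "ideal_in UNIV A" "range (\<lambda>i. pd i s) \<subseteq> A" for p A
  proof -
    have 1: "subst Y (pd u cubic) \<in> A" for u
      unfolding pd_cubic_s using A by (intro ideal_in_sum ideal_in_mult_right) auto
    have 2: "x + y \<in> A" "x - y \<in> A" if "x \<in> A" "y \<in> A" for x y
      using A(1) that ideal_in_diff by (auto simp: ideal_in_def)
    have 3: "subst Y (rel v) \<in> A" for v
      by (cases v; simp only: rel_pd_cubic subst_mult subst_add subst_diff subst_Const; intro 2 1 ideal_in_mult[OF A(1)])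
    have "subst Th p \<in> J" using p by (simp add: subst_b_eq kernel_subst_sb)
    then obtain h where "subst Th p = (\<Sum>v\<in>UNIV. h v * rel v)" by (auto simp: J_def)
    then have "p = (\<Sum>v\<in>UNIV. subst Y (h v) * subst Y (rel v))"
      using Y_Th[of p] by simp
    also have "\<dots> \<in> A" using A(1) 3 by (intro ideal_in_sum ideal_in_mult) auto
    finally show ?thesis .
  qed
  moreover have "ideal_in UNIV (I b)" by (simp add: I_eq ideal_in_def)
  moreover have "pd i s \<in> I b" for i
    using pd_cubic_in_J by (simp add: I_eq pd_s subst_b_Y flip: kernel_subst_sb)
  ultimately show ?thesis
    unfolding Sym_ring_on set_eq_iff UNIV.genideal_ring_on I_eq by blast
qed

lemma s_in_I: "s \<in> I b"
  by (simp add: I_eq s_def subst_b_Y subst_sb_cubic)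

text \<open>Since \<open>s\<close> lies in the ideal of its derivatives, adding it as a generator
  changes nothing.\<close>

lemma sing_ideal_s: "sing_ideal s = I b"
proof -
  have "Idl\<^bsub>Sym\<^esub> (insert s (range (\<lambda>i. pd i s))) = Idl\<^bsub>Sym\<^esub> (range (\<lambda>i. pd i s))"
    using s_in_I unfolding Idl_pd_s[symmetric] Sym_ring_on set_eq_iff UNIV.genideal_ring_on
    by blast
  then show ?thesis by (simp only: sing_ideal_def Idl_pd_s)
qed

lemma SpecR: "SpecR_is_subscheme b (sing_ideal s)"
  unfolding SpecR_is_subscheme_def sing_ideal_s I_def[symmetric]
  by (simp add: Sym_to_R_def Sym_def Rring_def Rcarrier_eq ring_of_type_algebra_def)

lemma pd_s_homog: "pd i s \<in> homog 2"
  using pd_homog[of s 2 i] s_homog by (simp add: numeral_3_eq_3 numeral_2_eq_2)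

text \<open>The kernel of the map to the ring of invariants is generated by the derivatives of
  \<open>s\<close>, which are homogeneous quadrics, so \<open>Proj_quotient\<close> identifies
  \<open>M8\<close> with the primes containing them; such primes contain \<open>s\<close>
  too.\<close>

lemma M8_eq: "M8 b = sing_locus s"
proof -
  have "M8 b = {P \<in> Proj (ring_on UNIV) homog. range (\<lambda>i. pd i s) \<subseteq> P}"
    unfolding M8_def Rring_def Rcarrier_eq Rpiece_eq[abs_def] Sym_to_R_def
    by (rule Proj_quotient)
      (use Idl_pd_s pd_s_homog in \<open>auto simp: I_eq Sym_ring_on\<close>)
  also have "\<dots> = sing_locus s"
  proof -
    have "s \<in> Idl\<^bsub>ring_on UNIV\<^esub> (range (\<lambda>i. pd i s))"
      using s_in_I by (simp only: Idl_pd_s flip: Sym_ring_on)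
    then have "s \<in> P" if "ideal_in UNIV P" "range (\<lambda>i. pd i s) \<subseteq> P" for P
      using that unfolding UNIV.genideal_ring_on by blast
    moreover have "ideal_in UNIV P" if "P \<in> Proj (ring_on UNIV) homog" for P :: "'n qpoly set"
      using that unfolding UNIV.Proj_ring_on by (rule conjunct1)
    ultimately show ?thesis unfolding sing_locus_def PV_def Sym_ring_on by blast
  qed
  finally show ?thesis .
qed

text \<open>The chain rule turns a syzygy of the derivatives of \<open>s\<close> into one of the
  derivatives of \<open>cubic\<close>, which is trivial.\<close>

lemma no_syzygy_1: "\<not> has_syzygy s 1"
proof
  assume "has_syzygy s 1"
  then obtain f i where f: "\<And>i. f i \<in> homog 1" "f i \<noteq> 0" "(\<Sum>i\<in>UNIV. f i * pd i s) = 0"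
    unfolding has_syzygy_def by blast
  define G where "G u = (\<Sum>i\<in>UNIV. Const (dY u i) * subst Th (f i))" for u
  have Th_pd: "subst Th (pd i s) = (\<Sum>u\<in>UNIV. pd u cubic * Const (dY u i))" for i
    by (simp only: pd_s subst_sum subst_mult Th_Y subst_Const)
  have "(\<Sum>u\<in>UNIV. G u * pd u cubic) = (\<Sum>u\<in>UNIV. \<Sum>i\<in>UNIV. Const (dY u i) * subst Th (f i) * pd u cubic)"
    unfolding G_def sum_distrib_right ..
  also have "\<dots> = (\<Sum>i\<in>UNIV. \<Sum>u\<in>UNIV. Const (dY u i) * subst Th (f i) * pd u cubic)"
    by (rule sum.swap)
  also have "\<dots> = (\<Sum>i\<in>UNIV. subst Th (f i) * subst Th (pd i s))"
    unfolding Th_pd sum_distrib_left by (intro sum.cong refl) (simp only: mult_ac)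
  also have "\<dots> = subst Th (\<Sum>i\<in>UNIV. f i * pd i s)" by (simp only: subst_sum subst_mult)
  finally have "(\<Sum>u\<in>UNIV. G u * pd u cubic) = 0" by (simp only: f(3) subst_0)
  then have G: "G u = 0" for u
  proof (rule no_linear_syzygy_cubic[of G, rotated])
    have "subst Th (f i) \<in> whomog (\<lambda>_. 1) 1" for i
      using homog_subst_Th[OF f(1)] by (simp only: homog_whomog)
    then show "G u \<in> homog 1" for u
      unfolding G_def homog_whomog by (intro whomog_sum whomog_Const_mult)
  qed
  \<comment> \<open>Multiplying by the inverse Jacobian recovers the coefficient \<open>f i\<close>
    from the vanishing \<open>G\<close>.\<close>
  have "0 = subst Y (\<Sum>u\<in>UNIV. Const (dTh i u) * G u)" by (simp add: G)
  also have "\<dots> = (\<Sum>u\<in>UNIV. \<Sum>j\<in>UNIV. Const (dTh i u) * Const (dY u j) * f j)"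
    by (simp add: G_def Y_Th sum_distrib_left mult.assoc)
  also have "\<dots> = (\<Sum>j\<in>UNIV. (if i = j then 1 else 0) * f j)"
    by (subst sum.swap) (simp only: dTh_dY flip: sum_distrib_right)
  also have "\<dots> = f i" by (simp add: if_distrib if_distribR cong: if_cong)
  finally show False using f(2) by simp
qed

text \<open>A constant syzygy times a variable is a linear one.\<close>

lemma no_syzygy_0: "\<not> has_syzygy s 0"
proof
  assume "has_syzygy s 0"
  then obtain f i where f: "\<And>i. f i \<in> homog 0" "f i \<noteq> 0" "(\<Sum>i\<in>UNIV. f i * pd i s) = 0"
    unfolding has_syzygy_def by blast
  define g where "g j = Var i * f j" for j
  have "g j \<in> homog 1" for j
    using homog_mult[OF homog_Var f(1), of i j] by (simp add: g_def)
  moreover have "(\<Sum>j\<in>UNIV. g j * pd j s) = 0"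
    using f(3) by (simp add: g_def mult.assoc flip: sum_distrib_left)
  moreover have "g i \<noteq> 0"
  proof
    assume "g i = 0"
    obtain c where c: "f i = Const c" using homog_0_Const[OF f(1)] by blast
    \<comment> \<open>Differentiating by the chosen variable returns the constant, so the product
      with that variable is not zero.\<close>
    have "pd i (Var i * Const c) = 0" using \<open>g i = 0\<close> by (simp only: g_def c pd_0)
    then show False using f(2) by (simp add: pd_mult pd_Var c)
  qed
  ultimately have "has_syzygy s 1" unfolding has_syzygy_def by blast
  then show False using no_syzygy_1 by blast
qed

end

theorem theorem1p1:
  shows "(\<exists>b :: 14 \<Rightarrow> coord qpoly. is_basis b) \<and>
    (\<forall>b :: 14 \<Rightarrow> coord qpoly. is_basis b \<longrightarrow>
      (\<exists>s. s \<in> homog 3 \<and> skew_invariant b s \<and> s \<noteq> 0 \<and>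
        (\<forall>s'. s' \<in> homog 3 \<and> skew_invariant b s' \<longrightarrow> (\<exists>c. s' = scale c s)) \<and>
        s \<in> I b \<and>
        M8 b = sing_locus s \<and>
        Idl\<^bsub>Sym\<^esub> (range (\<lambda>i. pd i s)) = I b \<and>
        SpecR_is_subscheme b (sing_ideal s) \<and>
        \<not> has_syzygy s 0 \<and> \<not> has_syzygy s 1 \<and>
        (\<forall>\<Gamma>. matching \<Gamma> \<longrightarrow>
          (\<exists>c. c \<noteq> 0 \<and> skew_average b (incl b (XG \<Gamma>) ^ 3) = scale c s))))"
proof (intro conjI allI impI)
  \<comment> \<open>The names of the fourteen invariants are put in bijection with the type
    \<open>14\<close>, which turns \<open>sb\<close> into a basis with the required index
    type.\<close>
  have "card (UNIV :: 14 set) = card (UNIV :: vi set)" by (simp add: UNIV_vi)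
  then obtain h :: "14 \<Rightarrow> vi" where h: "bij h"
    using finite_same_card_bij[OF finite finite] by blast
  have "range (sb \<circ> h) = range sb" by (simp only: image_comp[symmetric] bij_is_surj[OF h])
  moreover have "inj (sb \<circ> h)"
    using is_basis_sb bij_is_inj[OF h] unfolding is_basis_def by (intro inj_compose) auto
  ultimately have "is_basis (sb \<circ> h)"
    using is_basis_sb unfolding is_basis_def by simp
  then show "\<exists>b :: 14 \<Rightarrow> coord qpoly. is_basis b" by (rule exI[of _ "sb \<circ> h"])
next
  fix b :: "14 \<Rightarrow> coord qpoly" assume "is_basis b"
  then interpret basis b by (rule basis.intro)
  have unique: "\<forall>s'. s' \<in> homog 3 \<and> skew_invariant b s' \<longrightarrow> (\<exists>c. s' = scale c s)"
    using skew_unique by blast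
  have average: "\<forall>\<Gamma>. matching \<Gamma> \<longrightarrow>
      (\<exists>c. c \<noteq> 0 \<and> skew_average b (incl b (XG \<Gamma>) ^ 3) = scale c s)"
    using skew_average_matching by blast
  show "\<exists>s. s \<in> homog 3 \<and> skew_invariant b s \<and> s \<noteq> 0 \<and>
        (\<forall>s'. s' \<in> homog 3 \<and> skew_invariant b s' \<longrightarrow> (\<exists>c. s' = scale c s)) \<and>
        s \<in> I b \<and>
        M8 b = sing_locus s \<and>
        Idl\<^bsub>Sym\<^esub> (range (\<lambda>i. pd i s)) = I b \<and>
        SpecR_is_subscheme b (sing_ideal s) \<and>
        \<not> has_syzygy s 0 \<and> \<not> has_syzygy s 1 \<and>
        (\<forall>\<Gamma>. matching \<Gamma> \<longrightarrow>
          (\<exists>c. c \<noteq> 0 \<and> skew_average b (incl b (XG \<Gamma>) ^ 3) = scale c s))"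
    by (rule exI[of _ s])
      (intro conjI s_homog skew_s s_nonzero unique s_in_I M8_eq Idl_pd_s SpecR no_syzygy_0 no_syzygy_1 average)
qed

end
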